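(* Let $\alpha$ be a finite union of orbits of the symmetric group $\mathfrak S_n$ acting on $S^n$ by permuting coordinates. Then the algebra $e_\alpha H(A_n)_{\boldsymbol\lambda,m}$ is isomorphic to the cyclotomic KLR algebra $\mathbf R^\alpha_{\boldsymbol\lambda,m}$.
   Context: $K$ field of characteristic $\neq2$; $q\in K\setminus\{0\}$ with $q^2\ne1$ (and $p\in K\setminus\{0\}$ with $p^2\neq1$, only used to define $S$ through the standing conventions). For $\lambda\in K\setminus\{0\}$, $I_\lambda=\{\lambda^{\epsilon}q^{2k}:\epsilon=\pm1,k\in\mathbb Z\}$; $\boldsymbol\lambda=(\lambda_1,\dots,\lambda_l)$ with $I_{\lambda_a}\cap I_{\lambda_b}=\emptyset$ for $a\ne b$; $S=\bigcup_aI_{\lambda_a}$; $m:S\to\mathbb Z_{\ge0}$ of finite support. $\widehat H(A_n)$ is the unital $K$-algebra generated by $g_1,\dots,g_{n-1},X_1^{\pm1},\dots,X_n^{\pm1}$ with relations $X_iX_i^{-1}=1$; $X_iX_j=X_jX_i$; $g_i^2=(q-q^{-1})g_i+1$; $g_ig_{i+1}g_i=g_{i+1}g_ig_{i+1}$; $g_ig_j=g_jg_i$ ($|i-j|>1$); $g_iX_ig_i=X_{i+1}$; $g_iX_j=X_jg_i$ ($j\notin\{i,i+1\}$). $H(A_n)_{\boldsymbol\lambda,m}$ is its quotient by the two-sided ideal generated by $\prod_{i\in S}(X_1-i)^{m(i)}$; it is finite-dimensional and decomposes as $\bigoplus_{\mathbf i\in S^n}M_{\mathbf i}$ into generalized common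 eigenspaces $M_{\mathbf i}=\{x:(X_k-i_k)^Nx=0\ \forall k,\ \text{some }N\}$ for left multiplication by $X_1,\dots,X_n$; $e^H(\mathbf i)$ denote the associated mutually orthogonal idempotents (in the subalgebra generated by the $X_k^{\pm1}$, summing to $1$, left multiplication by $e^H(\mathbf i)$ projecting onto $M_{\mathbf i}$), and $e_\alpha=\sum_{\mathbf i\in\alpha}e^H(\mathbf i)$ (a central idempotent). For $i,j\in S$: $i\nleftrightarrow j$ if $i\ne j$ and $j\notin\{q^2i,q^{-2}i\}$; $i\to j$ if $j=q^2i\ne q^{-2}i$; $i\leftarrow j$ if $j=q^{-2}i\ne q^2i$; $i\leftrightarrow j$ if $j=q^2i=q^{-2}i$. $\mathbf R^\alpha_{\boldsymbol\lambda,m}$ is the unital $K$-algebra generated by $\psi_1,\dots,\psi_{n-1}$, $y_1,\dots,y_n$, $e(\mathbf i)$ ($\mathbf i\in\alpha$) with relations, for $a,c,b\in\{1,\dots,n-1\}$, $j\in\{1,\dots,n\}$, $\mathbf i\in\alpha$: $\sum_{\mathbf i}e(\mathbf i)=1$, $e(\mathbf i)e(\mathbf j)=\delta_{\mathbf i,\mathbf j}e(\mathbf i)$; $y$'s commute with each other and with the $e(\mathbf i)$; $\psi_ae(\mathbf i)=e(r_a(\mathbf i))\psi_a$ where $r_a$ swaps entries $a,a+1$; $(\psi_by_j-y_{s_b(j)}\psi_b)e(\mathbf i)$ equals $-e(\mathbf i)$ if $j=b$, $i_b=i_{b+1}$, equals $e(\mathbf i)$ if $j=b+1$, $i_b=i_{b+1}$,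 and $0$ otherwise ($s_b=(b,b+1)$); $\psi_a\psi_c=\psi_c\psi_a$ if $|a-c|>1$; $\psi_b^2e(\mathbf i)$ equals $0$ if $i_b=i_{b+1}$, $e(\mathbf i)$ if $i_b\nleftrightarrow i_{b+1}$, $(y_{b+1}-y_b)e(\mathbf i)$ if $i_b\to i_{b+1}$, $(y_b-y_{b+1})e(\mathbf i)$ if $i_b\leftarrow i_{b+1}$, $(y_{b+1}-y_b)(y_b-y_{b+1})e(\mathbf i)$ if $i_b\leftrightarrow i_{b+1}$; for $b\le n-2$, $(\psi_b\psi_{b+1}\psi_b-\psi_{b+1}\psi_b\psi_{b+1})e(\mathbf i)$ equals $e(\mathbf i)$ if $i_b=i_{b+2}\to i_{b+1}$, $-e(\mathbf i)$ if $i_b=i_{b+2}\leftarrow i_{b+1}$, $(y_{b+2}-2y_{b+1}+y_b)e(\mathbf i)$ if $i_b=i_{b+2}\leftrightarrow i_{b+1}$, $0$ otherwise; and the cyclotomic relation $y_1^{m(i_1)}e(\mathbf i)=0$. *)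

theory Defs
  imports "HOL-Algebra.QuotRing" "HOL-Library.Function_Algebras"
    "HOL-Computational_Algebra.Polynomial"
begin

text \<open>Elements of the free algebra on a generator set A over the field 'k are finitely
  supported functions from words (lists of generators) to 'k.\<close>

type_synonym ('x,'k) fa = "'x list \<Rightarrow> 'k"

definition fa_mult :: "('x,'k::field) fa \<Rightarrow> ('x,'k) fa \<Rightarrow> ('x,'k) fa" (infixl "\<star>" 70) where
  "fa_mult f g = (\<lambda>w. \<Sum>i\<le>length w. f (take i w) * g (drop i w))"

definition fa_one :: "('x,'k::field) fa" where
  "fa_one = (\<lambda>w. if w = [] then 1 else 0)"

definition sc :: "'k::field \<Rightarrow> ('x,'k) fa" where
  "sc c = (\<lambda>w. if w = [] then c else 0)"

definition gen :: "'x \<Rightarrow> ('x,'k::field) fa" where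
  "gen x = (\<lambda>w. if w = [x] then 1 else 0)"

definition fpow :: "('x,'k::field) fa \<Rightarrow> nat \<Rightarrow> ('x,'k) fa" where
  "fpow f N = (((\<star>) f) ^^ N) fa_one"

definition poly_elem :: "('x,'k::field) fa \<Rightarrow> 'k poly \<Rightarrow> ('x,'k) fa" where
  "poly_elem f P = (\<Sum>k\<le>degree P. sc (coeff P k) \<star> fpow f k)"

definition free_alg :: "'x set \<Rightarrow> (('x,'k::field) fa) ring" where
  "free_alg A = \<lparr>carrier = {f. finite {w. f w \<noteq> 0} \<and> (\<forall>w. f w \<noteq> 0 \<longrightarrow> set w \<subseteq> A)},
      monoid.mult = fa_mult, one = fa_one, zero = (\<lambda>w. 0), add = (\<lambda>f g. f + g)\<rparr>"

definition presented :: "'x set \<Rightarrow> ('x,'k::field) fa set \<Rightarrow> (('x,'k) fa set) ring" where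
  "presented A rels = free_alg A Quot genideal (free_alg A) rels"

definition cls :: "'x set \<Rightarrow> ('x,'k::field) fa set \<Rightarrow> ('x,'k) fa \<Rightarrow> ('x,'k) fa set" where
  "cls A rels f = genideal (free_alg A) rels +>\<^bsub>free_alg A\<^esub> f"

definition alg_iso :: "('a,'c) ring_scheme \<Rightarrow> ('k \<Rightarrow> 'a \<Rightarrow> 'a) \<Rightarrow> ('b,'d) ring_scheme
     \<Rightarrow> ('k \<Rightarrow> 'b \<Rightarrow> 'b) \<Rightarrow> ('a \<Rightarrow> 'b) \<Rightarrow> bool" where
  "alg_iso A sA B sB \<phi> \<longleftrightarrow> \<phi> \<in> ring_iso A B \<and> (\<forall>c. \<forall>x\<in>carrier A. \<phi> (sA c x) = sB c (\<phi> x))"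

text \<open>Corner algebra e A (for a central idempotent e), with unit e.\<close>
definition corner :: "('a,'c) ring_scheme \<Rightarrow> 'a \<Rightarrow> 'a ring" where
  "corner A e = \<lparr>carrier = {e \<otimes>\<^bsub>A\<^esub> x | x. x \<in> carrier A}, monoid.mult = monoid.mult A, one = e,
      zero = zero A, add = add A\<rparr>"

definition Ilam :: "'k::field \<Rightarrow> 'k \<Rightarrow> 'k set" where
  "Ilam q l = {l powi \<epsilon> * q powi (2 * k) | \<epsilon> k. \<epsilon> \<in> {1, -1}}"

definition Sset :: "'k::field \<Rightarrow> 'k list \<Rightarrow> 'k set" where
  "Sset q lam = (\<Union>a\<in>set lam. Ilam q a)"

text \<open>Entries of a tuple i = (i_1,...,i_n) are indexed from 1.\<close>
definition ix :: "'k list \<Rightarrow> nat \<Rightarrow> 'k" where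
  "ix i k = i ! (k - 1)"

definition swp :: "nat \<Rightarrow> 'k list \<Rightarrow> 'k list" where
  "swp a i = i[a - 1 := i ! a, a := i ! (a - 1)]"

definition sb :: "nat \<Rightarrow> nat \<Rightarrow> nat" where
  "sb b j = (if j = b then b + 1 else if j = b + 1 then b else j)"

definition nconn :: "'k::field \<Rightarrow> 'k \<Rightarrow> 'k \<Rightarrow> bool" where
  "nconn q i j \<longleftrightarrow> i \<noteq> j \<and> j \<noteq> q^2 * i \<and> j \<noteq> q powi (-2) * i"
definition arr_to :: "'k::field \<Rightarrow> 'k \<Rightarrow> 'k \<Rightarrow> bool" where
  "arr_to q i j \<longleftrightarrow> j = q^2 * i \<and> j \<noteq> q powi (-2) * i"
definition arr_from :: "'k::field \<Rightarrow> 'k \<Rightarrow> 'k \<Rightarrow> bool" where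
  "arr_from q i j \<longleftrightarrow> j = q powi (-2) * i \<and> j \<noteq> q^2 * i"
definition arr_both :: "'k::field \<Rightarrow> 'k \<Rightarrow> 'k \<Rightarrow> bool" where
  "arr_both q i j \<longleftrightarrow> j = q^2 * i \<and> j = q powi (-2) * i"

datatype hgen = G nat | X nat | Xi nat

definition hgens :: "nat \<Rightarrow> hgen set" where
  "hgens n = G ` {1..<n} \<union> X ` {1..n} \<union> Xi ` {1..n}"

definition cyc_poly :: "'k::field set \<Rightarrow> ('k \<Rightarrow> nat) \<Rightarrow> 'k poly" where
  "cyc_poly S m = (\<Prod>i\<in>{i\<in>S. m i \<noteq> 0}. [:-i, 1:] ^ m i)"

definition H_rels :: "'k::field \<Rightarrow> 'k set \<Rightarrow> ('k \<Rightarrow> nat) \<Rightarrow> nat \<Rightarrow> (hgen,'k) fa set" where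
  "H_rels q S m n =
     {gen (X i) \<star> gen (Xi i) - fa_one | i. i \<in> {1..n}}
   \<union> {gen (Xi i) \<star> gen (X i) - fa_one | i. i \<in> {1..n}}
   \<union> {gen x \<star> gen y - gen y \<star> gen x | x y. x \<in> X ` {1..n} \<union> Xi ` {1..n}
        \<and> y \<in> X ` {1..n} \<union> Xi ` {1..n}}
   \<union> {gen (G i) \<star> gen (G i) - (sc (q - inverse q) \<star> gen (G i) + fa_one) | i. i \<in> {1..<n}}
   \<union> {gen (G i) \<star> gen (G (i+1)) \<star> gen (G i) - gen (G (i+1)) \<star> gen (G i) \<star> gen (G (i+1))
        | i. 1 \<le> i \<and> i + 1 < n}
   \<union> {gen (G i) \<star> gen (G j) - gen (G j) \<star> gen (G i) | i j. i \<in> {1..<n} \<and> j \<in> {1..<n}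
        \<and> (i + 1 < j \<or> j + 1 < i)}
   \<union> {gen (G i) \<star> gen (X i) \<star> gen (G i) - gen (X (i+1)) | i. i \<in> {1..<n}}
   \<union> {gen (G i) \<star> gen (X j) - gen (X j) \<star> gen (G i) | i j. i \<in> {1..<n} \<and> j \<in> {1..n}
        \<and> j \<noteq> i \<and> j \<noteq> i + 1}
   \<union> {poly_elem (gen (X 1)) (cyc_poly S m)}"

definition Hcyc :: "'k::field \<Rightarrow> 'k list \<Rightarrow> ('k \<Rightarrow> nat) \<Rightarrow> nat \<Rightarrow> ((hgen,'k) fa set) ring" where
  "Hcyc q lam m n = presented (hgens n) (H_rels q (Sset q lam) m n)"

definition Hcls :: "'k::field \<Rightarrow> 'k list \<Rightarrow> ('k \<Rightarrow> nat) \<Rightarrow> nat \<Rightarrow> (hgen,'k) fa \<Rightarrow> (hgen,'k) fa set" where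
  "Hcls q lam m n f = cls (hgens n) (H_rels q (Sset q lam) m n) f"

definition Hsc :: "'k::field \<Rightarrow> 'k list \<Rightarrow> ('k \<Rightarrow> nat) \<Rightarrow> nat \<Rightarrow> 'k \<Rightarrow> (hgen,'k) fa set \<Rightarrow> (hgen,'k) fa set" where
  "Hsc q lam m n c x = Hcls q lam m n (sc c) \<otimes>\<^bsub>Hcyc q lam m n\<^esub> x"

definition Mspace :: "'k::field \<Rightarrow> 'k list \<Rightarrow> ('k \<Rightarrow> nat) \<Rightarrow> nat \<Rightarrow> 'k list \<Rightarrow> (hgen,'k) fa set set" where
  "Mspace q lam m n i = {x \<in> carrier (Hcyc q lam m n). \<forall>k\<in>{1..n}. \<exists>N.
      Hcls q lam m n (fpow (gen (X k) - sc (ix i k)) N) \<otimes>\<^bsub>Hcyc q lam m n\<^esub> x = \<zero>\<^bsub>Hcyc q lam m n\<^esub>}"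

text \<open>e_alpha: the element of H whose left multiplication is the projection onto the sum of
  the M_i with i in alpha (identity on M_i for i in alpha, zero on M_i for i in S^n - alpha).\<close>
definition is_e_alpha :: "'k::field \<Rightarrow> 'k list \<Rightarrow> ('k \<Rightarrow> nat) \<Rightarrow> nat \<Rightarrow> 'k list set \<Rightarrow> (hgen,'k) fa set \<Rightarrow> bool" where
  "is_e_alpha q lam m n \<alpha> e \<longleftrightarrow> e \<in> carrier (Hcyc q lam m n) \<and>
     (\<forall>i. length i = n \<and> set i \<subseteq> Sset q lam \<longrightarrow>
        (\<forall>x\<in>Mspace q lam m n i. e \<otimes>\<^bsub>Hcyc q lam m n\<^esub> x = (if i \<in> \<alpha> then x else \<zero>\<^bsub>Hcyc q lam m n\<^esub>)))"

datatype 'k rgen = Psi nat | Y nat | E "'k list"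

definition rgens :: "nat \<Rightarrow> 'k list set \<Rightarrow> 'k rgen set" where
  "rgens n \<alpha> = Psi ` {1..<n} \<union> Y ` {1..n} \<union> E ` \<alpha>"

definition psisq :: "'k::field \<Rightarrow> 'k list \<Rightarrow> nat \<Rightarrow> ('k rgen,'k) fa" where
  "psisq q i b = (let a = ix i b; c = ix i (b+1); e = gen (E i); y = (\<lambda>j. gen (Y j)) in
     if a = c then 0
     else if nconn q a c then e
     else if arr_to q a c then (y (b+1) - y b) \<star> e
     else if arr_from q a c then (y b - y (b+1)) \<star> e
     else if arr_both q a c then (y (b+1) - y b) \<star> (y b - y (b+1)) \<star> e
     else 0)"

definition braidrhs :: "'k::field \<Rightarrow> 'k list \<Rightarrow> nat \<Rightarrow> ('k rgen,'k) fa" where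
  "braidrhs q i b = (let a = ix i b; c = ix i (b+1); d = ix i (b+2); e = gen (E i);
       y = (\<lambda>j. gen (Y j)) in
     if a = d \<and> arr_to q a c then e
     else if a = d \<and> arr_from q a c then - e
     else if a = d \<and> arr_both q a c then (y (b+2) - y (b+1) - y (b+1) + y b) \<star> e
     else 0)"

definition R_rels :: "'k::field \<Rightarrow> ('k \<Rightarrow> nat) \<Rightarrow> nat \<Rightarrow> 'k list set \<Rightarrow> ('k rgen,'k) fa set" where
  "R_rels q m n \<alpha> =
     {(\<Sum>i\<in>\<alpha>. gen (E i)) - fa_one}
   \<union> {gen (E i) \<star> gen (E j) - (if i = j then gen (E i) else 0) | i j. i \<in> \<alpha> \<and> j \<in> \<alpha>}
   \<union> {gen (Y j) \<star> gen (Y k) - gen (Y k) \<star> gen (Y j) | j k. j \<in> {1..n} \<and> k \<in> {1..n}}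
   \<union> {gen (Y j) \<star> gen (E i) - gen (E i) \<star> gen (Y j) | j i. j \<in> {1..n} \<and> i \<in> \<alpha>}
   \<union> {gen (Psi a) \<star> gen (E i) - gen (E (swp a i)) \<star> gen (Psi a) | a i. a \<in> {1..<n} \<and> i \<in> \<alpha>}
   \<union> {(gen (Psi b) \<star> gen (Y j) - gen (Y (sb b j)) \<star> gen (Psi b)) \<star> gen (E i)
        - (if j = b \<and> ix i b = ix i (b+1) then - gen (E i)
           else if j = b + 1 \<and> ix i b = ix i (b+1) then gen (E i) else 0)
        | b j i. b \<in> {1..<n} \<and> j \<in> {1..n} \<and> i \<in> \<alpha>}
   \<union> {gen (Psi a) \<star> gen (Psi c) - gen (Psi c) \<star> gen (Psi a) | a c. a \<in> {1..<n} \<and> c \<in> {1..<n}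
        \<and> (a + 1 < c \<or> c + 1 < a)}
   \<union> {gen (Psi b) \<star> gen (Psi b) \<star> gen (E i) - psisq q i b | b i. b \<in> {1..<n} \<and> i \<in> \<alpha>}
   \<union> {(gen (Psi b) \<star> gen (Psi (b+1)) \<star> gen (Psi b) - gen (Psi (b+1)) \<star> gen (Psi b) \<star> gen (Psi (b+1)))
        \<star> gen (E i) - braidrhs q i b | b i. 1 \<le> b \<and> b + 2 \<le> n \<and> i \<in> \<alpha>}
   \<union> {fpow (gen (Y 1)) (m (ix i 1)) \<star> gen (E i) | i. i \<in> \<alpha>}"

definition KLR :: "'k::field \<Rightarrow> ('k \<Rightarrow> nat) \<Rightarrow> nat \<Rightarrow> 'k list set \<Rightarrow> (('k rgen,'k) fa set) ring" where
  "KLR q m n \<alpha> = presented (rgens n \<alpha>) (R_rels q m n \<alpha>)"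

definition Rsc :: "'k::field \<Rightarrow> ('k \<Rightarrow> nat) \<Rightarrow> nat \<Rightarrow> 'k list set \<Rightarrow> 'k \<Rightarrow> ('k rgen,'k) fa set \<Rightarrow> ('k rgen,'k) fa set" where
  "Rsc q m n \<alpha> c x = cls (rgens n \<alpha>) (R_rels q m n \<alpha>) (sc c) \<otimes>\<^bsub>KLR q m n \<alpha>\<^esub> x"

end

theory Submission
  imports Defs "HOL-Computational_Algebra.Formal_Power_Series"
begin

text \<open>Both algebras carry commuting elements X k with known finite spectrum. In the cyclotomic Hecke
  algebra, X k is i_k times a unipotent element on M_i, so y k = 1 - X k / i_k is nilpotent there;
  conversely, the cyclotomic relation for y 1 propagates along the strands and makes every y k
  nilpotent, so that the KLR algebra has a family X k = i_k (1 - y k) with the same spectrum.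
  A polynomial in the X k whose value at i is nonzero is therefore invertible on e(i). On e(i), the
  generators g_a and psi_a are linked by
  g_a = q - psi_a (q X_a - X_{a+1} / q) / i_a if i_a = i_{a+1}, and otherwise by
  g_a (X_a - X_{a+1}) + (q - 1/q) X_{a+1} = psi_a N, where N is i_a q if i_{a+1} = q^2 i_a, and
  q X_a - X_{a+1} / q if not. All factors here can be cancelled, so the quadratic, far commutation
  and braid relations of the g_a are equivalent to those of the psi_a, and each family determines
  the other. The resulting homomorphisms in both directions are mutually inverse because they
  match the e(i) and the X k.\<close>

text \<open>The obstacle is that the two quotient algebras are records with explicit carriers, while
  the calculations want type-class rings. All rings on a type are therefore collected in one product
  of class \<open>ring\<close>, which has no unit, and each algebra is a direct factor whose unit is
  the scalar \<open>\<kappa> 1\<close>. This is why powers are iterated left multiplications, why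
  nilpotency is stated relative to a vector, and why conditions such as
  \<open>\<kappa> 1 * v = v\<close> accompany the arguments. The exceptional value i_a q of N
  compensates for q X_a - X_{a+1} / q being nilpotent on e(i) when i_{a+1} = q^2 i_a. The factor
  omitted there is q i_a (y_{a+1} - y_a), and y_{a+1} - y_a is exactly the arrow term in psi_a^2. To
  serve both directions, the locale linking g and psi assumes the quadratic, far commutation and
  braid relations of neither family. The underlying ring identities carry the defects of these
  relations as explicit terms, so that one identity, with its regular factors cancelled, yields both
  implications. The spectrum of X_1 is read off from the cyclotomic polynomial and carried from
  strand to strand by the intertwiners.\<close>

lemma mult_eq_assoc: "x * y = w \<Longrightarrow> x * (y * a) = w * a" for x y w a :: "'a::semigroup_mult"
  by (metis mult.assoc)

section \<open>Nilpotent actions and scalars\<close>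

text \<open>A local notion, with an exponent that may depend on \<open>v\<close>. For an idempotent
  \<open>v\<close> commuting with \<open>x\<close> it says that \<open>x\<close> is nilpotent on the
  corner of \<open>v\<close>.\<close>

definition nil :: "'a::ring \<Rightarrow> 'a \<Rightarrow> bool" where
  "nil x v \<longleftrightarrow> (\<exists>N. ((*) x ^^ N) v = 0)"

lemma lpow_mult_left: "t * x = x * t \<Longrightarrow> ((*) x ^^ N) (t * v) = t * ((*) x ^^ N) v" for t :: "'a::ring"
  by (induction N) (auto simp: mult.assoc[symmetric])

lemma lpow_mult_right: "((*) x ^^ N) (v * t) = ((*) x ^^ N) v * t" for t :: "'a::ring"
  by (induction N) (auto simp: mult.assoc)

lemma lpow_zero [simp]: "((*) x ^^ N) 0 = (0::'a::ring)"
  by (induction N) auto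

lemma lpow_add: "((*) x ^^ N) (v + w) = ((*) x ^^ N) v + ((*) x ^^ N) w" for v :: "'a::ring"
  by (induction N) (auto simp: distrib_left)

lemma lpow_mono: "((*) x ^^ N) v = (0::'a::ring) \<Longrightarrow> N \<le> M \<Longrightarrow> ((*) x ^^ M) v = 0"
  by (metis funpow_add comp_apply le_add_diff_inverse2 lpow_zero)

lemma nil_0 [simp]: "nil x 0" by (simp add: nil_def)

lemma nil_mult_left: "nil x v \<Longrightarrow> t * x = x * t \<Longrightarrow> nil x (t * v)"
  unfolding nil_def by (metis lpow_mult_left mult_zero_right)

lemma nil_mult_right: "nil x v \<Longrightarrow> nil x (v * t)"
  unfolding nil_def by (metis lpow_mult_right mult_zero_left)

lemma nil_add: "nil x v \<Longrightarrow> nil x w \<Longrightarrow> nil x (v + w)"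
  unfolding nil_def by (metis lpow_add lpow_mono add_0 max.cobounded1 max.cobounded2)

lemma nil_minus: "nil x v \<Longrightarrow> nil x (- v)"
proof -
  have "((*) x ^^ N) (- v) = - ((*) x ^^ N) v" for N by (induction N) auto
  then show "nil x v \<Longrightarrow> nil x (- v)" unfolding nil_def by (metis neg_equal_0_iff_equal)
qed

lemma nil_diff: "nil x v \<Longrightarrow> nil x w \<Longrightarrow> nil x (v - w)"
  using nil_add[OF _ nil_minus, of x v w] by simp

lemma nil_step: "nil x (x * v) \<Longrightarrow> nil x v"
  unfolding nil_def by (metis comp_apply funpow_Suc_right)

lemma nil_step_iff: "nil x (x * v) \<longleftrightarrow> nil x v"
  using nil_step nil_mult_left by blast

text \<open>Stands in for the binomial theorem: if N and M are exponents for \<open>x\<close> and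
  \<open>y\<close> on \<open>v\<close>, then \<open>x * v\<close> and \<open>y * v\<close> have
  exponent sum N + M - 1. By induction \<open>x + y\<close> is nilpotent on both, hence on
  \<open>(x + y) * v\<close>, hence on \<open>v\<close>.\<close>

lemma nil_op_add:
  assumes "x * y = y * x" "nil x v" "nil y v"
  shows "nil (x + y) v"
proof -
  have "((*) x ^^ N) v = 0 \<Longrightarrow> ((*) y ^^ M) v = 0 \<Longrightarrow> nil (x + y) v" for N M
  proof (induction "N + M" arbitrary: N M v)
    case 0 then show ?case by simp
  next
    case (Suc k)
    show ?case
    proof (cases "N = 0 \<or> M = 0")
      case True then show ?thesis using Suc.prems by auto
    next
      case False
      then obtain N' M' where NM: "N = Suc N'" "M = Suc M'" by (meson not0_implies_Suc)
      have "nil (x + y) (x * v)"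
      proof (rule Suc.hyps(1)[of N' M])
        show "((*) x ^^ N') (x * v) = 0" using Suc.prems NM by (simp add: funpow_swap1)
        show "((*) y ^^ M) (x * v) = 0" using Suc.prems by (simp add: lpow_mult_left assms(1))
      qed (use Suc.hyps(2) NM in auto)
      moreover have "nil (x + y) (y * v)"
      proof (rule Suc.hyps(1)[of N M'])
        show "((*) y ^^ M') (y * v) = 0" using Suc.prems NM by (simp add: funpow_swap1)
        show "((*) x ^^ N) (y * v) = 0" using Suc.prems by (simp add: lpow_mult_left assms(1))
      qed (use Suc.hyps(2) NM in auto)
      ultimately have "nil (x + y) ((x + y) * v)" by (simp add: distrib_right nil_add)
      then show ?thesis by (rule nil_step)
    qed
  qed
  then show ?thesis using assms unfolding nil_def by blast
qed

lemma nil_op_mult_central: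
  assumes "\<And>a. a * c = c * a" "nil x v"
  shows "nil (c * x) v"
proof -
  have "((*) x ^^ N) v = 0 \<Longrightarrow> ((*) (c * x) ^^ N) v = 0" for N
  proof (induction N arbitrary: v)
    case (Suc N)
    have "((*) (c * x) ^^ Suc N) v = ((*) (c * x) ^^ N) (c * x * v)"
      by (simp only: funpow_Suc_right comp_apply)
    moreover have "c * x * v = c * (x * v)" by (rule mult.assoc)
    moreover have "((*) (c * x) ^^ N) (c * (x * v)) = c * ((*) (c * x) ^^ N) (x * v)"
      by (rule lpow_mult_left) (metis assms(1))
    moreover have "((*) (c * x) ^^ N) (x * v) = 0"
      using Suc.prems by - (rule Suc.IH, simp add: funpow_swap1)
    ultimately show ?case by simp
  qed auto
  then show ?thesis using assms(2) unfolding nil_def by blast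
qed

text \<open>A homomorphism from the field into the centre of a ring without unit, so
  \<open>\<kappa> 1\<close> is just a central idempotent. In the applications it is the unit of one
  direct factor of a larger ring, and \<open>u * v = v\<close> says that \<open>v\<close> lies in
  this factor.\<close>

locale scalars =
  fixes \<kappa> :: "'k::field \<Rightarrow> 'a::ring"
  assumes k_add: "\<kappa> (a + b) = \<kappa> a + \<kappa> b"
    and k_mult: "\<kappa> (a * b) = \<kappa> a * \<kappa> b"
    and k_central: "x * \<kappa> a = \<kappa> a * x"
begin

abbreviation u :: 'a where "u \<equiv> \<kappa> 1"

lemma k_0 [simp]: "\<kappa> 0 = 0" using k_add[of 0 0] by simp
lemma k_minus: "\<kappa> (- a) = - \<kappa> a" using k_add[of a "- a"] by (simp add: minus_unique)
lemma k_diff: "\<kappa> (a - b) = \<kappa> a - \<kappa> b" using k_add[of a "- b"] k_minus by simp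
lemma u_k [simp]: "u * \<kappa> a = \<kappa> a" by (metis k_mult mult_1)
lemma k_u [simp]: "\<kappa> a * u = \<kappa> a" by (metis k_mult mult_1_right)
lemma u_mult_left: "u * v = v \<Longrightarrow> u * (t * v) = t * v" by (metis k_central mult.assoc)
lemma u_mult_right: "u * v = v \<Longrightarrow> u * (v * t) = v * t" by (metis mult.assoc)
lemma u_right: "u * v = v \<Longrightarrow> v * u = v" by (metis k_central)
lemma k_left_commute: "x * (\<kappa> a * y) = \<kappa> a * (x * y)" by (metis k_central mult.assoc)
lemma k_inverse: "c \<noteq> 0 \<Longrightarrow> \<kappa> (inverse c) * \<kappa> c = u" by (metis k_mult left_inverse)
lemma k_inverse': "c \<noteq> 0 \<Longrightarrow> \<kappa> c * \<kappa> (inverse c) = u" by (metis k_mult right_inverse)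
lemma k_cancel: "c \<noteq> 0 \<Longrightarrow> u * v = v \<Longrightarrow> \<kappa> c * v = 0 \<Longrightarrow> v = 0"
  by (metis k_inverse mult.assoc mult_zero_right)

text \<open>The vector \<open>\<nu> * v\<close> satisfies the same equation with a smaller exponent,
  so it is 0 by induction; what remains of the equation is
  \<open>\<kappa> c * v = 0\<close>.\<close>

lemma nil_cancel:
  assumes "nil \<nu> v" "c \<noteq> 0" "u * v = v" "(\<kappa> c + \<nu>) * v = 0"
  shows "v = 0"
proof -
  have "((*) \<nu> ^^ N) v = 0 \<Longrightarrow> u * v = v \<Longrightarrow> (\<kappa> c + \<nu>) * v = 0 \<Longrightarrow> v = 0" for N
  proof (induction N arbitrary: v)
    case (Suc N)
    have "(\<kappa> c + \<nu>) * (\<nu> * v) = \<nu> * ((\<kappa> c + \<nu>) * v)"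
      by (simp add: distrib_left distrib_right mult.assoc k_left_commute)
    then have "\<nu> * v = 0" using Suc.prems by - (rule Suc.IH, simp_all add: funpow_swap1 u_mult_left)
    then show ?case using Suc.prems k_cancel assms(2) by (simp add: distrib_right)
  qed auto
  then show ?thesis using assms unfolding nil_def by blast
qed

text \<open>Generalized eigenspaces for different eigenvalues meet in 0:
  \<open>(x - \<kappa> a) * v\<close> vanishes by induction, and \<open>x - \<kappa> a\<close> is a
  nonzero scalar plus \<open>x - \<kappa> b\<close>, so it can be cancelled.\<close>

lemma nil_distinct:
  assumes "nil (x - \<kappa> a) v" "nil (x - \<kappa> b) v" "a \<noteq> b" "u * v = v"
  shows "v = 0"
proof -
  have *: "(\<kappa> (b - a) + (x - \<kappa> b)) = x - \<kappa> a" by (simp add: k_diff)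
  have "((*) (x - \<kappa> a) ^^ N) v = 0 \<Longrightarrow> nil (x - \<kappa> b) v \<Longrightarrow> u * v = v \<Longrightarrow> v = 0" for N
  proof (induction N arbitrary: v)
    case (Suc N)
    have "(x - \<kappa> a) * (x - \<kappa> b) = (x - \<kappa> b) * (x - \<kappa> a)"
      using k_mult[of a b] k_mult[of b a] by (simp add: algebra_simps k_central[of x])
    then have "(x - \<kappa> a) * v = 0"
      using Suc.prems by - (rule Suc.IH, simp_all add: funpow_swap1 u_mult_left nil_mult_left)
    then show ?case using nil_cancel[of "x - \<kappa> b" v "b - a"] Suc.prems assms(3) by (simp add: *)
  qed auto
  then show ?thesis using assms unfolding nil_def by blast
qed

text \<open>The geometric series, computed recursively: the solution is (v - w) / c where w solves
  the equation with \<open>\<nu> * v\<close> on the right. The last clause records that the solution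
  is built from \<open>\<nu>\<close> and \<open>v\<close> only; later proofs use it to commute
  inverses past other elements.\<close>

lemma nil_inverse:
  assumes "nil \<nu> v" "c \<noteq> 0" "u * v = v"
  obtains w where "(\<kappa> c + \<nu>) * w = v" "u * w = w" "nil \<nu> w"
    "\<And>t. t * \<nu> = \<nu> * t \<Longrightarrow> t * v = v * t \<Longrightarrow> t * w = w * t"
proof -
  have "((*) \<nu> ^^ N) v = 0 \<Longrightarrow> u * v = v \<Longrightarrow> nil \<nu> v \<Longrightarrow> \<exists>w. (\<kappa> c + \<nu>) * w = v \<and> u * w = w \<and> nil \<nu> w
     \<and> (\<forall>t. t * \<nu> = \<nu> * t \<longrightarrow> t * v = v * t \<longrightarrow> t * w = w * t)" for N
  proof (induction N arbitrary: v)
    case 0 then show ?case by (intro exI[of _ 0]) auto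
  next
    case (Suc N)
    obtain w where w: "(\<kappa> c + \<nu>) * w = \<nu> * v" "u * w = w" "nil \<nu> w"
       "\<And>t. t * \<nu> = \<nu> * t \<Longrightarrow> t * (\<nu> * v) = \<nu> * v * t \<Longrightarrow> t * w = w * t"
      using Suc.IH[of "\<nu> * v"] Suc.prems by (auto simp: funpow_swap1 u_mult_left nil_step_iff)
    define w' where "w' = \<kappa> (inverse c) * (v - w)"
    have "(\<kappa> c + \<nu>) * w' = \<kappa> (inverse c) * ((\<kappa> c + \<nu>) * v - (\<kappa> c + \<nu>) * w)"
      unfolding w'_def by (simp add: k_left_commute right_diff_distrib)
    also have "\<dots> = \<kappa> (inverse c) * (\<kappa> c * v)" unfolding w(1) by (simp add: distrib_right)
    also have "\<dots> = v" by (metis Suc.prems(2) assms(2) k_inverse mult.assoc)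
    finally have 1: "(\<kappa> c + \<nu>) * w' = v" .
    have 2: "u * w' = w'" unfolding w'_def by (metis u_k mult.assoc)
    have 3: "nil \<nu> w'" unfolding w'_def
      by (rule nil_mult_left[OF nil_diff[OF Suc.prems(3) w(3)] k_central[symmetric]])
    have 4: "t * w' = w' * t" if "t * \<nu> = \<nu> * t" "t * v = v * t" for t
    proof -
      have "t * (\<nu> * v) = \<nu> * v * t" using that by (metis mult.assoc)
      then have "t * (v - w) = (v - w) * t"
        using w(4)[of t] that by (simp add: right_diff_distrib left_diff_distrib)
      then show ?thesis unfolding w'_def by (simp add: k_left_commute[of t] mult.assoc)
    qed
    show ?case using 1 2 3 4 by blast
  qed
  then show thesis using assms that unfolding nil_def by blast
qed

text \<open>The product of the \<open>x - s\<close> for s in \<open>xs\<close>, applied to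
  \<open>v\<close>. Acting on a vector avoids the empty product, which would have to be a unit of
  the ring.\<close>

definition pr :: "'k list \<Rightarrow> 'a \<Rightarrow> 'a \<Rightarrow> 'a" where
  "pr xs x v = foldr (\<lambda>s w. (x - \<kappa> s) * w) xs v"

lemma pr_simps [simp]: "pr [] x v = v" "pr (s # xs) x v = (x - \<kappa> s) * pr xs x v"
  by (auto simp: pr_def)

lemma pr_append: "pr (xs @ ys) x v = pr xs x (pr ys x v)"
  by (induction xs) auto

lemma pr_0 [simp]: "pr xs x 0 = 0" by (induction xs) auto

lemma pr_mult_left: "t * x = y * t \<Longrightarrow> t * pr xs x v = pr xs y (t * v)"
proof (induction xs)
  case (Cons s xs)
  have "t * (x - \<kappa> s) = (y - \<kappa> s) * t"
    by (simp add: algebra_simps Cons.prems k_central[of t])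
  then have "t * pr (s # xs) x v = (y - \<kappa> s) * (t * pr xs x v)"
    by (simp add: mult.assoc[symmetric])
  then show ?case using Cons by simp
qed auto

lemma pr_mult_right: "pr xs x (v * t) = pr xs x v * t"
  by (induction xs) (auto simp: mult.assoc)

lemma pr_u: "u * v = v \<Longrightarrow> u * pr xs x v = pr xs x v"
  using pr_mult_left[of u x x xs v] by (simp add: k_central)

lemma pr_scale_zero:
  assumes "c \<noteq> 0" "u * v = v" "pr xs (\<kappa> c * x) v = 0"
  shows "pr (map (\<lambda>s. s / c) xs) x v = 0"
proof -
  have "pr xs (\<kappa> c * x) v = \<kappa> (c ^ length xs) * pr (map (\<lambda>s. s / c) xs) x v" for xs
  proof (induction xs)
    case Nil then show ?case using assms by simp
  next
    case (Cons s xs)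
    have "\<kappa> c * x - \<kappa> s = \<kappa> c * (x - \<kappa> (s / c))"
      using assms(1) by (simp add: right_diff_distrib k_mult[symmetric])
    then show ?case using Cons k_left_commute[of "x - \<kappa> (s / c)" "c ^ length xs"]
      by (simp add: mult.assoc k_mult)
  qed
  then show ?thesis using assms k_cancel[of "c ^ length xs"] pr_u by simp
qed

text \<open>Lets a product of linear factors in \<open>x\<close> be exchanged for one in
  \<open>y\<close> on a vector where the two act alike; commutation keeps this agreement valid after
  each factor.\<close>

lemma pr_eigen: "x * y = y * x \<Longrightarrow> x * v = y * v \<Longrightarrow> pr xs x v = pr xs y v"
proof (induction xs)
  case (Cons s xs)
  have "x * pr xs y v = y * pr xs y v"
    using Cons.prems by (metis pr_mult_left)
  then show ?case using Cons by (simp add: left_diff_distrib)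
qed auto

text \<open>Partial fractions by induction: decompose \<open>(x - a) * v\<close>, divide its
  components at s different from a by \<open>x - a\<close>, which is invertible there, and let the
  component at a be whatever is missing from \<open>v\<close>. The commutation clause later makes
  the components of different commuting elements compatible.\<close>

lemma spectral_vector:
  assumes "pr xs x v = 0" "u * v = v"
  shows "\<exists>E. (\<Sum>s\<in>set xs. E s) = v \<and> (\<forall>s\<in>set xs. nil (x - \<kappa> s) (E s) \<and> u * E s = E s
     \<and> (\<forall>t. t * x = x * t \<longrightarrow> t * v = v * t \<longrightarrow> t * E s = E s * t))"
  using assms
proof (induction xs arbitrary: v)
  case Nil then show ?case by auto
next
  case (Cons a xs)
  define v1 where "v1 = (x - \<kappa> a) * v"
  have v1: "pr xs x v1 = 0" "u * v1 = v1"
    using Cons.prems unfolding v1_def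
    using pr_mult_left[of "x - \<kappa> a" x x xs v] u_mult_left[OF Cons.prems(2)]
    by (simp_all add: algebra_simps k_central[of x])
  obtain E where E: "(\<Sum>s\<in>set xs. E s) = v1" "\<And>s. s \<in> set xs \<Longrightarrow> nil (x - \<kappa> s) (E s)"
    "\<And>s. s \<in> set xs \<Longrightarrow> u * E s = E s"
    "\<And>s t. s \<in> set xs \<Longrightarrow> t * x = x * t \<Longrightarrow> t * v1 = v1 * t \<Longrightarrow> t * E s = E s * t"
    using Cons.IH[OF v1] by blast
  have tx: "t * (x - \<kappa> a) = (x - \<kappa> a) * t" if "t * x = x * t" for t a
    using that by (simp add: algebra_simps k_central[of t])
  have tv1: "t * v1 = v1 * t" if "t * x = x * t" "t * v = v * t" for t
    using tx[of t a] that unfolding v1_def by (metis mult.assoc)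
  have ex: "\<exists>w. (x - \<kappa> a) * w = E s \<and> u * w = w \<and> nil (x - \<kappa> s) w \<and>
     (\<forall>t. t * x = x * t \<longrightarrow> t * v = v * t \<longrightarrow> t * w = w * t)" if s: "s \<in> set xs - {a}" for s
  proof -
    obtain w where w: "(\<kappa> (s - a) + (x - \<kappa> s)) * w = E s" "u * w = w" "nil (x - \<kappa> s) w"
      "\<And>t. t * (x - \<kappa> s) = (x - \<kappa> s) * t \<Longrightarrow> t * E s = E s * t \<Longrightarrow> t * w = w * t"
      using nil_inverse[of "x - \<kappa> s" "E s" "s - a"] E(2,3)[of s] s by auto
    moreover have "\<kappa> (s - a) + (x - \<kappa> s) = x - \<kappa> a" by (simp add: k_diff)
    moreover have "t * w = w * t" if "t * x = x * t" "t * v = v * t" for t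
      using w(4)[OF tx E(4)] that tv1[OF that] s by simp
    ultimately show ?thesis by (intro exI[of _ w]) simp
  qed
  define Q where "Q s w \<longleftrightarrow> (x - \<kappa> a) * w = E s \<and> u * w = w \<and>
     nil (x - \<kappa> s) w \<and> (\<forall>t. t * x = x * t \<longrightarrow> t * v = v * t \<longrightarrow> t * w = w * t)" for s w
  have "\<forall>s\<in>set xs - {a}. \<exists>w. Q s w"
    unfolding Q_def using ex by blast
  then obtain w where "\<forall>s\<in>set xs - {a}. Q s (w s)"
    using bchoice[of "set xs - {a}" Q] by blast
  then have w: "\<And>s. s \<in> set xs - {a} \<Longrightarrow> (x - \<kappa> a) * w s = E s"
    "\<And>s. s \<in> set xs - {a} \<Longrightarrow> u * w s = w s" "\<And>s. s \<in> set xs - {a} \<Longrightarrow> nil (x - \<kappa> s) (w s)"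
    "\<And>s t. s \<in> set xs - {a} \<Longrightarrow> t * x = x * t \<Longrightarrow> t * v = v * t \<Longrightarrow> t * w s = w s * t"
    unfolding Q_def by simp_all
  define F where "F = (\<lambda>s. if s = a then v - (\<Sum>s\<in>set xs - {a}. w s) else w s)"
  have set: "set (a # xs) = insert a (set xs - {a})" by auto
  have sumF: "(\<Sum>s\<in>set (a # xs). F s) = v"
    unfolding set by (subst sum.insert) (auto simp: F_def intro!: sum.cong)
  \<comment> \<open>The components \<open>w s\<close> were chosen so that multiplication by
    \<open>x - a\<close> leaves only the a-component of \<open>v1\<close>, or 0 if a does not occur
    again in \<open>xs\<close>. Either way \<open>nil_step\<close> places \<open>F a\<close> in the
    generalized eigenspace of a.\<close>
  have "(x - \<kappa> a) * F a = v1 - (\<Sum>s\<in>set xs - {a}. E s)"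
    unfolding F_def by (simp add: v1_def right_diff_distrib sum_distrib_left w(1))
  also have "\<dots> = (if a \<in> set xs then E a else 0)"
    unfolding E(1)[symmetric] by (auto simp: sum.remove[of "set xs" a])
  finally have "nil (x - \<kappa> a) ((x - \<kappa> a) * F a)" using E(2)[of a] by simp
  then have Fa: "nil (x - \<kappa> a) (F a)" by (rule nil_step)
  have uF: "u * F a = F a" unfolding F_def using Cons.prems w(2)
    by (simp add: right_diff_distrib sum_distrib_left)
  have tF: "t * F a = F a * t" if "t * x = x * t" "t * v = v * t" for t
    unfolding F_def using that w(4)[OF _ that]
    by (simp add: right_diff_distrib left_diff_distrib sum_distrib_left sum_distrib_right)
  show ?case
  proof (intro exI[of _ F] conjI ballI allI impI, goal_cases)
    case 1 show ?case by (rule sumF)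
  next
    case (2 s) then show ?case using Fa w(3)[of s] by (cases "s = a") (auto simp: F_def)
  next
    case (3 s) then show ?case using uF w(2)[of s] by (cases "s = a") (auto simp: F_def)
  next
    case (4 s t) then show ?case using tF w(4)[of s t] by (cases "s = a") (auto simp: F_def)
  qed
qed

end

declare One_nat_def [simp del]

section \<open>Ring identities\<close>

text \<open>Here \<open>p1\<close>, \<open>p2\<close> are the intertwiners phi and \<open>b\<close>
  is the defect of the braid relation, which is left open. All \<open>x\<close> are moved to the
  right of the \<open>g\<close> and squares are reduced; the words of length three that remain
  assemble to \<open>b\<close>. The four combinations serve the label patterns (i,i,j), (j,i,i),
  (i,j,i) and pairwise distinct: phi replaces g exactly at the crossings of distinct labels.\<close>

lemma hecke_braid_intertwiners:
  fixes g1 g2 x1 x2 x3 z u :: "'a::ring"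
  assumes z: "\<And>a. a * z = z * a"
    and u: "u * g1 = g1" "g1 * u = g1" "u * x1 = x1"  "u * x2 = x2" "x2 * u = x2" "u * x3 = x3"
      "x3 * u = x3" "u * g2 = g2" "g2 * u = g2"
    and xx: "x2 * x1 = x1 * x2" "x3 * x1 = x1 * x3" "x3 * x2 = x2 * x3"
    and g1: "x1 * g1 = g1 * x2 - z * x2" "x2 * g1 = g1 * x1 + z * x2" "x3 * g1 = g1 * x3"
    and g2: "x2 * g2 = g2 * x3 - z * x3" "x3 * g2 = g2 * x2 + z * x3" "x1 * g2 = g2 * x1"
    and q1: "g1 * g1 = z * g1 + u" and q2: "g2 * g2 = z * g2 + u"
  defines "p1 \<equiv> g1 * (x1 - x2) + z * x2" and "p2 \<equiv> g2 * (x2 - x3) + z * x3"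
    and "b \<equiv> g1 * g2 * g1 - g2 * g1 * g2"
  shows "p1 * p2 * g1 - g2 * p1 * p2 = b * (x1 - x3) * (x2 - x3)"
    and "p2 * p1 * g2 - g1 * p2 * p1 = - b * (x1 - x2) * (x1 - x3)"
    and "p1 * g2 * p1 - p2 * g1 * p2
      = b * (x1 - x2) * (x2 - x3) - z * x3 * (z * z * x2 + x2 + x2 - x1 - x3)"
    and "p1 * p2 * p1 - p2 * p1 * p2 = b * (x1 - x2) * (x1 - x3) * (x2 - x3)"
proof -
  have zz: "g1 * z = z * g1" "g2 * z = z * g2" "x1 * z = z * x1" "x2 * z = z * x2" "x3 * z = z * x3"
    "u * z = z * u"
    by (rule z)+
  note R = xx g1 g2 q1 q2 u zz
  note R' = R R[THEN mult_eq_assoc]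
  show "p1 * p2 * g1 - g2 * p1 * p2 = b * (x1 - x3) * (x2 - x3)"
    and "p2 * p1 * g2 - g1 * p2 * p1 = - b * (x1 - x2) * (x1 - x3)"
    and "p1 * g2 * p1 - p2 * g1 * p2
      = b * (x1 - x2) * (x2 - x3) - z * x3 * (z * z * x2 + x2 + x2 - x1 - x3)"
    and "p1 * p2 * p1 - p2 * p1 * p2 = b * (x1 - x2) * (x1 - x3) * (x2 - x3)"
    unfolding p1_def p2_def b_def by (simp_all add: algebra_simps R')
qed

text \<open>In a Hecke algebra the square of the intertwiner is the product of two linear factors;
  here the quadratic relation is left open and its defect appears as a correction term.\<close>

lemma hecke_intertwiner_square:
  fixes g x1 x2 Q Q' u :: "'a::ring"
  assumes c: "\<And>a. a * Q = Q * a" "\<And>a. a * Q' = Q' * a" and QQ: "Q * Q' = u"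
    and u: "u * x1 = x1" "u * x2 = x2" "u * g = g" "g * u = g"
    and xx: "x2 * x1 = x1 * x2"
  defines "z \<equiv> Q - Q'"
  assumes g: "g * x1 = x2 * g - z * x2" "g * x2 = x1 * g + z * x2"
  shows "(g * (x1 - x2) + z * x2) * (g * (x1 - x2) + z * x2)
    = (Q * x1 - Q' * x2) * (Q * x2 - Q' * x1) - (g * g - z * g - u) * (x1 - x2) * (x1 - x2)"
proof -
  have cc: "g * Q = Q * g" "x1 * Q = Q * x1" "x2 * Q = Q * x2" "u * Q = Q * u"
    "g * Q' = Q' * g" "x1 * Q' = Q' * x1" "x2 * Q' = Q' * x2" "u * Q' = Q' * u" "Q' * Q = Q * Q'"
    by (rule c)+
  have g': "x2 * g = g * x1 + z * x2" "x1 * g = g * x2 - z * x2" using g by simp_all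
  note R = xx g'[unfolded z_def] QQ u cc
  note R' = R R[THEN mult_eq_assoc]
  show ?thesis
    unfolding z_def by (simp add: algebra_simps R')
qed

text \<open>The model is the nil-Hecke algebra of divided differences \<open>f1\<close>,
  \<open>f2\<close>, with its braid relation left open. The \<open>g1\<close>, \<open>g2\<close>
  have the shape of Demazure-Lusztig elements, and their braid defect is the one of the
  \<open>f\<close> times a product of linear factors.\<close>

lemma nil_hecke_braid:
  fixes f1 f2 x1 x2 x3 c p r :: "'a::ring"
  assumes c: "\<And>a. a * p = p * a" "\<And>a. a * r = r * a"
    and fc: "f1 * c = c * f1" "f2 * c = c * f2" "x1 * c = c * x1" "x2 * c = c * x2" "x3 * c = c * x3"
    and xx: "x2 * x1 = x1 * x2" "x3 * x1 = x1 * x3" "x3 * x2 = x2 * x3"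
    and f1: "x1 * f1 = f1 * x2 + c" "x2 * f1 = f1 * x1 - c" "x3 * f1 = f1 * x3"
    and f2: "x2 * f2 = f2 * x3 + c" "x3 * f2 = f2 * x2 - c" "x1 * f2 = f2 * x1"
    and sq: "f1 * f1 = 0" "f2 * f2 = 0"
  defines "g1 \<equiv> p * c - f1 * (p * x1 - r * x2)" and "g2 \<equiv> p * c - f2 * (p * x2 - r * x3)"
  shows "g1 * g2 * g1 - g2 * g1 * g2
    = - (f1 * f2 * f1 - f2 * f1 * f2) * (p * x1 - r * x2) * (p * x1 - r * x3) * (p * x2 - r * x3)"
proof -
  have cc: "f1 * p = p * f1" "f2 * p = p * f2" "x1 * p = p * x1" "x2 * p = p * x2" "x3 * p = p * x3"
    "f1 * r = r * f1" "f2 * r = r * f2" "x1 * r = r * x1" "x2 * r = r * x2" "x3 * r = r * x3"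
    "c * p = p * c" "c * r = r * c" "r * p = p * r"
    by (rule c)+
  note R = xx f1 f2 sq fc cc
  note R' = R R[THEN mult_eq_assoc]
  show ?thesis
    unfolding g1_def g2_def by (simp add: algebra_simps R')
qed

text \<open>Each side is a Hecke generator completed by functions of its own two strands. These
  functions commute with everything on the other strands, so only the commutator of
  \<open>ga\<close> and \<open>gc\<close> survives.\<close>

lemma far_commutator:
  fixes ga gc da dc za zc :: "'a::ring"
  assumes "da * dc = dc * da" "za * dc = dc * za" "da * zc = zc * da" "za * zc = zc * za"
    and "da * gc = gc * da" "za * gc = gc * za" "dc * ga = ga * dc" "zc * ga = ga * zc"
  shows "(ga * da + za) * (gc * dc + zc) - (gc * dc + zc) * (ga * da + za)
    = (ga * gc - gc * ga) * (da * dc)"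
  by (simp add: algebra_simps assms assms[THEN mult_eq_assoc])

section \<open>Spectral decompositions\<close>

lemma length_swp [simp]: "length (swp a i) = length i"
  by (simp add: swp_def)

lemma sb_sb [simp]: "sb a (sb a k) = k"
  by (auto simp: sb_def)

lemma sb_range: "a \<in> {1..<n} \<Longrightarrow> k \<in> {1..n} \<Longrightarrow> sb a k \<in> {1..n}"
  by (auto simp: sb_def)

lemma ix_swp: "a \<in> {1..<n} \<Longrightarrow> length i = n \<Longrightarrow> k \<in> {1..n} \<Longrightarrow> ix (swp a i) k = ix i (sb a k)"
  by (auto simp: swp_def ix_def sb_def nth_list_update)

lemma list_eq_ix: "length i = n \<Longrightarrow> length j = n \<Longrightarrow> (\<And>k. k \<in> {1..n} \<Longrightarrow> ix i k = ix j k) \<Longrightarrow> i = j"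
proof (rule nth_equalityI)
  fix k assume *: "length i = n" "\<And>k. k \<in> {1..n} \<Longrightarrow> ix i k = ix j k" "k < length i"
  then have "ix i (Suc k) = ix j (Suc k)" by auto
  then show "i ! k = j ! k" by (simp add: ix_def)
qed simp

lemma swp_swp: "a \<in> {1..<n} \<Longrightarrow> length i = n \<Longrightarrow> swp a (swp a i) = i"
  by (rule list_eq_ix[where n = n]) (simp_all add: ix_swp sb_range del: atLeastLessThan_iff atLeastAtMost_iff)

lemma swp_same: "a \<in> {1..<n} \<Longrightarrow> length i = n \<Longrightarrow> ix i a = ix i (a + 1) \<Longrightarrow> swp a i = i"
  by (rule list_eq_ix[where n = n]) (auto simp: ix_swp sb_range sb_def)

locale idempotents = scalars \<kappa> for \<kappa> :: "'k::field \<Rightarrow> 'a::ring" +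
  fixes B :: "'i set" and e :: "'i \<Rightarrow> 'a"
  assumes fin_B: "finite B"
    and e_e: "i \<in> B \<Longrightarrow> j \<in> B \<Longrightarrow> e i * e j = (if i = j then e i else 0)"
    and sum_e: "(\<Sum>i\<in>B. e i) = \<kappa> 1"
begin

lemma u_e: "i \<in> B \<Longrightarrow> u * e i = e i"
  by (simp add: sum_e[symmetric] sum_distrib_right e_e if_distrib sum.delta fin_B cong: if_cong)

lemma e_u: "i \<in> B \<Longrightarrow> e i * u = e i"
  by (metis k_central u_e)

lemma e_idem: "i \<in> B \<Longrightarrow> e i * e i = e i" by (simp add: e_e)

lemma e_vec_u: "i \<in> B \<Longrightarrow> e i * v = v \<Longrightarrow> u * v = v"
  by (metis u_e mult.assoc)

lemma vec_k: "e i * v = v \<Longrightarrow> e i * (\<kappa> a * v) = \<kappa> a * v"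
  by (metis k_left_commute)

lemma vec_diff: "e i * v = v \<Longrightarrow> e i * w = w \<Longrightarrow> e i * (v - w) = v - w"
  by (simp add: right_diff_distrib)

lemma eq_on_e: "u * a = a \<Longrightarrow> u * b = b \<Longrightarrow> (\<And>i. i \<in> B \<Longrightarrow> a * e i = b * e i) \<Longrightarrow> a = b"
proof -
  assume "u * a = a" "u * b = b" and *: "\<And>i. i \<in> B \<Longrightarrow> a * e i = b * e i"
  then have "a = a * u" "b = b * u" by (metis u_right)+
  then show "a = b" using * by (metis (no_types, lifting) sum_e sum_distrib_left sum.cong)
qed

lemma eq_on_e_left: "u * a = a \<Longrightarrow> u * b = b \<Longrightarrow> (\<And>i. i \<in> B \<Longrightarrow> e i * a = e i * b) \<Longrightarrow> a = b"
  by (metis (no_types, lifting) sum_e sum_distrib_right sum.cong)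

text \<open>Elements defined blockwise as sums over \<open>B\<close> are evaluated through this
  rule.\<close>

lemma sum_at:
  assumes "\<And>i. i \<in> B \<Longrightarrow> f i * e i = f i" "j \<in> B"
  shows "(\<Sum>i\<in>B. f i) * e j = f j"
proof -
  have "(\<Sum>i\<in>B. f i) * e j = (\<Sum>i\<in>B. if i = j then f j else 0)"
    unfolding sum_distrib_right
  proof (rule sum.cong[OF refl])
    fix i assume i: "i \<in> B"
    have "f i * e j = f i * (e i * e j)" using assms(1)[OF i] by (metis mult.assoc)
    then show "f i * e j = (if i = j then f j else 0)" using assms i by (auto simp: e_e)
  qed
  then show ?thesis using assms(2) fin_B by simp
qed

end

text \<open>Shared by both algebras: commuting X k with joint generalized eigenspaces indexed by
  \<open>B\<close>, a set of tuples with nonzero entries closed under adjacent transpositions.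
  Neither g nor \<psi> occurs yet, so the facts about functions of the X k are proved once.\<close>

locale spectral = idempotents \<kappa> B e
  for \<kappa> :: "'k::field \<Rightarrow> 'a::ring" and q :: 'k and n :: nat and B :: "'k list set"
    and e :: "'k list \<Rightarrow> 'a" and X :: "nat \<Rightarrow> 'a" +
  assumes q0: "q \<noteq> 0" and q2: "q\<^sup>2 \<noteq> 1"
    and len: "i \<in> B \<Longrightarrow> length i = n"
    and swp_B: "a \<in> {1..<n} \<Longrightarrow> i \<in> B \<Longrightarrow> swp a i \<in> B"
    and nz: "i \<in> B \<Longrightarrow> k \<in> {1..n} \<Longrightarrow> ix i k \<noteq> 0"
    and u_X: "k \<in> {1..n} \<Longrightarrow> \<kappa> 1 * X k = X k"
    and X_X: "k \<in> {1..n} \<Longrightarrow> l \<in> {1..n} \<Longrightarrow> X k * X l = X l * X k"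
    and X_e: "k \<in> {1..n} \<Longrightarrow> i \<in> B \<Longrightarrow> X k * e i = e i * X k"
    and nil_X: "i \<in> B \<Longrightarrow> k \<in> {1..n} \<Longrightarrow> nil (X k - \<kappa> (ix i k)) (e i)"
begin

lemma vec_X: "k \<in> {1..n} \<Longrightarrow> i \<in> B \<Longrightarrow> e i * v = v \<Longrightarrow> e i * (X k * v) = X k * v"
  by (metis X_e mult.assoc)

text \<open>The tuples differ at some k, and there X k would have two different eigenvalues on
  \<open>e j * v\<close>. The tuple \<open>i\<close> may lie outside \<open>B\<close>; this covers
  the spaces M_i for arbitrary i in S^n.\<close>

lemma other_eigenspace:
  assumes i: "length i = n" and v: "u * v = v" "\<And>k. k \<in> {1..n} \<Longrightarrow> nil (X k - \<kappa> (ix i k)) v"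
    and j: "j \<in> B" "j \<noteq> i"
  shows "e j * v = 0"
proof -
  obtain k where k: "k \<in> {1..n}" "ix i k \<noteq> ix j k"
    using list_eq_ix[of i n j] len i j by blast
  show ?thesis
  proof (rule nil_distinct[OF _ _ k(2)])
    show "nil (X k - \<kappa> (ix i k)) (e j * v)"
      using v(2)[OF k(1)] by (rule nil_mult_left)
        (simp add: left_diff_distrib right_diff_distrib X_e[OF k(1) j(1)] k_central[of "e j"])
    show "nil (X k - \<kappa> (ix j k)) (e j * v)"
      using nil_X[OF j(1) k(1)] by (rule nil_mult_right)
    show "u * (e j * v) = e j * v" by (rule u_mult_left[OF v(1)])
  qed
qed

lemma in_eigenspace:
  assumes i: "i \<in> B" and v: "u * v = v" "\<And>k. k \<in> {1..n} \<Longrightarrow> nil (X k - \<kappa> (ix i k)) v"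
  shows "e i * v = v" and "j \<in> B \<Longrightarrow> j \<noteq> i \<Longrightarrow> e j * v = 0"
proof -
  have *: "e j * v = 0" if "j \<in> B" "j \<noteq> i" for j
    by (rule other_eigenspace[OF len[OF i] v that])
  then show "j \<in> B \<Longrightarrow> j \<noteq> i \<Longrightarrow> e j * v = 0" .
  have "v = (\<Sum>j\<in>B. e j * v)" using v(1) by (simp add: sum_distrib_right[symmetric] sum_e)
  also have "\<dots> = e i * v + (\<Sum>j\<in>B-{i}. e j * v)" by (rule sum.remove[OF fin_B i])
  also have "(\<Sum>j\<in>B-{i}. e j * v) = 0" by (rule sum.neutral) (use * in auto)
  finally show "e i * v = v" by simp
qed

text \<open>Double commutants play the role of the ring of functions of the X k, k in K,
  that are regular at the spectrum.\<close>

definition pc :: "nat set \<Rightarrow> 'a \<Rightarrow> bool" where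
  "pc K f \<longleftrightarrow> (\<forall>t. (\<forall>k\<in>K. t * X k = X k * t) \<longrightarrow> t * f = f * t)"

lemma pc_X: "k \<in> K \<Longrightarrow> pc K (X k)" by (auto simp: pc_def)
lemma pc_k: "pc K (\<kappa> a)" by (auto simp: pc_def k_central)
lemma pc_add: "pc K f \<Longrightarrow> pc K g \<Longrightarrow> pc K (f + g)" by (auto simp: pc_def algebra_simps)
lemma pc_diff: "pc K f \<Longrightarrow> pc K g \<Longrightarrow> pc K (f - g)" by (auto simp: pc_def algebra_simps)
lemma pc_minus: "pc K f \<Longrightarrow> pc K (- f)" by (auto simp: pc_def)
lemma pc_mult: "pc K f \<Longrightarrow> pc K g \<Longrightarrow> pc K (f * g)" unfolding pc_def by (metis mult.assoc)
lemma pc_mono: "pc K f \<Longrightarrow> K \<subseteq> L \<Longrightarrow> pc L f" unfolding pc_def by blast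
lemma pc_commute: "pc K f \<Longrightarrow> (\<And>k. k \<in> K \<Longrightarrow> t * X k = X k * t) \<Longrightarrow> t * f = f * t"
  unfolding pc_def by blast
lemmas pc_intros = pc_X pc_k pc_add pc_diff pc_minus pc_mult

lemma pc_pc: "pc {1..n} f \<Longrightarrow> pc {1..n} g \<Longrightarrow> f * g = g * f"
  by (rule pc_commute[of "{1..n}" g]) (auto intro: pc_commute[symmetric] simp: X_X)

lemma pc_e: "pc {1..n} f \<Longrightarrow> i \<in> B \<Longrightarrow> f * e i = e i * f"
  by (rule pc_commute[symmetric]) (auto simp: X_e)

lemma vec_pc: "pc {1..n} f \<Longrightarrow> i \<in> B \<Longrightarrow> e i * v = v \<Longrightarrow> e i * (f * v) = f * v"
  by (metis pc_e mult.assoc)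

text \<open>The linear form is its value at \<open>i\<close> plus a nilpotent part, so
  \<open>nil_inverse\<close> applies to the vector \<open>e i\<close>. Commutation with
  \<open>e i\<close> enters the last clause because the inverse starts from that vector.\<close>

lemma lin_inverse:
  assumes i: "i \<in> B" and kl: "k \<in> {1..n}" "l \<in> {1..n}" and c: "a * ix i k + b * ix i l \<noteq> 0"
  shows "\<exists>D. (\<kappa> a * X k + \<kappa> b * X l) * D = e i \<and> u * D = D
    \<and> (\<forall>t. t * X k = X k * t \<longrightarrow> t * X l = X l * t \<longrightarrow> t * e i = e i * t \<longrightarrow> t * D = D * t)"
proof -
  let ?c = "a * ix i k + b * ix i l"
  let ?\<nu> = "\<kappa> a * (X k - \<kappa> (ix i k)) + \<kappa> b * (X l - \<kappa> (ix i l))"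
  have eq: "\<kappa> ?c + ?\<nu> = \<kappa> a * X k + \<kappa> b * X l"
    by (simp add: k_add k_mult algebra_simps)
  have pcs: "pc {1..n} (\<kappa> a * (X k - \<kappa> (ix i k)))" "pc {1..n} (\<kappa> b * (X l - \<kappa> (ix i l)))"
    using kl by (auto intro!: pc_intros)
  have nil: "nil ?\<nu> (e i)"
    by (intro nil_op_add nil_op_mult_central nil_X i kl k_central pc_pc pcs)
  obtain D where D: "(\<kappa> ?c + ?\<nu>) * D = e i" "u * D = D"
     "\<And>t. t * ?\<nu> = ?\<nu> * t \<Longrightarrow> t * e i = e i * t \<Longrightarrow> t * D = D * t"
    using nil_inverse[OF nil c u_e[OF i]] by metis
  have "t * ?\<nu> = ?\<nu> * t" if "t * X k = X k * t" "t * X l = X l * t" for t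
  proof -
    have "pc {k, l} ?\<nu>" by (auto intro!: pc_intros)
    then show ?thesis by (rule pc_commute) (use that in auto)
  qed
  then show ?thesis using D unfolding eq by blast
qed

text \<open>Right cancellability of \<open>f\<close> on \<open>e i\<close>. Of invertibility only
  this consequence is recorded, since it passes to products without inverses being tracked.\<close>

definition reg :: "'k list \<Rightarrow> 'a \<Rightarrow> bool" where
  "reg i f \<longleftrightarrow> f * e i = e i * f \<and> (\<forall>T. T * (f * e i) = 0 \<longrightarrow> T * e i = 0)"

lemma reg_lin:
  assumes i: "i \<in> B" and kl: "k \<in> {1..n}" "l \<in> {1..n}" and c: "a * ix i k + b * ix i l \<noteq> 0"
  shows "reg i (\<kappa> a * X k + \<kappa> b * X l)"
proof -
  obtain D where D: "(\<kappa> a * X k + \<kappa> b * X l) * D = e i"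
     "\<And>t. t * X k = X k * t \<Longrightarrow> t * X l = X l * t \<Longrightarrow> t * e i = e i * t \<Longrightarrow> t * D = D * t"
    using lin_inverse[OF assms] by metis
  have eD: "e i * D = D * e i" by (rule D(2)) (simp_all only: X_e[OF kl(1) i] X_e[OF kl(2) i])
  have com: "(\<kappa> a * X k + \<kappa> b * X l) * e i = e i * (\<kappa> a * X k + \<kappa> b * X l)"
    by (rule pc_e) (use i kl in \<open>auto intro!: pc_intros\<close>)
  have "T * e i = 0" if "T * ((\<kappa> a * X k + \<kappa> b * X l) * e i) = 0" for T
  proof -
    have "T * e i = T * (e i * e i)" by (simp add: e_idem i)
    also have "\<dots> = T * ((\<kappa> a * X k + \<kappa> b * X l) * e i) * D"
      by (subst D(1)[symmetric]) (simp add: mult.assoc eD)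
    finally show ?thesis using that by simp
  qed
  then show ?thesis using com by (simp add: reg_def)
qed

lemma reg_mult: "reg i f \<Longrightarrow> reg i g \<Longrightarrow> reg i (f * g)"
proof -
  assume f: "reg i f" and g: "reg i g"
  have "f * g * e i = e i * (f * g)"
    using f g unfolding reg_def by (metis (no_types) mult.assoc)
  moreover have "T * e i = 0" if "T * (f * g * e i) = 0" for T
  proof -
    have "T * f * (g * e i) = 0" using that by (simp add: mult.assoc)
    then have "T * f * e i = 0" using g unfolding reg_def by blast
    then show ?thesis using f unfolding reg_def by (simp add: mult.assoc)
  qed
  ultimately show ?thesis unfolding reg_def by blast
qed

lemma reg_k: "i \<in> B \<Longrightarrow> c \<noteq> 0 \<Longrightarrow> reg i (\<kappa> c)"
proof -
  assume "i \<in> B" "c \<noteq> 0"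
  then have "T * e i = 0" if "T * (\<kappa> c * e i) = 0" for T
    using that k_cancel[of c "T * e i"] u_mult_left[OF u_e] by (simp add: k_left_commute[of T])
  then show ?thesis by (simp add: reg_def k_central)
qed

lemma reg_eq_0: "reg i f \<Longrightarrow> T * (f * e i) = 0 \<longleftrightarrow> T * e i = 0"
proof -
  assume f: "reg i f"
  then have "T * (f * e i) = T * e i * f" by (simp add: reg_def mult.assoc)
  then show ?thesis using f unfolding reg_def by auto
qed

text \<open>The linear factor whose value at \<open>i\<close> is 0 exactly when i_l = q^2 i_k. The
  square of the Hecke intertwiner is \<open>nn a (a + 1) * nn (a + 1) a\<close>.\<close>

definition nn :: "nat \<Rightarrow> nat \<Rightarrow> 'a" where
  "nn k l = \<kappa> q * X k - \<kappa> (inverse q) * X l"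

lemma u_nn: "k \<in> {1..n} \<Longrightarrow> l \<in> {1..n} \<Longrightarrow> u * nn k l = nn k l"
  by (simp add: nn_def right_diff_distrib mult.assoc[symmetric])

lemma pc_nn: "k \<in> K \<Longrightarrow> l \<in> K \<Longrightarrow> pc K (nn k l)"
  unfolding nn_def by (intro pc_intros)

lemma reg_nn:
  assumes "i \<in> B" "k \<in> {1..n}" "l \<in> {1..n}" "ix i l \<noteq> q\<^sup>2 * ix i k"
  shows "reg i (nn k l)"
proof -
  have "q * ix i k + (- inverse q) * ix i l \<noteq> 0"
    using q0 assms(4) by (simp add: field_simps power2_eq_square)
  from reg_lin[OF assms(1-3) this] show ?thesis by (simp add: nn_def k_minus)
qed

lemma reg_diff:
  assumes "i \<in> B" "k \<in> {1..n}" "l \<in> {1..n}" "ix i k \<noteq> ix i l"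
  shows "reg i (X k - X l)"
proof -
  have "1 * ix i k + (- 1) * ix i l \<noteq> 0" using assms(4) by simp
  from reg_lin[OF assms(1-3) this] show ?thesis by (simp add: u_X[OF assms(2)] u_X[OF assms(3)] k_minus)
qed

text \<open>At t = q^2 s the factor \<open>nn\<close> is nilpotent and cannot be cancelled, so the
  constant q s takes its place. The complementary factor is \<open>cc\<close>: the product of
  \<open>NN\<close> and \<open>cc\<close> is \<open>nn\<close>, and the normalization by q s makes
  \<open>cc\<close> equal to y l - y k on the idempotent.\<close>

definition NN :: "'k \<Rightarrow> 'k \<Rightarrow> nat \<Rightarrow> nat \<Rightarrow> 'a" where
  "NN s t k l = (if t = q\<^sup>2 * s then \<kappa> (q * s) else nn k l)"

definition cc :: "'k \<Rightarrow> 'k \<Rightarrow> nat \<Rightarrow> nat \<Rightarrow> 'a" where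
  "cc s t k l = (if t = q\<^sup>2 * s then \<kappa> (inverse (q * s)) * nn k l else u)"

lemma pc_NN: "k \<in> K \<Longrightarrow> l \<in> K \<Longrightarrow> pc K (NN s t k l)"
  unfolding NN_def by (auto intro: pc_k pc_nn)

lemma pc_cc: "k \<in> K \<Longrightarrow> l \<in> K \<Longrightarrow> pc K (cc s t k l)"
  unfolding cc_def by (auto intro: pc_k pc_nn pc_mult)

lemma NN_cc: "s \<noteq> 0 \<Longrightarrow> k \<in> {1..n} \<Longrightarrow> l \<in> {1..n} \<Longrightarrow> NN s t k l * cc s t k l = nn k l"
  using q0 u_nn[of k l] k_inverse'[of "q * s"]
  by (auto simp: NN_def cc_def mult.assoc[symmetric] u_right)

lemma reg_NN: "i \<in> B \<Longrightarrow> k \<in> {1..n} \<Longrightarrow> l \<in> {1..n} \<Longrightarrow> reg i (NN (ix i k) (ix i l) k l)"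
  unfolding NN_def using q0 nz by (auto intro!: reg_k reg_nn)

end

section \<open>The correspondence between Hecke and KLR generators\<close>

text \<open>Contains how both families move the X k, how \<psi> moves the idempotents, and how the
  families are linked, but the quadratic, far commutation and braid relations of neither. It can
  therefore be instantiated from either side, and those relations are transported in whichever
  direction is wanted. The terms \<open>\<kappa> (ix i a)\<close> arise from X k = i_k (1 - y k) and
  the relation between \<psi> and y.\<close>

locale hecke_klr = spectral \<kappa> q n B e X
  for \<kappa> :: "'k::field \<Rightarrow> 'a::ring" and q n B e X +
  fixes g \<psi> :: "nat \<Rightarrow> 'a"
  assumes u_g: "a \<in> {1..<n} \<Longrightarrow> \<kappa> 1 * g a = g a"
    and u_psi: "a \<in> {1..<n} \<Longrightarrow> \<kappa> 1 * \<psi> a = \<psi> a"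
    and psi_e: "a \<in> {1..<n} \<Longrightarrow> i \<in> B \<Longrightarrow> \<psi> a * e i = e (swp a i) * \<psi> a"
    and psi_X1: "a \<in> {1..<n} \<Longrightarrow> i \<in> B \<Longrightarrow> \<psi> a * (X a * e i)
      = X (a + 1) * (\<psi> a * e i) + (if ix i a = ix i (a + 1) then \<kappa> (ix i a) * e i else 0)"
    and psi_X2: "a \<in> {1..<n} \<Longrightarrow> i \<in> B \<Longrightarrow> \<psi> a * (X (a + 1) * e i)
      = X a * (\<psi> a * e i) - (if ix i a = ix i (a + 1) then \<kappa> (ix i a) * e i else 0)"
    and psi_X: "a \<in> {1..<n} \<Longrightarrow> k \<in> {1..n} \<Longrightarrow> k \<noteq> a \<Longrightarrow> k \<noteq> a + 1 \<Longrightarrow> \<psi> a * X k = X k * \<psi> a"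
    and g_X1: "a \<in> {1..<n} \<Longrightarrow> g a * X a = X (a + 1) * g a - \<kappa> (q - inverse q) * X (a + 1)"
    and g_X2: "a \<in> {1..<n} \<Longrightarrow> g a * X (a + 1) = X a * g a + \<kappa> (q - inverse q) * X (a + 1)"
    and g_X: "a \<in> {1..<n} \<Longrightarrow> k \<in> {1..n} \<Longrightarrow> k \<noteq> a \<Longrightarrow> k \<noteq> a + 1 \<Longrightarrow> g a * X k = X k * g a"
    and link_eq: "a \<in> {1..<n} \<Longrightarrow> i \<in> B \<Longrightarrow> ix i a = ix i (a + 1) \<Longrightarrow>
      g a * e i = \<kappa> q * e i - \<psi> a * (\<kappa> (inverse (ix i a)) * nn a (a + 1) * e i)"
    and link_ne: "a \<in> {1..<n} \<Longrightarrow> i \<in> B \<Longrightarrow> ix i a \<noteq> ix i (a + 1) \<Longrightarrow>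
      (g a * (X a - X (a + 1)) + \<kappa> (q - inverse q) * X (a + 1)) * e i
      = \<psi> a * (NN (ix i a) (ix i (a + 1)) a (a + 1) * e i)"
begin

abbreviation z :: 'a where "z \<equiv> \<kappa> (q - inverse q)"

text \<open>The standard intertwiner of the affine Hecke algebra, which exchanges X a and X (a +
  1).\<close>

definition phi :: "nat \<Rightarrow> 'a" where
  "phi a = g a * (X a - X (a + 1)) + z * X (a + 1)"

text \<open>The right-hand sides of the KLR relations for the square and the braid of the psi, rewritten in
  the X k by means of y k = 1 - X k / ix i k on e i.\<close>

definition psi_sq :: "'k list \<Rightarrow> nat \<Rightarrow> 'a" where
  "psi_sq i a = (if ix i a = ix i (a + 1) then 0
     else cc (ix i a) (ix i (a + 1)) a (a + 1) * cc (ix i (a + 1)) (ix i a) (a + 1) a * e i)"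

definition psi_braid :: "'k list \<Rightarrow> nat \<Rightarrow> 'a" where
  "psi_braid i a = (if ix i a = ix i (a + 2) then
      if ix i (a + 1) = q\<^sup>2 * ix i a then
        if ix i a = q\<^sup>2 * ix i (a + 1)
        then - \<kappa> (inverse (ix i a)) * (X a + X (a + 1) + X (a + 1) + X (a + 2)) else u
      else if ix i a = q\<^sup>2 * ix i (a + 1) then - u else 0
     else 0)"

definition gbr :: "nat \<Rightarrow> 'a" where
  "gbr a = g a * g (a + 1) * g a - g (a + 1) * g a * g (a + 1)"

definition pbr :: "nat \<Rightarrow> 'a" where
  "pbr a = \<psi> a * \<psi> (a + 1) * \<psi> a - \<psi> (a + 1) * \<psi> a * \<psi> (a + 1)"

lemma vec_psi: "a \<in> {1..<n} \<Longrightarrow> i \<in> B \<Longrightarrow> e i * v = v \<Longrightarrow> e (swp a i) * (\<psi> a * v) = \<psi> a * v"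
  by (metis psi_e mult.assoc)

lemma psi_X1_vec: "a \<in> {1..<n} \<Longrightarrow> i \<in> B \<Longrightarrow> e i * v = v \<Longrightarrow> X (a + 1) * (\<psi> a * v)
    = \<psi> a * (X a * v) - (if ix i a = ix i (a + 1) then \<kappa> (ix i a) * v else 0)"
proof -
  assume a: "a \<in> {1..<n}" "i \<in> B" and v: "e i * v = v"
  have "\<psi> a * (X a * e i) * v = \<psi> a * (X a * v)" by (simp add: mult.assoc v)
  then show ?thesis using v unfolding psi_X1[OF a] by (auto simp: distrib_right mult.assoc eq_diff_eq)
qed

lemma psi_X2_vec: "a \<in> {1..<n} \<Longrightarrow> i \<in> B \<Longrightarrow> e i * v = v \<Longrightarrow> X a * (\<psi> a * v)
    = \<psi> a * (X (a + 1) * v) + (if ix i a = ix i (a + 1) then \<kappa> (ix i a) * v else 0)"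
proof -
  assume a: "a \<in> {1..<n}" "i \<in> B" and v: "e i * v = v"
  have "\<psi> a * (X (a + 1) * e i) * v = \<psi> a * (X (a + 1) * v)" by (simp add: mult.assoc v)
  then show ?thesis using v unfolding psi_X2[OF a] by (auto simp: left_diff_distrib mult.assoc diff_eq_eq)
qed

lemma X_psi_far: "a \<in> {1..<n} \<Longrightarrow> k \<in> {1..n} \<Longrightarrow> k \<noteq> a \<Longrightarrow> k \<noteq> a + 1 \<Longrightarrow> X k * (\<psi> a * v) = \<psi> a * (X k * v)"
  by (metis psi_X mult.assoc)

text \<open>Distinct labels make the corrections in \<open>psi_X1\<close> and \<open>psi_X2\<close>
  vanish, so \<psi> a simply permutes the X k by \<open>sb a\<close>.\<close>

lemma X_psi_ne:
  assumes "a \<in> {1..<n}" "i \<in> B" "e i * v = v" "ix i a \<noteq> ix i (a + 1)" "k \<in> {1..n}"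
  shows "X (sb a k) * (\<psi> a * v) = \<psi> a * (X k * v)"
  using psi_X1_vec[OF assms(1-3)] psi_X2_vec[OF assms(1-3)] X_psi_far[OF assms(1,5)] assms(4)
  by (auto simp: sb_def)

lemma nn_psi_ne:
  assumes "a \<in> {1..<n}" "i \<in> B" "e i * v = v" "ix i a \<noteq> ix i (a + 1)" "k \<in> {1..n}" "l \<in> {1..n}"
  shows "nn (sb a k) (sb a l) * (\<psi> a * v) = \<psi> a * (nn k l * v)"
  using X_psi_ne[OF assms(1-5)] X_psi_ne[OF assms(1-4,6)]
  by (simp add: nn_def left_diff_distrib right_diff_distrib mult.assoc k_left_commute[of "\<psi> a"])

lemma NN_psi_ne:
  assumes "a \<in> {1..<n}" "i \<in> B" "e i * v = v" "ix i a \<noteq> ix i (a + 1)" "k \<in> {1..n}" "l \<in> {1..n}"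
  shows "NN s t (sb a k) (sb a l) * (\<psi> a * v) = \<psi> a * (NN s t k l * v)"
  using nn_psi_ne[OF assms] by (simp add: NN_def k_left_commute[of "\<psi> a"])

lemma g_vec:
  assumes "a \<in> {1..<n}" "i \<in> B" "e i * v = v" "ix i a = ix i (a + 1)"
  shows "g a * v = \<kappa> q * v - \<psi> a * (\<kappa> (inverse (ix i a)) * (nn a (a + 1) * v))"
proof -
  have "g a * v = g a * e i * v" by (simp add: mult.assoc assms(3))
  then show ?thesis unfolding link_eq[OF assms(1,2,4)]
    by (simp add: left_diff_distrib mult.assoc assms(3))
qed

lemma phi_vec:
  assumes "a \<in> {1..<n}" "i \<in> B" "e i * v = v" "ix i a \<noteq> ix i (a + 1)"
  shows "phi a * v = \<psi> a * (NN (ix i a) (ix i (a + 1)) a (a + 1) * v)"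
proof -
  have "phi a * v = phi a * e i * v" by (simp add: mult.assoc assms(3))
  then show ?thesis unfolding phi_def link_ne[OF assms(1,2,4)] by (simp add: mult.assoc assms(3))
qed

text \<open>On the eigenspace of \<open>swp a i\<close>, \<open>phi b\<close> becomes \<psi> b times
  a factor \<open>NN\<close>; moving this factor back through \<psi> a renames its strands by
  \<open>sb a\<close>. Labels and strands are tied by separate equations so that the rule unifies
  inside longer words.\<close>

lemma phi_psi_vec:
  assumes "a \<in> {1..<n}" "i \<in> B" "e i * v = v" "ix i a \<noteq> ix i (a + 1)"
    and "b \<in> {1..<n}" "ix i (sb a b) = s" "ix i (sb a (b + 1)) = t" "s \<noteq> t"
    and "sb a b = k" "sb a (b + 1) = l"
  shows "phi b * (\<psi> a * v) = \<psi> b * (\<psi> a * (NN s t k l * v))"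
proof -
  have b: "b \<in> {1..n}" "b + 1 \<in> {1..n}" using assms(5) by auto
  have ix: "ix (swp a i) b = s" "ix (swp a i) (b + 1) = t"
    using ix_swp[OF assms(1) len[OF assms(2)]] b assms(6,7) by auto
  have kl: "k \<in> {1..n}" "l \<in> {1..n}" using sb_range[OF assms(1)] b assms(9,10) by auto
  have "phi b * (\<psi> a * v) = \<psi> b * (NN s t b (b + 1) * (\<psi> a * v))"
    using phi_vec[OF assms(5) swp_B[OF assms(1,2)] vec_psi[OF assms(1-3)]] ix assms(8) by simp
  also have "NN s t b (b + 1) * (\<psi> a * v) = NN s t (sb a k) (sb a l) * (\<psi> a * v)"
    using assms(9,10) by (metis sb_sb)
  also have "\<dots> = \<psi> a * (NN s t k l * v)" by (rule NN_psi_ne[OF assms(1-4) kl])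
  finally show ?thesis .
qed

text \<open>The nil-Hecke corrections of the two terms of \<open>nn\<close> have opposite signs, as
  do the terms themselves; hence the sum q + 1/q.\<close>

lemma nn_psi_eq:
  assumes a: "a \<in> {1..<n}" "i \<in> B" and v: "e i * v = v" and eq: "ix i a = ix i (a + 1)"
  shows "nn a (a + 1) * (\<psi> a * v) = \<psi> a * (nn (a + 1) a * v) + \<kappa> ((q + inverse q) * ix i a) * v"
  using psi_X1_vec[OF a v] psi_X2_vec[OF a v] eq
  by (simp add: nn_def left_diff_distrib right_diff_distrib distrib_left distrib_right mult.assoc
      k_left_commute[of "\<psi> a"] k_mult k_add)

lemma k_q: "\<kappa> q * \<kappa> (inverse q) = u" using q0 by (rule k_inverse')

lemma z_eq: "z = \<kappa> q - \<kappa> (inverse q)" by (rule k_diff)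

section \<open>The quadratic relation\<close>

lemma phi_square:
  assumes a: "a \<in> {1..<n}"
  shows "phi a * phi a = nn a (a + 1) * nn (a + 1) a
     - (g a * g a - z * g a - u) * (X a - X (a + 1)) * (X a - X (a + 1))"
  unfolding phi_def nn_def z_eq using a
  by (intro hecke_intertwiner_square k_central k_q u_X X_X u_g u_right g_X1[unfolded z_eq] g_X2[unfolded z_eq]) auto

text \<open>Write g e = q e - \<psi> w. In g^2 - z g - 1 the terms linear in \<psi> have coefficient
  -2 q + (q + 1/q) + (q - 1/q) = 0 and the constant term is q^2 - z q - 1 = 0, so only the square of
  \<psi> survives.\<close>

lemma quadratic_eq_case:
  assumes a: "a \<in> {1..<n}" "i \<in> B" and eq: "ix i a = ix i (a + 1)"
  shows "(g a * g a - z * g a - u) * e i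
    = \<psi> a * \<psi> a * (\<kappa> (inverse (ix i a)) * nn (a + 1) a * (\<kappa> (inverse (ix i a)) * nn a (a + 1)) * e i)"
proof -
  let ?c = "inverse (ix i a)"
  have c0: "ix i a \<noteq> 0" using nz a by auto
  define w where "w = \<kappa> ?c * (nn a (a + 1) * e i)"
  have r: "a \<in> {1..n}" "a + 1 \<in> {1..n}" using a by auto
  have v: "e i * e i = e i" by (rule e_idem[OF a(2)])
  have w: "e i * w = w" unfolding w_def
    by (intro vec_k vec_pc pc_nn a v r)
  have iw: "e i * (\<psi> a * w) = \<psi> a * w"
    using vec_psi[OF a w] swp_same[OF a(1) len[OF a(2)] eq] by simp
  have g1: "g a * e i = \<kappa> q * e i - \<psi> a * w"
    using g_vec[OF a v eq] by (simp add: w_def)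
  have "\<kappa> ?c * (\<kappa> ((q + inverse q) * ix i a) * w) = \<kappa> (q + inverse q) * w"
    using c0 by (simp add: mult.assoc[symmetric] k_mult[symmetric] mult.commute mult.left_commute)
  then have "\<kappa> ?c * (nn a (a + 1) * (\<psi> a * w))
    = \<psi> a * (\<kappa> ?c * (nn (a + 1) a * w)) + \<kappa> (q + inverse q) * w"
    unfolding nn_psi_eq[OF a w eq] by (simp add: distrib_left k_left_commute[of "\<psi> a"])
  then have g2: "g a * (\<psi> a * w)
    = \<kappa> q * (\<psi> a * w) - (\<psi> a * (\<psi> a * (\<kappa> ?c * (nn (a + 1) a * w))) + \<kappa> (q + inverse q) * (\<psi> a * w))"
    using g_vec[OF a iw eq] by (simp add: distrib_left k_left_commute[of "\<psi> a"])
  have "g a * g a * e i = \<kappa> q * (g a * e i) - g a * (\<psi> a * w)"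
    unfolding mult.assoc g1 by (simp add: right_diff_distrib k_left_commute[of "g a"] g1)
  then have "(g a * g a - z * g a - u) * e i = (\<kappa> q * (\<kappa> q * e i) - z * (\<kappa> q * e i) - e i)
     + \<psi> a * (\<psi> a * (\<kappa> ?c * (nn (a + 1) a * w)))"
    unfolding left_diff_distrib mult.assoc[of z] g1 g2
    by (simp add: algebra_simps k_diff k_add u_e[OF a(2)])
  also have "\<kappa> q * (\<kappa> q * e i) - z * (\<kappa> q * e i) - e i = 0"
    unfolding z_eq using k_inverse[OF q0]
    by (simp add: left_diff_distrib mult.assoc[symmetric] u_e[OF a(2)])
  finally show ?thesis unfolding w_def
    by (simp add: mult.assoc k_left_commute[of "nn (a + 1) a"])
qed

text \<open>Computes phi^2 on \<open>e i\<close> twice: by the link relation it is the square of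
  \<psi> times two factors \<open>NN\<close>, and by \<open>phi_square\<close> it is a product of
  two \<open>nn\<close> minus the quadratic defect. The term with \<open>psi_sq\<close> absorbs the
  two \<open>nn\<close>, because each \<open>NN\<close> pairs with its \<open>cc\<close>.\<close>

lemma quadratic_ne_case:
  assumes a: "a \<in> {1..<n}" "i \<in> B" and ne: "ix i a \<noteq> ix i (a + 1)"
  shows "(\<psi> a * \<psi> a * e i - psi_sq i a) * (NN (ix i (a + 1)) (ix i a) (a + 1) a * NN (ix i a) (ix i (a + 1)) a (a + 1) * e i)
     = - (g a * g a - z * g a - u) * ((X a - X (a + 1)) * (X a - X (a + 1)) * e i)"
proof -
  let ?s = "ix i a" and ?t = "ix i (a + 1)"
  let ?N = "NN ?s ?t a (a + 1)" and ?N' = "NN ?t ?s (a + 1) a"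
  let ?c = "cc ?s ?t a (a + 1)" and ?c' = "cc ?t ?s (a + 1) a"
  have r: "a \<in> {1..n}" "a + 1 \<in> {1..n}" using a by auto
  have st: "?s \<noteq> 0" "?t \<noteq> 0" using nz a(2) r by auto
  have v: "e i * e i = e i" by (rule e_idem[OF a(2)])
  have w: "e i * (?N * e i) = ?N * e i" by (intro vec_pc pc_NN a v r)
  have w': "e i * (?N' * (?N * e i)) = ?N' * (?N * e i)" by (intro vec_pc pc_NN a w r)
  have p1: "phi a * e i = \<psi> a * (?N * e i)" by (rule phi_vec[OF a v ne])
  have p2: "phi a * (phi a * e i) = \<psi> a * (\<psi> a * (?N' * (?N * e i)))"
    unfolding p1 by (rule phi_psi_vec[OF a w ne a(1)]) (use ne in \<open>auto simp: sb_def\<close>)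
  have pcs: "pc {1..n} ?N" "pc {1..n} ?N'" "pc {1..n} ?c" "pc {1..n} ?c'"
    by (intro pc_NN pc_cc r)+
  have "psi_sq i a * (?N' * ?N * e i) = ?c * ?c' * (e i * (?N' * (?N * e i)))"
    using ne by (simp add: psi_sq_def mult.assoc)
  also have "\<dots> = ?c * (?c' * ?N') * ?N * e i" unfolding w' by (simp add: mult.assoc)
  also have "?c' * ?N' = nn (a + 1) a" using NN_cc[OF st(2) r(2,1)] pc_pc[OF pcs(2,4)] by simp
  also have "?c * nn (a + 1) a * ?N = (?N * ?c) * nn (a + 1) a"
  proof -
    have "?c * nn (a + 1) a * ?N = ?N * (?c * nn (a + 1) a)"
      by (rule pc_pc) (intro pc_mult pc_nn pcs r)+
    then show ?thesis by (simp add: mult.assoc)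
  qed
  also have "?N * ?c = nn a (a + 1)" by (rule NN_cc[OF st(1) r])
  finally have ps: "psi_sq i a * (?N' * ?N * e i) = nn a (a + 1) * nn (a + 1) a * e i" .
  have "\<psi> a * \<psi> a * e i * (?N' * ?N * e i) = phi a * phi a * e i"
    using p2 w' by (simp add: mult.assoc)
  then show ?thesis using ps unfolding left_diff_distrib[of _ "psi_sq i a"] phi_square[OF a(1)]
    by (simp add: left_diff_distrib mult.assoc)
qed

text \<open>At equal labels the value of this factor is q - 1/q, which is nonzero because q^2 is not
  1.\<close>

lemma reg_dot_eq:
  assumes a: "a \<in> {1..<n}" "i \<in> B" and eq: "ix i a = ix i (a + 1)"
    and kl: "k \<in> {1..n}" "l \<in> {1..n}" "ix i k = ix i a" "ix i l = ix i a"
  shows "reg i (\<kappa> (inverse (ix i a)) * nn k l)"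
  using nz[OF a(2), of a] a q2 kl by (intro reg_mult reg_k reg_nn) auto

text \<open>The Hecke defect vanishes, and the regular factor next to the KLR defect is cancelled.
  The converse \<open>g_square\<close> reads the same two identities from the other side.\<close>

lemma psi_square:
  assumes a: "a \<in> {1..<n}" "i \<in> B" and g: "g a * g a = z * g a + u"
  shows "\<psi> a * \<psi> a * e i = psi_sq i a"
proof -
  have r: "a \<in> {1..n}" "a + 1 \<in> {1..n}" using a by auto
  have g': "g a * g a - z * g a - u = 0" using g by simp
  show ?thesis
  proof (cases "ix i a = ix i (a + 1)")
    case True
    then have "reg i (\<kappa> (inverse (ix i a)) * nn (a + 1) a * (\<kappa> (inverse (ix i a)) * nn a (a + 1)))"
      by (intro reg_mult[of i "\<kappa> (inverse (ix i a)) * nn (a + 1) a"] reg_dot_eq a r) auto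
    then show ?thesis using quadratic_eq_case[OF a True] True g'
      by (simp add: reg_def psi_sq_def)
  next
    case False
    have "reg i (NN (ix i (a + 1)) (ix i a) (a + 1) a * NN (ix i a) (ix i (a + 1)) a (a + 1))"
      by (intro reg_mult reg_NN a r)
    then have "(\<psi> a * \<psi> a * e i - psi_sq i a) * e i = 0"
      using quadratic_ne_case[OF a False] g' by (simp add: reg_def)
    then show ?thesis using e_idem[OF a(2)]
      by (simp add: left_diff_distrib mult.assoc psi_sq_def split: if_splits)
  qed
qed

lemma g_square:
  assumes a: "a \<in> {1..<n}" and psi: "\<And>i. i \<in> B \<Longrightarrow> \<psi> a * \<psi> a * e i = psi_sq i a"
  shows "g a * g a = z * g a + u"
proof -
  have r: "a \<in> {1..n}" "a + 1 \<in> {1..n}" using a by auto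
  have ug: "u * g a = g a" using u_g a by simp
  have "g a * g a - z * g a - u = 0"
  proof (rule eq_on_e)
    fix i assume i: "i \<in> B"
    show "(g a * g a - z * g a - u) * e i = 0 * e i"
    proof (cases "ix i a = ix i (a + 1)")
      case True
      let ?F = "\<kappa> (inverse (ix i a)) * nn (a + 1) a * (\<kappa> (inverse (ix i a)) * nn a (a + 1))"
      have "?F * e i = e i * ?F" by (intro pc_e i pc_mult pc_k pc_nn r)
      then have "\<psi> a * \<psi> a * (?F * e i) = \<psi> a * \<psi> a * e i * ?F" by (simp add: mult.assoc)
      then show ?thesis using quadratic_eq_case[OF a i True] psi[OF i] True
        by (simp add: psi_sq_def)
    next
      case False
      have "reg i ((X a - X (a + 1)) * (X a - X (a + 1)))"
        by (intro reg_mult reg_diff i r False)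
      then have "- (g a * g a - z * g a - u) * e i = 0"
        using quadratic_ne_case[OF a i False] psi[OF i]
        by (subst reg_eq_0[symmetric]) (assumption, simp)
      then show ?thesis by (simp only: minus_mult_left[symmetric] neg_equal_0_iff_equal mult_zero_left)
    qed
  qed (use ug in \<open>simp_all add: right_diff_distrib mult.assoc[symmetric]\<close>)
  then show ?thesis by (simp add: algebra_simps)
qed


section \<open>Commutation of distant generators\<close>

lemma reg_minus: "reg i f \<Longrightarrow> reg i (- f)"
  unfolding reg_def by auto

text \<open>Both link relations take the common form g D + Z = A + \<psi> L on \<open>e i\<close>,
  with D, Z, A, L depending on whether the two labels agree. Commutators of the two sides then
  reduce to those of g and of \<psi>, each times a regular factor.\<close>

lemma far_identity:
  assumes ac: "a \<in> {1..<n}" "c \<in> {1..<n}" "a + 1 < c \<or> c + 1 < a" and i: "i \<in> B"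
  shows "\<exists>F G. reg i F \<and> reg i G \<and>
    (\<psi> a * \<psi> c - \<psi> c * \<psi> a) * (F * e i) = (g a * g c - g c * g a) * (G * e i)"
proof -
  define D where "D a = (if ix i a = ix i (a + 1) then u else X a - X (a + 1))" for a
  define Z where "Z a = (if ix i a = ix i (a + 1) then 0 else z * X (a + 1))" for a
  define L where "L a = (if ix i a = ix i (a + 1) then - (\<kappa> (inverse (ix i a)) * nn a (a + 1))
    else NN (ix i a) (ix i (a + 1)) a (a + 1))" for a
  define A where "A a = (if ix i a = ix i (a + 1) then q else 0)" for a
  have r: "a \<in> {1..n}" "a + 1 \<in> {1..n}" "c \<in> {1..n}" "c + 1 \<in> {1..n}" using ac by auto
  have pcD: "pc {a, a + 1} (D a)" and pcZ: "pc {a, a + 1} (Z a)" and pcL: "pc {a, a + 1} (L a)" for a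
    using pc_k[of _ 0] by (auto simp: D_def Z_def L_def intro!: pc_intros pc_nn pc_NN)
  have sub: "{a, a + 1} \<subseteq> {1..n}" "{c, c + 1} \<subseteq> {1..n}" using r by auto
  note pcn = pcD[THEN pc_mono, OF sub(1)] pcZ[THEN pc_mono, OF sub(1)] pcL[THEN pc_mono, OF sub(1)]
    pcD[THEN pc_mono, OF sub(2)] pcZ[THEN pc_mono, OF sub(2)] pcL[THEN pc_mono, OF sub(2)]
  have gD: "f * g b = g b * f" "f * \<psi> b = \<psi> b * f"
    if "pc {d, d + 1} f" "(b, d) = (a, c) \<or> (b, d) = (c, a)" for b d f
    using that ac r by (auto intro!: pc_commute[symmetric, OF that(1)] g_X psi_X)
  \<comment> \<open>Stated for every tuple \<open>j\<close> that agrees with \<open>i\<close> on the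
    two strands, since it is also applied after a distant crossing has permuted the other
    labels.\<close>
  have step: "(g b * D b + Z b) * v = \<kappa> (A b) * v + \<psi> b * (L b * v)"
    if b: "b \<in> {1..<n}" and j: "j \<in> B" and v: "e j * v = v" and
      jb: "ix j b = ix i b" "ix j (b + 1) = ix i (b + 1)" for b j v
  proof (cases "ix i b = ix i (b + 1)")
    case True
    then show ?thesis using g_vec[OF b j v] jb e_vec_u[OF j v]
      by (simp add: D_def Z_def A_def L_def mult.assoc)
  next
    case False
    then show ?thesis using phi_vec[OF b j v] jb by (simp add: D_def Z_def A_def L_def phi_def)
  qed
  \<comment> \<open>All terms except the last are symmetric in b and d, so they cancel in the
    commutator.\<close>
  have two: "(g b * D b + Z b) * ((g d * D d + Z d) * e i) = \<kappa> (A b * A d) * e i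
     + (\<kappa> (A d) * (\<psi> b * (L b * e i)) + \<kappa> (A b) * (\<psi> d * (L d * e i))) + \<psi> b * (\<psi> d * (L b * (L d * e i)))"
    if bd: "(b, d) = (a, c) \<or> (b, d) = (c, a)" for b d
  proof -
    have br: "b \<in> {1..<n}" "d \<in> {1..<n}" "b \<in> {1..n}" "b + 1 \<in> {1..n}" "{d, d + 1} \<subseteq> {1..n}"
      using bd ac by auto
    have sbd: "sb d b = b" "sb d (b + 1) = b + 1" using bd ac by (auto simp: sb_def)
    have w: "e i * (L d * e i) = L d * e i"
      by (intro vec_pc i e_idem pc_mono[OF pcL br(5)])
    have "e (swp d i) * (\<psi> d * (L d * e i)) = \<psi> d * (L d * e i)"
      by (rule vec_psi[OF br(2) i w])
    moreover have "ix (swp d i) b = ix i b" "ix (swp d i) (b + 1) = ix i (b + 1)"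
      using ix_swp[OF br(2) len[OF i]] br(3,4) sbd by auto
    ultimately have "(g b * D b + Z b) * (\<psi> d * (L d * e i))
       = \<kappa> (A b) * (\<psi> d * (L d * e i)) + \<psi> b * (L b * (\<psi> d * (L d * e i)))"
      by (intro step[OF br(1) swp_B[OF br(2) i]])
    moreover have "L b * \<psi> d = \<psi> d * L b" by (rule gD(2)[OF pcL]) (use bd in auto)
    then have "L b * (\<psi> d * (L d * e i)) = \<psi> d * (L b * (L d * e i))" by (metis mult.assoc)
    moreover have "(g d * D d + Z d) * e i = \<kappa> (A d) * e i + \<psi> d * (L d * e i)"
      "(g b * D b + Z b) * e i = \<kappa> (A b) * e i + \<psi> b * (L b * e i)"
      by (rule step[OF br(2) i e_idem[OF i] refl refl] step[OF br(1) i e_idem[OF i] refl refl])+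
    moreover have "\<kappa> (A b * A d) * e i = \<kappa> (A d) * (\<kappa> (A b) * e i)"
      using k_mult[of "A d" "A b"] by (simp add: mult.commute[of "A b"] mult.assoc)
    ultimately show ?thesis
      by (simp only: distrib_left k_left_commute[of "g b * D b + Z b"] add.assoc)
  qed
  have LL: "L c * L a = L a * L c" by (intro pc_pc pcn)
  have "((g a * D a + Z a) * (g c * D c + Z c) - (g c * D c + Z c) * (g a * D a + Z a)) * e i
    = (\<psi> a * \<psi> c - \<psi> c * \<psi> a) * (L a * L c * e i)"
  proof -
    have LLe: "L c * (L a * e i) = L a * (L c * e i)" by (metis LL mult.assoc)
    show ?thesis
      unfolding left_diff_distrib mult.assoc two[OF disjI1[OF refl]] two[OF disjI2[OF refl]] LLe
        mult.commute[of "A c"]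
      by (simp add: algebra_simps)
  qed
  moreover have "(g a * D a + Z a) * (g c * D c + Z c) - (g c * D c + Z c) * (g a * D a + Z a)
    = (g a * g c - g c * g a) * (D a * D c)"
    by (rule far_commutator) (intro pc_pc pcn gD[OF pcD] gD[OF pcZ]; simp)+
  moreover have "reg i (L a * L c)" "reg i (D a * D c)"
  proof -
    have "reg i (D b)" "reg i (L b)" if b: "b \<in> {1..<n}" for b
    proof -
      have that: "b \<in> {1..n}" "b + 1 \<in> {1..n}" using b by auto
      show "reg i (D b)" using reg_diff[OF i that] reg_k[OF i, of 1] by (auto simp: D_def)
      show "reg i (L b)"
      proof (cases "ix i b = ix i (b + 1)")
        case True
        then show ?thesis using reg_minus[OF reg_dot_eq[OF b i True that refl]] by (simp add: L_def)
      next
        case False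
        then show ?thesis using reg_NN[OF i that] by (simp add: L_def)
      qed
    qed
    then show "reg i (L a * L c)" "reg i (D a * D c)" using ac reg_mult by auto
  qed
  ultimately show ?thesis by (intro exI[of _ "L a * L c"] exI[of _ "D a * D c"]) (simp add: mult.assoc)
qed

lemma psi_far:
  assumes ac: "a \<in> {1..<n}" "c \<in> {1..<n}" "a + 1 < c \<or> c + 1 < a" and g: "g a * g c = g c * g a"
  shows "\<psi> a * \<psi> c = \<psi> c * \<psi> a"
proof (rule eq_on_e)
  fix i assume i: "i \<in> B"
  from far_identity[OF ac i] g have "(\<psi> a * \<psi> c - \<psi> c * \<psi> a) * e i = 0"
    by (auto simp: reg_def)
  then show "\<psi> a * \<psi> c * e i = \<psi> c * \<psi> a * e i" by (simp add: left_diff_distrib)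
qed (use ac u_psi in \<open>simp_all add: mult.assoc[symmetric]\<close>)

lemma g_far:
  assumes ac: "a \<in> {1..<n}" "c \<in> {1..<n}" "a + 1 < c \<or> c + 1 < a" and psi: "\<psi> a * \<psi> c = \<psi> c * \<psi> a"
  shows "g a * g c = g c * g a"
proof (rule eq_on_e)
  fix i assume i: "i \<in> B"
  from far_identity[OF ac i] psi have "(g a * g c - g c * g a) * e i = 0"
    by (auto simp: reg_def)
  then show "g a * g c * e i = g c * g a * e i" by (simp add: left_diff_distrib)
qed (use ac u_g in \<open>simp_all add: mult.assoc[symmetric]\<close>)


end

section \<open>The braid relation, by the pattern of the three labels\<close>

context hecke_klr begin

lemma g_psi_vec:
  assumes "a \<in> {1..<n}" "i \<in> B" "e i * v = v" "ix i a \<noteq> ix i (a + 1)"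
    and "b \<in> {1..<n}" "ix i (sb a b) = r" "ix i (sb a (b + 1)) = r"
    and "sb a b = k" "sb a (b + 1) = l"
  shows "g b * (\<psi> a * v) = \<kappa> q * (\<psi> a * v) - \<psi> b * (\<psi> a * (\<kappa> (inverse r) * (nn k l * v)))"
proof -
  have b: "b \<in> {1..n}" "b + 1 \<in> {1..n}" using assms(5) by auto
  have ix: "ix (swp a i) b = r" "ix (swp a i) (b + 1) = r"
    using ix_swp[OF assms(1) len[OF assms(2)]] b assms(6,7) by auto
  have kl: "k \<in> {1..n}" "l \<in> {1..n}" using sb_range[OF assms(1)] b assms(8,9) by auto
  have "nn b (b + 1) * (\<psi> a * v) = nn (sb a k) (sb a l) * (\<psi> a * v)"
    using assms(8,9) by (metis sb_sb)
  also have "\<dots> = \<psi> a * (nn k l * v)" by (rule nn_psi_ne[OF assms(1-4) kl])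
  finally show ?thesis
    using g_vec[OF assms(5) swp_B[OF assms(1,2)] vec_psi[OF assms(1-3)]] ix
    by (simp add: k_left_commute[of "\<psi> a"])
qed

lemma psi_vec_swp:
  assumes "a \<in> {1..<n}" "i \<in> B" "e i * v = v" "ix i a \<noteq> ix i (a + 1)" "k \<in> {1..n}" "l \<in> {1..n}"
  shows "swp a i \<in> B" "e (swp a i) * (\<psi> a * v) = \<psi> a * v"
    "NN s t k l * (\<psi> a * v) = \<psi> a * (NN s t (sb a k) (sb a l) * v)"
    "nn k l * (\<psi> a * v) = \<psi> a * (nn (sb a k) (sb a l) * v)"
  using swp_B[OF assms(1,2)] vec_psi[OF assms(1-3)]
    NN_psi_ne[OF assms(1-4) sb_range[OF assms(1,5)] sb_range[OF assms(1,6)]]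
    nn_psi_ne[OF assms(1-4) sb_range[OF assms(1,5)] sb_range[OF assms(1,6)]] by simp_all

text \<open>Two crossings have already been applied, so labels and strands are read through
  \<open>sb b\<close> followed by \<open>sb a\<close>.\<close>

lemma phi_psi_psi_vec:
  assumes "a \<in> {1..<n}" "i \<in> B" "e i * v = v" "ix i a \<noteq> ix i (a + 1)"
    and "b \<in> {1..<n}" "ix i (sb a b) \<noteq> ix i (sb a (b + 1))"
    and "d \<in> {1..<n}" "ix i (sb a (sb b d)) = s" "ix i (sb a (sb b (d + 1))) = t" "s \<noteq> t"
    and "sb a (sb b d) = k" "sb a (sb b (d + 1)) = l"
  shows "phi d * (\<psi> b * (\<psi> a * v)) = \<psi> d * (\<psi> b * (\<psi> a * (NN s t k l * v)))"
proof -
  have b: "b \<in> {1..n}" "b + 1 \<in> {1..n}" "d \<in> {1..n}" "d + 1 \<in> {1..n}" using assms by auto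
  have sb: "sb b d \<in> {1..n}" "sb b (d + 1) \<in> {1..n}" using sb_range[OF assms(5)] b by auto
  note p = psi_vec_swp[OF assms(1-4)]
  note ixs = ix_swp[OF assms(1) len[OF assms(2)]]
  have ix: "ix (swp a i) b \<noteq> ix (swp a i) (b + 1)" "ix (swp a i) (sb b d) = s"
    "ix (swp a i) (sb b (d + 1)) = t"
    using assms(6,8,9) ixs[OF b(1)] ixs[OF b(2)] ixs[OF sb(1)] ixs[OF sb(2)] by simp_all
  have "phi d * (\<psi> b * (\<psi> a * v)) = \<psi> d * (\<psi> b * (NN s t (sb b d) (sb b (d + 1)) * (\<psi> a * v)))"
    using assms(5,7,9-) p(1,2)[OF b(1,1)] ix by (intro phi_psi_vec[of b "swp a i"]) simp_all
  also have "NN s t (sb b d) (sb b (d + 1)) * (\<psi> a * v) = \<psi> a * (NN s t k l * v)"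
    using p(3)[OF sb] assms(11,12) by simp
  finally show ?thesis .
qed

lemma g_psi_psi_vec:
  assumes "a \<in> {1..<n}" "i \<in> B" "e i * v = v" "ix i a \<noteq> ix i (a + 1)"
    and "b \<in> {1..<n}" "ix i (sb a b) \<noteq> ix i (sb a (b + 1))"
    and "d \<in> {1..<n}" "ix i (sb a (sb b d)) = r" "ix i (sb a (sb b (d + 1))) = r"
    and "sb a (sb b d) = k" "sb a (sb b (d + 1)) = l"
  shows "g d * (\<psi> b * (\<psi> a * v))
    = \<kappa> q * (\<psi> b * (\<psi> a * v)) - \<psi> d * (\<psi> b * (\<psi> a * (\<kappa> (inverse r) * (nn k l * v))))"
proof -
  have b: "b \<in> {1..n}" "b + 1 \<in> {1..n}" "d \<in> {1..n}" "d + 1 \<in> {1..n}" using assms by auto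
  have sb: "sb b d \<in> {1..n}" "sb b (d + 1) \<in> {1..n}" using sb_range[OF assms(5)] b by auto
  note p = psi_vec_swp[OF assms(1-4)]
  note ixs = ix_swp[OF assms(1) len[OF assms(2)]]
  have ix: "ix (swp a i) b \<noteq> ix (swp a i) (b + 1)" "ix (swp a i) (sb b d) = r"
    "ix (swp a i) (sb b (d + 1)) = r"
    using assms(6,8,9) ixs[OF b(1)] ixs[OF b(2)] ixs[OF sb(1)] ixs[OF sb(2)] by simp_all
  have "g d * (\<psi> b * (\<psi> a * v)) = \<kappa> q * (\<psi> b * (\<psi> a * v))
     - \<psi> d * (\<psi> b * (\<kappa> (inverse r) * (nn (sb b d) (sb b (d + 1)) * (\<psi> a * v))))"
    using assms(5,7,9-) p(1,2)[OF b(1,1)] ix by (intro g_psi_vec[of b "swp a i"]) simp_all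
  also have "nn (sb b d) (sb b (d + 1)) * (\<psi> a * v) = \<psi> a * (nn k l * v)"
    using p(4)[OF sb] assms(10,11) by simp
  finally show ?thesis by (simp add: k_left_commute[of "\<psi> a"])
qed

lemma hecke_braids:
  assumes a: "a \<in> {1..<n}" and b: "b = a + 1" "b \<in> {1..<n}" and c: "c = b + 1"
    and quad: "g a * g a = z * g a + u" "g b * g b = z * g b + u"
  shows "phi a * phi b * g a - g b * phi a * phi b = gbr a * (X a - X c) * (X b - X c)"
    and "phi b * phi a * g b - g a * phi b * phi a = - gbr a * (X a - X b) * (X a - X c)"
    and "phi a * g b * phi a - phi b * g a * phi b
      = gbr a * (X a - X b) * (X b - X c) - z * X c * (z * z * X b + X b + X b - X a - X c)"
    and "phi a * phi b * phi a - phi b * phi a * phi b = gbr a * (X a - X b) * (X a - X c) * (X b - X c)"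
proof -
  have r: "a \<in> {1..n}" "b \<in> {1..n}" "c \<in> {1..n}" using a b c by auto
  have eqs: "X b * g a = g a * X a + z * X b" "X a * g a = g a * X b - z * X b" "X c * g a = g a * X c"
    "X c * g b = g b * X b + z * X c" "X b * g b = g b * X c - z * X c" "X a * g b = g b * X a"
    using g_X1[OF a] g_X2[OF a] g_X1[OF b(2)] g_X2[OF b(2)] g_X[OF a r(3)] g_X[OF b(2) r(1)] b(1) c
    by auto
  have us: "u * g a = g a" "g a * u = g a" "u * g b = g b" "g b * u = g b" "u * X a = X a" "u * X b = X b"
    "X b * u = X b" "u * X c = X c" "X c * u = X c"
    using u_g[OF a] u_g[OF b(2)] u_X r by (simp_all add: u_right)
  note * = hecke_braid_intertwiners[of z u "g a" "X a" "X b" "X c" "g b", OF k_central us(1,2,5-9,3,4)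
    X_X[OF r(2,1)] X_X[OF r(3,1)] X_X[OF r(3,2)] eqs(2,1,3,5,4,6) quad, folded phi_def[of b, folded c] phi_def[of a, folded b(1)]
    gbr_def[of a, folded b(1)]]
  show "phi a * phi b * g a - g b * phi a * phi b = gbr a * (X a - X c) * (X b - X c)"
    and "phi b * phi a * g b - g a * phi b * phi a = - gbr a * (X a - X b) * (X a - X c)"
    and "phi a * g b * phi a - phi b * g a * phi b
      = gbr a * (X a - X b) * (X b - X c) - z * X c * (z * z * X b + X b + X b - X a - X c)"
    and "phi a * phi b * phi a - phi b * phi a * phi b = gbr a * (X a - X b) * (X a - X c) * (X b - X c)"
    by (rule *)+
qed

text \<open>The product is symmetric in X a and X b, and at equal labels \<psi> a behaves like a
  divided difference, which commutes with symmetric functions: the corrections from the two factors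
  are opposite.\<close>

lemma NN_sym_psi1:
  assumes "a \<in> {1..<n}" "i \<in> B" and w: "e i * w = w" and eq: "ix i a = ix i (a + 1)"
    and b: "b = a + 1" and c: "c \<in> {1..n}" "c \<noteq> a" "c \<noteq> b"
  shows "NN s t a c * (NN s t b c * (\<psi> a * w)) = \<psi> a * (NN s t a c * (NN s t b c * w))"
proof (cases "t = q\<^sup>2 * s")
  case True then show ?thesis by (simp add: NN_def k_left_commute[of "\<psi> a"])
next
  case False
  have r: "a \<in> {1..n}" "b \<in> {1..n}" using assms(1) b by auto
  have x: "X b * (\<psi> a * v) = \<psi> a * (X a * v) - \<kappa> (ix i a) * v"
    "X a * (\<psi> a * v) = \<psi> a * (X b * v) + \<kappa> (ix i a) * v"
    "X c * (\<psi> a * v) = \<psi> a * (X c * v)" if "e i * v = v" for v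
    using psi_X1_vec[OF assms(1,2) that] psi_X2_vec[OF assms(1,2) that] eq b
     X_psi_far[OF assms(1) c(1,2)] c by auto
  let ?d = "\<kappa> (q * ix i a)"
  have n1: "nn b c * (\<psi> a * v) = \<psi> a * (nn a c * v) - ?d * v"
    "nn a c * (\<psi> a * v) = \<psi> a * (nn b c * v) + ?d * v" if "e i * v = v" for v
    using x[OF that] by (simp_all add: nn_def left_diff_distrib right_diff_distrib distrib_left mult.assoc
      k_left_commute[of "\<psi> a"] k_mult)
  have v: "e i * (nn a c * w) = nn a c * w" by (intro vec_pc pc_nn assms(2) w r c)
  have "nn b c * (nn a c * w) = nn a c * (nn b c * w)"
    by (simp add: mult.assoc[symmetric] pc_pc[OF pc_nn[OF r(2) c(1)] pc_nn[OF r(1) c(1)]])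
  then have "nn a c * (nn b c * (\<psi> a * w)) = \<psi> a * (nn a c * (nn b c * w))"
    unfolding n1(1)[OF w] right_diff_distrib n1(2)[OF v] by (simp add: k_left_commute[of "nn a c"])
  then show ?thesis using False by (simp add: NN_def)
qed

lemma NN_sym_psi2:
  assumes "b \<in> {1..<n}" "i \<in> B" and w: "e i * w = w" and eq: "ix i b = ix i (b + 1)"
    and c: "c = b + 1" and a: "a \<in> {1..n}" "a \<noteq> b" "a \<noteq> c"
  shows "NN s t a c * (NN s t a b * (\<psi> b * w)) = \<psi> b * (NN s t a c * (NN s t a b * w))"
proof (cases "t = q\<^sup>2 * s")
  case True then show ?thesis by (simp add: NN_def k_left_commute[of "\<psi> b"])
next
  case False
  have r: "b \<in> {1..n}" "c \<in> {1..n}" using assms(1) c by auto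
  have x: "X c * (\<psi> b * v) = \<psi> b * (X b * v) - \<kappa> (ix i b) * v"
    "X b * (\<psi> b * v) = \<psi> b * (X c * v) + \<kappa> (ix i b) * v"
    "X a * (\<psi> b * v) = \<psi> b * (X a * v)" if "e i * v = v" for v
    using psi_X1_vec[OF assms(1,2) that] psi_X2_vec[OF assms(1,2) that] eq c
     X_psi_far[OF assms(1) a(1,2)] a by auto
  let ?d = "\<kappa> (inverse q * ix i b)"
  have n1: "nn a b * (\<psi> b * v) = \<psi> b * (nn a c * v) - ?d * v"
    "nn a c * (\<psi> b * v) = \<psi> b * (nn a b * v) + ?d * v" if "e i * v = v" for v
    using x[OF that] by (simp_all add: nn_def left_diff_distrib right_diff_distrib distrib_left mult.assoc
      k_left_commute[of "\<psi> b"] k_mult)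
  have v: "e i * (nn a c * w) = nn a c * w" by (intro vec_pc pc_nn assms(2) w r a)
  have "nn a b * (nn a c * w) = nn a c * (nn a b * w)"
    by (simp add: mult.assoc[symmetric] pc_pc[OF pc_nn[OF a(1) r(1)] pc_nn[OF a(1) r(2)]])
  then have "nn a c * (nn a b * (\<psi> b * w)) = \<psi> b * (nn a c * (nn a b * w))"
    unfolding n1(1)[OF w] right_diff_distrib n1(2)[OF v] by (simp add: k_left_commute[of "nn a c"])
  then show ?thesis using False by (simp add: NN_def)
qed

lemma vec_NN:
  "k \<in> {1..n} \<Longrightarrow> l \<in> {1..n} \<Longrightarrow> i \<in> B \<Longrightarrow> e i * v = v \<Longrightarrow> e i * (NN s t k l * v) = NN s t k l * v"
  "k \<in> {1..n} \<Longrightarrow> l \<in> {1..n} \<Longrightarrow> i \<in> B \<Longrightarrow> e i * v = v \<Longrightarrow> e i * (nn k l * v) = nn k l * v"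
  by (intro vec_pc pc_NN pc_nn; assumption)+

text \<open>The common target of all label patterns: on \<open>e i\<close> the two braid defects
  agree up to regular factors, so that each vanishes if the other does.\<close>

definition braid_related :: "'k list \<Rightarrow> nat \<Rightarrow> bool" where
  "braid_related i a \<longleftrightarrow> (\<exists>F G. reg i F \<and> reg i G \<and> (pbr a - psi_braid i a) * (F * e i) = gbr a * (G * e i))"

lemma braid_relatedI: "reg i F \<Longrightarrow> reg i F' \<Longrightarrow> (pbr a - psi_braid i a) * (F * e i) = gbr a * (F' * e i)
    \<Longrightarrow> braid_related i a"
  unfolding braid_related_def by blast

text \<open>Every crossing meets distinct labels, so phi can be used throughout. Both words collect
  the same three factors \<open>NN\<close>, in different orders, and the fourth identity of
  \<open>hecke_braids\<close> compares them.\<close>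

lemma braid_distinct:
  assumes a: "a \<in> {1..<n}" and b: "b = a + 1" "b \<in> {1..<n}" and c: "c = b + 1" and i: "i \<in> B"
    and quad: "g a * g a = z * g a + u" "g b * g b = z * g b + u"
    and ne: "ix i a \<noteq> ix i b" "ix i b \<noteq> ix i c" "ix i a \<noteq> ix i c"
  shows "braid_related i a"
proof -
  let ?p = "ix i a" and ?s = "ix i b" and ?t = "ix i c"
  have r: "a \<in> {1..n}" "b \<in> {1..n}" "c \<in> {1..n}" using a b c by auto
  have sb: "sb a a = b" "sb a b = a" "sb a c = c" "sb b a = a" "sb b b = c" "sb b c = b"
    using b c by (auto simp: sb_def)
  have v: "e i * e i = e i" by (rule e_idem[OF i])
  let ?N1 = "NN ?p ?s a b" and ?N2 = "NN ?p ?t a c" and ?N3 = "NN ?s ?t b c"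
  have p1: "phi a * e i = \<psi> a * (?N1 * e i)" using phi_vec[OF a i v] ne b(1) by simp
  have p2: "phi b * (phi a * e i) = \<psi> b * (\<psi> a * (?N2 * (?N1 * e i)))"
    unfolding p1 by (rule phi_psi_vec[OF a i]) (use ne b c i r v sb in \<open>auto intro!: vec_NN\<close>)
  have p3: "phi a * (phi b * (phi a * e i)) = \<psi> a * (\<psi> b * (\<psi> a * (?N3 * (?N2 * (?N1 * e i)))))"
    unfolding p2 by (rule phi_psi_psi_vec[OF a i]) (use a ne b c i r v sb in \<open>auto intro!: vec_NN\<close>)
  have q1: "phi b * e i = \<psi> b * (?N3 * e i)" using phi_vec[OF b(2) i v] ne c by simp
  have q2: "phi a * (phi b * e i) = \<psi> a * (\<psi> b * (?N2 * (?N3 * e i)))"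
    unfolding q1 by (rule phi_psi_vec[OF b(2) i]) (use a ne b c i r v sb in \<open>auto intro!: vec_NN\<close>)
  have q3: "phi b * (phi a * (phi b * e i)) = \<psi> b * (\<psi> a * (\<psi> b * (?N1 * (?N2 * (?N3 * e i)))))"
    unfolding q2 by (rule phi_psi_psi_vec[OF b(2) i]) (use a ne b c i r v sb in \<open>auto intro!: vec_NN\<close>)
  have pcs: "pc {1..n} ?N1" "pc {1..n} ?N2" "pc {1..n} ?N3" by (intro pc_NN r)+
  have "?N1 * (?N2 * ?N3) = ?N2 * ?N3 * ?N1" by (rule pc_pc[OF pcs(1) pc_mult[OF pcs(2,3)]])
  then have "?N1 * (?N2 * ?N3) = ?N3 * (?N2 * ?N1)" using pc_pc[OF pcs(2,3)] by (metis mult.assoc)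
  from arg_cong[OF this, of "\<lambda>t. t * e i"] have eq: "?N1 * (?N2 * (?N3 * e i)) = ?N3 * (?N2 * (?N1 * e i))"
    by (simp only: mult.assoc)
  have "pbr a * (?N3 * (?N2 * ?N1) * e i) = (phi a * phi b * phi a - phi b * phi a * phi b) * e i"
    using p3 q3 eq by (simp add: pbr_def b(1)[symmetric] left_diff_distrib mult.assoc)
  also have "\<dots> = gbr a * ((X a - X b) * (X a - X c) * (X b - X c) * e i)"
    unfolding hecke_braids(4)[OF a b c quad] by (simp add: mult.assoc)
  moreover have "psi_braid i a = 0" using ne b c by (simp add: psi_braid_def add.assoc)
  moreover have "reg i (?N3 * (?N2 * ?N1))" "reg i ((X a - X b) * (X a - X c) * (X b - X c))"
    by (intro reg_mult reg_NN reg_diff i r ne)+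
  ultimately show ?thesis by (intro braid_relatedI[of i "?N3 * (?N2 * ?N1)" "(X a - X b) * (X a - X c) * (X b - X c)"]) simp_all
qed

text \<open>For labels (p,p,t) the first crossing of one word and the last crossing of the other
  meet equal labels; g is kept there and phi used elsewhere. The q-parts of g agree in both words,
  and the \<psi>-parts form the braid defect with a minus sign.\<close>

lemma braid_iij:
  assumes a: "a \<in> {1..<n}" and b: "b = a + 1" "b \<in> {1..<n}" and c: "c = b + 1" and i: "i \<in> B"
    and quad: "g a * g a = z * g a + u" "g b * g b = z * g b + u"
    and eq: "ix i a = ix i b" and ne: "ix i b \<noteq> ix i c"
  shows "braid_related i a"
proof -
  let ?p = "ix i a" and ?t = "ix i c"
  have r: "a \<in> {1..n}" "b \<in> {1..n}" "c \<in> {1..n}" using a b c by auto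
  have sb: "sb a a = b" "sb a b = a" "sb a c = c" "sb b a = a" "sb b b = c" "sb b c = b"
    using b c by (auto simp: sb_def)
  have v: "e i * e i = e i" by (rule e_idem[OF i])
  let ?N2 = "NN ?p ?t a c" and ?N3 = "NN ?p ?t b c" and ?M = "\<kappa> (inverse ?p) * nn a b"
  define w where "w = \<kappa> (inverse ?p) * (nn a b * e i)"
  have w: "e i * w = w" unfolding w_def by (intro vec_k vec_NN r i v)
  have ne': "?p \<noteq> ?t" using eq ne by simp
  have swa: "swp a i = i" using swp_same[OF a len[OF i]] eq b by simp
  have pw: "e i * (\<psi> a * w) = \<psi> a * w" using vec_psi[OF a i w] swa by simp
  have PP: "phi a * (phi b * v) = \<psi> a * (\<psi> b * (?N2 * (?N3 * v)))" if v: "e i * v = v" for v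
  proof -
    have 1: "phi b * v = \<psi> b * (?N3 * v)" using phi_vec[OF b(2) i v] ne c eq by simp
    show ?thesis unfolding 1
      by (rule phi_psi_vec[OF b(2) i]) (use a ne eq b c i r v sb in \<open>auto intro!: vec_NN\<close>)
  qed
  have cab: "c \<noteq> a" "c \<noteq> b" using b(1) c by auto
  have ga: "g a * e i = \<kappa> q * e i - \<psi> a * w" using g_vec[OF a i v] eq b(1) by (simp add: w_def)
  have "phi a * (phi b * (g a * e i)) = \<kappa> q * (\<psi> a * (\<psi> b * (?N2 * (?N3 * e i))))
     - \<psi> a * (\<psi> b * (\<psi> a * (?N2 * (?N3 * w))))"
    unfolding ga using PP[OF v] PP[OF pw] NN_sym_psi1[OF a i w eq[unfolded b(1)] b(1) r(3) cab]
    by (simp add: right_diff_distrib k_left_commute[of "phi a"] k_left_commute[of "phi b"])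
  moreover have "g b * (phi a * (phi b * e i)) = \<kappa> q * (\<psi> a * (\<psi> b * (?N2 * (?N3 * e i))))
     - \<psi> b * (\<psi> a * (\<psi> b * (\<kappa> (inverse ?p) * (nn a b * (?N2 * (?N3 * e i))))))"
    unfolding PP[OF v]
    by (rule g_psi_psi_vec[OF b(2) i]) (use a ne eq b c i r v sb in \<open>auto intro!: vec_NN\<close>)
  moreover have "?N2 * (?N3 * w) = ?N2 * ?N3 * ?M * e i" by (simp add: w_def mult.assoc)
  moreover have "\<kappa> (inverse ?p) * (nn a b * (?N2 * (?N3 * e i))) = ?N2 * ?N3 * ?M * e i"
  proof -
    have "?M * (?N2 * ?N3) = ?N2 * ?N3 * ?M" by (intro pc_pc pc_mult pc_k pc_nn pc_NN r)
    from arg_cong[OF this, of "\<lambda>t. t * e i"] show ?thesis by (simp only: mult.assoc)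
  qed
  ultimately have "pbr a * (?N2 * ?N3 * ?M * e i) = - ((phi a * phi b * g a - g b * phi a * phi b) * e i)"
    by (simp add: pbr_def b(1)[symmetric] left_diff_distrib mult.assoc)
  also have "\<dots> = gbr a * (- ((X a - X c) * (X b - X c)) * e i)"
    unfolding hecke_braids(1)[OF a b c quad] by (simp add: mult.assoc)
  moreover have "psi_braid i a = 0" using ne eq b c by (simp add: psi_braid_def add.assoc)
  moreover have "reg i (?N2 * ?N3 * ?M)" "reg i (- ((X a - X c) * (X b - X c)))"
    using reg_NN[OF i r(1,3)] reg_NN[OF i r(2,3)] eq b
    by (intro reg_mult reg_minus reg_diff reg_dot_eq i r a; use eq ne in simp)+
  ultimately show ?thesis by (intro braid_relatedI[of i "?N2 * ?N3 * ?M" "- ((X a - X c) * (X b - X c))"]) simp_all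
qed

text \<open>The mirror image of the pattern (p,p,t): the second identity of
  \<open>hecke_braids\<close> is used, and the factors moved past \<psi> b are symmetric in X b and
  X c.\<close>

lemma braid_jii:
  assumes a: "a \<in> {1..<n}" and b: "b = a + 1" "b \<in> {1..<n}" and c: "c = b + 1" and i: "i \<in> B"
    and quad: "g a * g a = z * g a + u" "g b * g b = z * g b + u"
    and eq: "ix i b = ix i c" and ne: "ix i a \<noteq> ix i b"
  shows "braid_related i a"
proof -
  let ?p = "ix i a" and ?s = "ix i b"
  have r: "a \<in> {1..n}" "b \<in> {1..n}" "c \<in> {1..n}" using a b c by auto
  have sb: "sb a a = b" "sb a b = a" "sb a c = c" "sb b a = a" "sb b b = c" "sb b c = b"
    using b c by (auto simp: sb_def)
  have v: "e i * e i = e i" by (rule e_idem[OF i])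
  let ?N2 = "NN ?p ?s a c" and ?N1 = "NN ?p ?s a b" and ?M = "\<kappa> (inverse ?s) * nn b c"
  define w where "w = \<kappa> (inverse ?s) * (nn b c * e i)"
  have w: "e i * w = w" unfolding w_def by (intro vec_k vec_NN r i v)
  have swb: "swp b i = i" using swp_same[OF b(2) len[OF i]] eq c by simp
  have pw: "e i * (\<psi> b * w) = \<psi> b * w" using vec_psi[OF b(2) i w] swb by simp
  have PP: "phi b * (phi a * v) = \<psi> b * (\<psi> a * (?N2 * (?N1 * v)))" if v: "e i * v = v" for v
  proof -
    have 1: "phi a * v = \<psi> a * (?N1 * v)" using phi_vec[OF a i v] ne b(1) by simp
    show ?thesis unfolding 1
      by (rule phi_psi_vec[OF a i]) (use a ne eq b c i r v sb in \<open>auto intro!: vec_NN\<close>)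
  qed
  have cab: "a \<noteq> b" "a \<noteq> c" using b(1) c by auto
  have gb: "g b * e i = \<kappa> q * e i - \<psi> b * w" using g_vec[OF b(2) i v] eq c by (simp add: w_def)
  have "phi b * (phi a * (g b * e i)) = \<kappa> q * (\<psi> b * (\<psi> a * (?N2 * (?N1 * e i))))
     - \<psi> b * (\<psi> a * (\<psi> b * (?N2 * (?N1 * w))))"
    unfolding gb using PP[OF v] PP[OF pw] NN_sym_psi2[OF b(2) i w eq[unfolded c] c r(1) cab]
    by (simp add: right_diff_distrib k_left_commute[of "phi a"] k_left_commute[of "phi b"])
  moreover have "g a * (phi b * (phi a * e i)) = \<kappa> q * (\<psi> b * (\<psi> a * (?N2 * (?N1 * e i))))
     - \<psi> a * (\<psi> b * (\<psi> a * (\<kappa> (inverse ?s) * (nn b c * (?N2 * (?N1 * e i))))))"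
    unfolding PP[OF v]
    by (rule g_psi_psi_vec[OF a i]) (use a ne eq b c i r v sb in \<open>auto intro!: vec_NN\<close>)
  moreover have "?N2 * (?N1 * w) = ?N2 * ?N1 * ?M * e i" by (simp add: w_def mult.assoc)
  moreover have "\<kappa> (inverse ?s) * (nn b c * (?N2 * (?N1 * e i))) = ?N2 * ?N1 * ?M * e i"
  proof -
    have "?M * (?N2 * ?N1) = ?N2 * ?N1 * ?M" by (intro pc_pc pc_mult pc_k pc_nn pc_NN r)
    from arg_cong[OF this, of "\<lambda>t. t * e i"] show ?thesis by (simp only: mult.assoc)
  qed
  ultimately have "pbr a * (?N2 * ?N1 * ?M * e i) = (phi b * phi a * g b - g a * phi b * phi a) * e i"
    by (simp add: pbr_def b(1)[symmetric] left_diff_distrib mult.assoc)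
  also have "\<dots> = gbr a * (- ((X a - X b) * (X a - X c)) * e i)"
    unfolding hecke_braids(2)[OF a b c quad] by (simp add: mult.assoc)
  moreover have "psi_braid i a = 0" using ne eq b c by (simp add: psi_braid_def add.assoc)
  moreover have "reg i (?N2 * ?N1 * ?M)" "reg i (- ((X a - X b) * (X a - X c)))"
    using reg_NN[OF i r(1,3)] reg_NN[OF i r(1,2)] eq c
    by (intro reg_mult reg_minus reg_diff reg_dot_eq i r b; use eq ne in simp)+
  ultimately show ?thesis by (intro braid_relatedI[of i "?N2 * ?N1 * ?M" "- ((X a - X b) * (X a - X c))"]) simp_all
qed


text \<open>Everything takes place in the corner of \<open>e i\<close>, where the quadratic relation
  forces the square of \<psi> to vanish. Then \<open>nil_hecke_braid\<close> applies with f = \<psi>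
  e, x = X e and c the common label times e.\<close>

lemma braid_iii:
  assumes a: "a \<in> {1..<n}" and b: "b = a + 1" "b \<in> {1..<n}" and c: "c = b + 1" and i: "i \<in> B"
    and quad: "g a * g a = z * g a + u" "g b * g b = z * g b + u"
    and eq: "ix i a = ix i b" "ix i b = ix i c"
  shows "braid_related i a"
proof -
  let ?p = "ix i a"
  let ?E = "e i"
  have r: "a \<in> {1..n}" "b \<in> {1..n}" "c \<in> {1..n}" using a b c by auto
  have p0: "?p \<noteq> 0" using nz i r by auto
  have eqa: "ix i a = ix i (a + 1)" and eqb: "ix i b = ix i (b + 1)" using eq b c by auto
  have v: "?E * ?E = ?E" by (rule e_idem[OF i])
  have sw: "swp a i = i" "swp b i = i"
    using swp_same[OF a len[OF i] eqa] swp_same[OF b(2) len[OF i] eqb] by auto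
  have E: "?E * (\<psi> a * ?E) = \<psi> a * ?E" "?E * (\<psi> b * ?E) = \<psi> b * ?E"
    using vec_psi[OF a i v] vec_psi[OF b(2) i v] sw by simp_all
  have EX: "?E * (X k * ?E) = X k * ?E" if "k \<in> {1..n}" for k by (rule vec_X[OF that i v])
  have "\<psi> a * \<psi> a * ?E = 0" "\<psi> b * \<psi> b * ?E = 0"
    using psi_square[OF a i quad(1)] psi_square[OF b(2) i quad(2)] eqa eqb by (simp_all add: psi_sq_def)
  then have sq: "\<psi> a * ?E * (\<psi> a * ?E) = 0" "\<psi> b * ?E * (\<psi> b * ?E) = 0"
    using E by (simp_all add: mult.assoc)
  have XX: "X k * ?E * (X l * ?E) = X l * ?E * (X k * ?E)" if "k \<in> {1..n}" "l \<in> {1..n}" for k l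
    using EX[OF that(1)] EX[OF that(2)] X_X[OF that] by (metis mult.assoc)
  have xp: "X k * ?E * (\<psi> d * ?E) = X k * (\<psi> d * ?E)" if "d = a \<or> d = b" for k d
    using that E by (auto simp: mult.assoc)
  have px: "\<psi> d * ?E * (X k * ?E) = \<psi> d * (X k * ?E)" if "k \<in> {1..n}" for k d
    using EX[OF that] by (simp add: mult.assoc)
  have far: "c \<noteq> a" "c \<noteq> a + 1" "a \<noteq> b" "a \<noteq> b + 1" using b(1) c by auto
  note X1 = psi_X1_vec[OF a i v, folded b(1)] psi_X1_vec[OF b(2) i v, folded c]
  note X2 = psi_X2_vec[OF a i v, folded b(1)] psi_X2_vec[OF b(2) i v, folded c]
  have f: "X a * ?E * (\<psi> a * ?E) = \<psi> a * ?E * (X b * ?E) + \<kappa> ?p * ?E"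
    "X b * ?E * (\<psi> a * ?E) = \<psi> a * ?E * (X a * ?E) - \<kappa> ?p * ?E"
    "X c * ?E * (\<psi> a * ?E) = \<psi> a * ?E * (X c * ?E)"
    "X b * ?E * (\<psi> b * ?E) = \<psi> b * ?E * (X c * ?E) + \<kappa> ?p * ?E"
    "X c * ?E * (\<psi> b * ?E) = \<psi> b * ?E * (X b * ?E) - \<kappa> ?p * ?E"
    "X a * ?E * (\<psi> b * ?E) = \<psi> b * ?E * (X a * ?E)"
    using X1 X2 eq X_psi_far[OF a r(3) far(1,2), of ?E] X_psi_far[OF b(2) r(1) far(3,4), of ?E]
    by (simp_all add: xp px[OF r(1)] px[OF r(2)] px[OF r(3)])
  \<comment> \<open>Scaled so that \<open>?P\<close> times the label is q, and \<open>?P\<close> X k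
    - \<open>?R\<close> X l is \<open>nn k l\<close> divided by the label, as \<open>link_eq\<close>
    requires.\<close>
  let ?P = "\<kappa> (q * inverse ?p)" and ?R = "\<kappa> (inverse q * inverse ?p)"
  have PM: "?P * (X k * ?E) - ?R * (X l * ?E) = \<kappa> (inverse ?p) * nn k l * ?E" for k l
    using k_mult[of "inverse ?p" q] k_mult[of "inverse ?p" "inverse q"]
    by (simp add: nn_def right_diff_distrib left_diff_distrib mult.assoc mult.commute[of _ "inverse ?p"])
  have Pp: "?P * (\<kappa> ?p * ?E) = \<kappa> q * ?E"
  proof -
    have "?P * \<kappa> ?p = \<kappa> q" using p0 by (simp add: k_mult[symmetric] mult.assoc)
    then show ?thesis by (simp add: mult.assoc[symmetric])
  qed
  have M: "?E * (\<kappa> (inverse ?p) * nn k l * ?E) = \<kappa> (inverse ?p) * nn k l * ?E"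
    if "k \<in> {1..n}" "l \<in> {1..n}" for k l
    using vec_NN(2)[OF that i v] by (simp add: mult.assoc k_left_commute[of ?E])
  have G: "g a * ?E = ?P * (\<kappa> ?p * ?E) - \<psi> a * ?E * (?P * (X a * ?E) - ?R * (X b * ?E))"
    "g b * ?E = ?P * (\<kappa> ?p * ?E) - \<psi> b * ?E * (?P * (X b * ?E) - ?R * (X c * ?E))"
    using link_eq[OF a i eqa] link_eq[OF b(2) i eqb] M[OF r(1,2)] M[OF r(2,3)] eq b(1) c
    unfolding PM Pp by (simp_all add: mult.assoc)
  have EE: "?E * (?E * x) = ?E * x" for x by (metis v mult.assoc)
  have EG: "?E * (g a * ?E) = g a * ?E" "?E * (g b * ?E) = g b * ?E"
  proof -
    have "\<kappa> q * ?E * ?E = \<kappa> q * ?E" by (simp add: mult.assoc v)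
    then show "?E * (g a * ?E) = g a * ?E" "?E * (g b * ?E) = g b * ?E"
      unfolding G Pp PM using E M[OF r(1,2)] M[OF r(2,3)]
      by (simp_all add: right_diff_distrib mult.assoc[symmetric] k_central[of ?E])
  qed
  have kc: "\<psi> a * ?E * (\<kappa> ?p * ?E) = \<kappa> ?p * ?E * (\<psi> a * ?E)"
    "\<psi> b * ?E * (\<kappa> ?p * ?E) = \<kappa> ?p * ?E * (\<psi> b * ?E)"
    "X k * ?E * (\<kappa> ?p * ?E) = \<kappa> ?p * ?E * (X k * ?E)" if "k \<in> {1..n}" for k
    using E EX[OF that] v
    by (simp_all add: mult.assoc k_left_commute[of ?E] k_left_commute[of "\<psi> a"]
       k_left_commute[of "\<psi> b"] k_left_commute[of "X k"])
  let ?M3 = "\<kappa> (inverse ?p) * (nn b c * ?E)"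
  let ?M2 = "\<kappa> (inverse ?p) * (nn a c * ?M3)"
  have M1: "?E * ?M3 = ?M3" and M2: "?E * ?M2 = ?M2"
    and M3: "?E * (\<kappa> (inverse ?p) * (nn a b * ?M2)) = \<kappa> (inverse ?p) * (nn a b * ?M2)"
    by (intro vec_k vec_NN r i v)+
  have "g a * ?E * (g b * ?E) * (g a * ?E) - g b * ?E * (g a * ?E) * (g b * ?E)
    = - (\<psi> a * ?E * (\<psi> b * ?E) * (\<psi> a * ?E) - \<psi> b * ?E * (\<psi> a * ?E) * (\<psi> b * ?E))
      * (?P * (X a * ?E) - ?R * (X b * ?E)) * (?P * (X a * ?E) - ?R * (X c * ?E)) * (?P * (X b * ?E) - ?R * (X c * ?E))"
    unfolding G
    by (rule nil_hecke_braid) (rule k_central kc r XX f sq)+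
  then have "gbr a * ?E = - pbr a * (\<kappa> (inverse ?p) * nn a b * (\<kappa> (inverse ?p) * nn a c) * (\<kappa> (inverse ?p) * nn b c) * ?E)"
    unfolding PM using EG E M1 M2 M3
    by (simp add: gbr_def pbr_def b(1)[symmetric] left_diff_distrib mult.assoc)
  then have "pbr a * (\<kappa> (inverse ?p) * nn a b * (\<kappa> (inverse ?p) * nn a c) * (\<kappa> (inverse ?p) * nn b c) * ?E)
     = gbr a * (- u * ?E)" by (simp add: u_e[OF i])
  moreover have "psi_braid i a = 0"
    using eq p0 q2 b c by (simp add: psi_braid_def add.assoc)
  moreover have "reg i (\<kappa> (inverse ?p) * nn a b * (\<kappa> (inverse ?p) * nn a c) * (\<kappa> (inverse ?p) * nn b c))"
    by (rule reg_mult[OF reg_mult]; rule reg_dot_eq[OF a i eqa]) (use eq r in auto)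
  moreover have "reg i (- u)" by (intro reg_minus reg_k i) simp
  ultimately show ?thesis by (intro braid_relatedI[of i "\<kappa> (inverse ?p) * nn a b * (\<kappa> (inverse ?p) * nn a c) * (\<kappa> (inverse ?p) * nn b c)" "- u"]) simp_all
qed

text \<open>Only one of the two strands in \<open>NN\<close> is touched by \<psi> a, so there is no
  symmetry and a constant remains, unless \<open>NN\<close> is itself constant. These remainders
  enter the nonzero right-hand sides of the KLR braid relation.\<close>

lemma NN_psi_eq:
  assumes a: "a \<in> {1..<n}" "i \<in> B" and w: "e i * w = w" and eq: "ix i a = ix i (a + 1)"
    and b: "b = a + 1" and c: "c \<in> {1..n}" "c \<noteq> a" "c \<noteq> b"
  shows "NN s t c a * (\<psi> a * w) = \<psi> a * (NN s t c b * w)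
      + (if t = q\<^sup>2 * s then 0 else - \<kappa> (inverse q * ix i a)) * w"
    and "NN s t b c * (\<psi> a * w) = \<psi> a * (NN s t a c * w)
      - (if t = q\<^sup>2 * s then 0 else \<kappa> (q * ix i a)) * w"
proof -
  have x: "X b * (\<psi> a * w) = \<psi> a * (X a * w) - \<kappa> (ix i a) * w"
    "X a * (\<psi> a * w) = \<psi> a * (X b * w) + \<kappa> (ix i a) * w"
    "X c * (\<psi> a * w) = \<psi> a * (X c * w)"
    using psi_X1_vec[OF assms(1,2) w] psi_X2_vec[OF assms(1,2) w] eq b
     X_psi_far[OF assms(1) c(1,2)] c by auto
  show "NN s t c a * (\<psi> a * w) = \<psi> a * (NN s t c b * w)
      + (if t = q\<^sup>2 * s then 0 else - \<kappa> (inverse q * ix i a)) * w"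
    "NN s t b c * (\<psi> a * w) = \<psi> a * (NN s t a c * w)
      - (if t = q\<^sup>2 * s then 0 else \<kappa> (q * ix i a)) * w"
    by (simp_all add: NN_def nn_def x left_diff_distrib right_diff_distrib distrib_left mult.assoc
      k_left_commute[of "\<psi> a"] k_mult)
qed

end

text \<open>Here \<open>w\<close> is the bracket in the third identity of
  \<open>hecke_braid_intertwiners\<close>. The first equation turns the polynomial terms of the
  pattern (i,j,i) into a multiple of the linear factor of the outer strands; the second relates that
  bracket to the corrections from \<open>NN_psi_eq\<close>.\<close>

lemma braid_iji_polynomial:
  fixes x1 x2 x3 Q Q' u :: "'a::ring"
  assumes c: "\<And>a. a * Q = Q * a" "\<And>a. a * Q' = Q' * a" and QQ: "Q * Q' = u"
    and u: "u * x1 = x1" "u * x2 = x2" "u * x3 = x3" "u * Q = Q" "u * Q' = Q'"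
    and xx: "x2 * x1 = x1 * x2" "x3 * x1 = x1 * x3" "x3 * x2 = x2 * x3"
  defines "z \<equiv> Q - Q'"
  defines "w \<equiv> z * z * x2 + x2 + x2 - x1 - x3"
  defines "n \<equiv> \<lambda>x y. Q * x - Q' * y"
  shows "Q * (n x1 x2 * n x2 x1 - n x2 x3 * n x3 x2) + z * x3 * w = n x1 x3 * w"
    and "w + Q' * n x1 x2 - Q * n x2 x3 = 0"
proof -
  have cc: "x1 * Q = Q * x1" "x2 * Q = Q * x2" "x3 * Q = Q * x3"
    "x1 * Q' = Q' * x1" "x2 * Q' = Q' * x2" "x3 * Q' = Q' * x3" "Q' * Q = Q * Q'"
    by (rule c)+
  have q3: "Q * (Q * Q') = Q" "Q * (Q' * Q') = Q'" "u * (x1 * y) = x1 * y" "u * (x2 * y) = x2 * y" "u * (x3 * y) = x3 * y" for y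
    using u QQ c by (metis mult.assoc)+
  note R = xx QQ u cc
  note R' = R R[THEN mult_eq_assoc] q3
  show "Q * (n x1 x2 * n x2 x1 - n x2 x3 * n x3 x2) + z * x3 * w = n x1 x3 * w"
    and "w + Q' * n x1 x2 - Q * n x2 x3 = 0"
    unfolding z_def w_def n_def by (simp_all add: algebra_simps R')
qed

context hecke_klr
begin

lemma reg_dot_eq':
  assumes i: "i \<in> B" and a: "a \<in> {1..n}"
    and kl: "k \<in> {1..n}" "l \<in> {1..n}" "ix i k = ix i a" "ix i l = ix i a"
  shows "reg i (\<kappa> (inverse (ix i a)) * nn k l)"
  using nz[OF i a] a q2 kl i by (intro reg_mult reg_k reg_nn) auto

text \<open>For labels (p,s,p) the middle generator meets equal labels. Its q-part leaves phi^2, and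
  pulling the outer \<open>NN\<close> through the inner \<psi> leaves a correction with the square
  of an outer \<psi>. These polynomial terms have to be matched with \<open>psi_braid\<close>,
  separately for each kind of arrow.\<close>

lemma braid_iji:
  assumes a: "a \<in> {1..<n}" and b: "b = a + 1" "b \<in> {1..<n}" and c: "c = b + 1" and i: "i \<in> B"
    and quad: "g a * g a = z * g a + u" "g b * g b = z * g b + u"
    and eq: "ix i a = ix i c" and ne: "ix i a \<noteq> ix i b"
  shows "braid_related i a"
proof -
  let ?p = "ix i a" and ?s = "ix i b"
  have r: "a \<in> {1..n}" "b \<in> {1..n}" "c \<in> {1..n}" using a b c by auto
  have p0: "?p \<noteq> 0" and s0: "?s \<noteq> 0" using nz i r by auto
  have ne': "ix i a \<noteq> ix i (a + 1)" "ix i b \<noteq> ix i (b + 1)" using ne eq b c by auto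
  have sb: "sb a a = b" "sb a b = a" "sb a c = c" "sb b a = a" "sb b b = c" "sb b c = b"
    "sb a (a + 1) = a" "sb a (b + 1) = c" "sb b (a + 1) = c" "sb b (b + 1) = b"
    using b c by (auto simp: sb_def)
  have far: "c \<noteq> a" "c \<noteq> b" "a \<noteq> b" "a \<noteq> c" using b(1) c by auto
  have v: "e i * e i = e i" by (rule e_idem[OF i])
  let ?N1 = "NN ?p ?s a b" and ?N2 = "NN ?s ?p b c" and ?M = "\<kappa> (inverse ?p) * nn a c"
  \<comment> \<open>The remainders of \<open>NN_psi_eq\<close> in the two words; each is 0 when the
    \<open>NN\<close> concerned is constant.\<close>
  define \<beta> where "\<beta> = (if ?p = q\<^sup>2 * ?s then 0 else - \<kappa> (inverse q * ?p))"
  define \<alpha> where "\<alpha> = (if ?s = q\<^sup>2 * ?p then 0 else \<kappa> (q * ?p))"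
  define w1 where "w1 = ?M * (?N1 * e i)"
  define w2 where "w2 = ?M * (?N2 * e i)"
  have vN: "e i * (?N1 * e i) = ?N1 * e i" "e i * (?N2 * e i) = ?N2 * e i"
    by (intro vec_NN i r v)+
  have w1: "e i * w1 = w1" and w2: "e i * w2 = w2"
    unfolding w1_def w2_def by (intro vec_pc pc_mult pc_k pc_nn i r vN)+
  let ?ia = "swp a i" and ?ib = "swp b i"
  have iB: "?ia \<in> B" "?ib \<in> B" using swp_B i a b(2) by auto
  note ixs = ix_swp[OF a len[OF i]] ix_swp[OF b(2) len[OF i]]
  have lab: "ix ?ia a = ?s" "ix ?ia b = ?p" "ix ?ia c = ?p" "ix ?ib a = ?p" "ix ?ib b = ?p" "ix ?ib c = ?s"
    using ixs(1)[OF r(1)] ixs(1)[OF r(2)] ixs(1)[OF r(3)] ixs(2)[OF r(1)] ixs(2)[OF r(2)] ixs(2)[OF r(3)] eq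
    by (simp_all add: sb)
  have vv: "e ?ia * (\<psi> a * w1) = \<psi> a * w1" "e ?ib * (\<psi> b * w2) = \<psi> b * w2"
    by (rule vec_psi[OF a i w1], rule vec_psi[OF b(2) i w2])
  have eqia: "ix ?ia b = ix ?ia (b + 1)" and eqib: "ix ?ib a = ix ?ib (a + 1)" using lab b c by auto
  have fix_ia: "swp b ?ia = ?ia" and fix_ib: "swp a ?ib = ?ib"
    using swp_same[OF b(2) len[OF iB(1)] eqia] swp_same[OF a len[OF iB(2)] eqib] by auto
  have vv': "e ?ia * (\<psi> b * (\<psi> a * w1)) = \<psi> b * (\<psi> a * w1)"
    "e ?ib * (\<psi> a * (\<psi> b * w2)) = \<psi> a * (\<psi> b * w2)"
    using vec_psi[OF b(2) iB(1) vv(1)] vec_psi[OF a iB(2) vv(2)] fix_ia fix_ib by simp_all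

  \<comment> \<open>The word with \<psi> b in the middle: (p,s,p) becomes (s,p,p) and
    returns.\<close>
  have A1: "phi a * e i = \<psi> a * (?N1 * e i)" using phi_vec[OF a i v ne'(1)] b(1) by simp
  have A2: "g b * (\<psi> a * (?N1 * e i)) = \<kappa> q * (\<psi> a * (?N1 * e i)) - \<psi> b * (\<psi> a * w1)"
    unfolding w1_def mult.assoc by (rule g_psi_vec[OF a i vN(1) ne'(1) b(2)]) (use sb eq in auto)
  have "phi a * (\<psi> b * (\<psi> a * w1)) = \<psi> a * (NN ?s ?p a b * (\<psi> b * (\<psi> a * w1)))"
    using phi_vec[OF a iB(1) vv'(1)] lab ne b(1) by simp
  also have "NN ?s ?p a b * (\<psi> b * (\<psi> a * w1)) = \<psi> b * (NN ?s ?p a c * (\<psi> a * w1)) + \<beta> * (\<psi> a * w1)"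
    using NN_psi_eq(1)[OF b(2) iB(1) vv(1) eqia c r(1) far(3,4)] lab by (simp add: \<beta>_def)
  also have "NN ?s ?p a c * (\<psi> a * w1) = \<psi> a * (?N2 * w1)"
    using psi_vec_swp(3)[OF a i w1 ne'(1) r(1,3)] by (simp add: sb)
  finally have A3: "phi a * (\<psi> b * (\<psi> a * w1)) = \<psi> a * (\<psi> b * (\<psi> a * (?N2 * w1))) + \<beta> * (\<psi> a * (\<psi> a * w1))"
    by (auto simp: distrib_left \<beta>_def k_left_commute[of "\<psi> a"])
  have A4: "\<psi> a * (\<psi> a * w1) = cc ?p ?s a b * cc ?s ?p b a * w1"
  proof -
    have "\<psi> a * (\<psi> a * w1) = \<psi> a * \<psi> a * e i * w1" by (simp add: mult.assoc w1)
    also have "\<dots> = psi_sq i a * w1" by (simp only: psi_square[OF a i quad(1)])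
    finally show ?thesis using ne by (simp add: psi_sq_def b(1)[symmetric] mult.assoc w1)
  qed
  have A: "phi a * g b * phi a * e i = \<kappa> q * (nn a b * nn b a * e i)
     - (\<psi> a * (\<psi> b * (\<psi> a * (?N2 * w1))) + \<beta> * (cc ?p ?s a b * cc ?s ?p b a * w1))"
  proof -
    have "phi a * phi a = nn a b * nn b a" using phi_square[OF a] quad(1) b(1) by simp
    then have sq: "phi a * (\<psi> a * (?N1 * e i)) = nn a b * nn b a * e i"
      unfolding A1[symmetric] by (simp only: mult.assoc[symmetric])
    have "phi a * g b * phi a * e i = phi a * (\<kappa> q * (\<psi> a * (?N1 * e i)) - \<psi> b * (\<psi> a * w1))"
      by (simp only: mult.assoc A1 A2)
    also have "\<dots> = \<kappa> q * (nn a b * nn b a * e i) - phi a * (\<psi> b * (\<psi> a * w1))"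
      by (simp only: right_diff_distrib k_left_commute[of "phi a"] sq)
    finally show ?thesis by (simp only: A3 A4)
  qed

  \<comment> \<open>The word with \<psi> a in the middle: (p,s,p) becomes (p,p,s) and
    returns.\<close>
  have B1: "phi b * e i = \<psi> b * (?N2 * e i)" using phi_vec[OF b(2) i v ne'(2)] c eq by simp
  have B2: "g a * (\<psi> b * (?N2 * e i)) = \<kappa> q * (\<psi> b * (?N2 * e i)) - \<psi> a * (\<psi> b * w2)"
    unfolding w2_def mult.assoc by (rule g_psi_vec[OF b(2) i vN(2) ne'(2) a]) (use sb eq in auto)
  have "phi b * (\<psi> a * (\<psi> b * w2)) = \<psi> b * (NN ?p ?s b c * (\<psi> a * (\<psi> b * w2)))"
    using phi_vec[OF b(2) iB(2) vv'(2)] lab ne c by simp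
  also have "NN ?p ?s b c * (\<psi> a * (\<psi> b * w2)) = \<psi> a * (NN ?p ?s a c * (\<psi> b * w2)) - \<alpha> * (\<psi> b * w2)"
    using NN_psi_eq(2)[OF a iB(2) vv(2) eqib b(1) r(3) far(1,2)] lab by (simp add: \<alpha>_def)
  also have "NN ?p ?s a c * (\<psi> b * w2) = \<psi> b * (?N1 * w2)"
    using psi_vec_swp(3)[OF b(2) i w2 ne'(2) r(1,3)] by (simp add: sb)
  finally have B3: "phi b * (\<psi> a * (\<psi> b * w2)) = \<psi> b * (\<psi> a * (\<psi> b * (?N1 * w2))) - \<alpha> * (\<psi> b * (\<psi> b * w2))"
    by (auto simp: right_diff_distrib \<alpha>_def k_left_commute[of "\<psi> b"])
  have B4: "\<psi> b * (\<psi> b * w2) = cc ?s ?p b c * cc ?p ?s c b * w2"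
  proof -
    have "\<psi> b * (\<psi> b * w2) = \<psi> b * \<psi> b * e i * w2" by (simp add: mult.assoc w2)
    also have "\<dots> = psi_sq i b * w2" by (simp only: psi_square[OF b(2) i quad(2)])
    finally show ?thesis using ne eq by (simp add: psi_sq_def c[symmetric] mult.assoc w2)
  qed
  have B: "phi b * g a * phi b * e i = \<kappa> q * (nn b c * nn c b * e i)
     - (\<psi> b * (\<psi> a * (\<psi> b * (?N1 * w2))) - \<alpha> * (cc ?s ?p b c * cc ?p ?s c b * w2))"
  proof -
    have "phi b * phi b = nn b c * nn c b" using phi_square[OF b(2)] quad(2) c by simp
    then have sq: "phi b * (\<psi> b * (?N2 * e i)) = nn b c * nn c b * e i"
      unfolding B1[symmetric] by (simp only: mult.assoc[symmetric])
    have "phi b * g a * phi b * e i = phi b * (\<kappa> q * (\<psi> b * (?N2 * e i)) - \<psi> a * (\<psi> b * w2))"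
      by (simp only: mult.assoc B1 B2)
    also have "\<dots> = \<kappa> q * (nn b c * nn c b * e i) - phi b * (\<psi> a * (\<psi> b * w2))"
      by (simp only: right_diff_distrib k_left_commute[of "phi b"] sq)
    finally show ?thesis by (simp only: B3 B4)
  qed

  let ?F = "?N2 * ?M * ?N1"
  have pcs: "pc {1..n} ?N1" "pc {1..n} ?N2" "pc {1..n} ?M" "pc {1..n} (cc ?p ?s a b)" "pc {1..n} (cc ?s ?p b a)"
     "pc {1..n} (cc ?s ?p b c)" "pc {1..n} (cc ?p ?s c b)"
    by (intro pc_NN pc_mult pc_k pc_nn pc_cc r)+
  have F1: "?N2 * w1 = ?F * e i" by (simp add: w1_def mult.assoc)
  have F2: "?N1 * w2 = ?F * e i"
  proof -
    have "?N1 * (?M * ?N2) = ?M * ?N2 * ?N1" by (rule pc_pc[OF pcs(1) pc_mult[OF pcs(3,2)]])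
    then have "?N1 * (?M * ?N2) = ?F" using pc_pc[OF pcs(3,2)] by simp
    from arg_cong[OF this, of "\<lambda>t. t * e i"] show ?thesis by (simp only: w2_def mult.assoc)
  qed
  have C1: "cc ?p ?s a b * cc ?s ?p b a * w1 = cc ?s ?p b a * ?M * nn a b * e i"
  proof -
    have "cc ?p ?s a b * (cc ?s ?p b a * ?M * ?N1) = cc ?s ?p b a * ?M * ?N1 * cc ?p ?s a b"
      by (rule pc_pc) (intro pcs pc_mult)+
    also have "\<dots> = cc ?s ?p b a * ?M * nn a b" using NN_cc[OF p0 r(1,2)] by (simp add: mult.assoc)
    finally have * : "cc ?p ?s a b * (cc ?s ?p b a * ?M * ?N1) = cc ?s ?p b a * ?M * nn a b" .
    from arg_cong[OF *, of "\<lambda>t. t * e i"] show ?thesis by (simp only: w1_def mult.assoc)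
  qed
  have C2: "cc ?s ?p b c * cc ?p ?s c b * w2 = cc ?p ?s c b * ?M * nn b c * e i"
  proof -
    have "cc ?s ?p b c * (cc ?p ?s c b * ?M * ?N2) = cc ?p ?s c b * ?M * ?N2 * cc ?s ?p b c"
      by (rule pc_pc) (intro pcs pc_mult)+
    also have "\<dots> = cc ?p ?s c b * ?M * nn b c" using NN_cc[OF s0 r(2,3)] by (simp add: mult.assoc)
    finally have * : "cc ?s ?p b c * (cc ?p ?s c b * ?M * ?N2) = cc ?p ?s c b * ?M * nn b c" .
    from arg_cong[OF *, of "\<lambda>t. t * e i"] show ?thesis by (simp only: w2_def mult.assoc)
  qed
  let ?W = "z * z * X b + X b + X b - X a - X c"
  \<comment> \<open>The third identity of \<open>hecke_braids\<close> solved for the difference of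
    the two \<psi>-words; the bracket that remains is a function of X a, X b, X c alone.\<close>
  have main: "pbr a * (?F * e i) = gbr a * (- ((X a - X b) * (X b - X c)) * e i)
     + (\<kappa> q * (nn a b * nn b a - nn b c * nn c b) + z * X c * ?W
        - \<beta> * (cc ?s ?p b a * ?M * nn a b) - \<alpha> * (cc ?p ?s c b * ?M * nn b c)) * e i"
  proof -
    have group: "s1 - (t1 + b1) - (s2 - (t2 - a2)) = d - y \<Longrightarrow> t1 - t2 = - d + (s1 - s2 + y - b1 - a2)"
      for s1 t1 b1 s2 t2 a2 d y :: 'a by (simp add: algebra_simps)
    have "pbr a * (?F * e i) = \<psi> a * (\<psi> b * (\<psi> a * (?F * e i))) - \<psi> b * (\<psi> a * (\<psi> b * (?F * e i)))"
      by (simp add: pbr_def b(1)[symmetric] left_diff_distrib mult.assoc)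
    moreover have "phi a * g b * phi a * e i - phi b * g a * phi b * e i
        = gbr a * (X a - X b) * (X b - X c) * e i - z * X c * ?W * e i"
      using arg_cong[OF hecke_braids(3)[OF a b c quad], of "\<lambda>t. t * e i"]
      by (simp only: left_diff_distrib[of "phi a * g b * phi a"]
          left_diff_distrib[of "gbr a * (X a - X b) * (X b - X c)"])
    note group[OF this[unfolded A B F1 F2 C1 C2]]
    moreover have "gbr a * (- ((X a - X b) * (X b - X c)) * e i) = - (gbr a * (X a - X b) * (X b - X c) * e i)"
      by (simp only: minus_mult_left[symmetric] minus_mult_right[symmetric] mult.assoc)
    moreover have "(\<kappa> q * (nn a b * nn b a - nn b c * nn c b) + z * X c * ?W
        - \<beta> * (cc ?s ?p b a * ?M * nn a b) - \<alpha> * (cc ?p ?s c b * ?M * nn b c)) * e i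
      = \<kappa> q * (nn a b * nn b a * e i) - \<kappa> q * (nn b c * nn c b * e i) + z * X c * ?W * e i
        - \<beta> * (cc ?s ?p b a * ?M * nn a b * e i) - \<alpha> * (cc ?p ?s c b * ?M * nn b c * e i)"
      by (simp only: left_diff_distrib distrib_right right_diff_distrib[of "\<kappa> q"] mult.assoc)
    ultimately show ?thesis by (simp only:)
  qed
  have "(\<kappa> q * (nn a b * nn b a - nn b c * nn c b) + z * X c * ?W
        - \<beta> * (cc ?s ?p b a * ?M * nn a b) - \<alpha> * (cc ?p ?s c b * ?M * nn b c)) = psi_braid i a * ?F"
  proof -
    have W: "nn a c * (?W + \<kappa> (inverse q) * nn a b) = \<kappa> q * (nn a c * nn b c)"
      "nn a c * (?W - \<kappa> q * nn b c) = - (\<kappa> (inverse q) * (nn a c * nn a b))"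
      "nn a c * (?W + \<kappa> (inverse q) * nn a b - \<kappa> q * nn b c) = 0"
    proof -
      have 0: "?W + \<kappa> (inverse q) * nn a b - \<kappa> q * nn b c = 0"
        unfolding nn_def z_eq
        by (rule braid_iji_polynomial(2)[where u = u]) (rule k_central k_q u_X r u_k X_X)+
      then show "nn a c * (?W + \<kappa> (inverse q) * nn a b - \<kappa> q * nn b c) = 0" by simp
      have 1: "?W + \<kappa> (inverse q) * nn a b = \<kappa> q * nn b c" using 0 by simp
      show "nn a c * (?W + \<kappa> (inverse q) * nn a b) = \<kappa> q * (nn a c * nn b c)"
        unfolding 1 by (rule k_left_commute)
      have 2: "?W - \<kappa> q * nn b c = - (\<kappa> (inverse q) * nn a b)" using 0 by (simp add: algebra_simps)
      show "nn a c * (?W - \<kappa> q * nn b c) = - (\<kappa> (inverse q) * (nn a c * nn a b))"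
        unfolding 2 by (simp add: k_left_commute[of "nn a c"])
    qed
    have D: "\<kappa> q * (nn a b * nn b a - nn b c * nn c b) + z * X c * ?W = nn a c * ?W"
      unfolding nn_def z_eq
      by (rule braid_iji_polynomial(1)[where u = u]) (rule k_central k_q u_X r u_k X_X)+
    have kM: "\<kappa> (x * ?p) * (?M * y) = \<kappa> x * (nn a c * y)" for x y
    proof -
      have "\<kappa> (x * ?p) * \<kappa> (inverse ?p) = \<kappa> x" using p0 by (simp add: k_mult[symmetric] mult.assoc)
      then show ?thesis by (simp add: mult.assoc[symmetric])
    qed
    have uM: "u * ?M = ?M" by (metis u_k mult.assoc)
    have nM: "nn b c * ?M = ?M * nn b c" "?M * nn a b = nn a b * ?M"
      by (rule pc_pc; intro pc_mult pc_k pc_nn r)+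
    have lab_c: "ix i (a + 1) = ?s" "ix i (a + 2) = ?p" using b c eq by (simp_all add: add.assoc)
    \<comment> \<open>The four cases are no arrow, an arrow from p to s, an arrow from s to p, and a
      double arrow. The equations \<open>W\<close> make the bracket vanish in the first case and
      supply the surviving term for single arrows.\<close>
    consider (n) "?s \<noteq> q\<^sup>2 * ?p" "?p \<noteq> q\<^sup>2 * ?s" | (t) "?s = q\<^sup>2 * ?p" "?p \<noteq> q\<^sup>2 * ?s"
      | (f) "?s \<noteq> q\<^sup>2 * ?p" "?p = q\<^sup>2 * ?s" | (b) "?s = q\<^sup>2 * ?p" "?p = q\<^sup>2 * ?s" by blast
    then show ?thesis
    proof cases
      case n
      then have "\<beta> = - \<kappa> (inverse q * ?p)" "\<alpha> = \<kappa> (q * ?p)" "cc ?s ?p b a = u" "cc ?p ?s c b = u"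
        "psi_braid i a = 0"
        unfolding \<alpha>_def \<beta>_def cc_def psi_braid_def lab_c by simp_all
      then show ?thesis unfolding D using W(3)
        by (simp only: uM mult.assoc[of ?M] kM minus_mult_left[symmetric])
          (simp add: distrib_left right_diff_distrib k_left_commute[of "nn a c"])
    next
      case t
      then have "\<beta> = - \<kappa> (inverse q * ?p)" "\<alpha> = 0" "cc ?s ?p b a = u" "?N1 = \<kappa> (q * ?p)" "?N2 = nn b c"
        "psi_braid i a = u"
        unfolding \<alpha>_def \<beta>_def cc_def psi_braid_def lab_c NN_def by simp_all
      moreover have "u * (nn b c * ?M * \<kappa> (q * ?p)) = \<kappa> q * (nn a c * nn b c)"
        unfolding k_central[of _ "q * ?p"] nM(1) kM by (metis u_k mult.assoc)
      moreover have "nn a c * ?W + \<kappa> (inverse q) * (nn a c * nn a b) = \<kappa> q * (nn a c * nn b c)"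
        using W(1) by (simp add: distrib_left k_left_commute[of "nn a c"])
      ultimately show ?thesis unfolding D
        by (simp only: uM mult.assoc[of ?M] kM minus_mult_left[symmetric]) simp
    next
      case f
      have qs: "q * ?s = inverse q * ?p" using f(2) q0 by (simp add: power2_eq_square)
      from f have "\<beta> = 0" "\<alpha> = \<kappa> (q * ?p)" "cc ?p ?s c b = u" "?N1 = nn a b" "?N2 = \<kappa> (inverse q * ?p)"
        "psi_braid i a = - u"
        unfolding \<alpha>_def \<beta>_def cc_def psi_braid_def lab_c NN_def qs[symmetric] by simp_all
      moreover have "- u * (\<kappa> (inverse q * ?p) * ?M * nn a b) = - (\<kappa> (inverse q) * (nn a c * nn a b))"
        unfolding mult.assoc[of _ ?M] kM by (simp add: mult.assoc[symmetric])
      moreover have "nn a c * ?W - \<kappa> q * (nn a c * nn b c) = - (\<kappa> (inverse q) * (nn a c * nn a b))"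
        using W(2) by (simp add: right_diff_distrib k_left_commute[of "nn a c"])
      ultimately show ?thesis unfolding D
        by (simp only: uM mult.assoc[of ?M] kM) simp
    next
      \<comment> \<open>A double arrow forces q^4 = 1, hence q^2 = -1 and z^2 = -4, and the bracket
        \<open>?W\<close> collapses to -(X a + 2 X b + X c).\<close>
      case b
      have "?p = q\<^sup>2 * (q\<^sup>2 * ?p)" using b by metis
      then have "(q\<^sup>2 - 1) * (q\<^sup>2 + 1) = 0" using p0 by (simp add: algebra_simps)
      then have qq: "q\<^sup>2 = - 1" using q2 by (auto simp: eq_neg_iff_add_eq_0)
      then have iq: "inverse q = - q" using q0 by (simp add: power2_eq_square field_simps)
      have qs: "q * ?s = inverse q * ?p" using b(2) q0 by (simp add: power2_eq_square)
      let ?V = "X a + X b + X b + X c"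
      have "z * z = \<kappa> ((q - inverse q) * (q - inverse q))" by (simp add: k_mult)
      also have "(q - inverse q) * (q - inverse q) = 4 * q\<^sup>2"
        unfolding iq by (simp add: power2_eq_square algebra_simps)
      also have "\<dots> = - (1 + 1 + 1 + 1)" unfolding qq by simp
      finally have "z * z = - (u + u + u + u)" unfolding k_minus k_add .
      then have "z * z * X b = - (X b + X b + X b + X b)"
        by (simp only: minus_mult_left[symmetric] distrib_right u_X[OF r(2)])
      then have WV: "?W = - ?V" by (simp only:) (simp add: algebra_simps)
      from b have "\<beta> = 0" "\<alpha> = 0" "?N1 = \<kappa> (q * ?p)" "?N2 = \<kappa> (inverse q * ?p)"
        "psi_braid i a = - (\<kappa> (inverse ?p) * ?V)"
        unfolding \<alpha>_def \<beta>_def psi_braid_def lab_c NN_def qs[symmetric] using \<open>b = a + 1\<close> c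
        by (simp_all add: add.assoc)
      moreover have "\<kappa> (inverse ?p) * ?V * (\<kappa> (inverse q * ?p) * ?M * \<kappa> (q * ?p)) = nn a c * ?V"
      proof -
        have "\<kappa> (inverse ?p) * (\<kappa> (inverse q * ?p) * (\<kappa> (inverse ?p) * \<kappa> (q * ?p))) = u"
        proof -
          have "inverse ?p * (inverse q * ?p * (inverse ?p * (q * ?p))) = 1" using p0 q0 by (simp add: field_simps)
          then show ?thesis by (simp only: k_mult[symmetric])
        qed
        moreover have "?V * nn a c = nn a c * ?V" by (intro pc_pc pc_add pc_X pc_nn r)
        moreover have "\<kappa> (inverse ?p) * ?V * (\<kappa> (inverse q * ?p) * ?M * \<kappa> (q * ?p))
          = \<kappa> (inverse ?p) * (\<kappa> (inverse q * ?p) * (\<kappa> (inverse ?p) * \<kappa> (q * ?p))) * (?V * nn a c)"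
          by (simp only: mult.assoc k_left_commute[of ?V] k_central[of "nn a c"])
        ultimately show ?thesis using u_mult_right[OF u_nn[OF r(1,3)]] by (simp only:)
      qed
      ultimately show ?thesis unfolding WV D[unfolded WV] by (simp only: minus_mult_left[symmetric] minus_mult_right[symmetric]) simp
    qed
  qed
  then have "(pbr a - psi_braid i a) * (?F * e i) = gbr a * (- ((X a - X b) * (X b - X c)) * e i)"
    using main by (simp add: left_diff_distrib mult.assoc)
  moreover have "reg i ?F" "reg i (- ((X a - X b) * (X b - X c)))"
    using reg_NN[OF i r(2,3)] reg_NN[OF i r(1,2)] reg_dot_eq'[OF i r(1) r(1,3) refl eq[symmetric]] eq ne
    by (auto intro!: reg_mult reg_minus reg_diff i r)
  ultimately show ?thesis by (intro braid_relatedI)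
qed

lemma braid_related:
  assumes a: "a \<in> {1..<n}" "a + 1 \<in> {1..<n}" and i: "i \<in> B"
    and quad: "\<And>a. a \<in> {1..<n} \<Longrightarrow> g a * g a = z * g a + u"
  shows "braid_related i a"
  using braid_distinct[OF a(1) refl a(2) refl i quad[OF a(1)] quad[OF a(2)]]
    braid_iij[OF a(1) refl a(2) refl i quad[OF a(1)] quad[OF a(2)]]
    braid_jii[OF a(1) refl a(2) refl i quad[OF a(1)] quad[OF a(2)]]
    braid_iji[OF a(1) refl a(2) refl i quad[OF a(1)] quad[OF a(2)]]
    braid_iii[OF a(1) refl a(2) refl i quad[OF a(1)] quad[OF a(2)]]
  by metis

lemma psi_braid:
  assumes a: "a \<in> {1..<n}" "a + 1 \<in> {1..<n}" and i: "i \<in> B"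
    and quad: "\<And>a. a \<in> {1..<n} \<Longrightarrow> g a * g a = z * g a + u"
    and g: "g a * g (a + 1) * g a = g (a + 1) * g a * g (a + 1)"
  shows "(\<psi> a * \<psi> (a + 1) * \<psi> a - \<psi> (a + 1) * \<psi> a * \<psi> (a + 1)) * e i = psi_braid i a * e i"
proof -
  obtain F where "reg i F" "(pbr a - psi_braid i a) * (F * e i) = 0"
    using braid_related[OF a i quad] g by (auto simp: braid_related_def gbr_def)
  then have "(pbr a - psi_braid i a) * e i = 0" by (simp add: reg_def)
  then show ?thesis by (simp add: pbr_def left_diff_distrib)
qed

lemma g_braid:
  assumes a: "a \<in> {1..<n}" "a + 1 \<in> {1..<n}"
    and quad: "\<And>a. a \<in> {1..<n} \<Longrightarrow> g a * g a = z * g a + u"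
    and psi: "\<And>i. i \<in> B \<Longrightarrow>
      (\<psi> a * \<psi> (a + 1) * \<psi> a - \<psi> (a + 1) * \<psi> a * \<psi> (a + 1)) * e i = psi_braid i a * e i"
  shows "g a * g (a + 1) * g a = g (a + 1) * g a * g (a + 1)"
proof (rule eq_on_e)
  fix i assume i: "i \<in> B"
  obtain F F' where F: "reg i F" "reg i F'" "(pbr a - psi_braid i a) * (F * e i) = gbr a * (F' * e i)"
    using braid_related[OF a i quad] by (auto simp: braid_related_def)
  have "(pbr a - psi_braid i a) * (F * e i) = (pbr a - psi_braid i a) * e i * F"
    using F(1) by (simp add: reg_def mult.assoc)
  also have "(pbr a - psi_braid i a) * e i = 0" using psi[OF i] by (simp add: pbr_def left_diff_distrib)
  finally have "gbr a * e i = 0" using F(2,3) by (simp add: reg_def)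
  then show "g a * g (a + 1) * g a * e i = g (a + 1) * g a * g (a + 1) * e i"
    by (simp add: gbr_def left_diff_distrib)
qed (use u_g[OF a(1)] u_g[OF a(2)] in \<open>simp_all add: mult.assoc[symmetric]\<close>)

end

section \<open>The Hecke side\<close>

lemma mset_swp: "a \<in> {1..<n} \<Longrightarrow> length i = n \<Longrightarrow> mset (swp a i) = mset i"
  unfolding swp_def by (rule mset_swap) auto

text \<open>The idempotent of a tuple is the product over k of the spectral component of
  \<open>u\<close> for X k at the k-th entry; orthogonality comes from the separation of
  eigenvalues. All tuples over \<open>T\<close> are kept, so some of these idempotents may be
  0.\<close>

lemma (in scalars) spectral_exists:
  fixes q :: 'k and X :: "nat \<Rightarrow> 'a"
  assumes q: "q \<noteq> 0" "q\<^sup>2 \<noteq> 1"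
    and uX: "\<And>k. k \<in> {1..n} \<Longrightarrow> u * X k = X k"
    and XX: "\<And>k l. k \<in> {1..n} \<Longrightarrow> l \<in> {1..n} \<Longrightarrow> X k * X l = X l * X k"
    and T: "finite T" "0 \<notin> T"
    and roots: "\<And>k. k \<in> {1..n} \<Longrightarrow> \<exists>xs. set xs \<subseteq> T \<and> pr xs (X k) u = 0"
  shows "\<exists>e. spectral \<kappa> q n {i. set i \<subseteq> T \<and> length i = n} e X
    \<and> (\<forall>i t. set i \<subseteq> T \<longrightarrow> length i = n \<longrightarrow> (\<forall>k\<in>{1..n}. t * X k = X k * t) \<longrightarrow> t * e i = e i * t)"
proof -
  define Q where "Q k E \<longleftrightarrow> (\<Sum>s\<in>T. E s) = u \<and> (\<forall>s\<in>T. nil (X k - \<kappa> s) (E s)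
     \<and> (\<forall>t. t * X k = X k * t \<longrightarrow> t * E s = E s * t))" for k and E :: "'k \<Rightarrow> 'a"
  have "\<forall>k\<in>{1..n}. \<exists>E. Q k E"
  proof
    fix k assume "k \<in> {1..n}"
    then obtain xs where xs: "set xs \<subseteq> T" "pr xs (X k) u = 0" using roots by blast
    obtain E where E: "(\<Sum>s\<in>set xs. E s) = u" "\<And>s. s \<in> set xs \<Longrightarrow> nil (X k - \<kappa> s) (E s)"
      "\<And>s t. s \<in> set xs \<Longrightarrow> t * X k = X k * t \<Longrightarrow> t * u = u * t \<Longrightarrow> t * E s = E s * t"
      using spectral_vector[OF xs(2) u_k] by blast
    define E' where "E' s = (if s \<in> set xs then E s else 0)" for s
    have "(\<Sum>s\<in>T. E' s) = u"
      unfolding E'_def using xs(1) T(1) E(1) by (simp add: sum.If_cases Int_absorb1)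
    then have "Q k E'" unfolding Q_def E'_def using E(2,3) by (auto simp: k_central)
    then show "\<exists>E. Q k E" by blast
  qed
  then obtain E where "\<forall>k\<in>{1..n}. Q k (E k)" using bchoice[of "{1..n}" Q] by blast
  then have sumE: "\<And>k. k \<in> {1..n} \<Longrightarrow> (\<Sum>s\<in>T. E k s) = u"
    and nilE: "\<And>k s. k \<in> {1..n} \<Longrightarrow> s \<in> T \<Longrightarrow> nil (X k - \<kappa> s) (E k s)"
    and comE: "\<And>k s t. k \<in> {1..n} \<Longrightarrow> s \<in> T \<Longrightarrow> t * X k = X k * t \<Longrightarrow> t * E k s = E k s * t"
    unfolding Q_def by blast+
  \<comment> \<open>The recursion carries the strand number, since the tail of a tuple belongs to
    the following strands.\<close>
  define pe where "pe = rec_list (\<lambda>k. u) (\<lambda>s i r k. E k s * r (Suc k))"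
  have pe: "pe [] k = u" "pe (s # i) k = E k s * pe i (Suc k)" for s i k by (simp_all add: pe_def)
  have com: "t * pe i k = pe i k * t"
    if "set i \<subseteq> T" "1 \<le> k" "k + length i \<le> Suc n" "\<And>l. l \<in> {1..n} \<Longrightarrow> t * X l = X l * t" for i k t
    using that
  proof (induction i arbitrary: k)
    case Nil then show ?case by (simp add: pe k_central)
  next
    case (Cons s i)
    have "t * E k s = E k s * t" using Cons.prems by (intro comE) auto
    moreover have "t * pe i (Suc k) = pe i (Suc k) * t" using Cons.prems by (intro Cons.IH) auto
    ultimately show ?case by (simp add: pe) (metis mult.assoc)
  qed
  have upe: "u * pe i k = pe i k" if "set i \<subseteq> T" "1 \<le> k" "k + length i \<le> Suc n" for i k
    using that
  proof (induction i arbitrary: k)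
    case (Cons s i) then show ?case by (simp add: pe u_mult_left)
  qed (simp add: pe)
  have nilpe: "nil (X l - \<kappa> (i ! (l - k))) (pe i k)"
    if "set i \<subseteq> T" "1 \<le> k" "k + length i \<le> Suc n" "k \<le> l" "l < k + length i" for i k l
    using that
  proof (induction i arbitrary: k)
    case (Cons s i)
    show ?case
    proof (cases "l = k")
      case True then show ?thesis using nilE[of k s] Cons.prems by (simp add: pe nil_mult_right)
    next
      case False
      have "nil (X l - \<kappa> (i ! (l - Suc k))) (pe i (Suc k))" using Cons.prems False by (intro Cons.IH) auto
      moreover have "E k s * (X l - \<kappa> (i ! (l - Suc k))) = (X l - \<kappa> (i ! (l - Suc k))) * E k s"
        using comE[of k s "X l"] XX[of l k] Cons.prems False
        by (simp add: left_diff_distrib right_diff_distrib k_central[of "E k s"])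
      ultimately show ?thesis using False Cons.prems
        by (simp add: pe nth_Cons' nil_mult_left Suc_eq_plus1)
    qed
  qed auto
  have sumpe: "(\<Sum>i | set i \<subseteq> T \<and> length i = m. pe i k) = u" if "1 \<le> k" "k + m \<le> Suc n" for m k
    using that
  proof (induction m arbitrary: k)
    case 0
    have "{i. set i \<subseteq> T \<and> length i = 0} = {[]}" by auto
    then show ?case by (simp add: pe)
  next
    case (Suc m)
    have "(\<Sum>i | set i \<subseteq> T \<and> length i = Suc m. pe i k)
       = (\<Sum>(i, s)\<in>{i. set i \<subseteq> T \<and> length i = m} \<times> T. pe (s # i) k)"
      unfolding lists_length_Suc_eq by (subst sum.reindex) (auto simp: inj_on_def case_prod_unfold)
    also have "\<dots> = (\<Sum>i | set i \<subseteq> T \<and> length i = m. (\<Sum>s\<in>T. E k s) * pe i (Suc k))"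
      by (simp add: sum.cartesian_product[symmetric] pe sum_distrib_right)
    also have "\<dots> = (\<Sum>i | set i \<subseteq> T \<and> length i = m. pe i (Suc k))"
      using Suc.prems by (intro sum.cong) (auto simp: sumE upe)
    also have "\<dots> = u" using Suc.prems by (intro Suc.IH) auto
    finally show ?case .
  qed
  let ?B = "{i. set i \<subseteq> T \<and> length i = n}"
  define e where "e i = pe i 1" for i
  have fin: "finite ?B" using finite_lists_length_eq[OF T(1)] by simp
  have comX: "t * e i = e i * t" if "i \<in> ?B" "\<And>l. l \<in> {1..n} \<Longrightarrow> t * X l = X l * t" for i t
    unfolding e_def using that by (intro com) auto
  have ue: "u * e i = e i" if "i \<in> ?B" for i
    unfolding e_def using that by (intro upe) auto
  have nile: "nil (X k - \<kappa> (ix i k)) (e i)" if "i \<in> ?B" "k \<in> {1..n}" for i k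
    unfolding e_def ix_def using that by (intro nilpe) auto
  have sume: "(\<Sum>i\<in>?B. e i) = u" unfolding e_def by (intro sumpe) auto
  have orth: "e i * e j = 0" if ij: "i \<in> ?B" "j \<in> ?B" "i \<noteq> j" for i j
  proof -
    obtain k where k: "k \<in> {1..n}" "ix i k \<noteq> ix j k" using list_eq_ix[of i n j] ij by blast
    have "e i * X k = X k * e i" using comX[OF ij(1)] XX k(1) by metis
    then have "nil (X k - \<kappa> (ix j k)) (e i * e j)"
      by (intro nil_mult_left nile ij k) (simp add: left_diff_distrib right_diff_distrib k_central[of "e i"])
    moreover have "nil (X k - \<kappa> (ix i k)) (e i * e j)" by (intro nil_mult_right nile ij k)
    ultimately show ?thesis using nil_distinct k(2) u_mult_left[OF ue[OF ij(2)]] by blast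
  qed
  have idem: "e i * e i = e i" if i: "i \<in> ?B" for i
  proof -
    have "e i = e i * (\<Sum>j\<in>?B. e j)" unfolding sume by (metis ue[OF i] k_central)
    also have "\<dots> = (\<Sum>j\<in>?B. e i * e j)" by (rule sum_distrib_left)
    also have "\<dots> = e i * e i + (\<Sum>j\<in>?B - {i}. e i * e j)" by (rule sum.remove[OF fin i])
    also have "(\<Sum>j\<in>?B - {i}. e i * e j) = 0" using orth i by (intro sum.neutral) auto
    finally show ?thesis by simp
  qed
  have "spectral \<kappa> q n ?B e X"
  proof unfold_locales
    show "swp a i \<in> ?B" if "a \<in> {1..<n}" "i \<in> ?B" for a i
      using that mset_eq_setD[OF mset_swp[of a n i]] by simp
    show "ix i k \<noteq> 0" if "i \<in> ?B" "k \<in> {1..n}" for i k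
    proof -
      have "i ! (k - 1) \<in> set i" using that by (intro nth_mem) auto
      then show ?thesis using that T(2) by (auto simp: ix_def)
    qed
    show "e i * e j = (if i = j then e i else 0)" if "i \<in> ?B" "j \<in> ?B" for i j
      using idem orth that by simp
    show "X k * e i = e i * X k" if "k \<in> {1..n}" "i \<in> ?B" for k i
      using comX[OF that(2)] XX that(1) by metis
  qed (use q fin sume uX XX nile in auto)
  then show ?thesis using comX by (intro exI[of _ e]) auto
qed

section \<open>The affine Hecke relations and the spectra of the X k\<close>

locale hecke = scalars \<kappa> for \<kappa> :: "'k::field \<Rightarrow> 'a::ring" +
  fixes q :: 'k and n :: nat and X g :: "nat \<Rightarrow> 'a"
  assumes q_0: "q \<noteq> 0" and q_2: "q\<^sup>2 \<noteq> 1"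
    and u_X': "k \<in> {1..n} \<Longrightarrow> \<kappa> 1 * X k = X k"
    and u_g': "a \<in> {1..<n} \<Longrightarrow> \<kappa> 1 * g a = g a"
    and X_X': "k \<in> {1..n} \<Longrightarrow> l \<in> {1..n} \<Longrightarrow> X k * X l = X l * X k"
    and g_quad: "a \<in> {1..<n} \<Longrightarrow> g a * g a = \<kappa> (q - inverse q) * g a + \<kappa> 1"
    and g_X_g: "a \<in> {1..<n} \<Longrightarrow> g a * X a * g a = X (a + 1)"
    and g_X': "a \<in> {1..<n} \<Longrightarrow> k \<in> {1..n} \<Longrightarrow> k \<noteq> a \<Longrightarrow> k \<noteq> a + 1 \<Longrightarrow> g a * X k = X k * g a"
    and g_g_far: "a \<in> {1..<n} \<Longrightarrow> c \<in> {1..<n} \<Longrightarrow> a + 1 < c \<or> c + 1 < a \<Longrightarrow> g a * g c = g c * g a"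
    and g_g_braid: "a \<in> {1..<n} \<Longrightarrow> a + 1 \<in> {1..<n} \<Longrightarrow>
      g a * g (a + 1) * g a = g (a + 1) * g a * g (a + 1)"
begin

abbreviation zz :: 'a where "zz \<equiv> \<kappa> (q - inverse q)"

definition ph :: "nat \<Rightarrow> 'a" where
  "ph a = g a * (X a - X (a + 1)) + zz * X (a + 1)"

text \<open>Multiply g X_a g = X_{a+1} by g on the right and reduce the square; multiplying on the
  left gives \<open>gX2\<close>.\<close>

lemma gX1: assumes a: "a \<in> {1..<n}" shows "g a * X a = X (a + 1) * g a - zz * X (a + 1)"
proof -
  have "X (a + 1) * g a = g a * X a * (g a * g a)" by (simp add: g_X_g[OF a, symmetric] mult.assoc)
  also have "\<dots> = zz * X (a + 1) + g a * X a"
    using a u_X'[of a] by (simp add: g_quad distrib_left k_left_commute mult.assoc[symmetric] g_X_g[OF a, symmetric]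
      u_right u_mult_left u_g' k_central[of "g a * X a"])
  finally show ?thesis by simp
qed

lemma gX2: assumes a: "a \<in> {1..<n}" shows "g a * X (a + 1) = X a * g a + zz * X (a + 1)"
proof -
  have "g a * X (a + 1) = g a * g a * (X a * g a)" by (simp add: g_X_g[OF a, symmetric] mult.assoc)
  also have "\<dots> = zz * (g a * X a * g a) + u * (X a * g a)"
    by (simp add: g_quad[OF a] distrib_right mult.assoc)
  finally show ?thesis using a u_X'[of a] u_mult_right[of "X a" "g a"] by (simp add: g_X_g)
qed

lemma ph_X: assumes a: "a \<in> {1..<n}" and k: "k \<in> {1..n}" shows "ph a * X k = X (sb a k) * ph a"
proof -
  have r: "a \<in> {1..n}" "a + 1 \<in> {1..n}" using a by auto
  define y where "y = X (a + 1)"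
  have ph: "ph a = g a * (X a - y) + zz * y" by (simp add: ph_def y_def)
  have XX: "y * X a = X a * y" "X k * X a = X a * X k" "y * X k = X k * y"
    unfolding y_def using X_X' r k by auto
  note kc = k_left_commute[of "X a"] k_left_commute[of y] k_left_commute[of "X k"] k_central[of "X a"]
    k_central[of y] k_central[of "X k"]
  consider "k = a" | "k = a + 1" | "k \<noteq> a" "k \<noteq> a + 1" by blast
  then show ?thesis
  proof cases
    case 1
    have "ph a * X a = g a * X a * (X a - y) + zz * y * X a" by (simp add: ph algebra_simps XX)
    also have "\<dots> = y * ph a" unfolding gX1[OF a, folded y_def] by (simp add: ph algebra_simps XX kc)
    finally show ?thesis using 1 by (simp add: sb_def y_def)
  next
    case 2
    have "ph a * y = g a * y * (X a - y) + zz * y * y" by (simp add: ph algebra_simps XX)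
    also have "\<dots> = X a * ph a" unfolding gX2[OF a, folded y_def] by (simp add: ph algebra_simps XX kc)
    finally show ?thesis using 2 by (simp add: sb_def y_def)
  next
    case 3
    have "ph a * X k = g a * X k * (X a - y) + zz * X k * y" by (simp add: ph algebra_simps XX)
    also have "\<dots> = X k * ph a" unfolding g_X'[OF a k 3] by (simp add: ph algebra_simps kc)
    finally show ?thesis using 3 by (simp add: sb_def)
  qed
qed

lemma ph_ph:
  assumes a: "a \<in> {1..<n}"
  shows "ph a * ph a = (\<kappa> q * X a - \<kappa> (inverse q) * X (a + 1)) * (\<kappa> q * X (a + 1) - \<kappa> (inverse q) * X a)"
proof -
  have z: "zz = \<kappa> q - \<kappa> (inverse q)" by (rule k_diff)
  have r: "a \<in> {1..n}" "a + 1 \<in> {1..n}" using a by auto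
  have g0: "g a * g a - (\<kappa> q - \<kappa> (inverse q)) * g a - u = 0" using g_quad[OF a] by (simp add: z)
  show ?thesis
    using hecke_intertwiner_square[OF k_central k_central k_inverse'[OF q_0] u_X'[OF r(1)] u_X'[OF r(2)]
      u_g'[OF a] u_right[OF u_g'[OF a]] X_X'[OF r(2,1)] gX1[OF a, unfolded z] gX2[OF a, unfolded z]]
    unfolding ph_def z g0 by simp
qed

text \<open>The intertwiner carries a product of linear factors annihilating X a to one in X (a +
  1), and its square is the product of \<open>?m\<close> and \<open>?m'\<close>. On vectors killed
  by \<open>?m'\<close> (by \<open>?m\<close>), X a acts as q^2 (as q^-2) times X (a + 1), which
  yields the two rescaled copies of the old roots.\<close>

lemma roots_step:
  assumes a: "a \<in> {1..<n}" and xs: "pr xs (X a) u = 0"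
  shows "pr (map (\<lambda>s. s / inverse (q\<^sup>2)) xs @ map (\<lambda>s. s / q\<^sup>2) xs @ xs) (X (a + 1)) u = 0"
proof -
  let ?x = "X a" and ?y = "X (a + 1)"
  let ?m = "\<kappa> q * ?x - \<kappa> (inverse q) * ?y" and ?m' = "\<kappa> q * ?y - \<kappa> (inverse q) * ?x"
  have r: "a \<in> {1..n}" "a + 1 \<in> {1..n}" using a by auto
  have xy: "?x * ?y = ?y * ?x" using X_X' r by blast
  have q0': "\<kappa> q * \<kappa> q = \<kappa> (q\<^sup>2)" "\<kappa> (inverse q) * \<kappa> (inverse q) = \<kappa> (inverse (q\<^sup>2))"
    by (simp_all add: k_mult[symmetric] power2_eq_square)
  have xs0: "pr xs ?x v = 0" if "u * v = v" for v
    using pr_mult_right[of xs ?x u v] xs that by simp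
  have m_y: "?m * ?y = ?y * ?m" "?m' * ?y = ?y * ?m'"
    by (simp_all add: left_diff_distrib right_diff_distrib mult.assoc xy k_left_commute[of ?y])
  have um: "u * ?m = ?m" "u * ?m' = ?m'"
    using u_X' r by (simp_all add: right_diff_distrib mult.assoc[symmetric])
  have mm: "?m * ?m' = ?m' * ?m"
  proof -
    have "\<kappa> (inverse q) * (\<kappa> q * v) = \<kappa> q * (\<kappa> (inverse q) * v)" for v by (rule k_left_commute)
    then show ?thesis
      by (simp add: left_diff_distrib right_diff_distrib mult.assoc xy k_left_commute[of ?x] k_left_commute[of ?y])
  qed
  \<comment> \<open>This vector is killed by \<open>?m'\<close>, so the roots divided by q^2
    annihilate it.\<close>
  define w1 where "w1 = pr xs ?y ?m"
  have uw1: "u * w1 = w1" unfolding w1_def by (rule pr_u[OF um(1)])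
  have "?m' * w1 = pr xs ?y (?m' * ?m)" unfolding w1_def by (rule pr_mult_left[OF m_y(2)])
  also have "?m' * ?m = ph a * ph a" unfolding ph_ph[OF a] by (rule mm[symmetric])
  also have "pr xs ?y (ph a * ph a) = ph a * pr xs ?x (ph a)"
    by (rule pr_mult_left[symmetric]) (use ph_X[OF a r(1)] in \<open>simp add: sb_def\<close>)
  also have "pr xs ?x (ph a) = 0"
    by (rule xs0) (use u_g'[OF a] in \<open>simp add: ph_def distrib_left u_mult_right mult.assoc[symmetric]\<close>)
  finally have "\<kappa> q * (?m' * w1) = 0" by simp
  then have "\<kappa> q * \<kappa> q * (?y * w1) = \<kappa> q * \<kappa> (inverse q) * (?x * w1)"
    by (simp add: left_diff_distrib right_diff_distrib mult.assoc)
  then have 1: "\<kappa> (q\<^sup>2) * ?y * w1 = ?x * w1"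
    using u_mult_left[OF uw1, of ?x] by (simp add: q0' k_inverse'[OF q_0] mult.assoc)
  have "pr xs (\<kappa> (q\<^sup>2) * ?y) w1 = pr xs ?x w1"
    by (rule pr_eigen[OF _ 1]) (simp add: k_left_commute[of ?x] mult.assoc xy)
  then have "pr (map (\<lambda>s. s / q\<^sup>2) xs) ?y w1 = 0"
    using xs0[OF uw1] q_0 by (intro pr_scale_zero uw1) simp_all
  then have 2: "pr (map (\<lambda>s. s / q\<^sup>2) xs @ xs) ?y ?m = 0" by (simp add: pr_append w1_def)
  \<comment> \<open>The first two groups of factors, applied to \<open>u\<close>, leave a vector
    killed by \<open>?m\<close>, to which the last group of roots applies.\<close>
  define w2 where "w2 = pr (map (\<lambda>s. s / q\<^sup>2) xs @ xs) ?y u"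
  have uw2: "u * w2 = w2" unfolding w2_def by (rule pr_u) simp
  have "?m * w2 = 0" unfolding w2_def using pr_mult_left[OF m_y(1), of _ u] 2 u_right[OF um(1)] by simp
  then have "\<kappa> (inverse q) * (?m * w2) = 0" by simp
  then have "\<kappa> (inverse q) * \<kappa> (inverse q) * (?y * w2) = \<kappa> (inverse q) * \<kappa> q * (?x * w2)"
    by (simp add: left_diff_distrib right_diff_distrib mult.assoc)
  then have 3: "\<kappa> (inverse (q\<^sup>2)) * ?y * w2 = ?x * w2"
    using u_mult_left[OF uw2, of ?x] by (simp add: q0' k_inverse[OF q_0] mult.assoc)
  have "pr xs (\<kappa> (inverse (q\<^sup>2)) * ?y) w2 = pr xs ?x w2"
    by (rule pr_eigen[OF _ 3]) (simp add: k_left_commute[of ?x] mult.assoc xy)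
  then have "pr (map (\<lambda>s. s / inverse (q\<^sup>2)) xs) ?y w2 = 0"
    using xs0[OF uw2] q_0 by (intro pr_scale_zero uw2) simp_all
  then show ?thesis unfolding w2_def by (simp only: pr_append)
qed

lemma roots_exist:
  assumes S: "\<And>s. s \<in> S \<Longrightarrow> s / q\<^sup>2 \<in> S" "\<And>s. s \<in> S \<Longrightarrow> s / inverse (q\<^sup>2) \<in> S"
    and xs: "set xs \<subseteq> S" "pr xs (X 1) u = 0" and k: "k \<in> {1..n}"
  shows "\<exists>xs. set xs \<subseteq> S \<and> pr xs (X k) u = 0"
proof -
  have "1 \<le> k" "k \<le> n" using k by auto
  then show ?thesis
  proof (induction k rule: dec_induct)
    case base then show ?case using xs by blast
  next
    case (step a)
    then obtain ys where ys: "set ys \<subseteq> S" "pr ys (X a) u = 0" by auto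
    have "set (map (\<lambda>s. s / inverse (q\<^sup>2)) ys @ map (\<lambda>s. s / q\<^sup>2) ys @ ys) \<subseteq> S"
      using ys(1) S by auto
    moreover have "pr (map (\<lambda>s. s / inverse (q\<^sup>2)) ys @ map (\<lambda>s. s / q\<^sup>2) ys @ ys) (X (Suc a)) u = 0"
      using roots_step[of a ys] step.hyps step.prems ys by (simp add: Suc_eq_plus1 del: add_Suc_right)
    ultimately show ?case by blast
  qed
qed

end

lemma nil_transport: "t * x = y * t \<Longrightarrow> nil x v \<Longrightarrow> nil y (t * v)"
proof -
  assume t: "t * x = y * t" and "nil x v"
  have "((*) y ^^ N) (t * v) = t * ((*) x ^^ N) v" for N
    by (induction N) (simp_all add: mult.assoc[symmetric] t)
  then show ?thesis using \<open>nil x v\<close> unfolding nil_def by (metis mult_zero_right)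
qed

section \<open>Construction of \<psi> from g\<close>

context spectral
begin

lemma sum_e_mult: "\<alpha> \<subseteq> B \<Longrightarrow> i \<in> B \<Longrightarrow> (\<Sum>j\<in>\<alpha>. e j) * e i = (if i \<in> \<alpha> then e i else 0)"
  using finite_subset[OF _ fin_B, of \<alpha>]
  by (subst sum_distrib_right, subst sum.cong[OF refl, of _ _ "\<lambda>j. if j = i then e i else 0"])
    (auto simp: e_e)

lemma e_mult_sum: "\<alpha> \<subseteq> B \<Longrightarrow> i \<in> B \<Longrightarrow> e i * (\<Sum>j\<in>\<alpha>. e j) = (if i \<in> \<alpha> then e i else 0)"
  using finite_subset[OF _ fin_B, of \<alpha>]
  by (subst sum_distrib_left, subst sum.cong[OF refl, of _ _ "\<lambda>j. if j = i then e i else 0"])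
    (auto simp: e_e)

text \<open>It suffices to know where t sends each single eigenspace: \<open>swp a\<close> is
  injective on tuples, so all other blocks of t vanish.\<close>

lemma intertwines_e:
  assumes a: "a \<in> {1..<n}" and t: "u * t = t" "\<And>j. j \<in> B \<Longrightarrow> e (swp a j) * (t * e j) = t * e j"
    and i: "i \<in> B"
  shows "t * e i = e (swp a i) * t"
proof (rule eq_on_e)
  show "u * (t * e i) = t * e i" by (rule u_mult_right[OF t(1)])
  show "u * (e (swp a i) * t) = e (swp a i) * t" by (rule u_mult_left[OF t(1)])
  fix j assume j: "j \<in> B"
  show "t * e i * e j = e (swp a i) * t * e j"
  proof (cases "i = j")
    case True then show ?thesis using t(2)[OF i] e_idem[OF i] by (simp add: mult.assoc)
  next
    case False
    then have "swp a i \<noteq> swp a j" using swp_swp[OF a len] i j by metis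
    then have "e (swp a i) * e (swp a j) = 0" using swp_B[OF a] i j by (simp add: e_e)
    then have "e (swp a i) * (e (swp a j) * (t * e j)) = 0" by (metis mult.assoc mult_zero_left)
    then have "e (swp a i) * (t * e j) = 0" unfolding t(2)[OF j] .
    then show ?thesis using False i j by (simp add: mult.assoc e_e)
  qed
qed

text \<open>The cofactor of \<psi> a in the link relations on \<open>e i\<close>, up to sign. It is
  invertible there, with inverse \<open>LI\<close>.\<close>

definition LL :: "'k list \<Rightarrow> nat \<Rightarrow> 'a" where
  "LL i a = (if ix i a = ix i (a + 1) then \<kappa> (inverse (ix i a)) * nn a (a + 1)
     else NN (ix i a) (ix i (a + 1)) a (a + 1))"

lemma nn_inverse:
  assumes i: "i \<in> B" and kl: "k \<in> {1..n}" "l \<in> {1..n}" and ne: "ix i l \<noteq> q\<^sup>2 * ix i k"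
  shows "\<exists>D. nn k l * D = e i \<and> u * D = D
    \<and> (\<forall>t. t * X k = X k * t \<longrightarrow> t * X l = X l * t \<longrightarrow> t * e i = e i * t \<longrightarrow> t * D = D * t)"
proof -
  have "q * ix i k + (- inverse q) * ix i l \<noteq> 0"
    using q0 ne by (simp add: field_simps power2_eq_square)
  from lin_inverse[OF i kl this] show ?thesis by (simp add: nn_def k_minus)
qed

lemma LL_inverse:
  assumes i: "i \<in> B" and a: "a \<in> {1..<n}"
  shows "\<exists>D. LL i a * D = e i \<and> e i * D = D
    \<and> (\<forall>t. t * X a = X a * t \<longrightarrow> t * X (a + 1) = X (a + 1) * t \<longrightarrow> t * e i = e i * t \<longrightarrow> t * D = D * t)"
proof -
  let ?P = "\<lambda>D. \<forall>t. t * X a = X a * t \<longrightarrow> t * X (a + 1) = X (a + 1) * t \<longrightarrow> t * e i = e i * t \<longrightarrow> t * D = D * t"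
  have r: "a \<in> {1..n}" "a + 1 \<in> {1..n}" using a by auto
  have nz0: "ix i a \<noteq> 0" using nz i r by auto
  have Pk: "?P (\<kappa> c * D)" if "?P D" for c D
  proof (intro allI impI)
    fix t assume "t * X a = X a * t" "t * X (a + 1) = X (a + 1) * t" "t * e i = e i * t"
    then have "t * D = D * t" using that by blast
    then show "t * (\<kappa> c * D) = \<kappa> c * D * t" by (simp add: k_left_commute[of t] mult.assoc)
  qed
  have "\<exists>D. LL i a * D = e i \<and> u * D = D \<and> ?P D"
  proof (cases "ix i (a + 1) = q\<^sup>2 * ix i a")
    case True
    then have "LL i a = \<kappa> (q * ix i a)" using nz0 q2 by (simp add: LL_def NN_def)
    moreover have "\<kappa> (q * ix i a) * (\<kappa> (inverse (q * ix i a)) * e i) = e i"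
      using k_inverse'[of "q * ix i a"] nz0 q0 u_e[OF i] by (simp add: mult.assoc[symmetric])
    ultimately show ?thesis
      using Pk[of "e i"] u_mult_left[OF u_e[OF i]]
      by (intro exI[of _ "\<kappa> (inverse (q * ix i a)) * e i"]) auto
  next
    case False
    obtain D where D: "nn a (a + 1) * D = e i" "u * D = D" "?P D"
      using nn_inverse[OF i r False] by blast
    show ?thesis
    proof (cases "ix i a = ix i (a + 1)")
      case True
      have "\<kappa> (inverse (ix i a)) * nn a (a + 1) * (\<kappa> (ix i a) * D) = e i"
        using k_inverse[OF nz0] D(1) u_e[OF i]
        by (simp add: mult.assoc k_left_commute[of "nn a (a + 1)"]) (simp add: mult.assoc[symmetric])
      moreover have "?P (\<kappa> (ix i a) * D)" using D(3) by (rule Pk)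
      ultimately show ?thesis using True u_mult_left[OF D(2)]
        by (intro exI[of _ "\<kappa> (ix i a) * D"]) (simp add: LL_def)
    next
      case F: False
      then show ?thesis using D False by (intro exI[of _ D]) (simp add: LL_def NN_def)
    qed
  qed
  then obtain D where D: "LL i a * D = e i" "u * D = D" "?P D" by blast
  have "LL i a * e i = e i * LL i a"
    unfolding LL_def by (intro pc_e i) (auto intro!: pc_mult pc_k pc_nn pc_NN r)
  then have "LL i a * (e i * D) = e i" using D(1) e_idem[OF i] by (metis mult.assoc)
  moreover have "e i * (e i * D) = e i * D" using e_idem[OF i] by (metis mult.assoc)
  moreover have "?P (e i * D)"
  proof (intro allI impI)
    fix t assume t: "t * X a = X a * t" "t * X (a + 1) = X (a + 1) * t" "t * e i = e i * t"
    then have "t * D = D * t" using D(3) by blast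
    then show "t * (e i * D) = e i * D * t" using t(3) by (metis mult.assoc)
  qed
  ultimately show ?thesis by blast
qed

definition LI :: "'k list \<Rightarrow> nat \<Rightarrow> 'a" where
  "LI i a = (SOME D. LL i a * D = e i \<and> e i * D = D
    \<and> (\<forall>t. t * X a = X a * t \<longrightarrow> t * X (a + 1) = X (a + 1) * t \<longrightarrow> t * e i = e i * t \<longrightarrow> t * D = D * t))"

lemma LI:
  assumes i: "i \<in> B" and a: "a \<in> {1..<n}"
  shows "LL i a * LI i a = e i" "LI i a * LL i a = e i" "e i * LI i a = LI i a" "LI i a * e i = LI i a"
    "k \<in> {1..n} \<Longrightarrow> X k * LI i a = LI i a * X k"
proof -
  have r: "a \<in> {1..n}" "a + 1 \<in> {1..n}" using a by auto
  note D = someI_ex[OF LL_inverse[OF i a], folded LI_def]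
  show 1: "LL i a * LI i a = e i" "e i * LI i a = LI i a" using D by auto
  have com: "t * LI i a = LI i a * t" if "t * X a = X a * t" "t * X (a + 1) = X (a + 1) * t" "t * e i = e i * t" for t
    using D that by blast
  have pcL: "pc {1..n} (LL i a)"
    unfolding LL_def by (auto intro!: pc_mult pc_k pc_nn pc_NN r)
  show "LI i a * LL i a = e i" using com[of "LL i a"] pc_pc[OF pcL pc_X] pc_e[OF pcL i] r 1(1) by simp
  show "LI i a * e i = LI i a" using com[of "e i"] X_e[OF _ i] r 1(2) by metis
  show "X k * LI i a = LI i a * X k" if "k \<in> {1..n}"
    by (rule com) (use that r X_X X_e[OF _ i] in auto)
qed

end

locale hecke_spectral = hecke \<kappa> q n X g + spectral \<kappa> q n B e X
  for \<kappa> :: "'k::field \<Rightarrow> 'a::ring" and q n B e X g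
begin

lemma u_ph: "a \<in> {1..<n} \<Longrightarrow> u * ph a = ph a"
  using u_g' by (simp add: ph_def distrib_left mult.assoc[symmetric])

lemma ph_e: assumes a: "a \<in> {1..<n}" and i: "i \<in> B" shows "ph a * e i = e (swp a i) * ph a"
proof (rule intertwines_e[OF a u_ph[OF a] _ i])
  fix j assume j: "j \<in> B"
  show "e (swp a j) * (ph a * e j) = ph a * e j"
  proof (rule in_eigenspace(1)[OF swp_B[OF a j]])
    show "u * (ph a * e j) = ph a * e j" by (rule u_mult_left[OF u_e[OF j]])
    fix k assume k: "k \<in> {1..n}"
    have k': "sb a k \<in> {1..n}" by (rule sb_range[OF a k])
    have "ph a * (X (sb a k) - \<kappa> (ix j (sb a k))) = (X k - \<kappa> (ix j (sb a k))) * ph a"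
      using ph_X[OF a k'] by (simp add: left_diff_distrib right_diff_distrib k_central[of "ph a"])
    then show "nil (X k - \<kappa> (ix (swp a j) k)) (ph a * e j)"
      unfolding ix_swp[OF a len[OF j] k] using nil_X[OF j k'] by (rule nil_transport)
  qed
qed

text \<open>For distinct labels phi leads to \<open>swp a i\<close> and the factor X a - X (a + 1)
  can be cancelled. For equal labels that factor is nilpotent instead. The block T then intertwines
  X k with X (sb a k) and is annihilated by X a - X (a + 1), so it commutes with every X k and stays
  in the eigenspace of \<open>i\<close>.\<close>

lemma g_off:
  assumes a: "a \<in> {1..<n}" and i: "i \<in> B" and j: "j \<in> B" "j \<noteq> i" "j \<noteq> swp a i"
  shows "e j * (g a * e i) = 0"
proof -
  have r: "a \<in> {1..n}" "a + 1 \<in> {1..n}" using a by auto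
  have eX: "e j * (X k * e i) = 0" if "k \<in> {1..n}" for k
    using that i j X_e[OF that i] e_e[OF j(1) i] by (metis mult.assoc mult_zero_left)
  have "e j * (ph a * e i) = e j * e (swp a i) * ph a" by (simp add: ph_e[OF a i] mult.assoc)
  also have "\<dots> = 0" using j swp_B[OF a i] by (simp add: e_e)
  finally have z: "e j * (g a * ((X a - X (a + 1)) * e i)) = 0"
    using eX[OF r(2)] by (simp add: ph_def distrib_right distrib_left mult.assoc k_left_commute[of "e j"])
  show ?thesis
  proof (cases "ix i a = ix i (a + 1)")
    case False
    then have "e j * g a * e i = 0"
      using reg_eq_0[OF reg_diff[OF i r False], of "e j * g a"] z by (simp add: mult.assoc)
    then show ?thesis by (simp add: mult.assoc)
  next
    case True
    define T where "T = e j * (g a * e i)"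
    have eT: "e j * T = T" "T * e i = T"
      unfolding T_def using e_idem[OF j(1)] e_idem[OF i] by (metis mult.assoc)+
    have swap: "X (sb a k) * T = T * X k" if k: "k \<in> {1..n}" for k
    proof -
      have TX: "T * X k = e j * (g a * X k) * e i"
        using X_e[OF k i] by (simp add: T_def mult.assoc)
      have XT: "X l * T = e j * (X l * g a) * e i" if "l \<in> {1..n}" for l
        using X_e[OF that j(1)] by (simp add: T_def mult.assoc[symmetric])
      consider "k = a" | "k = a + 1" | "k \<noteq> a" "k \<noteq> a + 1" by blast
      then show ?thesis
      proof cases
        case 1
        then show ?thesis unfolding TX using gX1[OF a] eX[OF r(2)] XT[OF r(2)]
          by (simp add: sb_def right_diff_distrib left_diff_distrib mult.assoc k_left_commute[of "e j"])
      next
        case 2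
        then show ?thesis unfolding TX using gX2[OF a] eX[OF r(2)] XT[OF r(1)]
          by (simp add: sb_def distrib_left distrib_right mult.assoc k_left_commute[of "e j"])
      next
        case 3
        then show ?thesis unfolding TX using g_X'[OF a k 3] XT[OF k] by (simp add: sb_def)
      qed
    qed
    have "T * (X a - X (a + 1)) = 0"
    proof -
      have "(X a - X (a + 1)) * e i = e i * (X a - X (a + 1))"
        by (intro pc_e pc_diff pc_X r i)
      then show ?thesis using z by (simp add: T_def mult.assoc)
    qed
    then have "T * X a = T * X (a + 1)" by (simp add: right_diff_distrib)
    then have com: "T * X k = X k * T" if "k \<in> {1..n}" for k
      using swap[OF r(1)] swap[OF r(2)] swap[OF that] by (auto simp: sb_def split: if_splits)
    have "nil (X k - \<kappa> (ix i k)) T" if k: "k \<in> {1..n}" for k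
    proof -
      have "nil (X k - \<kappa> (ix i k)) (T * e i)"
        by (rule nil_mult_left[OF nil_X[OF i k]])
          (use com[OF k] in \<open>simp add: left_diff_distrib right_diff_distrib k_central[of T]\<close>)
      then show ?thesis by (simp add: eT)
    qed
    moreover have "u * T = T" unfolding T_def by (intro u_mult_left u_e i)
    ultimately have "e j * T = 0" using in_eigenspace(2)[OF i _ _ j(1,2)] by blast
    then show ?thesis using eT(1) by (simp add: T_def)
  qed
qed

lemma g_e_eq:
  assumes a: "a \<in> {1..<n}" and i: "i \<in> B" and eq: "ix i a = ix i (a + 1)"
  shows "e i * (g a * e i) = g a * e i"
proof (rule eq_on_e_left[symmetric])
  show "u * (g a * e i) = g a * e i" "u * (e i * (g a * e i)) = e i * (g a * e i)"
    by (intro u_mult_left u_e i)+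
  fix j assume j: "j \<in> B"
  show "e j * (g a * e i) = e j * (e i * (g a * e i))"
    using g_off[OF a i j] swp_same[OF a len[OF i] eq] e_e[OF j i]
    by (cases "j = i") (auto simp: mult.assoc[symmetric])
qed

text \<open>Nonzero blocks of g a lead from \<open>i\<close> only to \<open>i\<close> or
  \<open>swp a i\<close>, and \<open>\<alpha>\<close> contains both or neither of them.\<close>

lemma sum_e_central:
  assumes \<alpha>: "\<alpha> \<subseteq> B" "\<And>a i. a \<in> {1..<n} \<Longrightarrow> i \<in> \<alpha> \<Longrightarrow> swp a i \<in> \<alpha>"
  shows "a \<in> {1..<n} \<Longrightarrow> (\<Sum>i\<in>\<alpha>. e i) * g a = g a * (\<Sum>i\<in>\<alpha>. e i)"
    and "k \<in> {1..n} \<Longrightarrow> (\<Sum>i\<in>\<alpha>. e i) * X k = X k * (\<Sum>i\<in>\<alpha>. e i)"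
proof -
  let ?E = "\<Sum>i\<in>\<alpha>. e i"
  show "?E * X k = X k * ?E" if "k \<in> {1..n}"
    using X_e[OF that] \<alpha>(1) by (auto simp: sum_distrib_left sum_distrib_right intro!: sum.cong)
  assume a: "a \<in> {1..<n}"
  have uE: "u * ?E = ?E" using u_e \<alpha>(1) by (auto simp: sum_distrib_left intro!: sum.cong)
  show "?E * g a = g a * ?E"
  proof (rule eq_on_e)
    show "u * (?E * g a) = ?E * g a" "u * (g a * ?E) = g a * ?E"
      using u_mult_right[OF uE] u_mult_left[OF uE] by auto
    fix i assume i: "i \<in> B"
    show "?E * g a * e i = g a * ?E * e i"
    proof (rule eq_on_e_left)
      show "u * (?E * g a * e i) = ?E * g a * e i" "u * (g a * ?E * e i) = g a * ?E * e i"
        by (intro u_mult_left u_e i)+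
      fix j assume j: "j \<in> B"
      have "e j * (g a * e i) = 0" if "(j \<in> \<alpha>) \<noteq> (i \<in> \<alpha>)"
      proof (rule g_off[OF a i j])
        show "j \<noteq> i" using that by auto
        show "j \<noteq> swp a i" using that \<alpha>(2)[OF a] swp_swp[OF a len[OF i]] by metis
      qed
      moreover have "e j * (?E * g a * e i) = (if j \<in> \<alpha> then e j * (g a * e i) else 0)"
        using e_mult_sum[OF \<alpha>(1) j] by (simp add: mult.assoc[symmetric])
      moreover have "e j * (g a * ?E * e i) = (if i \<in> \<alpha> then e j * (g a * e i) else 0)"
        using sum_e_mult[OF \<alpha>(1) i] by (simp add: mult.assoc)
      ultimately show "e j * (?E * g a * e i) = e j * (g a * ?E * e i)" by auto
    qed
  qed
qed

text \<open>The value that the link relations prescribe for \<psi> a times \<open>LL i a\<close> on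
  \<open>e i\<close>; dividing by \<open>LL\<close> defines \<psi>.\<close>

definition GG :: "'k list \<Rightarrow> nat \<Rightarrow> 'a" where
  "GG i a = (if ix i a = ix i (a + 1) then \<kappa> q - g a else ph a)"

definition psi :: "nat \<Rightarrow> 'a" where
  "psi a = (\<Sum>i\<in>B. GG i a * LI i a)"

lemma psi_at: assumes "a \<in> {1..<n}" "i \<in> B" shows "psi a * e i = GG i a * LI i a"
  unfolding psi_def by (rule sum_at[OF _ assms(2)]) (simp add: mult.assoc LI(4)[OF _ assms(1)])

lemma GG_vec: assumes a: "a \<in> {1..<n}" "i \<in> B" and v: "e i * v = v"
  shows "e (swp a i) * (GG i a * v) = GG i a * v"
proof (cases "ix i a = ix i (a + 1)")
  case True
  have "e i * (g a * e i) * v = g a * e i * v" using g_e_eq[OF a True] by simp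
  then show ?thesis using True swp_same[OF a(1) len[OF a(2)] True] vec_k[OF v]
    by (simp add: GG_def left_diff_distrib right_diff_distrib mult.assoc v)
next
  case False
  have "e (swp a i) * (ph a * v) = ph a * e i * v" unfolding ph_e[OF a] by (simp add: mult.assoc)
  then show ?thesis using False by (simp add: GG_def mult.assoc v)
qed

lemma LL_eq: "i \<in> B \<Longrightarrow> a \<in> {1..<n} \<Longrightarrow> ix i a = ix i (a + 1) \<Longrightarrow> nn a (a + 1) * LI i a = \<kappa> (ix i a) * e i"
proof -
  assume i: "i \<in> B" and a: "a \<in> {1..<n}" and eq: "ix i a = ix i (a + 1)"
  have r: "a \<in> {1..n}" "a + 1 \<in> {1..n}" using a by auto
  have "\<kappa> (ix i a) * LL i a = nn a (a + 1)"
    using eq k_inverse'[OF nz[OF i r(1)]] u_nn[OF r] by (simp add: LL_def mult.assoc[symmetric])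
  then show ?thesis using LI(1)[OF i a] by (metis mult.assoc)
qed

lemma hecke_klr: "hecke_klr \<kappa> q n B e X g psi"
proof unfold_locales
  fix a assume a: "a \<in> {1..<n}"
  have r: "a \<in> {1..n}" "a + 1 \<in> {1..n}" using a by auto
  show "\<kappa> 1 * g a = g a" by (rule u_g'[OF a])
  show up: "\<kappa> 1 * psi a = psi a"
    unfolding psi_def sum_distrib_left
  proof (rule sum.cong[OF refl])
    fix i assume i: "i \<in> B"
    have "u * LI i a = LI i a" by (rule e_vec_u[OF i LI(3)[OF i a]])
    then show "u * (GG i a * LI i a) = GG i a * LI i a" by (rule u_mult_left)
  qed
  show "g a * X a = X (a + 1) * g a - \<kappa> (q - inverse q) * X (a + 1)" by (rule gX1[OF a])
  show "g a * X (a + 1) = X a * g a + \<kappa> (q - inverse q) * X (a + 1)" by (rule gX2[OF a])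
  show "g a * X k = X k * g a" if "k \<in> {1..n}" "k \<noteq> a" "k \<noteq> a + 1" for k using g_X' a that by blast
  show "psi a * X k = X k * psi a" if k: "k \<in> {1..n}" "k \<noteq> a" "k \<noteq> a + 1" for k
  proof (rule eq_on_e)
    show "u * (psi a * X k) = psi a * X k" by (rule u_mult_right[OF up])
    show "u * (X k * psi a) = X k * psi a" by (rule u_mult_left[OF up])
    fix i assume i: "i \<in> B"
    have "GG i a * X k = X k * GG i a"
      using g_X'[OF a k] ph_X[OF a k(1)] k
      by (simp add: GG_def sb_def left_diff_distrib right_diff_distrib k_central[of "X k"])
    then have "GG i a * LI i a * X k = X k * (GG i a * LI i a)"
      using LI(5)[OF i a k(1)] by (metis mult.assoc)
    then show "psi a * X k * e i = X k * psi a * e i"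
      using psi_at[OF a i] X_e[OF k(1) i] by (metis mult.assoc)
  qed
  fix i assume i: "i \<in> B"
  show "psi a * e i = e (swp a i) * psi a"
  proof (rule intertwines_e[OF a up _ i])
    fix j assume j: "j \<in> B"
    show "e (swp a j) * (psi a * e j) = psi a * e j"
      unfolding psi_at[OF a j] by (rule GG_vec[OF a j LI(3)[OF j a]])
  qed
  have psiX: "psi a * (X k * e i) = GG i a * X k * LI i a" if "k \<in> {1..n}" for k
    using psi_at[OF a i] X_e[OF that i] LI(5)[OF i a that] by (metis mult.assoc)
  note gx = gX1[OF a] gX2[OF a] ph_X[OF a r(1)] ph_X[OF a r(2)]
  define D where "D = LI i a"
  define y where "y = X (a + 1)"
  note gx' = gx[folded y_def, unfolded sb_def, simplified, folded y_def]
  \<comment> \<open>At equal labels the z-term of the Hecke relation combines with q into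
    \<open>nn\<close>, and \<open>LI\<close> turns \<open>nn\<close> into the label: this is the
    nil-Hecke correction.\<close>
  have nD: "ix i a = ix i (a + 1) \<Longrightarrow> \<kappa> q * (X a * D) - \<kappa> (inverse q) * (y * D) = \<kappa> (ix i a) * e i"
    using LL_eq[OF i a] by (simp add: nn_def D_def y_def left_diff_distrib mult.assoc)
  have nD': "ix i a = ix i (a + 1) \<Longrightarrow> \<kappa> (inverse q) * (y * D) = \<kappa> q * (X a * D) - \<kappa> (ix i a) * e i"
    using nD by (simp add: algebra_simps)
  show "psi a * (X a * e i) = X (a + 1) * (psi a * e i) + (if ix i a = ix i (a + 1) then \<kappa> (ix i a) * e i else 0)"
    unfolding psi_at[OF a i] psiX[OF r(1)] D_def[symmetric] y_def[symmetric]
    using gx' nD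
    by (auto simp: GG_def left_diff_distrib right_diff_distrib k_diff mult.assoc k_left_commute[of y] mult.assoc[of "g a" "X a" D, symmetric]
        mult.assoc[of "ph a" "X a" D, symmetric] simp flip: nD)
  show "psi a * (X (a + 1) * e i) = X a * (psi a * e i) - (if ix i a = ix i (a + 1) then \<kappa> (ix i a) * e i else 0)"
    unfolding psi_at[OF a i] psiX[OF r(2), folded y_def] D_def[symmetric] y_def[symmetric]
    using gx' nD'
    by (auto simp: GG_def left_diff_distrib right_diff_distrib distrib_right k_diff mult.assoc k_left_commute[of "X a"]
        mult.assoc[of "g a" y D, symmetric] mult.assoc[of "ph a" y D, symmetric])
  have pcL: "pc {1..n} (LL i a)"
    unfolding LL_def by (auto intro!: pc_mult pc_k pc_nn pc_NN r)
  have psiL: "psi a * (LL i a * e i) = GG i a * e i"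
    using psi_at[OF a i] pc_e[OF pcL i] LI(2)[OF i a] by (metis mult.assoc)
  show "g a * e i = \<kappa> q * e i - psi a * (\<kappa> (inverse (ix i a)) * nn a (a + 1) * e i)"
    if "ix i a = ix i (a + 1)"
    using psiL that by (simp add: LL_def GG_def left_diff_distrib)
  show "(g a * (X a - X (a + 1)) + \<kappa> (q - inverse q) * X (a + 1)) * e i
      = psi a * (NN (ix i a) (ix i (a + 1)) a (a + 1) * e i)" if "ix i a \<noteq> ix i (a + 1)"
    using psiL that by (simp add: LL_def GG_def ph_def)
qed

end

section \<open>Restriction to a block\<close>

lemma lpow_mult_central:
  assumes "\<And>a. a * c = c * a" "c * v = v"
  shows "((*) (x * c) ^^ N) v = ((*) x ^^ N) (v::'a::ring)"
proof (induction N)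
  case (Suc N)
  have "c * ((*) x ^^ N) v = ((*) x ^^ N) v"
    using lpow_mult_left[of c x N v] assms(1)[of x] assms(2) by simp
  then show ?case using Suc by (simp add: mult.assoc)
qed simp

lemma nil_mult_central:
  assumes "\<And>a. a * c = c * a" "c * v = v" "nil x v"
  shows "nil (x * c) v"
  using assms(3) unfolding nil_def lpow_mult_central[OF assms(1,2)] .

text \<open>Multiplying by the central idempotent \<open>c\<close> replaces the unit by
  \<open>u * c\<close>, which equals \<open>c\<close>. Because scalars need not be unital, the block
  is an instance of the same locale on the same ring type.\<close>

lemma (in hecke_spectral) restrict:
  assumes \<alpha>: "\<alpha> \<subseteq> B" "\<And>a i. a \<in> {1..<n} \<Longrightarrow> i \<in> \<alpha> \<Longrightarrow> swp a i \<in> \<alpha>"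
    and c: "\<And>x. x * c = c * x" and c_def: "c = (\<Sum>i\<in>\<alpha>. e i)"
  shows "hecke_spectral (\<lambda>a. \<kappa> a * c) q n \<alpha> e (\<lambda>k. X k * c) (\<lambda>a. g a * c)"
proof -
  have fin: "finite \<alpha>" using finite_subset[OF \<alpha>(1) fin_B] .
  have ce: "c * e i = e i" "e i * c = e i" if "i \<in> \<alpha>" for i
    using sum_e_mult[OF \<alpha>(1), of i] that \<alpha>(1) c[of "e i"] by (auto simp: c_def)
  have cc: "c * c = c" by (subst (2) c_def) (simp add: sum_distrib_left ce c_def cong: sum.cong, simp add: c_def[symmetric] ce cong: sum.cong)
  have uc: "u * c = c" unfolding c_def sum_distrib_left using u_e \<alpha>(1) by (intro sum.cong) auto
  have cx: "c * (x * y) = x * (c * y)" for x y by (metis c mult.assoc)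
  have m: "x * c * (y * c) = x * y * c" for x y by (metis c cc mult.assoc)
  show ?thesis
  proof unfold_locales
    show "\<kappa> (a + b) * c = \<kappa> a * c + \<kappa> b * c" for a b by (simp add: k_add distrib_right)
    show "\<kappa> (a * b) * c = \<kappa> a * c * (\<kappa> b * c)" for a b by (simp add: k_mult m)
    show "x * (\<kappa> a * c) = \<kappa> a * c * x" for x a
      by (metis k_left_commute mult.assoc c)
    show "q \<noteq> 0" "q\<^sup>2 \<noteq> 1" by (fact q0 q2)+
    show "finite \<alpha>" by fact
    show uX: "u * c * (X k * c) = X k * c" if "k \<in> {1..n}" for k using u_X[OF that] by (simp add: m)
    show XX: "X k * c * (X l * c) = X l * c * (X k * c)" if "k \<in> {1..n}" "l \<in> {1..n}" for k l
      using X_X[OF that] by (simp add: m)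
    show "length i = n" if "i \<in> \<alpha>" for i using that \<alpha>(1) len by auto
    show "ix i k \<noteq> 0" if "i \<in> \<alpha>" "k \<in> {1..n}" for i k using that \<alpha>(1) nz by auto
    show "e i * e j = (if i = j then e i else 0)" if "i \<in> \<alpha>" "j \<in> \<alpha>" for i j
      by (rule e_e) (use that \<alpha>(1) in auto)
    show "sum e \<alpha> = u * c" using uc by (simp add: c_def)
    show "swp a i \<in> \<alpha>" if "a \<in> {1..<n}" "i \<in> \<alpha>" for a i using that \<alpha>(2) by blast
    show "X k * c * e i = e i * (X k * c)" if "k \<in> {1..n}" "i \<in> \<alpha>" for k i
      using X_e[OF that(1), of i] that(2) \<alpha>(1) ce[OF that(2)] by (metis mult.assoc subsetD c)
    show "nil (X k * c - \<kappa> (ix i k) * c) (e i)" if "i \<in> \<alpha>" "k \<in> {1..n}" for i k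
      using nil_mult_central[OF c ce(1)[OF that(1)] nil_X[of i k]] that \<alpha>(1) by (auto simp: left_diff_distrib)
    show "u * c * (g a * c) = g a * c" if "a \<in> {1..<n}" for a using u_g'[OF that] by (simp add: m)
    show "g a * c * (g a * c) = \<kappa> (q - inverse q) * c * (g a * c) + u * c" if "a \<in> {1..<n}" for a
      using g_quad[OF that] by (simp add: m distrib_right)
    show "g a * c * (X a * c) * (g a * c) = X (a + 1) * c" if "a \<in> {1..<n}" for a
      using g_X_g[OF that] by (simp add: m)
    show "g a * c * (X k * c) = X k * c * (g a * c)" if "a \<in> {1..<n}" "k \<in> {1..n}" "k \<noteq> a" "k \<noteq> a + 1" for a k
      using g_X'[OF that] by (simp add: m)
    show "g a * c * (g b * c) = g b * c * (g a * c)" if "a \<in> {1..<n}" "b \<in> {1..<n}" "a + 1 < b \<or> b + 1 < a" for a b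
      using g_g_far[OF that] by (simp add: m)
    show "g a * c * (g (a + 1) * c) * (g a * c) = g (a + 1) * c * (g a * c) * (g (a + 1) * c)"
      if "a \<in> {1..<n}" "a + 1 \<in> {1..<n}" for a
      using g_g_braid[OF that] by (simp add: m)
  qed
qed

section \<open>The KLR side\<close>

text \<open>The right-hand side \<open>psisq\<close> read in an arbitrary ring instead of the free
  algebra; \<open>klr_braid\<close> does the same for \<open>braidrhs\<close>.\<close>

definition klr_sq :: "'k::field \<Rightarrow> (nat \<Rightarrow> 'a::ring) \<Rightarrow> ('k list \<Rightarrow> 'a) \<Rightarrow> 'k list \<Rightarrow> nat \<Rightarrow> 'a" where
  "klr_sq q y e i b = (let a = ix i b; c = ix i (b+1) in
     if a = c then 0
     else if nconn q a c then e i
     else if arr_to q a c then (y (b+1) - y b) * e i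
     else if arr_from q a c then (y b - y (b+1)) * e i
     else if arr_both q a c then (y (b+1) - y b) * (y b - y (b+1)) * e i
     else 0)"

definition klr_braid :: "'k::field \<Rightarrow> (nat \<Rightarrow> 'a::ring) \<Rightarrow> ('k list \<Rightarrow> 'a) \<Rightarrow> 'k list \<Rightarrow> nat \<Rightarrow> 'a" where
  "klr_braid q y e i b = (let a = ix i b; c = ix i (b+1); d = ix i (b+2) in
     if a = d \<and> arr_to q a c then e i
     else if a = d \<and> arr_from q a c then - e i
     else if a = d \<and> arr_both q a c then (y (b+2) - y (b+1) - y (b+1) + y b) * e i
     else 0)"

text \<open>Moves the negative power of q to the other side, so that all arrow conditions become
  combinations of the same two equations.\<close>

lemma arr_iff:
  assumes "q \<noteq> 0"
  shows "arr_to q a c \<longleftrightarrow> c = q\<^sup>2 * a \<and> a \<noteq> q\<^sup>2 * c"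
    and "arr_from q a c \<longleftrightarrow> a = q\<^sup>2 * c \<and> c \<noteq> q\<^sup>2 * a"
    and "arr_both q a c \<longleftrightarrow> c = q\<^sup>2 * a \<and> a = q\<^sup>2 * c"
    and "nconn q a c \<longleftrightarrow> a \<noteq> c \<and> c \<noteq> q\<^sup>2 * a \<and> a \<noteq> q\<^sup>2 * c"
proof -
  have "q powi (- 2) = inverse (q\<^sup>2)" by (simp add: power_int_minus)
  then have "c = q powi (- 2) * a \<longleftrightarrow> a = q\<^sup>2 * c" using assms by (auto simp: field_simps)
  then show "arr_to q a c \<longleftrightarrow> c = q\<^sup>2 * a \<and> a \<noteq> q\<^sup>2 * c"
    "arr_from q a c \<longleftrightarrow> a = q\<^sup>2 * c \<and> c \<noteq> q\<^sup>2 * a"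
    "arr_both q a c \<longleftrightarrow> c = q\<^sup>2 * a \<and> a = q\<^sup>2 * c"
    "nconn q a c \<longleftrightarrow> a \<noteq> c \<and> c \<noteq> q\<^sup>2 * a \<and> a \<noteq> q\<^sup>2 * c"
    unfolding arr_to_def arr_from_def arr_both_def nconn_def by auto
qed

context spectral
begin

lemma pc_swap: "pc {1..n} f \<Longrightarrow> pc {1..n} g \<Longrightarrow> f * (g * v) = g * (f * v)"
  by (simp only: mult.assoc[symmetric] pc_pc[of f g])

context
  fixes y :: "nat \<Rightarrow> 'a"
  assumes X_y: "\<And>i k. i \<in> B \<Longrightarrow> k \<in> {1..n} \<Longrightarrow> X k * e i = \<kappa> (ix i k) * (e i - y k * e i)"
begin

lemma y_X: "i \<in> B \<Longrightarrow> k \<in> {1..n} \<Longrightarrow> y k * e i = e i - \<kappa> (inverse (ix i k)) * (X k * e i)"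
proof -
  assume i: "i \<in> B" and k: "k \<in> {1..n}"
  have "\<kappa> (inverse (ix i k)) * (X k * e i) = u * (e i - y k * e i)"
    unfolding X_y[OF i k] by (simp add: mult.assoc[symmetric] k_inverse nz[OF i k])
  also have "u * (e i - y k * e i) = u * e i - y k * (u * e i)"
    by (simp add: right_diff_distrib k_left_commute[of "y k"])
  finally show ?thesis by (simp add: u_e[OF i])
qed

text \<open>On \<open>e i\<close>, y l - y k is X k / i_k - X l / i_l, and i_l = q^2 i_k turns this
  into \<open>nn k l\<close> divided by q i_k. This is the origin of the constant in
  \<open>NN\<close> and \<open>cc\<close>.\<close>

lemma y_diff_cc:
  assumes i: "i \<in> B" and k: "k \<in> {1..n}" and l: "l \<in> {1..n}" and eq: "ix i l = q\<^sup>2 * ix i k"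
  shows "(y l - y k) * e i = cc (ix i k) (ix i l) k l * e i"
proof -
  have "inverse (q * ix i k) * q = inverse (ix i k)" "inverse (q * ix i k) * inverse q = inverse (ix i l)"
    using q0 nz[OF i k] eq by (simp_all add: field_simps power2_eq_square)
  then have "\<kappa> (inverse (q * ix i k)) * \<kappa> q = \<kappa> (inverse (ix i k))"
    "\<kappa> (inverse (q * ix i k)) * \<kappa> (inverse q) = \<kappa> (inverse (ix i l))"
    by (simp_all only: k_mult[symmetric])
  then have "cc (ix i k) (ix i l) k l * e i
      = \<kappa> (inverse (ix i k)) * (X k * e i) - \<kappa> (inverse (ix i l)) * (X l * e i)"
    using eq by (simp add: cc_def nn_def right_diff_distrib left_diff_distrib mult.assoc[symmetric])
  then show ?thesis using y_X[OF i k] y_X[OF i l] by (simp add: left_diff_distrib)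
qed

text \<open>Each arrow contributes one factor \<open>cc\<close>, and for an absent arrow
  \<open>cc\<close> is \<open>u\<close>; one product thus covers no arrow, single arrows and the
  double arrow.\<close>

lemma klr_sq_eq:
  assumes i: "i \<in> B" and b: "b \<in> {1..<n}"
  shows "klr_sq q y e i b = (if ix i b = ix i (b + 1) then 0
     else cc (ix i b) (ix i (b + 1)) b (b + 1) * cc (ix i (b + 1)) (ix i b) (b + 1) b * e i)"
proof -
  let ?s = "ix i b" and ?t = "ix i (b + 1)"
  have r: "b \<in> {1..n}" "b + 1 \<in> {1..n}" using b by auto
  define P where "P \<longleftrightarrow> ?t = q\<^sup>2 * ?s"
  define Q where "Q \<longleftrightarrow> ?s = q\<^sup>2 * ?t"
  note arr = arr_iff[OF q0, of ?s ?t, folded P_def Q_def]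
  have PQ: "\<not> P" "\<not> Q" if "?s = ?t"
    unfolding P_def Q_def using that q2 nz[OF i r(1)] nz[OF i r(2)] by auto
  let ?c = "cc ?s ?t b (b + 1)" and ?c' = "cc ?t ?s (b + 1) b"
  have yd: "P \<Longrightarrow> (y (b + 1) - y b) * e i = ?c * e i" "Q \<Longrightarrow> (y b - y (b + 1)) * e i = ?c' * e i"
    unfolding P_def Q_def using y_diff_cc[OF i r] y_diff_cc[OF i r(2,1)] by blast+
  have c: "\<not> P \<Longrightarrow> ?c = u" "\<not> Q \<Longrightarrow> ?c' = u" by (simp_all add: cc_def P_def Q_def)
  have uu: "u * ?c' * e i = ?c' * e i" "?c * u * e i = ?c * e i" "u * u * e i = e i"
    by (simp_all add: mult.assoc u_mult_left[OF u_e[OF i]] u_e[OF i])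
  have e': "?c' * e i = e i * ?c'" by (intro pc_e pc_cc r i)
  have both: "(y (b + 1) - y b) * (y b - y (b + 1)) * e i = ?c * ?c' * e i" if "P" "Q"
  proof -
    have "(y (b + 1) - y b) * ((y b - y (b + 1)) * e i) = (y (b + 1) - y b) * e i * ?c'"
      unfolding yd(2)[OF that(2)] e' by (simp add: mult.assoc)
    also have "\<dots> = ?c * ?c' * e i" unfolding yd(1)[OF that(1)] by (simp add: mult.assoc e')
    finally show ?thesis by (simp add: mult.assoc)
  qed
  show ?thesis
    unfolding klr_sq_def Let_def arr
    using PQ yd c uu both by (cases "?s = ?t"; cases P; cases Q) (simp_all only: simp_thms if_True if_False)
qed

end

end

context hecke_klr
begin

lemma klr_sq_psi_sq:
  assumes "\<And>i k. i \<in> B \<Longrightarrow> k \<in> {1..n} \<Longrightarrow> X k * e i = \<kappa> (ix i k) * (e i - y k * e i)"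
    and "i \<in> B" "b \<in> {1..<n}"
  shows "klr_sq q y e i b = psi_sq i b"
  using klr_sq_eq[OF assms] by (simp add: psi_sq_def)

text \<open>Only the double arrow needs a calculation: there q^2 = -1, the middle label is minus the
  outer one, and the constants 1 - 2 + 1 in the combination of the y cancel.\<close>

lemma klr_braid_psi_braid:
  assumes X_y: "\<And>i k. i \<in> B \<Longrightarrow> k \<in> {1..n} \<Longrightarrow> X k * e i = \<kappa> (ix i k) * (e i - y k * e i)"
    and i: "i \<in> B" and b: "b \<in> {1..<n}" "b + 1 \<in> {1..<n}"
  shows "klr_braid q y e i b = psi_braid i b * e i"
proof -
  let ?p = "ix i b" and ?s = "ix i (b + 1)"
  have r: "b \<in> {1..n}" "b + 1 \<in> {1..n}" "b + 2 \<in> {1..n}" using b by auto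
  have p0: "?p \<noteq> 0" and s0: "?s \<noteq> 0" using nz[OF i] r by auto
  note Y = y_X[OF X_y i r(1)] y_X[OF X_y i r(2)] y_X[OF X_y i r(3)]
  define c where "c = b + 2"
  note Y = Y[folded c_def]
  have both: "(y c - y (b+1) - y (b+1) + y b) * e i
      = - \<kappa> (inverse ?p) * (X b + X (b + 1) + X (b + 1) + X c) * e i"
    if 1: "?s = q\<^sup>2 * ?p" and 2: "?p = q\<^sup>2 * ?s" and 3: "?p = ix i c"
  proof -
    have "?p = q\<^sup>2 * (q\<^sup>2 * ?p)" using 1 2 by metis
    then have "(q\<^sup>2 - 1) * (q\<^sup>2 + 1) = 0" using p0 by (simp add: algebra_simps)
    then have qq: "q\<^sup>2 = - 1" using q2 by (auto simp: eq_neg_iff_add_eq_0)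
    then have "\<kappa> (inverse ?s) = - \<kappa> (inverse ?p)" using 1 by (simp add: k_minus)
    then have Y': "y (b + 1) * e i = e i + \<kappa> (inverse ?p) * (X (b + 1) * e i)"
      using Y(2) by (simp add: minus_mult_left[symmetric])
    have Yc: "y c * e i = e i - \<kappa> (inverse ?p) * (X c * e i)" using Y(3) 3 by simp
    show ?thesis
      by (simp only: distrib_right left_diff_distrib Y(1) Yc Y' mult.assoc distrib_left minus_mult_left[symmetric])
        simp
  qed
  define P where "P \<longleftrightarrow> ?s = q\<^sup>2 * ?p"
  define Q where "Q \<longleftrightarrow> ?p = q\<^sup>2 * ?s"
  note arr = arr_iff[OF q0, of ?p ?s, folded P_def Q_def]
  note both = both[folded P_def Q_def]
  have u: "u * e i = e i" "- u * e i = - e i" using u_e[OF i] by (simp_all add: minus_mult_left[symmetric])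
  show ?thesis
    unfolding klr_braid_def psi_braid_def Let_def arr c_def[symmetric] P_def[symmetric] Q_def[symmetric]
    using both u by (cases "?p = ix i c"; cases P; cases Q) (simp_all only: simp_thms if_True if_False mult_zero_left)
qed

end

text \<open>The element \<open>y - x\<close> is nilpotent on \<open>(y - x) * w\<close>, hence on
  \<open>w\<close>, and y = x + (y - x). It removes an arrow factor from the square of \<psi> when
  nilpotency is passed along the strands.\<close>

lemma nil_cancel_diff:
  assumes "x * y = y * x" "nil y ((y - x) * w)" "nil x w"
  shows "nil y w"
proof -
  have "nil x ((y - x) * w)" using assms(1,3) by (intro nil_mult_left) (simp_all add: algebra_simps)
  then have "nil (y + - x) ((y - x) * w)"
  proof (intro nil_op_add assms(2))
    have "nil (- x) v" if "nil x v" for v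
    proof -
      have "((*) (- x) ^^ N) v = (if even N then ((*) x ^^ N) v else - ((*) x ^^ N) v)" for N
        by (induction N) auto
      then show ?thesis using that unfolding nil_def by (metis neg_equal_0_iff_equal)
    qed
    then show "nil (- x) ((y - x) * w)" if "nil x ((y - x) * w)" using that .
  qed (use assms(1) in simp)
  then have "nil (y - x) w" by (simp add: nil_step_iff)
  then have "nil (x + (y - x)) w" using assms by (intro nil_op_add) (simp_all add: algebra_simps)
  then show ?thesis by simp
qed

text \<open>In the nil-Hecke algebra this element plays the role of the transposition: it carries x
  to y and squares to the unit of the corner of \<open>e\<close>, so nilpotency of x passes to
  y.\<close>

lemma nil_hecke_intertwiner:
  fixes f x y e :: "'a::ring"
  assumes "f * x = y * f - e" "f * y = x * f + e" "f * f = 0" "x * y = y * x"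
    and e: "e * x = x" "x * e = x" "e * y = y" "y * e = y" "e * f = f" "f * e = f" "e * e = e"
  shows "(f * (x - y) + e) * x = y * (f * (x - y) + e)"
    and "(f * (x - y) + e) * (f * (x - y) + e) = e"
proof -
  have 1: "x * f = f * y - e" "y * f = f * x + e" "y * x = x * y" using assms by simp_all
  note R = 1 assms(3) e
  note R' = R R[THEN mult_eq_assoc]
  show "(f * (x - y) + e) * x = y * (f * (x - y) + e)" "(f * (x - y) + e) * (f * (x - y) + e) = e"
    by (simp_all add: algebra_simps R')
qed

locale klr = idempotents \<kappa> B e
  for \<kappa> :: "'k::field \<Rightarrow> 'a::ring" and q :: 'k and n :: nat and B :: "'k list set"
    and e :: "'k list \<Rightarrow> 'a" and y \<psi> :: "nat \<Rightarrow> 'a" and m :: "'k \<Rightarrow> nat" +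
  assumes q_0: "q \<noteq> 0" and q_2: "q\<^sup>2 \<noteq> 1"
    and length_B: "i \<in> B \<Longrightarrow> length i = n"
    and swp_in_B: "a \<in> {1..<n} \<Longrightarrow> i \<in> B \<Longrightarrow> swp a i \<in> B"
    and ix_nz: "i \<in> B \<Longrightarrow> k \<in> {1..n} \<Longrightarrow> ix i k \<noteq> 0"
    and u_y: "k \<in> {1..n} \<Longrightarrow> \<kappa> 1 * y k = y k"
    and u_psi': "a \<in> {1..<n} \<Longrightarrow> \<kappa> 1 * \<psi> a = \<psi> a"
    and y_y: "k \<in> {1..n} \<Longrightarrow> l \<in> {1..n} \<Longrightarrow> y k * y l = y l * y k"
    and y_e: "k \<in> {1..n} \<Longrightarrow> i \<in> B \<Longrightarrow> y k * e i = e i * y k"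
    and psi_e': "a \<in> {1..<n} \<Longrightarrow> i \<in> B \<Longrightarrow> \<psi> a * e i = e (swp a i) * \<psi> a"
    and psi_y: "b \<in> {1..<n} \<Longrightarrow> j \<in> {1..n} \<Longrightarrow> i \<in> B \<Longrightarrow> (\<psi> b * y j - y (sb b j) * \<psi> b) * e i
      = (if j = b \<and> ix i b = ix i (b+1) then - e i else if j = b + 1 \<and> ix i b = ix i (b+1) then e i else 0)"
    and psi_psi_far: "a \<in> {1..<n} \<Longrightarrow> c \<in> {1..<n} \<Longrightarrow> a + 1 < c \<or> c + 1 < a \<Longrightarrow> \<psi> a * \<psi> c = \<psi> c * \<psi> a"
    and psi_psi_sq: "b \<in> {1..<n} \<Longrightarrow> i \<in> B \<Longrightarrow> \<psi> b * \<psi> b * e i = klr_sq q y e i b"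
    and psi_psi_braid: "b \<in> {1..<n} \<Longrightarrow> b + 1 \<in> {1..<n} \<Longrightarrow> i \<in> B \<Longrightarrow>
      (\<psi> b * \<psi> (b+1) * \<psi> b - \<psi> (b+1) * \<psi> b * \<psi> (b+1)) * e i = klr_braid q y e i b"
    and cyclotomic: "i \<in> B \<Longrightarrow> ((*) (y 1) ^^ m (ix i 1)) (e i) = 0"
begin

lemma psi_y_vec:
  assumes "b \<in> {1..<n}" "j \<in> {1..n}" "i \<in> B" "e i * v = v"
  shows "\<psi> b * (y j * v) = y (sb b j) * (\<psi> b * v) +
    (if j = b \<and> ix i b = ix i (b+1) then - v else if j = b + 1 \<and> ix i b = ix i (b+1) then v else 0)"
proof -
  have "(\<psi> b * y j - y (sb b j) * \<psi> b) * v = (\<psi> b * y j - y (sb b j) * \<psi> b) * e i * v"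
    by (simp add: mult.assoc assms(4))
  then show ?thesis unfolding psi_y[OF assms(1-3)] using assms(4)
    by (auto simp: left_diff_distrib mult.assoc algebra_simps split: if_splits)
qed

text \<open>From strand a to b = a + 1. For distinct labels \<psi> carries y a to y b, so y b is
  nilpotent on the square of \<psi>, which is \<open>e i\<close> up to factors +-(y b - y a) that
  can be removed. For equal labels that square is 0, and the nil-Hecke involution is used
  instead.\<close>

lemma nil_y:
  assumes "1 \<le> k" "k \<le> n" "i \<in> B"
  shows "nil (y k) (e i)"
  using assms
proof (induction k arbitrary: i rule: dec_induct)
  case base
  then show ?case using cyclotomic unfolding nil_def by blast
next
  case (step a)
  define b where "b = a + 1"
  have a: "a \<in> {1..<n}" and r: "a \<in> {1..n}" "b \<in> {1..n}" using step by (auto simp: b_def)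
  have sbs: "sb a a = b" "sb a b = a" "b \<noteq> a" "a \<noteq> b" by (auto simp: sb_def b_def)
  have IH: "nil (y a) (e j)" if "j \<in> B" for j using step.IH[OF _ that] step by simp
  have i: "i \<in> B" by fact
  have v: "e i * e i = e i" by (rule e_idem[OF i])
  have comm: "y a * y b = y b * y a" by (rule y_y[OF r])
  have "nil (y b) (e i)"
  proof (cases "ix i a = ix i b")
    case False
    let ?j = "swp a i"
    have j: "?j \<in> B" by (rule swp_in_B[OF a i])
    have nej: "ix ?j a \<noteq> ix ?j b"
      using False ix_swp[OF a length_B[OF i] r(1)] ix_swp[OF a length_B[OF i] r(2)] by (auto simp: sb_def b_def)
    have "\<psi> a * e ?j * y a = y b * (\<psi> a * e ?j)"
      using psi_y_vec[OF a r(1) j e_idem[OF j], folded b_def] nej y_e[OF r(1) j] by (simp add: mult.assoc sbs)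
    then have "nil (y b) (\<psi> a * e ?j * (e ?j * (\<psi> a * e i)))"
      by (rule nil_transport) (intro nil_mult_right IH j)
    moreover have "\<psi> a * e ?j * (e ?j * (\<psi> a * e i)) = \<psi> a * \<psi> a * e i"
      using psi_e'[OF a i] e_idem[OF j] e_idem[OF i] by (metis mult.assoc)
    ultimately have N: "nil (y b) (klr_sq q y e i a)" using psi_psi_sq[OF a i] by simp
    have 1: "nil (y b) w" if "nil (y b) ((y b - y a) * w)" "nil (y a) w" for w
      using nil_cancel_diff[OF comm that] .
    have 2: "nil (y b) w" if "nil (y b) ((y a - y b) * w)" "nil (y a) w" for w
      using 1[OF _ that(2)] nil_minus[OF that(1)] by (simp add: minus_mult_left)
    \<comment> \<open>For the double arrow two factors are removed in turn; this is the hypothesis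
      for the first removal.\<close>
    have 3: "nil (y a) ((y a - y b) * e i)"
      using IH[OF i] comm by (intro nil_mult_left) (simp_all add: algebra_simps)
    have "nconn q (ix i a) (ix i b) \<or> arr_to q (ix i a) (ix i b) \<or> arr_from q (ix i a) (ix i b)
        \<or> arr_both q (ix i a) (ix i b)"
      unfolding arr_iff[OF q_0] using False by blast
    then show ?thesis
      using N False 1[OF _ IH[OF i]] 2[OF _ IH[OF i]] 1[OF _ 3]
      unfolding klr_sq_def Let_def b_def[symmetric] by (auto simp: mult.assoc split: if_splits)
  next
    case True
    have sw: "swp a i = i" by (rule swp_same[OF a length_B[OF i] True[unfolded b_def]])
    define f where "f = \<psi> a * e i"
    have ef: "e i * f = f" "f * e i = f"
      using psi_e'[OF a i] sw v unfolding f_def by (metis mult.assoc)+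
    have psisq: "\<psi> a * f = 0" using psi_psi_sq[OF a i] True by (simp add: f_def klr_sq_def mult.assoc flip: b_def)
    have ff: "f * f = 0"
      using psisq ef unfolding f_def by (metis mult.assoc)
    have ey: "e i * (y k * e i) = y k * e i" "y k * e i * e i = y k * e i" if "k \<in> {1..n}" for k
      using y_e[OF that i] v by (metis mult.assoc)+
    have yy: "y a * e i * (y b * e i) = y b * e i * (y a * e i)"
      using ey[OF r(1)] ey[OF r(2)] comm by (metis mult.assoc)
    have f1: "f * (y a * e i) = y b * e i * f - e i"
      using psi_y_vec[OF a r(1) i v, folded b_def] True ey(1)[OF r(1)] ef by (simp add: f_def mult.assoc sbs)
    have f2: "f * (y b * e i) = y a * e i * f + e i"
      using psi_y_vec[OF a r(2) i v, folded b_def] True ey(1)[OF r(2)] ef by (simp add: f_def mult.assoc sbs)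
    define t where "t = f * (y a * e i - y b * e i) + e i"
    note T = nil_hecke_intertwiner[OF f1 f2 ff yy ey(1)[OF r(1)] ey(2)[OF r(1)] ey(1)[OF r(2)] ey(2)[OF r(2)]
      ef v, folded t_def]
    have et: "e i * t = t" unfolding t_def using ef v by (simp add: distrib_left mult.assoc[symmetric])
    \<comment> \<open>The involution lives in the corner of \<open>e i\<close>, so nilpotency is
      first restated for y a times \<open>e i\<close>, and translated back at the end.\<close>
    have "nil (y a * e i) (e i)"
    proof -
      have "((*) (y a * e i) ^^ N) (e i) = ((*) (y a) ^^ N) (e i) \<and> e i * ((*) (y a) ^^ N) (e i) = ((*) (y a) ^^ N) (e i)" for N
      proof (induction N)
        case (Suc N) then show ?case using y_e[OF r(1) i] v by (simp add: mult.assoc) (metis mult.assoc)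
      qed (simp add: v)
      then show ?thesis using IH[OF i] unfolding nil_def by simp
    qed
    then have "nil (y b * e i) (t * (e i * t))" by (intro nil_transport[OF T(1)] nil_mult_right)
    then have N: "nil (y b * e i) (e i)" using T(2) et by simp
    have "((*) (y b * e i) ^^ N) (e i) = ((*) (y b) ^^ N) (e i) \<and> e i * ((*) (y b) ^^ N) (e i) = ((*) (y b) ^^ N) (e i)" for N
    proof (induction N)
      case (Suc N) then show ?case using y_e[OF r(2) i] v by (simp add: mult.assoc) (metis mult.assoc)
    qed (simp add: v)
    then show ?thesis using N unfolding nil_def by simp
  qed
  then show ?case unfolding b_def Suc_eq_plus1 .
qed

definition XX :: "nat \<Rightarrow> 'a" where
  "XX k = (\<Sum>i\<in>B. \<kappa> (ix i k) * (e i - y k * e i))"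

lemma XX_at: "i \<in> B \<Longrightarrow> k \<in> {1..n} \<Longrightarrow> XX k * e i = \<kappa> (ix i k) * (e i - y k * e i)"
  unfolding XX_def by (rule sum_at) (simp_all add: mult.assoc left_diff_distrib e_idem)

lemma XX_vec: "i \<in> B \<Longrightarrow> k \<in> {1..n} \<Longrightarrow> e i * v = v \<Longrightarrow> XX k * v = \<kappa> (ix i k) * (v - y k * v)"
proof -
  assume i: "i \<in> B" and k: "k \<in> {1..n}" and v: "e i * v = v"
  have "XX k * v = XX k * e i * v" by (simp add: mult.assoc v)
  then show ?thesis unfolding XX_at[OF i k] by (simp add: mult.assoc left_diff_distrib v)
qed

lemma u_XX: "k \<in> {1..n} \<Longrightarrow> u * XX k = XX k"
  unfolding XX_def sum_distrib_left by (intro sum.cong refl) (simp add: mult.assoc[symmetric])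

lemma y_vec: "i \<in> B \<Longrightarrow> k \<in> {1..n} \<Longrightarrow> e i * v = v \<Longrightarrow> e i * (y k * v) = y k * v"
  by (metis y_e mult.assoc)

lemma XX_e: "k \<in> {1..n} \<Longrightarrow> i \<in> B \<Longrightarrow> XX k * e i = e i * XX k"
proof -
  assume k: "k \<in> {1..n}" and i: "i \<in> B"
  have *: "e i * (XX k * e j) = XX k * (e i * e j)" if j: "j \<in> B" for j
  proof -
    have "e i * (y k * e j) = y k * (e i * e j)" using y_e[OF k i] by (metis mult.assoc)
    then show ?thesis using XX_at[OF j k] XX_at[OF i k] i j
      by (simp add: e_e right_diff_distrib k_left_commute[of "e i"])
  qed
  show ?thesis
  proof (rule eq_on_e)
    show "u * (XX k * e i) = XX k * e i" "u * (e i * XX k) = e i * XX k"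
      using u_mult_right u_mult_left u_XX[OF k] by auto
    show "XX k * e i * e j = e i * XX k * e j" if "j \<in> B" for j using *[OF that] by (simp add: mult.assoc)
  qed
qed

lemma spectral: "spectral \<kappa> q n B e XX"
proof unfold_locales
  show "XX k * XX l = XX l * XX k" if k: "k \<in> {1..n}" and l: "l \<in> {1..n}" for k l
  proof (rule eq_on_e)
    show "u * (XX k * XX l) = XX k * XX l" "u * (XX l * XX k) = XX l * XX k"
      using u_mult_right u_XX k l by auto
    fix i assume i: "i \<in> B"
    have v: "e i * e i = e i" by (rule e_idem[OF i])
    have yy: "y k * (y l * e i) = y l * (y k * e i)" using y_y[OF k l] by (metis mult.assoc)
    have e1: "e i * (e i - y l * e i) = e i - y l * e i" "e i * (e i - y k * e i) = e i - y k * e i"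
      using v y_vec[OF i _ v] k l by (auto simp: right_diff_distrib)
    have "XX k * (XX l * e i) = \<kappa> (ix i l) * (\<kappa> (ix i k) * (e i - y l * e i - (y k * (e i - y l * e i))))"
      unfolding XX_at[OF i l] k_left_commute[of "XX k"] XX_vec[OF i k e1(1)] ..
    moreover have "XX l * (XX k * e i) = \<kappa> (ix i k) * (\<kappa> (ix i l) * (e i - y k * e i - (y l * (e i - y k * e i))))"
      unfolding XX_at[OF i k] k_left_commute[of "XX l"] XX_vec[OF i l e1(2)] ..
    moreover have "e i - y l * e i - (y k * (e i - y l * e i)) = e i - y k * e i - (y l * (e i - y k * e i))"
      using yy by (simp add: right_diff_distrib)
    ultimately show "XX k * XX l * e i = XX l * XX k * e i"
      using k_left_commute[of "\<kappa> (ix i k)" "ix i l"] by (simp only: mult.assoc)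
  qed
  show "nil (XX k - \<kappa> (ix i k)) (e i)" if i: "i \<in> B" and k: "k \<in> {1..n}" for i k
  proof -
    have v: "e i * e i = e i" by (rule e_idem[OF i])
    \<comment> \<open>On the corner of \<open>e i\<close>, \<open>XX k\<close> minus its label acts
      as minus the label times y k.\<close>
    have "((*) (XX k - \<kappa> (ix i k)) ^^ N) (e i) = ((*) (\<kappa> (- ix i k) * y k) ^^ N) (e i)
      \<and> e i * ((*) (\<kappa> (- ix i k) * y k) ^^ N) (e i) = ((*) (\<kappa> (- ix i k) * y k) ^^ N) (e i)" for N
    proof (induction N)
      case (Suc N)
      let ?w = "((*) (\<kappa> (- ix i k) * y k) ^^ N) (e i)"
      have w: "e i * ?w = ?w" using Suc by simp
      have "(XX k - \<kappa> (ix i k)) * ?w = \<kappa> (- ix i k) * y k * ?w"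
        using XX_vec[OF i k w] by (simp add: left_diff_distrib right_diff_distrib k_minus mult.assoc)
      moreover have "e i * (\<kappa> (- ix i k) * y k * ?w) = \<kappa> (- ix i k) * y k * ?w"
        using y_vec[OF i k w] by (simp add: mult.assoc k_left_commute[of "e i"])
      ultimately show ?case using Suc by simp
    qed (simp add: v)
    moreover have "nil (\<kappa> (- ix i k) * y k) (e i)"
      using nil_y[of k i] i k by (intro nil_op_mult_central k_central) auto
    ultimately show ?thesis unfolding nil_def by simp
  qed
qed (use q_0 q_2 length_B swp_in_B ix_nz u_XX XX_e in auto)

sublocale spectral \<kappa> q n B e XX by (rule spectral)

lemma psi_XX:
  assumes a: "a \<in> {1..<n}" and j: "j \<in> {1..n}" and i: "i \<in> B" and v: "e i * v = v"
  shows "\<psi> a * (XX j * v) = XX (sb a j) * (\<psi> a * v) + (if ix i a = ix i (a + 1)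
    then if j = a then \<kappa> (ix i a) * v else if j = a + 1 then - (\<kappa> (ix i a) * v) else 0 else 0)"
proof -
  have w: "e (swp a i) * (\<psi> a * v) = \<psi> a * v" using psi_e'[OF a i] v by (metis mult.assoc)
  have r: "sb a j \<in> {1..n}" by (rule sb_range[OF a j])
  have ix: "ix (swp a i) (sb a j) = ix i j" using ix_swp[OF a length_B[OF i] r] by simp
  show ?thesis
    unfolding XX_vec[OF i j v] XX_vec[OF swp_in_B[OF a i] r w] ix
    using psi_y_vec[OF a j i v]
    by (auto simp: right_diff_distrib distrib_left k_left_commute[of "\<psi> a"])
qed

text \<open>The inverse of XX a - XX (a + 1) on \<open>e i\<close>. It exists for distinct labels,
  which is the case in which \<open>gg\<close> calls for it.\<close>

definition DI :: "'k list \<Rightarrow> nat \<Rightarrow> 'a" where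
  "DI i a = (SOME D. (XX a - XX (a + 1)) * D = e i \<and> e i * D = D \<and> D * (XX a - XX (a + 1)) = e i \<and> D * e i = D)"

lemma DI:
  assumes i: "i \<in> B" and a: "a \<in> {1..<n}" and ne: "ix i a \<noteq> ix i (a + 1)"
  shows "e i * DI i a = DI i a" "DI i a * (XX a - XX (a + 1)) = e i" "DI i a * e i = DI i a"
proof -
  let ?d = "XX a - XX (a + 1)"
  have r: "a \<in> {1..n}" "a + 1 \<in> {1..n}" using a by auto
  have "1 * ix i a + (- 1) * ix i (a + 1) \<noteq> 0" using ne by simp
  from lin_inverse[OF i r this] obtain D where D: "?d * D = e i"
    "\<And>t. t * XX a = XX a * t \<Longrightarrow> t * XX (a + 1) = XX (a + 1) * t \<Longrightarrow> t * e i = e i * t \<Longrightarrow> t * D = D * t"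
    by (auto simp: k_minus u_X[OF r(1)] u_X[OF r(2)])
  have pd: "pc {1..n} ?d" by (intro pc_diff pc_X r)
  have dX: "?d * XX a = XX a * ?d" "?d * XX (a + 1) = XX (a + 1) * ?d" "?d * e i = e i * ?d"
    using pc_pc[OF pd pc_X[OF r(1)]] pc_pc[OF pd pc_X[OF r(2)]] pc_e[OF pd i] by auto
  have dD: "?d * D = D * ?d" by (rule D(2)[OF dX])
  have eD: "e i * D = D * e i" by (rule D(2)) (simp_all only: X_e[OF r(1) i] X_e[OF r(2) i])
  have "?d * (e i * D) = e i" using dX(3) D(1) e_idem[OF i] by (metis mult.assoc)
  moreover have "e i * (e i * D) = e i * D" using e_idem[OF i] by (metis mult.assoc)
  moreover have "e i * D * ?d = e i" using dD D(1) e_idem[OF i] by (metis mult.assoc)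
  moreover have "e i * D * e i = e i * D" using eD e_idem[OF i] by (metis mult.assoc)
  ultimately have "\<exists>D. ?d * D = e i \<and> e i * D = D \<and> D * ?d = e i \<and> D * e i = D" by blast
  from someI_ex[OF this, folded DI_def]
  show "e i * DI i a = DI i a" "DI i a * ?d = e i" "DI i a * e i = DI i a" by auto
qed

text \<open>The link relations solved for g: directly at equal labels, and after division by XX a -
  XX (a + 1) otherwise.\<close>

definition gg :: "nat \<Rightarrow> 'a" where
  "gg a = (\<Sum>i\<in>B. if ix i a = ix i (a + 1)
     then \<kappa> q * e i - \<psi> a * (\<kappa> (inverse (ix i a)) * nn a (a + 1) * e i)
     else (\<psi> a * (NN (ix i a) (ix i (a + 1)) a (a + 1) * e i) - \<kappa> (q - inverse q) * (XX (a + 1) * e i)) * DI i a)"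

lemma gg_at:
  assumes "a \<in> {1..<n}" "i \<in> B"
  shows "gg a * e i = (if ix i a = ix i (a + 1)
     then \<kappa> q * e i - \<psi> a * (\<kappa> (inverse (ix i a)) * nn a (a + 1) * e i)
     else (\<psi> a * (NN (ix i a) (ix i (a + 1)) a (a + 1) * e i) - \<kappa> (q - inverse q) * (XX (a + 1) * e i)) * DI i a)"
  unfolding gg_def
  by (rule sum_at[OF _ assms(2)])
    (simp add: left_diff_distrib mult.assoc e_idem DI(3)[OF _ assms(1)])

lemma gg_diff:
  assumes a: "a \<in> {1..<n}" and i: "i \<in> B" and ne: "ix i a \<noteq> ix i (a + 1)" and v: "e i * v = v"
  shows "gg a * ((XX a - XX (a + 1)) * v)
    = \<psi> a * (NN (ix i a) (ix i (a + 1)) a (a + 1) * v) - \<kappa> (q - inverse q) * (XX (a + 1) * v)"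
proof -
  let ?d = "XX a - XX (a + 1)"
  have r: "a \<in> {1..n}" "a + 1 \<in> {1..n}" using a by auto
  have "pc {1..n} ?d" by (intro pc_diff pc_X r)
  then have "e i * (?d * v) = ?d * v" by (rule vec_pc[OF _ i v])
  then have "gg a * (?d * v) = gg a * e i * (?d * v)" by (simp add: mult.assoc)
  also have "\<dots> = (\<psi> a * (NN (ix i a) (ix i (a + 1)) a (a + 1) * e i) - \<kappa> (q - inverse q) * (XX (a + 1) * e i)) * ((DI i a * ?d) * v)"
    unfolding gg_at[OF a i] using ne by (simp add: mult.assoc)
  also have "DI i a * ?d = e i" by (rule DI(2)[OF i a ne])
  finally show ?thesis by (simp add: v left_diff_distrib mult.assoc)
qed

lemma u_gg: assumes a: "a \<in> {1..<n}" shows "u * gg a = gg a"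
  unfolding gg_def sum_distrib_left
proof (rule sum.cong[OF refl])
  fix i assume i: "i \<in> B"
  have 1: "u * (\<psi> a * w) = \<psi> a * w" for w by (rule u_mult_right[OF u_psi'[OF a]])
  show "u * (if ix i a = ix i (a + 1)
     then \<kappa> q * e i - \<psi> a * (\<kappa> (inverse (ix i a)) * nn a (a + 1) * e i)
     else (\<psi> a * (NN (ix i a) (ix i (a + 1)) a (a + 1) * e i) - \<kappa> (q - inverse q) * (XX (a + 1) * e i)) * DI i a)
   = (if ix i a = ix i (a + 1)
     then \<kappa> q * e i - \<psi> a * (\<kappa> (inverse (ix i a)) * nn a (a + 1) * e i)
     else (\<psi> a * (NN (ix i a) (ix i (a + 1)) a (a + 1) * e i) - \<kappa> (q - inverse q) * (XX (a + 1) * e i)) * DI i a)"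
    using 1 u_mult_left[OF u_e[OF i]] u_e[OF i]
    by (simp add: right_diff_distrib left_diff_distrib mult.assoc[of u, symmetric] mult.assoc[of "\<psi> a"]
        mult.assoc[of "\<kappa> (q - inverse q)"])
qed

text \<open>At equal labels the z-term comes from the nil-Hecke correction of \<psi> applied to
  \<open>nn\<close>. At distinct labels the identity is checked after multiplication by the regular
  factor XX a - XX (a + 1), where \<open>gg_diff\<close> has removed the division.\<close>

lemma gg_XX:
  assumes a: "a \<in> {1..<n}" and k: "k \<in> {1..n}"
  shows "gg a * XX k = XX (sb a k) * gg a + (if k = a then - (\<kappa> (q - inverse q) * XX (a + 1))
    else if k = a + 1 then \<kappa> (q - inverse q) * XX (a + 1) else 0)"
proof (rule eq_on_e)
  let ?z = "\<kappa> (q - inverse q)"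
  let ?c = "if k = a then - (?z * XX (a + 1)) else if k = a + 1 then ?z * XX (a + 1) else 0"
  have r: "a \<in> {1..n}" "a + 1 \<in> {1..n}" "sb a k \<in> {1..n}" using a sb_range[OF a k] by auto
  show "u * (gg a * XX k) = gg a * XX k" by (rule u_mult_left[OF u_X[OF k]])
  have "u * (XX (sb a k) * gg a) = XX (sb a k) * gg a" by (rule u_mult_left[OF u_gg[OF a]])
  moreover have "u * ?c = ?c" by (auto simp: mult.assoc[symmetric])
  ultimately show "u * (XX (sb a k) * gg a + ?c) = XX (sb a k) * gg a + ?c" by (simp add: distrib_left)
  fix i assume i: "i \<in> B"
  have v: "e i * e i = e i" by (rule e_idem[OF i])
  have Xv: "e i * (XX k * e i) = XX k * e i" by (rule vec_X[OF k i v])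
  show "gg a * XX k * e i = (XX (sb a k) * gg a + ?c) * e i"
  proof (cases "ix i a = ix i (a + 1)")
    case True
    let ?M = "\<kappa> (inverse (ix i a)) * nn a (a + 1)"
    have pM: "pc {1..n} ?M" by (intro pc_mult pc_k pc_nn r)
    have Mv: "e i * (?M * e i) = ?M * e i" by (rule vec_pc[OF pM i v])
    have "gg a * XX k * e i = gg a * e i * (XX k * e i)" by (simp add: mult.assoc Xv)
    also have "\<dots> = \<kappa> q * (XX k * e i) - \<psi> a * (?M * (XX k * e i))"
      unfolding gg_at[OF a i] using True Xv by (simp add: left_diff_distrib mult.assoc)
    also have "?M * (XX k * e i) = XX k * (?M * e i)"
      by (rule pc_swap[OF pM pc_X[OF k]])
    also have "\<psi> a * (XX k * (?M * e i)) = XX (sb a k) * (\<psi> a * (?M * e i))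
      + (if k = a then nn a (a + 1) * e i else if k = a + 1 then - (nn a (a + 1) * e i) else 0)"
    proof -
      have "\<kappa> (ix i a) * (?M * e i) = nn a (a + 1) * e i"
        using k_inverse'[OF nz[OF i r(1)]] u_nn[OF r(1,2)] by (simp add: mult.assoc[symmetric])
      then show ?thesis using psi_XX[OF a k i Mv] True by simp
    qed
    finally have L: "gg a * XX k * e i = \<kappa> q * (XX k * e i) - (XX (sb a k) * (\<psi> a * (?M * e i))
      + (if k = a then nn a (a + 1) * e i else if k = a + 1 then - (nn a (a + 1) * e i) else 0))" .
    have R: "XX (sb a k) * gg a * e i = \<kappa> q * (XX (sb a k) * e i) - XX (sb a k) * (\<psi> a * (?M * e i))"
      using gg_at[OF a i] True by (simp add: mult.assoc right_diff_distrib k_left_commute[of "XX (sb a k)"])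
    show ?thesis unfolding distrib_right L R
      by (auto simp: sb_def nn_def k_diff left_diff_distrib mult.assoc)
  next
    case False
    let ?d = "XX a - XX (a + 1)" and ?N = "NN (ix i a) (ix i (a + 1)) a (a + 1)"
    have pd: "pc {1..n} ?d" "pc {1..n} ?N" by (intro pc_diff pc_X pc_NN r)+
    have Nv: "e i * (?N * e i) = ?N * e i" by (rule vec_pc[OF pd(2) i v])
    have "?d * (XX k * e i) = XX k * (?d * e i)" by (rule pc_swap[OF pd(1) pc_X[OF k]])
    then have "gg a * XX k * (?d * e i) = gg a * (?d * (XX k * e i))" by (simp add: mult.assoc)
    also have "\<dots> = \<psi> a * (?N * (XX k * e i)) - ?z * (XX (a + 1) * (XX k * e i))"
      by (rule gg_diff[OF a i False Xv])
    also have "?N * (XX k * e i) = XX k * (?N * e i)" by (rule pc_swap[OF pd(2) pc_X[OF k]])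
    also have "\<psi> a * (XX k * (?N * e i)) = XX (sb a k) * (\<psi> a * (?N * e i))"
      using psi_XX[OF a k i Nv] False by simp
    finally have L: "gg a * XX k * (?d * e i)
      = XX (sb a k) * (\<psi> a * (?N * e i)) - ?z * (XX (a + 1) * (XX k * e i))" .
    have R: "XX (sb a k) * gg a * (?d * e i) = XX (sb a k) * (\<psi> a * (?N * e i)) - ?z * (XX (sb a k) * (XX (a + 1) * e i))"
      using gg_diff[OF a i False v] by (simp add: mult.assoc right_diff_distrib k_left_commute[of "XX (sb a k)"])
    have X: "XX l * (XX l' * e i) = XX l' * (XX l * e i)" if "l \<in> {1..n}" "l' \<in> {1..n}" for l l'
      by (rule pc_swap[OF pc_X[OF that(1)] pc_X[OF that(2)]])
    have "(gg a * XX k - (XX (sb a k) * gg a + ?c)) * (?d * e i) = 0"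
      unfolding left_diff_distrib[of "gg a * XX k"] distrib_right L R
      using X[OF r(1,2)] X[OF k r(2)]
      by (auto simp: sb_def right_diff_distrib left_diff_distrib mult.assoc)
    then have "(gg a * XX k - (XX (sb a k) * gg a + ?c)) * e i = 0"
      using reg_eq_0[OF reg_diff[OF i r(1,2) False]] by blast
    then show ?thesis by (simp add: left_diff_distrib)
  qed
qed

sublocale hecke_klr \<kappa> q n B e XX gg \<psi>
proof unfold_locales
  fix a assume a: "a \<in> {1..<n}"
  have r: "a \<in> {1..n}" "a + 1 \<in> {1..n}" using a by auto
  show "\<kappa> 1 * gg a = gg a" by (rule u_gg[OF a])
  show up: "\<kappa> 1 * \<psi> a = \<psi> a" by (rule u_psi'[OF a])
  show "gg a * XX a = XX (a + 1) * gg a - \<kappa> (q - inverse q) * XX (a + 1)"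
    using gg_XX[OF a r(1)] by (simp add: sb_def)
  show "gg a * XX (a + 1) = XX a * gg a + \<kappa> (q - inverse q) * XX (a + 1)"
    using gg_XX[OF a r(2)] by (simp add: sb_def)
  show "gg a * XX k = XX k * gg a" if "k \<in> {1..n}" "k \<noteq> a" "k \<noteq> a + 1" for k
    using gg_XX[OF a that(1)] that by (simp add: sb_def)
  show "\<psi> a * XX k = XX k * \<psi> a" if k: "k \<in> {1..n}" "k \<noteq> a" "k \<noteq> a + 1" for k
  proof (rule eq_on_e)
    show "u * (\<psi> a * XX k) = \<psi> a * XX k" "u * (XX k * \<psi> a) = XX k * \<psi> a"
      using u_mult_right[OF up] u_mult_left[OF up] by auto
    fix i assume i: "i \<in> B"
    show "\<psi> a * XX k * e i = XX k * \<psi> a * e i"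
      using psi_XX[OF a k(1) i e_idem[OF i]] k by (simp add: sb_def mult.assoc)
  qed
  fix i assume i: "i \<in> B"
  have v: "e i * e i = e i" by (rule e_idem[OF i])
  show "\<psi> a * e i = e (swp a i) * \<psi> a" by (rule psi_e'[OF a i])
  show "\<psi> a * (XX a * e i) = XX (a + 1) * (\<psi> a * e i) + (if ix i a = ix i (a + 1) then \<kappa> (ix i a) * e i else 0)"
    using psi_XX[OF a r(1) i v] by (simp add: sb_def)
  show "\<psi> a * (XX (a + 1) * e i) = XX a * (\<psi> a * e i) - (if ix i a = ix i (a + 1) then \<kappa> (ix i a) * e i else 0)"
    using psi_XX[OF a r(2) i v] by (simp add: sb_def)
  show "gg a * e i = \<kappa> q * e i - \<psi> a * (\<kappa> (inverse (ix i a)) * nn a (a + 1) * e i)"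
    if "ix i a = ix i (a + 1)" using gg_at[OF a i] that by simp
  show "(gg a * (XX a - XX (a + 1)) + \<kappa> (q - inverse q) * XX (a + 1)) * e i
      = \<psi> a * (NN (ix i a) (ix i (a + 1)) a (a + 1) * e i)" if "ix i a \<noteq> ix i (a + 1)"
    using gg_diff[OF a i that v] by (simp add: distrib_right mult.assoc)
qed

text \<open>The instance of \<open>hecke_klr\<close> transports the quadratic, far and braid
  relations from \<psi> to g; g X_a g = X_{a+1} then follows from the exchange relation and the
  quadratic one.\<close>

lemma hecke: "hecke \<kappa> q n XX gg"
proof unfold_locales
  have sq: "gg a * gg a = \<kappa> (q - inverse q) * gg a + \<kappa> 1" if a: "a \<in> {1..<n}" for a
    by (rule g_square[OF a]) (use psi_psi_sq[OF a] klr_sq_psi_sq[OF XX_at _ a] in auto)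
  show "gg a * gg a = \<kappa> (q - inverse q) * gg a + \<kappa> 1" if "a \<in> {1..<n}" for a by (rule sq[OF that])
  show "gg a * XX a * gg a = XX (a + 1)" if a: "a \<in> {1..<n}" for a
  proof -
    have r: "a + 1 \<in> {1..n}" using a by auto
    have "XX (a + 1) * (gg a * gg a) = \<kappa> (q - inverse q) * (XX (a + 1) * gg a) + XX (a + 1)"
      unfolding sq[OF a] distrib_left by (simp add: k_left_commute[of "XX (a + 1)"] u_right u_X[OF r])
    then show ?thesis unfolding g_X1[OF a] by (simp add: left_diff_distrib mult.assoc)
  qed
  show "gg a * gg c = gg c * gg a" if "a \<in> {1..<n}" "c \<in> {1..<n}" "a + 1 < c \<or> c + 1 < a" for a c
    by (rule g_far[OF that psi_psi_far[OF that]])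
  show "gg a * gg (a + 1) * gg a = gg (a + 1) * gg a * gg (a + 1)" if a: "a \<in> {1..<n}" "a + 1 \<in> {1..<n}" for a
    by (rule g_braid[OF a sq]) (use psi_psi_braid[OF a] klr_braid_psi_braid[OF XX_at _ a] in auto)
qed (use q_0 q_2 u_X u_gg X_X g_X in auto)

end

section \<open>All rings on a type as one type-class ring\<close>

text \<open>Quotients of the free algebra are rings with explicit carriers. Collecting all rings with
  elements of type 'b into one product gives a type of class ring, in which every single one of
  them sits as a direct factor.\<close>

typedef 'b big = "{F :: 'b ring \<Rightarrow> 'b. \<forall>R. if Ring.ring R then F R \<in> carrier R else F R = undefined}"
proof
  show "(\<lambda>R. if Ring.ring R then \<zero>\<^bsub>R\<^esub> else undefined) \<in>
    {F. \<forall>R. if Ring.ring R then F R \<in> carrier R else F R = undefined}"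
    by (auto simp: ring.ring_simprules)
qed

definition mk_big :: "('b ring \<Rightarrow> 'b) \<Rightarrow> 'b big" where
  "mk_big F = Abs_big (\<lambda>R. if Ring.ring R then F R else undefined)"

lemma Rep_mk_big: "(\<And>R. Ring.ring R \<Longrightarrow> F R \<in> carrier R) \<Longrightarrow> Ring.ring R \<Longrightarrow> Rep_big (mk_big F) R = F R"
  unfolding mk_big_def by (subst Abs_big_inverse) auto

lemma Rep_big_carrier: "Ring.ring R \<Longrightarrow> Rep_big x R \<in> carrier R"
  using Rep_big[of x] by (auto dest: spec[of _ R])

lemma big_eqI: "(\<And>R. Ring.ring R \<Longrightarrow> Rep_big x R = Rep_big y R) \<Longrightarrow> x = y"
proof -
  assume *: "\<And>R. Ring.ring R \<Longrightarrow> Rep_big x R = Rep_big y R"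
  have "Rep_big x R = Rep_big y R" for R
    using *[of R] Rep_big[of x] Rep_big[of y] by (cases "Ring.ring R") (auto dest!: spec[of _ R])
  then show ?thesis by (auto simp: Rep_big_inject[symmetric])
qed

instantiation big :: (type) ring
begin

definition "0 = mk_big (\<lambda>R. \<zero>\<^bsub>R\<^esub>)"
definition "x + y = mk_big (\<lambda>R. Rep_big x R \<oplus>\<^bsub>R\<^esub> Rep_big y R)"
definition "- x = mk_big (\<lambda>R. \<ominus>\<^bsub>R\<^esub> Rep_big x R)"
definition "x - y = mk_big (\<lambda>R. Rep_big x R \<ominus>\<^bsub>R\<^esub> Rep_big y R)"
definition "x * y = mk_big (\<lambda>R. Rep_big x R \<otimes>\<^bsub>R\<^esub> Rep_big y R)"

lemma Rep_big_simps:
  assumes "Ring.ring R"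
  shows "Rep_big 0 R = \<zero>\<^bsub>R\<^esub>" "Rep_big (x + y) R = Rep_big x R \<oplus>\<^bsub>R\<^esub> Rep_big y R"
    "Rep_big (- x) R = \<ominus>\<^bsub>R\<^esub> Rep_big x R" "Rep_big (x - y) R = Rep_big x R \<ominus>\<^bsub>R\<^esub> Rep_big y R"
    "Rep_big (x * y) R = Rep_big x R \<otimes>\<^bsub>R\<^esub> Rep_big y R"
  unfolding zero_big_def plus_big_def uminus_big_def minus_big_def times_big_def
  by (rule Rep_mk_big[OF _ assms]; auto simp: ring.ring_simprules Rep_big_carrier)+

instance
proof
  fix a b c :: "'a big"
  note s = Rep_big_simps ring.ring_simprules Rep_big_carrier
  show "a + b + c = a + (b + c)" by (rule big_eqI) (simp add: Rep_big_simps ring.ring_simprules(7) Rep_big_carrier)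
  show "a + b = b + a" by (rule big_eqI) (simp add: Rep_big_simps ring.ring_simprules(10) Rep_big_carrier)
  show "0 + a = a" by (rule big_eqI) (simp add: s)
  show "- a + a = 0" by (rule big_eqI) (simp add: s)
  show "a - b = a + - b" by (rule big_eqI) (simp add: s)
  show "a * b * c = a * (b * c)" by (rule big_eqI) (simp add: s)
  show "(a + b) * c = a * c + b * c" by (rule big_eqI) (simp add: s)
  show "a * (b + c) = a * b + a * c" by (rule big_eqI) (simp add: s)
qed

end

text \<open>Extension by zero from the factor \<open>R\<close>. Sums and products are preserved,
  while the unit of \<open>R\<close> becomes an idempotent of the product.\<close>

definition emb :: "'b ring \<Rightarrow> 'b \<Rightarrow> 'b big" where
  "emb R x = mk_big (\<lambda>R'. if R' = R then x else \<zero>\<^bsub>R'\<^esub>)"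

lemma Rep_emb: "x \<in> carrier R \<Longrightarrow> Ring.ring R' \<Longrightarrow> Rep_big (emb R x) R' = (if R' = R then x else \<zero>\<^bsub>R'\<^esub>)"
  unfolding emb_def by (rule Rep_mk_big) (auto simp: ring.ring_simprules)

lemma emb_add:
  assumes "Ring.ring R" "x \<in> carrier R" "y \<in> carrier R"
  shows "emb R (x \<oplus>\<^bsub>R\<^esub> y) = emb R x + emb R y"
  by (rule big_eqI) (simp add: assms Rep_emb Rep_big_simps ring.ring_simprules)

lemma emb_mult:
  assumes "Ring.ring R" "x \<in> carrier R" "y \<in> carrier R"
  shows "emb R (x \<otimes>\<^bsub>R\<^esub> y) = emb R x * emb R y"
  by (rule big_eqI) (simp add: assms Rep_emb Rep_big_simps ring.ring_simprules)

lemma emb_zero: "Ring.ring R \<Longrightarrow> emb R \<zero>\<^bsub>R\<^esub> = 0"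
  by (rule big_eqI) (simp add: Rep_emb Rep_big_simps ring.ring_simprules)

text \<open>Each factor is a two-sided ideal: multiplication by an arbitrary element of the product
  sees only its component at \<open>R\<close>.\<close>

lemma emb_mult_big:
  assumes "Ring.ring R" "x \<in> carrier R"
  shows "emb R x * F = emb R (x \<otimes>\<^bsub>R\<^esub> Rep_big F R)" "F * emb R x = emb R (Rep_big F R \<otimes>\<^bsub>R\<^esub> x)"
  by (rule big_eqI; simp add: assms Rep_emb Rep_big_simps Rep_big_carrier ring.ring_simprules)+

lemma emb_inj: "Ring.ring R \<Longrightarrow> x \<in> carrier R \<Longrightarrow> y \<in> carrier R \<Longrightarrow> emb R x = emb R y \<Longrightarrow> x = y"
  by (metis Rep_emb)

section \<open>Free algebras\<close>

text \<open>Both sides run over the ways to cut w into three consecutive pieces. The arguments of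
  \<open>F\<close> are the lengths of the pieces, which matches the exchange of summation known from
  power series.\<close>

lemma fa_mult_assoc: "(f \<star> g) \<star> h = f \<star> (g \<star> h)"
proof
  fix w :: "'a list"
  define F where "F a b c = f (take a w) * g (take b (drop a w)) * h (drop (a + b) w)" for a b and c :: nat
  have "(f \<star> g \<star> h) w = (\<Sum>i=0..length w. \<Sum>j=0..i. F j (i - j) (length w - i))"
    unfolding fa_mult_def F_def
    by (auto simp: sum_distrib_right atLeast0AtMost min_def take_drop intro!: sum.cong)
  also have "\<dots> = (\<Sum>j=0..length w. \<Sum>i=0..length w - j. F j i (length w - j - i))"
    by (rule fps_mult_assoc_lemma)
  also have "\<dots> = (f \<star> (g \<star> h)) w"
    unfolding fa_mult_def F_def
    by (auto simp: sum_distrib_left atLeast0AtMost mult.assoc add.commute intro!: sum.cong)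
  finally show "(f \<star> g \<star> h) w = (f \<star> (g \<star> h)) w" .
qed

lemma sc_mult: "sc c \<star> f = (\<lambda>w. c * f w)" "f \<star> sc c = (\<lambda>w. c * f w)"
proof -
  have "(\<Sum>i\<le>length w. sc c (take i w) * f (drop i w)) = (\<Sum>i\<le>length w. if i = 0 then c * f w else 0)" for w
    by (rule sum.cong) (auto simp: sc_def)
  then show "sc c \<star> f = (\<lambda>w. c * f w)" by (simp add: fa_mult_def)
  have "(\<Sum>i\<le>length w. f (take i w) * sc c (drop i w)) = (\<Sum>i\<le>length w. if i = length w then c * f w else 0)" for w
    by (rule sum.cong) (auto simp: sc_def)
  then show "f \<star> sc c = (\<lambda>w. c * f w)" by (simp add: fa_mult_def)
qed

lemma fa_one_sc: "fa_one = sc 1" by (simp add: fa_one_def sc_def)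

lemma fa_distrib: "(f + g) \<star> h = f \<star> h + g \<star> h" "h \<star> (f + g) = h \<star> f + h \<star> g"
  by (auto simp: fa_mult_def algebra_simps sum.distrib)

definition fac :: "'x set \<Rightarrow> ('x,'k::field) fa set" where
  "fac A = {f. finite {w. f w \<noteq> 0} \<and> (\<forall>w. f w \<noteq> 0 \<longrightarrow> set w \<subseteq> A)}"

lemma free_alg_simps [simp]:
  "carrier (free_alg A) = fac A" "monoid.mult (free_alg A) = fa_mult" "one (free_alg A) = fa_one"
  "zero (free_alg A) = 0" "add (free_alg A) = (+)"
  by (auto simp: free_alg_def fac_def zero_fun_def)

lemma fac_add [simp, intro]: "f \<in> fac A \<Longrightarrow> g \<in> fac A \<Longrightarrow> f + g \<in> fac A"
proof -
  assume f: "f \<in> fac A" and g: "g \<in> fac A"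
  have "{w. (f + g) w \<noteq> 0} \<subseteq> {w. f w \<noteq> 0} \<union> {w. g w \<noteq> 0}" by auto
  then have "finite {w. (f + g) w \<noteq> 0}"
    by (rule finite_subset) (use f g in \<open>simp add: fac_def\<close>)
  moreover have "set w \<subseteq> A" if "(f + g) w \<noteq> 0" for w
  proof -
    have "f w \<noteq> 0 \<or> g w \<noteq> 0" using that by auto
    then show ?thesis using f g unfolding fac_def by blast
  qed
  ultimately show ?thesis unfolding fac_def by blast
qed

lemma fac_uminus [simp, intro]: "f \<in> fac A \<Longrightarrow> - f \<in> fac A"
  by (auto simp: fac_def)

lemma fac_minus [simp, intro]: "f \<in> fac A \<Longrightarrow> g \<in> fac A \<Longrightarrow> f - g \<in> fac A"
  using fac_add[of f A "- g"] by simp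

lemma fac_0 [simp, intro]: "0 \<in> fac A"
  by (auto simp: fac_def)

lemma fac_mult [simp, intro]: "f \<in> fac A \<Longrightarrow> g \<in> fac A \<Longrightarrow> f \<star> g \<in> fac A"
proof -
  assume f: "f \<in> fac A" and g: "g \<in> fac A"
  have *: "\<exists>v v'. w = v @ v' \<and> f v \<noteq> 0 \<and> g v' \<noteq> 0" if "(f \<star> g) w \<noteq> 0" for w
  proof -
    have "\<exists>i\<in>{..length w}. f (take i w) * g (drop i w) \<noteq> 0"
      using that unfolding fa_mult_def by (meson sum.neutral)
    then obtain i where "f (take i w) * g (drop i w) \<noteq> 0" by blast
    then show ?thesis by (metis append_take_drop_id mult_zero_left mult_zero_right)
  qed
  have "{w. (f \<star> g) w \<noteq> 0} \<subseteq> (\<lambda>(v, v'). v @ v') ` ({w. f w \<noteq> 0} \<times> {w. g w \<noteq> 0})"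
    using * by fastforce
  moreover have "finite ((\<lambda>(v, v'). v @ v') ` ({w. f w \<noteq> 0} \<times> {w. g w \<noteq> 0}))"
    using f g by (intro finite_imageI finite_cartesian_product) (auto simp: fac_def)
  moreover have "set w \<subseteq> A" if "(f \<star> g) w \<noteq> 0" for w
    using *[OF that] f g unfolding fac_def by (metis (mono_tags, lifting) Un_least mem_Collect_eq set_append)
  ultimately show ?thesis unfolding fac_def using finite_subset by blast
qed

declare plus_fun_apply [simp del] minus_apply [simp del] uminus_apply [simp del]

definition mon :: "'k \<Rightarrow> 'x list \<Rightarrow> ('x,'k::field) fa" where
  "mon c w = (\<lambda>v. if v = w then c else 0)"

lemma sc_mon: "sc c = mon c []" and gen_mon: "gen x = mon 1 [x]"
  by (auto simp: sc_def gen_def mon_def)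

lemma fac_mon [simp, intro]: "set w \<subseteq> A \<Longrightarrow> mon c w \<in> fac A"
proof -
  assume "set w \<subseteq> A"
  moreover have "{v. mon c w v \<noteq> 0} \<subseteq> {w}" by (auto simp: mon_def)
  then have "finite {v. mon c w v \<noteq> 0}" using finite_subset by blast
  ultimately show ?thesis by (auto simp: fac_def mon_def split: if_splits)
qed

lemma fac_sc [simp, intro]: "sc c \<in> fac A" by (simp add: sc_mon)
lemma fac_one [simp, intro]: "fa_one \<in> fac A" by (simp add: fa_one_sc)
lemma fac_gen [simp, intro]: "x \<in> A \<Longrightarrow> gen x \<in> fac A" by (simp add: gen_mon)

lemma fac_sum [simp, intro]: "(\<And>i. i \<in> I \<Longrightarrow> f i \<in> fac A) \<Longrightarrow> sum f I \<in> fac A"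
  by (induction I rule: infinite_finite_induct) auto

lemma fac_fpow [simp, intro]: "f \<in> fac A \<Longrightarrow> fpow f N \<in> fac A"
  unfolding fpow_def by (induction N) auto

lemma mon_mult: "mon c v \<star> mon d w = mon (c * d) (v @ w)"
proof
  fix x
  have "(mon c v \<star> mon d w) x = (\<Sum>i\<le>length x. if i = length v \<and> x = v @ w then c * d else 0)"
    unfolding fa_mult_def mon_def
  proof (rule sum.cong[OF refl])
    fix i assume "i \<in> {..length x}"
    then have "take i x = v \<and> drop i x = w \<longleftrightarrow> i = length v \<and> x = v @ w" by auto
    then show "(if take i x = v then c else 0) * (if drop i x = w then d else 0)
      = (if i = length v \<and> x = v @ w then c * d else 0)" by auto
  qed
  also have "\<dots> = mon (c * d) (v @ w) x"
    by (cases "x = v @ w") (auto simp: mon_def)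
  finally show "(mon c v \<star> mon d w) x = mon (c * d) (v @ w) x" .
qed

text \<open>The restrictions of f to finite subsets of its support are built up one word at a
  time.\<close>

lemma fac_add_induct [consumes 1, case_names mon add]:
  assumes f: "f \<in> fac A" and mon: "\<And>c w. set w \<subseteq> A \<Longrightarrow> P (mon c w)"
    and add: "\<And>f g. f \<in> fac A \<Longrightarrow> g \<in> fac A \<Longrightarrow> P f \<Longrightarrow> P g \<Longrightarrow> P (f + g)"
  shows "P f"
proof -
  define r where "r W = (\<lambda>v. if v \<in> W then f v else 0)" for W
  have "P (r W) \<and> r W \<in> fac A" if "finite W" "W \<subseteq> {w. f w \<noteq> 0}" for W
    using that
  proof (induction W)
    case empty
    have "r {} = mon 0 []" by (auto simp: r_def mon_def)
    then show ?case using mon[of "[]" 0] by simp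
  next
    case (insert w W)
    have "set w \<subseteq> A" using insert.prems f by (auto simp: fac_def)
    moreover have "r (insert w W) = mon (f w) w + r W"
      using insert.hyps by (auto simp: r_def mon_def plus_fun_apply)
    ultimately show ?case using insert mon add by auto
  qed
  moreover have "r {w. f w \<noteq> 0} = f" by (auto simp: r_def)
  ultimately show ?thesis using f by (metis (mono_tags, lifting) fac_def mem_Collect_eq order_refl)
qed

lemma fac_induct [consumes 1, case_names sc gen add mult]:
  assumes f: "f \<in> fac A" and sc: "\<And>c. P (sc c)" and gen: "\<And>x. x \<in> A \<Longrightarrow> P (gen x)"
    and add: "\<And>f g. f \<in> fac A \<Longrightarrow> g \<in> fac A \<Longrightarrow> P f \<Longrightarrow> P g \<Longrightarrow> P (f + g)"
    and mult: "\<And>f g. f \<in> fac A \<Longrightarrow> g \<in> fac A \<Longrightarrow> P f \<Longrightarrow> P g \<Longrightarrow> P (f \<star> g)"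
  shows "P f"
  using f
proof (induction rule: fac_add_induct)
  case (mon c w)
  then show ?case
  proof (induction w)
    case Nil then show ?case using sc by (simp add: sc_mon[symmetric])
  next
    case (Cons x w)
    have "mon c (x # w) = gen x \<star> mon c w" by (simp add: gen_mon mon_mult)
    then show ?case using Cons gen mult by simp
  qed
qed (rule add)

lemma ring_free_alg: "Ring.ring (free_alg A :: ('x,'k::field) fa ring)"
proof (intro ringI abelian_groupI monoidI)
  show "\<exists>y\<in>carrier (free_alg A). y \<oplus>\<^bsub>free_alg A\<^esub> x = \<zero>\<^bsub>free_alg A\<^esub>" if "x \<in> carrier (free_alg A)"
    for x :: "('x,'k) fa"
    using that by (intro bexI[of _ "- x"]) auto
qed (auto simp: fa_mult_assoc fa_distrib fa_one_sc sc_mult add.assoc add.commute)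

section \<open>Evaluation homomorphisms\<close>

context scalars
begin

text \<open>The empty word goes to \<open>u\<close>, so that evaluation is unital into the factor of
  \<open>u\<close> although the ring itself has no unit.\<close>

primrec wd :: "('x \<Rightarrow> 'a) \<Rightarrow> 'x list \<Rightarrow> 'a" where
  "wd a [] = u" | "wd a (x # w) = a x * wd a w"

definition ev :: "('x \<Rightarrow> 'a) \<Rightarrow> ('x,'k) fa \<Rightarrow> 'a" where
  "ev a f = (\<Sum>w | f w \<noteq> 0. \<kappa> (f w) * wd a w)"

lemma ev_superset: "finite W \<Longrightarrow> {w. f w \<noteq> 0} \<subseteq> W \<Longrightarrow> ev a f = (\<Sum>w\<in>W. \<kappa> (f w) * wd a w)"
  unfolding ev_def by (rule sum.mono_neutral_left) auto

lemma ev_add: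
  assumes f: "f \<in> fac A" and g: "g \<in> fac A"
  shows "ev a (f + g) = ev a f + ev a g"
proof -
  let ?W = "{w. f w \<noteq> 0} \<union> {w. g w \<noteq> 0}"
  have fin: "finite ?W" using f g by (simp add: fac_def)
  have "ev a (f + g) = (\<Sum>w\<in>?W. \<kappa> ((f + g) w) * wd a w)"
    by (rule ev_superset[OF fin]) (auto simp: plus_fun_apply)
  also have "\<dots> = (\<Sum>w\<in>?W. \<kappa> (f w) * wd a w) + (\<Sum>w\<in>?W. \<kappa> (g w) * wd a w)"
    by (simp add: k_add distrib_right sum.distrib plus_fun_apply)
  also have "\<dots> = ev a f + ev a g"
    by (intro arg_cong2[where f = "(+)"] ev_superset[symmetric] fin) auto
  finally show ?thesis .
qed

lemma ev_mon: "ev a (mon c w) = \<kappa> c * wd a w"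
  by (subst ev_superset[of "{w}"]) (auto simp: mon_def)

lemma ev_0 [simp]: "ev a 0 = 0"
  by (simp add: ev_def)

lemma ev_uminus: "f \<in> fac A \<Longrightarrow> ev a (- f) = - ev a f"
  using ev_add[of f A "- f" a] by (simp add: add_eq_0_iff)

lemma ev_minus: "f \<in> fac A \<Longrightarrow> g \<in> fac A \<Longrightarrow> ev a (f - g) = ev a f - ev a g"
  using ev_add[of f A "- g" a] ev_uminus[of g A a] by simp

lemma ev_sum: "(\<And>i. i \<in> I \<Longrightarrow> f i \<in> fac A) \<Longrightarrow> ev a (sum f I) = (\<Sum>i\<in>I. ev a (f i))"
proof (induction I rule: infinite_finite_induct)
  case (insert i I)
  then show ?case using ev_add[of "f i" A "sum f I" a] by simp
qed simp_all

lemma ev_sc: "ev a (sc c) = \<kappa> c"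
  by (simp add: sc_mon ev_mon)

lemma ev_one: "ev a fa_one = u"
  by (simp add: fa_one_sc ev_sc)

context
  fixes a :: "'x \<Rightarrow> 'a" and A :: "'x set"
  assumes u_a: "\<And>x. x \<in> A \<Longrightarrow> u * a x = a x"
begin

lemma ev_gen: "x \<in> A \<Longrightarrow> ev a (gen x) = a x"
  by (simp add: gen_mon ev_mon u_right[OF u_a] u_a)

lemma u_wd: "set w \<subseteq> A \<Longrightarrow> u * wd a w = wd a w"
  by (cases w) (simp_all add: mult.assoc[symmetric] u_a)

lemma wd_append: "set v \<subseteq> A \<Longrightarrow> set w \<subseteq> A \<Longrightarrow> wd a (v @ w) = wd a v * wd a w"
  by (induction v) (simp_all add: u_wd mult.assoc)

lemma ev_mult:
  assumes f: "f \<in> fac A" and g: "g \<in> fac A"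
  shows "ev a (f \<star> g) = ev a f * ev a g"
  using f
proof (induction rule: fac_add_induct)
  case (mon c v)
  show ?case using g
  proof (induction rule: fac_add_induct)
    case (mon d w)
    then show ?case using \<open>set v \<subseteq> A\<close> k_left_commute[of "wd a v" d]
      by (simp add: mon_mult ev_mon k_mult wd_append mult.assoc)
  next
    case (add f g)
    then show ?case using mon ev_add[of "mon c v \<star> f" A "mon c v \<star> g" a] ev_add[of f A g a]
      by (simp add: fa_distrib distrib_left)
  qed
next
  case (add f h)
  then show ?case using g ev_add[of "f \<star> g" A "h \<star> g" a] ev_add[of f A h a]
    by (simp add: fa_distrib distrib_right)
qed

lemma ev_fpow: "f \<in> fac A \<Longrightarrow> ev a (fpow f N) = ((*) (ev a f) ^^ N) u"
proof (induction N)
  case (Suc N)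
  have "fpow f (Suc N) = f \<star> fpow f N" by (simp add: fpow_def)
  then show ?case using Suc ev_mult[of f "fpow f N"] by simp
qed (simp add: fpow_def ev_one)

end

end

section \<open>Presented algebras\<close>

locale presentation =
  fixes A :: "'x set" and rels :: "('x,'k::field) fa set"
  assumes rels: "rels \<subseteq> fac A"
begin

definition I :: "('x,'k) fa set" where "I = genideal (free_alg A) rels"

abbreviation P :: "(('x,'k) fa set) ring" where "P \<equiv> presented A rels"

abbreviation pc :: "('x,'k) fa \<Rightarrow> ('x,'k) fa set" where "pc \<equiv> cls A rels"

lemma ideal_I: "ideal I (free_alg A)"
  unfolding I_def using ring.genideal_ideal[OF ring_free_alg, of rels] rels by simp

lemma ring_P: "Ring.ring P"
  unfolding presented_def using ideal.quotient_is_ring[OF ideal_I] by (simp add: I_def)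

lemma pc_hom: "pc \<in> ring_hom (free_alg A) P"
  unfolding presented_def cls_def[abs_def] using ideal.rcos_ring_hom[OF ideal_I] by (simp add: I_def)

lemma pc_carrier: "f \<in> fac A \<Longrightarrow> pc f \<in> carrier P"
  using ring_hom_closed[OF pc_hom] by simp

lemma pc_add: "f \<in> fac A \<Longrightarrow> g \<in> fac A \<Longrightarrow> pc (f + g) = pc f \<oplus>\<^bsub>P\<^esub> pc g"
  using ring_hom_add[OF pc_hom] by simp

lemma pc_mult: "f \<in> fac A \<Longrightarrow> g \<in> fac A \<Longrightarrow> pc (f \<star> g) = pc f \<otimes>\<^bsub>P\<^esub> pc g"
  using ring_hom_mult[OF pc_hom] by simp

lemma pc_one: "pc fa_one = \<one>\<^bsub>P\<^esub>"
  using ring_hom_one[OF pc_hom] by simp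

lemma pc_0: "pc 0 = \<zero>\<^bsub>P\<^esub>"
  using ring_hom_zero[OF pc_hom ring_free_alg ring_P] by simp

lemma carrier_P: "x \<in> carrier P \<Longrightarrow> \<exists>f\<in>fac A. x = pc f"
  unfolding presented_def FactRing_def cls_def A_RCOSETS_def' by auto

lemma pc_eq_iff: "f \<in> fac A \<Longrightarrow> g \<in> fac A \<Longrightarrow> pc f = pc g \<longleftrightarrow> f - g \<in> I"
proof -
  assume f: "f \<in> fac A" and g: "g \<in> fac A"
  interpret F: Ring.ring "free_alg A :: ('x,'k) fa ring" by (rule ring_free_alg)
  have "\<ominus>\<^bsub>free_alg A\<^esub> g = - g"
    by (rule F.minus_equality) (use g in auto)
  then have "f \<ominus>\<^bsub>free_alg A\<^esub> g = f - g" by (simp add: a_minus_def)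
  then show ?thesis
    using ring.quotient_eq_iff_same_a_r_cos[OF ring_free_alg ideal_I, of f g] f g by (simp add: cls_def I_def)
qed

lemma pc_rel: "f \<in> rels \<Longrightarrow> pc f = \<zero>\<^bsub>P\<^esub>"
proof -
  assume f: "f \<in> rels"
  then have "f \<in> I" unfolding I_def using ring.genideal_self[OF ring_free_alg, of rels] rels by auto
  then have "pc f = pc 0" using f rels by (subst pc_eq_iff) auto
  then show ?thesis by (simp add: pc_0)
qed

text \<open>All calculations with classes pass through this map from the free algebra into the
  type-class ring; by \<open>em_inj\<close> it separates different classes.\<close>

definition em :: "('x,'k) fa \<Rightarrow> ('x,'k) fa set big" where "em f = emb P (pc f)"

lemma em_add: "f \<in> fac A \<Longrightarrow> g \<in> fac A \<Longrightarrow> em (f + g) = em f + em g"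
  unfolding em_def by (simp add: pc_add emb_add[OF ring_P] pc_carrier)

lemma em_mult: "f \<in> fac A \<Longrightarrow> g \<in> fac A \<Longrightarrow> em (f \<star> g) = em f * em g"
  unfolding em_def by (simp add: pc_mult emb_mult[OF ring_P] pc_carrier)

lemma em_rel: "f \<in> rels \<Longrightarrow> em f = 0"
  unfolding em_def by (simp add: pc_rel emb_zero[OF ring_P])

definition sk :: "'k \<Rightarrow> ('x,'k) fa set big" where "sk c = em (sc c)"

lemma scalars_sk: "scalars sk"
proof
  show "sk (a + b) = sk a + sk b" for a b
  proof -
    have "sc (a + b) = (sc a + sc b :: ('x,'k) fa)" by (auto simp: sc_def plus_fun_apply)
    then show ?thesis by (simp add: sk_def em_add)
  qed
  show "sk (a * b) = sk a * sk b" for a b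
  proof -
    have "sc (a * b) = (sc a \<star> sc b :: ('x,'k) fa)" by (simp add: sc_mult) (auto simp: sc_def)
    then show ?thesis by (simp add: sk_def em_mult)
  qed
  \<comment> \<open>Here x is any element of the product ring; by \<open>emb_mult_big\<close> only
    its component in the presented algebra matters, and there constants are central.\<close>
  show "x * sk a = sk a * x" for x a
  proof -
    obtain f where f: "f \<in> fac A" "Rep_big x P = pc f"
      using carrier_P[OF Rep_big_carrier[OF ring_P]] by blast
    have "pc f \<otimes>\<^bsub>P\<^esub> pc (sc a) = pc (sc a) \<otimes>\<^bsub>P\<^esub> pc f"
      using f by (simp add: pc_mult[symmetric] sc_mult)
    then show ?thesis
      unfolding sk_def em_def by (simp add: emb_mult_big[OF ring_P] pc_carrier f)
  qed
qed

sublocale scalars sk by (rule scalars_sk)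

lemma u_em: "f \<in> fac A \<Longrightarrow> u * em f = em f"
proof -
  assume "f \<in> fac A"
  then have "sk 1 * em f = em (sc 1 \<star> f)" by (simp add: sk_def em_mult)
  then show ?thesis by (simp add: sc_mult)
qed

lemma em_eq_ev:
  assumes "f \<in> fac A"
  shows "em f = ev (\<lambda>x. em (gen x)) f"
  using assms
proof (induction rule: fac_induct)
  case (sc c) show ?case by (subst ev_sc) (rule sk_def[symmetric])
next
  case (gen x) then show ?case by (subst ev_gen[where A = A]) (auto simp: u_em)
next
  case (add f g) then show ?case by (simp add: em_add ev_add[of f A g])
next
  case (mult f g) then show ?case by (simp add: em_mult ev_mult[of A _ f g] u_em)
qed

lemma em_inj: "f \<in> fac A \<Longrightarrow> g \<in> fac A \<Longrightarrow> em f = em g \<Longrightarrow> pc f = pc g"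
  unfolding em_def by (rule emb_inj[OF ring_P]) (auto simp: pc_carrier)

text \<open>Projection to the factor of the presented algebra: elements fixed by \<open>u\<close>
  thereby acquire representatives in the free algebra.\<close>

lemma big_em: obtains f where "f \<in> fac A" "u * x = em f" "Rep_big x P = pc f"
proof -
  obtain f where f: "f \<in> fac A" "Rep_big x P = pc f"
    using carrier_P[OF Rep_big_carrier[OF ring_P]] by blast
  have "u * x = emb P (pc (sc 1) \<otimes>\<^bsub>P\<^esub> pc f)"
    unfolding sk_def em_def by (simp add: emb_mult_big[OF ring_P] pc_carrier f)
  also have "\<dots> = em f" using f by (simp add: em_def pc_mult[symmetric] sc_mult)
  finally show thesis using f that by blast
qed

text \<open>Commutation with the generators extends to the factor, and to the whole product ring
  because c = u c replaces any x by its projection.\<close>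

lemma central:
  assumes c: "u * c = c" and gens: "\<And>x. x \<in> A \<Longrightarrow> em (gen x) * c = c * em (gen x)"
  shows "x * c = c * x"
proof -
  have "em f * c = c * em f" if "f \<in> fac A" for f
    using that
  proof (induction rule: fac_induct)
    case (sc a) then show ?case using k_central[of c a] by (simp add: sk_def)
  next
    case (add f g) then show ?case by (simp add: em_add distrib_left distrib_right)
  next
    case (mult f g) then show ?case by (simp add: em_mult) (metis mult.assoc)
  qed (rule gens)
  moreover obtain f where "f \<in> fac A" "u * x = em f" by (rule big_em)
  ultimately have "u * x * c = c * (u * x)" by simp
  then show ?thesis using c by (metis k_central mult.assoc)
qed

text \<open>The kernel of evaluation is an ideal containing the relations. The induced map is made
  total on the product ring by first projecting to the factor, which gives a map between type-class
  rings.\<close>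

lemma universal:
  fixes \<kappa> :: "'k \<Rightarrow> 'r::ring"
  assumes \<kappa>: "scalars \<kappa>" and a: "\<And>x. x \<in> A \<Longrightarrow> \<kappa> 1 * a x = a x"
    and r: "\<And>f. f \<in> rels \<Longrightarrow> scalars.ev \<kappa> a f = 0"
  obtains h :: "('x,'k) fa set big \<Rightarrow> 'r" where "\<And>x y. h (x + y) = h x + h y" "\<And>x y. h (x * y) = h x * h y"
    "\<And>f. f \<in> fac A \<Longrightarrow> h (em f) = scalars.ev \<kappa> a f"
proof -
  interpret T: scalars \<kappa> by (rule \<kappa>)
  interpret F: Ring.ring "free_alg A :: ('x,'k) fa ring" by (rule ring_free_alg)
  let ?K = "{f \<in> fac A. T.ev a f = 0}"
  have inv: "inv\<^bsub>add_monoid (free_alg A)\<^esub> f = - f" if "f \<in> fac A" for f :: "('x,'k) fa"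
    using F.minus_equality[of "- f" f] that unfolding a_inv_def by auto
  have "ideal ?K (free_alg A)"
  proof (rule idealI[OF ring_free_alg])
    show "subgroup ?K (add_monoid (free_alg A))"
    proof (rule subgroup.intro)
      fix f assume f: "f \<in> ?K"
      then show "inv\<^bsub>add_monoid (free_alg A)\<^esub> f \<in> ?K" by (subst inv) (auto simp: T.ev_uminus[of _ A])
    qed (auto simp: T.ev_add[of _ A])
  qed (auto simp: T.ev_mult[OF a])
  then have IK: "I \<subseteq> ?K" unfolding I_def using r rels
    by (intro ring.genideal_minimal[OF ring_free_alg]) auto
  have wd: "T.ev a f = T.ev a g" if "f \<in> fac A" "g \<in> fac A" "pc f = pc g" for f g
    using that IK by (auto simp: pc_eq_iff T.ev_minus[of f A g])
  define h0 where "h0 c = T.ev a (SOME f. f \<in> fac A \<and> pc f = c)" for c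
  have h0: "h0 (pc f) = T.ev a f" if "f \<in> fac A" for f
  proof -
    have "\<exists>g. g \<in> fac A \<and> pc g = pc f" using that by blast
    from someI_ex[OF this] show ?thesis unfolding h0_def using wd that by blast
  qed
  define h where "h x = h0 (Rep_big x P)" for x
  show thesis
  proof (rule that[of h])
    fix x y
    obtain f g where fg: "f \<in> fac A" "Rep_big x P = pc f" "g \<in> fac A" "Rep_big y P = pc g"
      using carrier_P[OF Rep_big_carrier[OF ring_P]] by meson
    show "h (x + y) = h x + h y"
      unfolding h_def Rep_big_simps[OF ring_P] fg using fg(1,3)
      by (simp add: pc_add[symmetric] h0 T.ev_add[of _ A])
    show "h (x * y) = h x * h y"
      unfolding h_def Rep_big_simps[OF ring_P] fg using fg(1,3)
      by (simp add: pc_mult[symmetric] h0 T.ev_mult[OF a])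
  next
    show "h (em f) = T.ev a f" if "f \<in> fac A" for f
      unfolding h_def em_def using that by (simp add: Rep_emb[OF pc_carrier ring_P] h0)
  qed
qed

text \<open>The maps are non-unital, so agreement on scalars is a condition of its own.\<close>

lemma hom_unique:
  fixes h h' :: "('x,'k) fa set big \<Rightarrow> 'r::ring"
  assumes h: "\<And>x y. h (x + y) = h x + h y" "\<And>x y. h (x * y) = h x * h y"
    and h': "\<And>x y. h' (x + y) = h' x + h' y" "\<And>x y. h' (x * y) = h' x * h' y"
    and sc: "\<And>c. h (sk c) = h' (sk c)" and gen: "\<And>x. x \<in> A \<Longrightarrow> h (em (gen x)) = h' (em (gen x))"
    and f: "f \<in> fac A"
  shows "h (em f) = h' (em f)"
  using f
proof (induction rule: fac_induct)
  case (sc c) then show ?case using assms(5) by (simp add: sk_def)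
next
  case (add f g) then show ?case by (simp add: em_add h h')
next
  case (mult f g) then show ?case by (simp add: em_mult h h')
qed (rule gen)

end

section \<open>Polynomials in one element\<close>

context scalars
begin

definition pev :: "'k poly \<Rightarrow> 'a \<Rightarrow> 'a" where
  "pev p x = (\<Sum>k\<le>degree p. \<kappa> (coeff p k) * ((*) x ^^ k) u)"

lemma pev_superset: "degree p \<le> N \<Longrightarrow> pev p x = (\<Sum>k\<le>N. \<kappa> (coeff p k) * ((*) x ^^ k) u)"
  unfolding pev_def by (rule sum.mono_neutral_left) (auto simp: coeff_eq_0)

lemma pev_pCons: "pev (pCons c p) x = \<kappa> c + x * pev p x"
proof -
  have "pev (pCons c p) x = (\<Sum>k\<le>Suc (degree p). \<kappa> (coeff (pCons c p) k) * ((*) x ^^ k) u)"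
    by (rule pev_superset) (rule degree_pCons_le)
  also have "\<dots> = \<kappa> c * u + (\<Sum>k\<le>degree p. \<kappa> (coeff p k) * (x * ((*) x ^^ k) u))"
    by (subst sum.atMost_Suc_shift) simp
  also have "\<dots> = \<kappa> c + x * pev p x" by (simp add: pev_def sum_distrib_left k_left_commute[of x])
  finally show ?thesis .
qed

lemma pev_smult: "pev (smult c p) x = \<kappa> c * pev p x"
  using pev_superset[OF degree_smult_le, of c p x]
  by (simp add: pev_def sum_distrib_left k_mult mult.assoc)

lemma pev_add: "pev (p + p') x = pev p x + pev p' x"
proof -
  let ?N = "max (degree p) (degree p')"
  have "pev (p + p') x = (\<Sum>k\<le>?N. \<kappa> (coeff (p + p') k) * ((*) x ^^ k) u)"
    by (rule pev_superset) (rule degree_add_le_max)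
  also have "\<dots> = pev p x + pev p' x"
    by (simp add: pev_superset[of p ?N] pev_superset[of p' ?N] k_add distrib_right sum.distrib)
  finally show ?thesis .
qed

lemma pev_linear: "pev ([:- s, 1:] * p) x = (x - \<kappa> s) * pev p x"
proof -
  have "[:- s, 1:] * p = smult (- s) p + pCons 0 p" by simp
  then show ?thesis by (simp only: pev_add pev_smult pev_pCons) (simp add: k_minus left_diff_distrib)
qed

lemma pev_prod: "pev (\<Prod>s\<leftarrow>xs. [:- s, 1:]) x = pr xs x u"
proof (induction xs)
  case Nil then show ?case by (simp add: pev_def)
next
  case (Cons s xs) then show ?case using pev_linear[of s "\<Prod>s\<leftarrow>xs. [:- s, 1:]"] by simp
qed

lemma pr_replicate: "pr (replicate N s) x v = ((*) (x - \<kappa> s) ^^ N) v"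
  by (induction N) simp_all

lemma ev_poly_elem:
  assumes a: "\<And>x. x \<in> A \<Longrightarrow> u * a x = a x" and f: "f \<in> fac A"
  shows "ev a (poly_elem f p) = pev p (ev a f)"
proof -
  have "ev a (poly_elem f p) = (\<Sum>k\<le>degree p. ev a (sc (coeff p k) \<star> fpow f k))"
    unfolding poly_elem_def by (rule ev_sum[where A = A]) (use f in auto)
  also have "\<dots> = (\<Sum>k\<le>degree p. \<kappa> (coeff p k) * ((*) (ev a f) ^^ k) u)"
    using f by (intro sum.cong refl) (simp add: ev_mult[OF a] ev_fpow[OF a] ev_sc)
  finally show ?thesis by (simp add: pev_def)
qed

end

lemma linear_factors:
  "finite F \<Longrightarrow> \<exists>zs. set zs \<subseteq> F \<and> (\<Prod>i\<in>F. [:- i, 1:] ^ m i) = (\<Prod>s\<leftarrow>zs. [:- s, 1 :: 'k::field:])"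
proof (induction F rule: finite_induct)
  case empty then show ?case by auto
next
  case (insert i F)
  then obtain zs where "set zs \<subseteq> F" "(\<Prod>i\<in>F. [:- i, 1:] ^ m i) = (\<Prod>s\<leftarrow>zs. [:- s, 1:])" by blast
  then show ?case using insert.hyps
    by (intro exI[of _ "replicate (m i) i @ zs"]) (auto simp: prod_list_replicate split: if_splits)
qed

text \<open>The factors of the root \<open>s\<close> are put last because the last entry of a list
  acts first on a vector.\<close>

lemma cyc_poly_factors:
  assumes "finite {i \<in> S. m i \<noteq> 0}" "s \<in> S"
  shows "\<exists>zs. set zs \<subseteq> {i \<in> S. m i \<noteq> 0} - {s} \<and>
    cyc_poly S m = (\<Prod>t\<leftarrow>zs @ replicate (m s) s. [:- t, 1 :: 'k::field:])"
proof -
  let ?F = "{i \<in> S. m i \<noteq> 0}"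
  obtain zs where zs: "set zs \<subseteq> ?F - {s}" "(\<Prod>i\<in>?F - {s}. [:- i, 1:] ^ m i) = (\<Prod>t\<leftarrow>zs. [:- t, 1:])"
    using linear_factors[of "?F - {s}" m] assms(1) by blast
  have "cyc_poly S m = (\<Prod>i\<in>?F - {s}. [:- i, 1:] ^ m i) * [:- s, 1:] ^ m s"
  proof (cases "m s = 0")
    case True
    then have "?F - {s} = ?F" by auto
    then show ?thesis using True by (simp add: cyc_poly_def)
  next
    case False
    then have "s \<in> ?F" using assms(2) by simp
    then show ?thesis unfolding cyc_poly_def using prod.remove[OF assms(1)] by (simp add: mult.commute)
  qed
  then show ?thesis using zs by (intro exI[of _ zs]) (simp add: prod_list_replicate)
qed

section \<open>Transfer along ring homomorphisms\<close>

locale ring_map =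
  fixes h :: "'a::ring \<Rightarrow> 'b::ring"
  assumes h_add: "h (x + y) = h x + h y" and h_mult: "h (x * y) = h x * h y"
begin

lemma h_0 [simp]: "h 0 = 0" using h_add[of 0 0] by simp
lemma h_uminus: "h (- x) = - h x" using h_add[of x "- x"] by (simp add: add_eq_0_iff)
lemma h_diff: "h (x - y) = h x - h y" using h_add[of x "- y"] h_uminus by simp
lemma h_sum: "h (sum f A) = (\<Sum>i\<in>A. h (f i))"
  by (induction A rule: infinite_finite_induct) (simp_all add: h_add)

lemma h_nil: "nil x v \<Longrightarrow> nil (h x) (h v)"
proof -
  have "h (((*) x ^^ N) v) = ((*) (h x) ^^ N) (h v)" for N
    by (induction N) (simp_all add: h_mult)
  then show "nil x v \<Longrightarrow> nil (h x) (h v)" unfolding nil_def by (metis h_0)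
qed

text \<open>The linking relations determine the Hecke generators from the KLR generators and vice versa,
  because the linear factors relating them are regular.\<close>

lemma link_transfer:
  assumes 1: "hecke_klr \<kappa>1 q n B e1 X1 g1 \<psi>1" and 2: "hecke_klr \<kappa>2 q n B e2 X2 g2 \<psi>2"
    and hk: "\<And>c. h (\<kappa>1 c) = \<kappa>2 c" and he: "\<And>i. i \<in> B \<Longrightarrow> h (e1 i) = e2 i"
    and hX: "\<And>k. k \<in> {1..n} \<Longrightarrow> h (X1 k) = X2 k" and a: "a \<in> {1..<n}"
  shows "h (\<psi>1 a) = \<psi>2 a \<Longrightarrow> h (g1 a) = g2 a" and "h (g1 a) = g2 a \<Longrightarrow> h (\<psi>1 a) = \<psi>2 a"
proof -
  interpret P: hecke_klr \<kappa>1 q n B e1 X1 g1 \<psi>1 by (rule 1)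
  interpret Q: hecke_klr \<kappa>2 q n B e2 X2 g2 \<psi>2 by (rule 2)
  have r: "a \<in> {1..n}" "a + 1 \<in> {1..n}" using a by auto
  have hnn: "h (P.nn a (a + 1)) = Q.nn a (a + 1)"
    by (simp add: P.nn_def Q.nn_def h_diff h_mult hk hX[OF r(1)] hX[OF r(2)])
  then have hNN: "h (P.NN s t a (a + 1)) = Q.NN s t a (a + 1)" for s t
    by (simp add: P.NN_def Q.NN_def hk)
  have eq: "h (g1 a) * e2 i = \<kappa>2 q * e2 i - h (\<psi>1 a) * (\<kappa>2 (inverse (ix i a)) * Q.nn a (a + 1) * e2 i)"
    if "i \<in> B" "ix i a = ix i (a + 1)" for i
    using arg_cong[OF P.link_eq[OF a that], of h] by (simp add: h_mult h_diff hk he[OF that(1)] hnn)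
  have ne: "h (g1 a) * ((X2 a - X2 (a + 1)) * e2 i) + \<kappa>2 (q - inverse q) * X2 (a + 1) * e2 i
      = h (\<psi>1 a) * (Q.NN (ix i a) (ix i (a + 1)) a (a + 1) * e2 i)"
    if "i \<in> B" "ix i a \<noteq> ix i (a + 1)" for i
    using arg_cong[OF P.link_ne[OF a that], of h]
    by (simp add: h_mult h_diff h_add hk he[OF that(1)] hNN hX[OF r(1)] hX[OF r(2)] distrib_right mult.assoc)
  have ne2: "g2 a * ((X2 a - X2 (a + 1)) * e2 i) + \<kappa>2 (q - inverse q) * X2 (a + 1) * e2 i
      = \<psi>2 a * (Q.NN (ix i a) (ix i (a + 1)) a (a + 1) * e2 i)"
    if "i \<in> B" "ix i a \<noteq> ix i (a + 1)" for i
    using Q.link_ne[OF a that] by (simp add: distrib_right mult.assoc)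
  have ug: "\<kappa>2 1 * h (g1 a) = h (g1 a)" using arg_cong[OF P.u_g[OF a], of h] by (simp add: h_mult hk)
  have up: "\<kappa>2 1 * h (\<psi>1 a) = h (\<psi>1 a)" using arg_cong[OF P.u_psi[OF a], of h] by (simp add: h_mult hk)
  show "h (g1 a) = g2 a" if psi: "h (\<psi>1 a) = \<psi>2 a"
  proof (rule Q.eq_on_e[OF ug Q.u_g[OF a]])
    fix i assume i: "i \<in> B"
    show "h (g1 a) * e2 i = g2 a * e2 i"
    proof (cases "ix i a = ix i (a + 1)")
      case True
      then show ?thesis using eq[OF i True] Q.link_eq[OF a i True] psi by simp
    next
      case False
      have "(h (g1 a) - g2 a) * ((X2 a - X2 (a + 1)) * e2 i) = 0"
        using trans[OF ne[OF i False, unfolded psi] ne2[OF i False, symmetric]]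
        unfolding left_diff_distrib[of "h (g1 a)"] by (simp only: add_right_cancel diff_self)
      then have "(h (g1 a) - g2 a) * e2 i = 0" using Q.reg_eq_0[OF Q.reg_diff[OF i r False]] by blast
      then show ?thesis by (simp add: left_diff_distrib)
    qed
  qed
  show "h (\<psi>1 a) = \<psi>2 a" if g: "h (g1 a) = g2 a"
  proof (rule Q.eq_on_e[OF up Q.u_psi[OF a]])
    fix i assume i: "i \<in> B"
    show "h (\<psi>1 a) * e2 i = \<psi>2 a * e2 i"
    proof (cases "ix i a = ix i (a + 1)")
      case True
      have "(h (\<psi>1 a) - \<psi>2 a) * (\<kappa>2 (inverse (ix i a)) * Q.nn a (a + 1) * e2 i) = 0"
        using eq[OF i True] Q.link_eq[OF a i True] g unfolding left_diff_distrib[of "h (\<psi>1 a)"] by simp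
      then have "(h (\<psi>1 a) - \<psi>2 a) * e2 i = 0"
        using Q.reg_eq_0[OF Q.reg_dot_eq'[OF i r(1) r refl True[symmetric]]] by blast
      then show ?thesis by (simp add: left_diff_distrib)
    next
      case False
      have "(h (\<psi>1 a) - \<psi>2 a) * (Q.NN (ix i a) (ix i (a + 1)) a (a + 1) * e2 i) = 0"
        using trans[OF ne[OF i False, unfolded g, symmetric] ne2[OF i False]]
        unfolding left_diff_distrib[of "h (\<psi>1 a)"] by (simp only: diff_self)
      then have "(h (\<psi>1 a) - \<psi>2 a) * e2 i = 0" using Q.reg_eq_0[OF Q.reg_NN[OF i r]] by blast
      then show ?thesis by (simp add: left_diff_distrib)
    qed
  qed
qed

end

context presentation
begin

lemma em_uminus: "f \<in> fac A \<Longrightarrow> em (- f) = - em f"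
  using em_add[of f "- f"] em_add[of 0 0] by (simp add: add_eq_0_iff)

lemma em_minus: "f \<in> fac A \<Longrightarrow> g \<in> fac A \<Longrightarrow> em (f - g) = em f - em g"
  using em_add[of f "- g"] em_uminus[of g] by simp

lemma em_0 [simp]: "em 0 = 0"
  using em_add[of 0 0] by simp

lemma em_sum: "(\<And>i. i \<in> J \<Longrightarrow> f i \<in> fac A) \<Longrightarrow> em (sum f J) = (\<Sum>i\<in>J. em (f i))"
  by (induction J rule: infinite_finite_induct) (simp_all add: em_add)

lemma em_sc: "em (sc c) = sk c"
  by (simp add: sk_def)

lemma em_one: "em fa_one = u"
  by (simp add: fa_one_sc em_sc)

lemma em_fpow: "f \<in> fac A \<Longrightarrow> em (fpow f N) = ((*) (em f) ^^ N) u"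
proof (induction N)
  case (Suc N)
  have "fpow f (Suc N) = f \<star> fpow f N" by (simp add: fpow_def)
  then show ?case using Suc by (simp add: em_mult)
qed (simp add: fpow_def em_one)

lemma em_poly_elem: "f \<in> fac A \<Longrightarrow> em (poly_elem f p) = pev p (em f)"
proof -
  assume f: "f \<in> fac A"
  have "poly_elem f p \<in> fac A" unfolding poly_elem_def using f by auto
  then have "em (poly_elem f p) = ev (\<lambda>x. em (gen x)) (poly_elem f p)" by (rule em_eq_ev)
  also have "\<dots> = pev p (ev (\<lambda>x. em (gen x)) f)" by (rule ev_poly_elem[OF _ f]) (simp add: u_em)
  finally show ?thesis by (simp only: em_eq_ev[OF f])
qed

lemmas em_simps = em_add em_minus em_uminus em_mult em_sc em_one em_fpow

end

section \<open>The two presentations\<close>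

locale cyclotomic =
  fixes q :: "'k::field" and lam :: "'k list" and m :: "'k \<Rightarrow> nat" and n :: nat and \<alpha> :: "'k list set"
  assumes char: "(2::'k) \<noteq> 0"
    and q0: "q \<noteq> 0" and q2: "q^2 \<noteq> 1"
    and lam0: "\<forall>a\<in>set lam. a \<noteq> 0"
    and mfin: "finite {i \<in> Sset q lam. m i \<noteq> 0}"
    and n1: "n \<ge> 1"
    and alpha_sub: "\<alpha> \<subseteq> {i. length i = n \<and> set i \<subseteq> Sset q lam}"
    and alpha_fin: "finite \<alpha>"
    and alpha_orb: "\<forall>i\<in>\<alpha>. \<forall>j. mset j = mset i \<longrightarrow> j \<in> \<alpha>"
begin

abbreviation S :: "'k set" where "S \<equiv> Sset q lam"

lemma S_nz: "0 \<notin> S"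
  using lam0 q0 by (auto simp: Sset_def Ilam_def power_int_minus)

text \<open>Each I_lambda is stable under multiplication by q^2 and q^-2, so
  \<open>roots_exist\<close> keeps the spectra of all X k inside S.\<close>

lemma S_div: "s \<in> S \<Longrightarrow> s / q\<^sup>2 \<in> S" "s \<in> S \<Longrightarrow> s / inverse (q\<^sup>2) \<in> S"
proof -
  have *: "l powi \<epsilon> * q powi (2 * k) / q\<^sup>2 = l powi \<epsilon> * q powi (2 * (k - 1))"
    "l powi \<epsilon> * q powi (2 * k) / inverse (q\<^sup>2) = l powi \<epsilon> * q powi (2 * (k + 1))" for l :: 'k and \<epsilon> k :: int
  proof -
    have "2 * k = 2 * (k - 1) + 2" "2 * (k + 1) = 2 * k + 2" by simp_all
    then have "q powi (2 * k) = q powi (2 * (k - 1)) * q\<^sup>2" "q powi (2 * (k + 1)) = q powi (2 * k) * q\<^sup>2"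
      using power_int_add[of q "2 * (k - 1)" 2] power_int_add[of q "2 * k" 2] q0 by simp_all
    then show "l powi \<epsilon> * q powi (2 * k) / q\<^sup>2 = l powi \<epsilon> * q powi (2 * (k - 1))"
      "l powi \<epsilon> * q powi (2 * k) / inverse (q\<^sup>2) = l powi \<epsilon> * q powi (2 * (k + 1))"
      using q0 by (simp_all add: divide_inverse mult.assoc)
  qed
  have S: "s \<in> S \<longleftrightarrow> (\<exists>l\<in>set lam. \<exists>\<epsilon> k. s = l powi \<epsilon> * q powi (2 * k) \<and> \<epsilon> \<in> {1, - 1})" for s
    by (simp only: Sset_def Ilam_def UN_iff mem_Collect_eq)
  assume "s \<in> S"
  then obtain l \<epsilon> k where l: "l \<in> set lam" "\<epsilon> \<in> {1, - 1}" and s: "s = l powi \<epsilon> * q powi (2 * k)"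
    unfolding S by blast
  show "s / q\<^sup>2 \<in> S"
    unfolding S s by (intro bexI[OF _ l(1)] exI[of _ \<epsilon>] exI[of _ "k - 1"] conjI l(2) *)
  show "s / inverse (q\<^sup>2) \<in> S"
    unfolding S s by (intro bexI[OF _ l(1)] exI[of _ \<epsilon>] exI[of _ "k + 1"] conjI l(2) *)
qed

lemma alpha_swp: "a \<in> {1..<n} \<Longrightarrow> i \<in> \<alpha> \<Longrightarrow> swp a i \<in> \<alpha>"
  using alpha_orb alpha_sub mset_swp[of a n i] by blast

lemma alpha_len: "i \<in> \<alpha> \<Longrightarrow> length i = n"
  using alpha_sub by auto

lemma alpha_ix: "i \<in> \<alpha> \<Longrightarrow> k \<in> {1..n} \<Longrightarrow> ix i k \<in> S"
proof -
  assume i: "i \<in> \<alpha>" and k: "k \<in> {1..n}"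
  have "i ! (k - 1) \<in> set i" using alpha_len[OF i] k by (intro nth_mem) auto
  then show ?thesis using i alpha_sub by (auto simp: ix_def)
qed

lemma alpha_nz: "i \<in> \<alpha> \<Longrightarrow> k \<in> {1..n} \<Longrightarrow> ix i k \<noteq> 0"
  using alpha_ix S_nz by metis

lemma hgens_simps [simp]: "G a \<in> hgens n \<longleftrightarrow> a \<in> {1..<n}" "X k \<in> hgens n \<longleftrightarrow> k \<in> {1..n}"
    "Xi k \<in> hgens n \<longleftrightarrow> k \<in> {1..n}"
  by (auto simp: hgens_def)

lemma rgens_simps [simp]: "Psi a \<in> rgens n \<alpha> \<longleftrightarrow> a \<in> {1..<n}" "Y k \<in> rgens n \<alpha> \<longleftrightarrow> k \<in> {1..n}"
    "E i \<in> rgens n \<alpha> \<longleftrightarrow> i \<in> \<alpha>"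
  by (auto simp: rgens_def)

sublocale HP: presentation "hgens n" "H_rels q S m n"
proof
  have "poly_elem (gen (X 1)) p \<in> fac (hgens n)" for p
    unfolding poly_elem_def using n1 by auto
  then show "H_rels q S m n \<subseteq> fac (hgens n)"
    unfolding H_rels_def by (intro Un_least) auto
qed

sublocale KP: presentation "rgens n \<alpha>" "R_rels q m n \<alpha>"
proof
  have if_in: "(b \<Longrightarrow> x \<in> A) \<Longrightarrow> (\<not> b \<Longrightarrow> z \<in> A) \<Longrightarrow> (if b then x else z) \<in> A"
    for b and x z :: "('k rgen, 'k) fa" and A by simp
  have 1: "psisq q i b \<in> fac (rgens n \<alpha>)" if "b \<in> {1..<n}" "i \<in> \<alpha>" for i b
    unfolding psisq_def Let_def using that by auto
  have 2: "braidrhs q i b \<in> fac (rgens n \<alpha>)" if "1 \<le> b" "b + 2 \<le> n" "i \<in> \<alpha>" for i b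
    unfolding braidrhs_def Let_def
    by (intro if_in fac_mult fac_add fac_minus fac_uminus fac_0 fac_gen) (use that in auto)
  show "R_rels q m n \<alpha> \<subseteq> fac (rgens n \<alpha>)"
    unfolding R_rels_def using 1 2 alpha_swp n1
    by (intro Un_least) (auto simp: sb_def)
qed

abbreviation HX :: "nat \<Rightarrow> (hgen, 'k) fa set big" where "HX k \<equiv> HP.em (gen (X k))"
abbreviation HXi :: "nat \<Rightarrow> (hgen, 'k) fa set big" where "HXi k \<equiv> HP.em (gen (Xi k))"
abbreviation HG :: "nat \<Rightarrow> (hgen, 'k) fa set big" where "HG a \<equiv> HP.em (gen (G a))"

lemma H_rel:
  "i \<in> {1..n} \<Longrightarrow> gen (X i) \<star> gen (Xi i) - fa_one \<in> H_rels q S m n"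
  "i \<in> {1..n} \<Longrightarrow> gen (Xi i) \<star> gen (X i) - fa_one \<in> H_rels q S m n"
  "i \<in> {1..n} \<Longrightarrow> j \<in> {1..n} \<Longrightarrow> gen (X i) \<star> gen (X j) - gen (X j) \<star> gen (X i) \<in> H_rels q S m n"
  "a \<in> {1..<n} \<Longrightarrow> gen (G a) \<star> gen (G a) - (sc (q - inverse q) \<star> gen (G a) + fa_one) \<in> H_rels q S m n"
  "1 \<le> a \<Longrightarrow> a + 1 < n \<Longrightarrow> gen (G a) \<star> gen (G (a+1)) \<star> gen (G a) - gen (G (a+1)) \<star> gen (G a) \<star> gen (G (a+1))
     \<in> H_rels q S m n"
  "a \<in> {1..<n} \<Longrightarrow> c \<in> {1..<n} \<Longrightarrow> a + 1 < c \<or> c + 1 < a \<Longrightarrow>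
     gen (G a) \<star> gen (G c) - gen (G c) \<star> gen (G a) \<in> H_rels q S m n"
  "a \<in> {1..<n} \<Longrightarrow> gen (G a) \<star> gen (X a) \<star> gen (G a) - gen (X (a+1)) \<in> H_rels q S m n"
  "a \<in> {1..<n} \<Longrightarrow> j \<in> {1..n} \<Longrightarrow> j \<noteq> a \<Longrightarrow> j \<noteq> a + 1 \<Longrightarrow> gen (G a) \<star> gen (X j) - gen (X j) \<star> gen (G a)
     \<in> H_rels q S m n"
  "poly_elem (gen (X 1)) (cyc_poly S m) \<in> H_rels q S m n"
  unfolding H_rels_def by blast+

lemma hecke_H: "hecke HP.sk q n HX HG"
proof unfold_locales
  show "q \<noteq> 0" "q\<^sup>2 \<noteq> 1" by (fact q0 q2)+
  show "HP.sk 1 * HX k = HX k" if "k \<in> {1..n}" for k using that by (intro HP.u_em) auto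
  show "HP.sk 1 * HG a = HG a" if "a \<in> {1..<n}" for a using that by (intro HP.u_em) auto
  show "HX k * HX l = HX l * HX k" if "k \<in> {1..n}" "l \<in> {1..n}" for k l
    using HP.em_rel[OF H_rel(3)[OF that]] that by (simp add: HP.em_simps)
  show "HG a * HG a = HP.sk (q - inverse q) * HG a + HP.sk 1" if "a \<in> {1..<n}" for a
    using HP.em_rel[OF H_rel(4)[OF that]] that by (simp add: HP.em_simps)
  show "HG a * HX a * HG a = HX (a + 1)" if "a \<in> {1..<n}" for a
    using HP.em_rel[OF H_rel(7)[OF that]] that by (simp add: HP.em_simps)
  show "HG a * HX k = HX k * HG a" if "a \<in> {1..<n}" "k \<in> {1..n}" "k \<noteq> a" "k \<noteq> a + 1" for a k
    using HP.em_rel[OF H_rel(8)[OF that]] that by (simp add: HP.em_simps)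
  show "HG a * HG c = HG c * HG a" if "a \<in> {1..<n}" "c \<in> {1..<n}" "a + 1 < c \<or> c + 1 < a" for a c
    using HP.em_rel[OF H_rel(6)[OF that]] that by (simp add: HP.em_simps)
  show "HG a * HG (a + 1) * HG a = HG (a + 1) * HG a * HG (a + 1)" if "a \<in> {1..<n}" "a + 1 \<in> {1..<n}" for a
    using HP.em_rel[OF H_rel(5)[of a]] that by (simp add: HP.em_simps)
qed

lemma HXi: "k \<in> {1..n} \<Longrightarrow> HX k * HXi k = HP.sk 1" "k \<in> {1..n} \<Longrightarrow> HXi k * HX k = HP.sk 1"
  using HP.em_rel[OF H_rel(1), of k] HP.em_rel[OF H_rel(2), of k] by (simp_all add: HP.em_simps)

lemma H_cyclotomic: "HP.pev (cyc_poly S m) (HX 1) = 0"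
  using HP.em_rel[OF H_rel(9)] n1 by (simp add: HP.em_poly_elem)

end

section \<open>Verification of the relations\<close>

text \<open>Compares the cyclotomic relation for X 1 with the one for y 1: on the corner of
  \<open>e\<close> the elements X 1 - i_1 and y 1 differ by a scalar, and the corner is
  preserved.\<close>

lemma (in scalars) lpow_affine:
  assumes e: "e * e = e" and x: "\<And>v. e * v = v \<Longrightarrow> x * v = \<kappa> c * (y * v)" and y: "\<And>v. e * v = v \<Longrightarrow> e * (y * v) = y * v"
    and u: "u * e = e"
  shows "((*) x ^^ N) e = \<kappa> (c ^ N) * ((*) y ^^ N) e"
proof -
  have v: "e * ((*) y ^^ N) e = ((*) y ^^ N) e" for N
    by (induction N) (simp_all add: e y)
  show ?thesis
  proof (induction N)
    case (Suc N)
    have "e * (\<kappa> (c ^ N) * ((*) y ^^ N) e) = \<kappa> (c ^ N) * ((*) y ^^ N) e"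
      using v by (simp add: k_left_commute[of e])
    from x[OF this] show ?case using Suc by (simp add: k_mult mult.assoc k_left_commute[of y])
  qed (simp add: u)
qed

text \<open>On the generalized eigenspace of \<open>a\<close> each factor x - s with s different
  from a is injective.\<close>

lemma (in scalars) pr_cancel:
  assumes "pr zs x v = 0" "nil (x - \<kappa> a) v" "a \<notin> set zs" "u * v = v"
  shows "v = 0"
  using assms
proof (induction zs)
  case (Cons s zs)
  have xx: "x * (x - \<kappa> a) = (x - \<kappa> a) * x" for a by (simp add: algebra_simps k_central[of x])
  have nil: "nil (x - \<kappa> a) (pr zs x v)" for zs
  proof (induction zs)
    case (Cons s zs)
    have "(x - \<kappa> s) * (x - \<kappa> a) = (x - \<kappa> a) * (x - \<kappa> s)"
      using k_mult[of a s] k_mult[of s a] by (simp add: algebra_simps k_central[of x])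
    then show ?case using Cons by (simp add: nil_mult_left)
  qed (simp add: assms)
  have "(\<kappa> (a - s) + (x - \<kappa> a)) * pr zs x v = 0" using Cons.prems(1) by (simp add: k_diff)
  then have "pr zs x v = 0" using nil_cancel[OF nil, of "a - s" zs] Cons.prems pr_u by simp
  then show ?case using Cons by simp
qed simp

context hecke_klr
begin

definition yy :: "nat \<Rightarrow> 'a" where
  "yy k = (\<Sum>i\<in>B. e i - \<kappa> (inverse (ix i k)) * (X k * e i))"

lemma yy_at: "i \<in> B \<Longrightarrow> k \<in> {1..n} \<Longrightarrow> yy k * e i = e i - \<kappa> (inverse (ix i k)) * (X k * e i)"
  unfolding yy_def by (rule sum_at) (simp_all add: mult.assoc left_diff_distrib e_idem)

lemma yy_vec: "i \<in> B \<Longrightarrow> k \<in> {1..n} \<Longrightarrow> e i * v = v \<Longrightarrow> yy k * v = v - \<kappa> (inverse (ix i k)) * (X k * v)"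
proof -
  assume i: "i \<in> B" and k: "k \<in> {1..n}" and v: "e i * v = v"
  have "yy k * v = yy k * e i * v" by (simp add: mult.assoc v)
  then show ?thesis unfolding yy_at[OF i k] by (simp add: mult.assoc left_diff_distrib v)
qed

lemma X_yy: "i \<in> B \<Longrightarrow> k \<in> {1..n} \<Longrightarrow> X k * e i = \<kappa> (ix i k) * (e i - yy k * e i)"
proof -
  assume i: "i \<in> B" and k: "k \<in> {1..n}"
  have "\<kappa> (ix i k) * (\<kappa> (inverse (ix i k)) * (X k * e i)) = u * (X k * e i)"
    by (simp add: mult.assoc[symmetric] k_inverse'[OF nz[OF i k]])
  then show ?thesis unfolding yy_at[OF i k] by (simp add: u_mult_left[OF u_e[OF i]])
qed

lemma u_yy: "k \<in> {1..n} \<Longrightarrow> u * yy k = yy k"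
  unfolding yy_def sum_distrib_left
  by (intro sum.cong refl) (simp add: right_diff_distrib u_e mult.assoc[symmetric])

lemma yy_e: "k \<in> {1..n} \<Longrightarrow> i \<in> B \<Longrightarrow> yy k * e i = e i * yy k"
proof -
  assume k: "k \<in> {1..n}" and i: "i \<in> B"
  show ?thesis
  proof (rule eq_on_e)
    show "u * (yy k * e i) = yy k * e i" "u * (e i * yy k) = e i * yy k"
      using u_mult_right u_mult_left u_yy[OF k] by auto
    fix j assume j: "j \<in> B"
    have "e i * (X k * e j) = X k * (e i * e j)" using X_e[OF k i] by (metis mult.assoc)
    then have L: "e i * yy k * e j = e i * e j - \<kappa> (inverse (ix j k)) * (X k * (e i * e j))"
      using yy_at[OF j k] by (simp add: mult.assoc right_diff_distrib k_left_commute[of "e i"])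
    show "yy k * e i * e j = e i * yy k * e j"
      unfolding L unfolding mult.assoc e_e[OF i j] using yy_at[OF j k] by auto
  qed
qed

lemma psi_X_vec:
  assumes a: "a \<in> {1..<n}" and j: "j \<in> {1..n}" and i: "i \<in> B"
  shows "\<psi> a * (X j * e i) = X (sb a j) * (\<psi> a * e i) + (if ix i a = ix i (a + 1)
    then if j = a then \<kappa> (ix i a) * e i else if j = a + 1 then - (\<kappa> (ix i a) * e i) else 0 else 0)"
  using psi_X1[OF a i] psi_X2[OF a i] X_psi_far[OF a j, of "e i"] by (auto simp: sb_def)

text \<open>The direction from Hecke to KLR. The hypothesis \<open>cyc\<close> is already localized
  at \<open>e i\<close>, where the power of X 1 - i_1 is a scalar multiple of that of y 1.\<close>

lemma klr:
  assumes H: "hecke \<kappa> q n X g"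
    and cyc: "\<And>i. i \<in> B \<Longrightarrow> ((*) (X 1 - \<kappa> (ix i 1)) ^^ m (ix i 1)) (e i) = 0" and n1: "1 \<le> n"
  shows "klr \<kappa> q n B e yy \<psi> m"
proof -
  interpret H: hecke \<kappa> q n X g by (rule H)
  show ?thesis
  proof unfold_locales
    show "yy k * yy l = yy l * yy k" if k: "k \<in> {1..n}" and l: "l \<in> {1..n}" for k l
    proof (rule eq_on_e)
      show "u * (yy k * yy l) = yy k * yy l" "u * (yy l * yy k) = yy l * yy k"
        using u_mult_right u_yy k l by auto
      fix i assume i: "i \<in> B"
      have v: "e i * e i = e i" by (rule e_idem[OF i])
      have e1: "e i * (e i - \<kappa> a * (X k * e i)) = e i - \<kappa> a * (X k * e i)" if "k \<in> {1..n}" for a k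
        by (intro vec_diff vec_k vec_X v i that)
      have XX: "X k * (X l * e i) = X l * (X k * e i)" by (rule pc_swap) (intro pc_X k l)+
      have kk: "\<kappa> (inverse (ix i k)) * (\<kappa> (inverse (ix i l)) * w) = \<kappa> (inverse (ix i l)) * (\<kappa> (inverse (ix i k)) * w)" for w
        by (rule k_left_commute)
      show "yy k * yy l * e i = yy l * yy k * e i"
        unfolding mult.assoc yy_at[OF i k] yy_at[OF i l] yy_vec[OF i k e1[OF l]] yy_vec[OF i l e1[OF k]]
        using kk by (simp add: right_diff_distrib k_left_commute[of "X k"] k_left_commute[of "X l"] XX)
    qed
    show "\<kappa> 1 * yy k = yy k" if "k \<in> {1..n}" for k by (rule u_yy[OF that])
    show "yy k * e i = e i * yy k" if "k \<in> {1..n}" "i \<in> B" for k i by (rule yy_e[OF that])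
    show "(\<psi> b * yy j - yy (sb b j) * \<psi> b) * e i = (if j = b \<and> ix i b = ix i (b+1) then - e i
        else if j = b + 1 \<and> ix i b = ix i (b+1) then e i else 0)"
      if b: "b \<in> {1..<n}" and j: "j \<in> {1..n}" and i: "i \<in> B" for b j i
    proof -
      have r: "sb b j \<in> {1..n}" by (rule sb_range[OF b j])
      have v: "e i * e i = e i" by (rule e_idem[OF i])
      have ixs: "ix (swp b i) (sb b j) = ix i j" using ix_swp[OF b len[OF i] r] by simp
      have ii: "\<kappa> (inverse (ix i j)) * (\<kappa> (ix i j) * e i) = e i"
        using k_inverse[OF nz[OF i j]] u_e[OF i] by (simp add: mult.assoc[symmetric])
      have "\<psi> b * (yy j * e i) - yy (sb b j) * (\<psi> b * e i)
        = - (\<kappa> (inverse (ix i j)) * (\<psi> b * (X j * e i) - X (sb b j) * (\<psi> b * e i)))"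
        unfolding yy_at[OF i j] yy_vec[OF swp_B[OF b i] r vec_psi[OF b i v]] ixs
        by (simp add: right_diff_distrib k_left_commute[of "\<psi> b"])
      then show ?thesis unfolding psi_X_vec[OF b j i]
        using ii by (auto simp: left_diff_distrib mult.assoc)
    qed
    show "\<psi> a * \<psi> c = \<psi> c * \<psi> a" if "a \<in> {1..<n}" "c \<in> {1..<n}" "a + 1 < c \<or> c + 1 < a" for a c
      by (rule psi_far[OF that H.g_g_far[OF that]])
    show "\<psi> b * \<psi> b * e i = klr_sq q yy e i b" if "b \<in> {1..<n}" "i \<in> B" for b i
      using psi_square[OF that H.g_quad[OF that(1)]] klr_sq_psi_sq[OF X_yy that(2,1)] by simp
    show "(\<psi> b * \<psi> (b+1) * \<psi> b - \<psi> (b+1) * \<psi> b * \<psi> (b+1)) * e i = klr_braid q yy e i b"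
      if b: "b \<in> {1..<n}" "b + 1 \<in> {1..<n}" and i: "i \<in> B" for b i
      using psi_braid[OF b i H.g_quad H.g_g_braid[OF b]] klr_braid_psi_braid[OF X_yy i b] by simp
    show "((*) (yy 1) ^^ m (ix i 1)) (e i) = 0" if i: "i \<in> B" for i
    proof -
      have k: "1 \<in> {1..n}" using n1 by auto
      have "((*) (yy 1) ^^ m (ix i 1)) (e i) = \<kappa> ((- inverse (ix i 1)) ^ m (ix i 1)) * ((*) (X 1 - \<kappa> (ix i 1)) ^^ m (ix i 1)) (e i)"
      proof (rule lpow_affine)
        show "e i * e i = e i" "u * e i = e i" using e_idem u_e i by auto
        fix v assume v: "e i * v = v"
        have uv: "u * v = v" by (rule e_vec_u[OF i v])
        have "\<kappa> (inverse (ix i 1)) * (\<kappa> (ix i 1) * v) = v"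
          using k_inverse[OF nz[OF i k]] uv by (simp add: mult.assoc[symmetric])
        then show "yy 1 * v = \<kappa> (- inverse (ix i 1)) * ((X 1 - \<kappa> (ix i 1)) * v)"
          unfolding yy_vec[OF i k v] by (simp add: k_minus left_diff_distrib right_diff_distrib)
        show "e i * ((X 1 - \<kappa> (ix i 1)) * v) = (X 1 - \<kappa> (ix i 1)) * v"
          by (intro vec_pc pc_diff pc_X pc_k k i v)
      qed
      then show ?thesis using cyc[OF i] by simp
    qed
  qed (use q0 q2 len swp_B nz u_psi psi_e in auto)
qed

end

context klr
begin

definition asg :: "'k rgen \<Rightarrow> 'a" where
  "asg x = (case x of Psi a \<Rightarrow> \<psi> a | Y k \<Rightarrow> y k | E i \<Rightarrow> e i)"

lemma asg_simps [simp]: "asg (Psi a) = \<psi> a" "asg (Y k) = y k" "asg (E i) = e i"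
  by (simp_all add: asg_def)

lemma gens: "Psi a \<in> rgens n B \<longleftrightarrow> a \<in> {1..<n}" "Y k \<in> rgens n B \<longleftrightarrow> k \<in> {1..n}" "E i \<in> rgens n B \<longleftrightarrow> i \<in> B"
  by (auto simp: rgens_def)

lemma u_asg: "x \<in> rgens n B \<Longrightarrow> u * asg x = asg x"
  by (cases x) (auto simp: gens u_psi' u_y u_e)

lemmas ev_simps = ev_add[where A = "rgens n B"] ev_minus[where A = "rgens n B"] ev_uminus[where A = "rgens n B"]
  ev_mult[OF u_asg] ev_gen[OF u_asg] ev_sc ev_one ev_fpow[OF u_asg] gens

lemma ev_relations: "1 \<le> n \<Longrightarrow> f \<in> R_rels q m n B \<Longrightarrow> ev asg f = 0"
proof -
  assume n1: "1 \<le> n"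
  have 1: "ev asg ((\<Sum>i\<in>B. gen (E i)) - fa_one) = 0"
  proof -
    have "ev asg (\<Sum>i\<in>B. gen (E i)) = (\<Sum>i\<in>B. ev asg (gen (E i)))"
      by (rule ev_sum[where A = "rgens n B"]) (simp add: gens)
    also have "\<dots> = u" unfolding sum_e[symmetric] by (intro sum.cong refl) (simp add: ev_simps)
    finally show ?thesis
      by (subst ev_minus[where A = "rgens n B"]) (auto simp: ev_one gens intro!: fac_sum)
  qed
  have 2: "ev asg (gen (E i) \<star> gen (E j) - (if i = j then gen (E i) else 0)) = 0" if "i \<in> B" "j \<in> B" for i j
    using that by (simp add: ev_simps e_e)
  have 3: "ev asg (gen (Y j) \<star> gen (Y k) - gen (Y k) \<star> gen (Y j)) = 0" if "j \<in> {1..n}" "k \<in> {1..n}" for j k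
    using that y_y[OF that] by (simp add: ev_simps)
  have 4: "ev asg (gen (Y j) \<star> gen (E i) - gen (E i) \<star> gen (Y j)) = 0" if "j \<in> {1..n}" "i \<in> B" for j i
    using that y_e[OF that] by (simp add: ev_simps)
  have 5: "ev asg (gen (Psi a) \<star> gen (E i) - gen (E (swp a i)) \<star> gen (Psi a)) = 0" if "a \<in> {1..<n}" "i \<in> B" for a i
    using that psi_e'[OF that] swp_in_B[OF that] by (simp add: ev_simps)
  have 6: "ev asg ((gen (Psi b) \<star> gen (Y j) - gen (Y (sb b j)) \<star> gen (Psi b)) \<star> gen (E i)
        - (if j = b \<and> ix i b = ix i (b+1) then - gen (E i)
           else if j = b + 1 \<and> ix i b = ix i (b+1) then gen (E i) else 0)) = 0"
    if "b \<in> {1..<n}" "j \<in> {1..n}" "i \<in> B" for b j i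
    using that psi_y[OF that] sb_range[OF that(1,2)] by (simp add: ev_simps)
  have 7: "ev asg (gen (Psi a) \<star> gen (Psi c) - gen (Psi c) \<star> gen (Psi a)) = 0"
    if "a \<in> {1..<n}" "c \<in> {1..<n}" "a + 1 < c \<or> c + 1 < a" for a c
    using that psi_psi_far[OF that] by (simp add: ev_simps)
  have 8: "ev asg (gen (Psi b) \<star> gen (Psi b) \<star> gen (E i) - psisq q i b) = 0" if "b \<in> {1..<n}" "i \<in> B" for b i
  proof -
    have r: "b \<in> {1..n}" "b + 1 \<in> {1..n}" using that by auto
    have "psisq q i b \<in> fac (rgens n B) \<and> ev asg (psisq q i b) = klr_sq q y e i b"
      unfolding psisq_def klr_sq_def Let_def using r that by (simp add: ev_simps)
    then show ?thesis using that psi_psi_sq[OF that] by (simp add: ev_simps)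
  qed
  have 9: "ev asg ((gen (Psi b) \<star> gen (Psi (b+1)) \<star> gen (Psi b) - gen (Psi (b+1)) \<star> gen (Psi b) \<star> gen (Psi (b+1)))
        \<star> gen (E i) - braidrhs q i b) = 0" if "1 \<le> b" "b + 2 \<le> n" "i \<in> B" for b i
  proof -
    have b: "b \<in> {1..<n}" "b + 1 \<in> {1..<n}" using that by auto
    have r: "b \<in> {1..n}" "b + 1 \<in> {1..n}" "b + 2 \<in> {1..n}" using that by auto
    have d: "gen (Y (b+2)) - gen (Y (b+1)) - gen (Y (b+1)) \<in> fac (rgens n B)"
      "gen (Y (b+2)) - gen (Y (b+1)) - gen (Y (b+1)) + gen (Y b) \<in> fac (rgens n B)"
      by (intro fac_minus fac_add fac_gen; use r in \<open>simp only: gens\<close>)+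
    have g: "gen (Y k) \<in> fac (rgens n B)" if "k \<in> {1..n}" for k using that by (simp add: gens)
    have "ev asg (gen (Y (b+2)) - gen (Y (b+1)) - gen (Y (b+1)) + gen (Y b)) = y (b+2) - y (b+1) - y (b+1) + y b"
      unfolding ev_add[OF d(1) g[OF r(1)]] ev_minus[OF fac_minus[OF g[OF r(3)] g[OF r(2)]] g[OF r(2)]]
        ev_minus[OF g[OF r(3)] g[OF r(2)]]
      using r by (simp only: ev_gen[OF u_asg] gens asg_simps)
    moreover have e_in: "E i \<in> rgens n B" using that(3) by (simp only: gens)
    ultimately have "braidrhs q i b \<in> fac (rgens n B) \<and> ev asg (braidrhs q i b) = klr_braid q y e i b"
      unfolding braidrhs_def klr_braid_def Let_def
      using d that(3) ev_mult[OF u_asg d(2) fac_gen[OF e_in]]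
      by (auto simp only: ev_simps if_True if_False fac_mult fac_uminus fac_0 fac_gen ev_0 asg_simps split: if_split)
    then show ?thesis using that b psi_psi_braid[OF b that(3)] by (simp add: ev_simps)
  qed
  have 10: "ev asg (fpow (gen (Y 1)) (m (ix i 1)) \<star> gen (E i)) = 0" if "i \<in> B" for i
    using that n1 cyclotomic[OF that] lpow_mult_right[of "m (ix i 1)" "y 1" u "e i"]
    by (simp add: ev_simps u_e)
  assume "f \<in> R_rels q m n B"
  then show ?thesis unfolding R_rels_def
    by (elim UnE singletonE CollectE exE conjE) (simp_all only: 1 2 3 4 5 6 7 8 9 10)
qed

end

context hecke
begin

context
  fixes Y :: "nat \<Rightarrow> 'a"
begin

text \<open>The images \<open>Y\<close> of the inverse generators are a parameter, supplied by
  \<open>inverse_family\<close> when the homomorphism is formed.\<close>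

definition hasg :: "hgen \<Rightarrow> 'a" where
  "hasg x = (case x of G a \<Rightarrow> g a | hgen.X k \<Rightarrow> X k | Xi k \<Rightarrow> Y k)"

lemma hasg_simps [simp]: "hasg (G a) = g a" "hasg (hgen.X k) = X k" "hasg (Xi k) = Y k"
  by (simp_all add: hasg_def)

lemma hgens: "G a \<in> hgens n \<longleftrightarrow> a \<in> {1..<n}" "hgen.X k \<in> hgens n \<longleftrightarrow> k \<in> {1..n}" "Xi k \<in> hgens n \<longleftrightarrow> k \<in> {1..n}"
  by (auto simp: hgens_def)

context
  assumes u_Y: "\<And>k. k \<in> {1..n} \<Longrightarrow> u * Y k = Y k"
    and X_Y: "\<And>k. k \<in> {1..n} \<Longrightarrow> X k * Y k = u" "\<And>k. k \<in> {1..n} \<Longrightarrow> Y k * X k = u"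
    and X_Y_comm: "\<And>k l. k \<in> {1..n} \<Longrightarrow> l \<in> {1..n} \<Longrightarrow> X k * Y l = Y l * X k"
    and Y_Y_comm: "\<And>k l. k \<in> {1..n} \<Longrightarrow> l \<in> {1..n} \<Longrightarrow> Y k * Y l = Y l * Y k"
begin

lemma u_hasg: "x \<in> hgens n \<Longrightarrow> u * hasg x = hasg x"
  by (cases x) (auto simp: hgens u_g' u_X' u_Y)

lemmas hev_simps = ev_add[where A = "hgens n"] ev_minus[where A = "hgens n"] ev_uminus[where A = "hgens n"]
  ev_mult[OF u_hasg] ev_gen[OF u_hasg] ev_sc ev_one ev_fpow[OF u_hasg] hgens

lemma ev_relations:
  assumes n1: "1 \<le> n" and cyc: "pev (cyc_poly S m) (X 1) = 0"
  shows "f \<in> H_rels q S m n \<Longrightarrow> ev hasg f = 0"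
proof -
  have 1: "ev hasg (gen (hgen.X i) \<star> gen (Xi i) - fa_one) = 0" if "i \<in> {1..n}" for i
    using that X_Y by (simp add: hev_simps)
  have 2: "ev hasg (gen (Xi i) \<star> gen (hgen.X i) - fa_one) = 0" if "i \<in> {1..n}" for i
    using that X_Y by (simp add: hev_simps)
  have 3: "ev hasg (gen x \<star> gen y - gen y \<star> gen x) = 0" if "x \<in> hgen.X ` {1..n} \<union> Xi ` {1..n}" "y \<in> hgen.X ` {1..n} \<union> Xi ` {1..n}" for x y
    using that X_Y_comm Y_Y_comm X_X' by (auto simp: hev_simps)
  have 4: "ev hasg (gen (G i) \<star> gen (G i) - (sc (q - inverse q) \<star> gen (G i) + fa_one)) = 0" if "i \<in> {1..<n}" for i
    using that g_quad[OF that] by (simp add: hev_simps)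
  have 5: "ev hasg (gen (G i) \<star> gen (G (i+1)) \<star> gen (G i) - gen (G (i+1)) \<star> gen (G i) \<star> gen (G (i+1))) = 0"
    if "1 \<le> i" "i + 1 < n" for i
    using that g_g_braid[of i] by (simp add: hev_simps)
  have 6: "ev hasg (gen (G i) \<star> gen (G j) - gen (G j) \<star> gen (G i)) = 0"
    if "i \<in> {1..<n}" "j \<in> {1..<n}" "i + 1 < j \<or> j + 1 < i" for i j
    using that g_g_far[OF that] by (simp add: hev_simps)
  have 7: "ev hasg (gen (G i) \<star> gen (hgen.X i) \<star> gen (G i) - gen (hgen.X (i+1))) = 0" if "i \<in> {1..<n}" for i
    using that g_X_g[OF that] by (simp add: hev_simps)
  have 8: "ev hasg (gen (G i) \<star> gen (hgen.X j) - gen (hgen.X j) \<star> gen (G i)) = 0"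
    if "i \<in> {1..<n}" "j \<in> {1..n}" "j \<noteq> i" "j \<noteq> i + 1" for i j
    using that g_X'[OF that] by (simp add: hev_simps)
  have 9: "ev hasg (poly_elem (gen (hgen.X 1)) (cyc_poly S m)) = 0"
  proof -
    have "1 \<in> {1..n}" using n1 by simp
    then have X1: "gen (hgen.X 1) \<in> fac (hgens n)" "ev hasg (gen (hgen.X 1)) = X 1" by (simp_all only: hgens fac_gen ev_gen[OF u_hasg] hasg_simps)
    have "ev hasg (poly_elem (gen (hgen.X 1)) (cyc_poly S m)) = pev (cyc_poly S m) (ev hasg (gen (hgen.X 1)))"
      by (rule ev_poly_elem[OF _ X1(1)]) (rule u_hasg)
    then show ?thesis unfolding X1(2) cyc .
  qed
  assume "f \<in> H_rels q S m n"
  then show ?thesis unfolding H_rels_def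
    by (elim UnE singletonE CollectE exE conjE) (simp_all only: 1 2 3 4 5 6 7 8 9 Un_iff simp_thms)
qed

end

end

end

lemma (in scalars) inverse_commute:
  assumes "x * y = u" "y * x = u" "u * y = y" "u * c = c" "x * c = c * x"
  shows "y * c = c * y"
proof -
  have "y * c = y * c * (x * y)" using assms(1) u_right[OF u_mult_left[OF assms(4)], of y] by simp
  also have "\<dots> = y * (c * x) * y" by (simp only: mult.assoc)
  also have "\<dots> = y * x * (c * y)" by (simp only: assms(5)[symmetric] mult.assoc)
  also have "\<dots> = c * y" using assms(2) u_mult_left[OF assms(3)] by simp
  finally show ?thesis .
qed

text \<open>On each \<open>e i\<close> the element X k is its nonzero label plus a nilpotent part;
  the local inverses are added up.\<close>

lemma (in spectral) inverse_family:
  "\<exists>Y. (\<forall>k\<in>{1..n}. u * Y k = Y k \<and> X k * Y k = u \<and> Y k * X k = u) \<and>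
    (\<forall>k\<in>{1..n}. \<forall>l\<in>{1..n}. X k * Y l = Y l * X k \<and> Y k * Y l = Y l * Y k)"
proof -
  have "\<exists>D. X k * D = e i \<and> u * D = D \<and> (\<forall>t. t * X k = X k * t \<longrightarrow> t * e i = e i * t \<longrightarrow> t * D = D * t)"
    if "k \<in> {1..n}" "i \<in> B" for k i
    using lin_inverse[OF that(2,1,1), of 1 0] nz[OF that(2,1)] u_X[OF that(1)] by auto
  then obtain D where D: "\<And>k i. k \<in> {1..n} \<Longrightarrow> i \<in> B \<Longrightarrow> X k * D k i = e i"
    "\<And>k i. k \<in> {1..n} \<Longrightarrow> i \<in> B \<Longrightarrow> u * D k i = D k i"
    "\<And>k i t. k \<in> {1..n} \<Longrightarrow> i \<in> B \<Longrightarrow> t * X k = X k * t \<Longrightarrow> t * e i = e i * t \<Longrightarrow> t * D k i = D k i * t"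
    by metis
  define Y where "Y k = (\<Sum>i\<in>B. D k i)" for k
  have comm: "t * Y k = Y k * t" if "k \<in> {1..n}" "t * X k = X k * t" "\<And>i. i \<in> B \<Longrightarrow> t * e i = e i * t" for t k
    unfolding Y_def sum_distrib_left sum_distrib_right using D(3) that by (intro sum.cong) auto
  have uY: "u * Y k = Y k" if "k \<in> {1..n}" for k
    unfolding Y_def sum_distrib_left using D(2) that by (intro sum.cong) auto
  have XY: "X k * Y k = u" if "k \<in> {1..n}" for k
    unfolding Y_def sum_distrib_left sum_e[symmetric] using D(1) that by (intro sum.cong) auto
  have XYc: "X k * Y l = Y l * X k" if "k \<in> {1..n}" "l \<in> {1..n}" for k l
    by (rule comm) (use that X_X X_e in auto)
  have eY: "e i * Y k = Y k * e i" if "i \<in> B" "k \<in> {1..n}" for i k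
    by (rule comm) (use that X_e[OF that(2,1)] in \<open>auto simp: e_e\<close>)
  have YY: "Y k * Y l = Y l * Y k" if "k \<in> {1..n}" "l \<in> {1..n}" for k l
    by (rule comm) (use that XYc eY in auto)
  have YX: "Y k * X k = u" if "k \<in> {1..n}" for k using XY[OF that] XYc[OF that that] by simp
  show ?thesis using uY XY YX XYc YY by (intro exI[of _ Y]) blast
qed

lemma (in hecke_klr) sum_X_e: "k \<in> {1..n} \<Longrightarrow> (\<Sum>i\<in>B. X k * e i) = X k"
  using u_right[OF u_X, of k] by (simp add: sum_distrib_left[symmetric] sum_e)

context klr
begin

lemma sum_y_e: "k \<in> {1..n} \<Longrightarrow> (\<Sum>i\<in>B. y k * e i) = y k"
  using u_right[OF u_y, of k] by (simp add: sum_distrib_left[symmetric] sum_e)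

text \<open>Passing from y to \<open>XX\<close> and back returns y; this makes the two homomorphisms
  mutually inverse on the generators y k.\<close>

lemma yy_XX: "k \<in> {1..n} \<Longrightarrow> yy k = y k"
proof -
  assume k: "k \<in> {1..n}"
  have "yy k = (\<Sum>i\<in>B. y k * e i)"
    unfolding yy_def
  proof (rule sum.cong[OF refl])
    fix i assume i: "i \<in> B"
    have "\<kappa> (inverse (ix i k)) * (\<kappa> (ix i k) * (e i - y k * e i)) = e i - y k * e i"
      using k_inverse[OF ix_nz[OF i k]] u_e[OF i] u_mult_left[OF u_e[OF i], of "y k"]
      by (simp add: mult.assoc[symmetric] right_diff_distrib)
    then show "e i - \<kappa> (inverse (ix i k)) * (XX k * e i) = y k * e i" unfolding XX_at[OF i k] by simp
  qed
  then show ?thesis using sum_y_e[OF k] by simp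
qed

lemma XX_cyclotomic_at: "1 \<le> n \<Longrightarrow> i \<in> B \<Longrightarrow> ((*) (XX 1 - \<kappa> (ix i 1)) ^^ m (ix i 1)) (e i) = 0"
proof -
  assume n1: "1 \<le> n" and i: "i \<in> B"
  have k: "1 \<in> {1..n}" using n1 by auto
  have "((*) (XX 1 - \<kappa> (ix i 1)) ^^ m (ix i 1)) (e i) = \<kappa> ((- ix i 1) ^ m (ix i 1)) * ((*) (y 1) ^^ m (ix i 1)) (e i)"
  proof (rule lpow_affine)
    show "e i * e i = e i" "u * e i = e i" using e_idem u_e i by auto
    show "(XX 1 - \<kappa> (ix i 1)) * v = \<kappa> (- ix i 1) * (y 1 * v)" if "e i * v = v" for v
      using XX_vec[OF i k that] by (simp add: left_diff_distrib right_diff_distrib k_minus)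
    show "e i * (y 1 * v) = y 1 * v" if "e i * v = v" for v by (rule y_vec[OF i k that])
  qed
  then show ?thesis using cyclotomic[OF i] by simp
qed

end

context cyclotomic
begin

abbreviation Ke :: "'k list \<Rightarrow> ('k rgen, 'k) fa set big" where "Ke i \<equiv> KP.em (gen (E i))"
abbreviation Ky :: "nat \<Rightarrow> ('k rgen, 'k) fa set big" where "Ky k \<equiv> KP.em (gen (Y k))"
abbreviation Kp :: "nat \<Rightarrow> ('k rgen, 'k) fa set big" where "Kp a \<equiv> KP.em (gen (Psi a))"

lemma R_rel:
  "(\<Sum>i\<in>\<alpha>. gen (E i)) - fa_one \<in> R_rels q m n \<alpha>"
  "i \<in> \<alpha> \<Longrightarrow> i' \<in> \<alpha> \<Longrightarrow> gen (E i) \<star> gen (E i') - (if i = i' then gen (E i) else 0) \<in> R_rels q m n \<alpha>"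
  "k \<in> {1..n} \<Longrightarrow> l \<in> {1..n} \<Longrightarrow> gen (Y k) \<star> gen (Y l) - gen (Y l) \<star> gen (Y k) \<in> R_rels q m n \<alpha>"
  "k \<in> {1..n} \<Longrightarrow> i \<in> \<alpha> \<Longrightarrow> gen (Y k) \<star> gen (E i) - gen (E i) \<star> gen (Y k) \<in> R_rels q m n \<alpha>"
  "a \<in> {1..<n} \<Longrightarrow> i \<in> \<alpha> \<Longrightarrow> gen (Psi a) \<star> gen (E i) - gen (E (swp a i)) \<star> gen (Psi a) \<in> R_rels q m n \<alpha>"
  "b \<in> {1..<n} \<Longrightarrow> j \<in> {1..n} \<Longrightarrow> i \<in> \<alpha> \<Longrightarrow> (gen (Psi b) \<star> gen (Y j) - gen (Y (sb b j)) \<star> gen (Psi b)) \<star> gen (E i)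
        - (if j = b \<and> ix i b = ix i (b+1) then - gen (E i)
           else if j = b + 1 \<and> ix i b = ix i (b+1) then gen (E i) else 0) \<in> R_rels q m n \<alpha>"
  "a \<in> {1..<n} \<Longrightarrow> c \<in> {1..<n} \<Longrightarrow> a + 1 < c \<or> c + 1 < a \<Longrightarrow>
     gen (Psi a) \<star> gen (Psi c) - gen (Psi c) \<star> gen (Psi a) \<in> R_rels q m n \<alpha>"
  "b \<in> {1..<n} \<Longrightarrow> i \<in> \<alpha> \<Longrightarrow> gen (Psi b) \<star> gen (Psi b) \<star> gen (E i) - psisq q i b \<in> R_rels q m n \<alpha>"
  "1 \<le> b \<Longrightarrow> b + 2 \<le> n \<Longrightarrow> i \<in> \<alpha> \<Longrightarrow>
     (gen (Psi b) \<star> gen (Psi (b+1)) \<star> gen (Psi b) - gen (Psi (b+1)) \<star> gen (Psi b) \<star> gen (Psi (b+1)))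
        \<star> gen (E i) - braidrhs q i b \<in> R_rels q m n \<alpha>"
  "i \<in> \<alpha> \<Longrightarrow> fpow (gen (Y 1)) (m (ix i 1)) \<star> gen (E i) \<in> R_rels q m n \<alpha>"
  unfolding R_rels_def by blast+

lemma klr_K: "klr KP.sk q n \<alpha> Ke Ky Kp m"
proof unfold_locales
  show "finite \<alpha>" by (rule alpha_fin)
  show "q \<noteq> 0" "q\<^sup>2 \<noteq> 1" by (fact q0 q2)+
  show "length i = n" if "i \<in> \<alpha>" for i by (rule alpha_len[OF that])
  show "swp a i \<in> \<alpha>" if "a \<in> {1..<n}" "i \<in> \<alpha>" for a i by (rule alpha_swp[OF that])
  show "ix i k \<noteq> 0" if "i \<in> \<alpha>" "k \<in> {1..n}" for i k by (rule alpha_nz[OF that])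
  show "KP.sk 1 * Ky k = Ky k" if "k \<in> {1..n}" for k using that by (intro KP.u_em) auto
  show "KP.sk 1 * Kp a = Kp a" if "a \<in> {1..<n}" for a using that by (intro KP.u_em) auto
  have s: "(\<Sum>i\<in>\<alpha>. gen (E i)) \<in> fac (rgens n \<alpha>)" by (intro fac_sum) auto
  have "KP.em (\<Sum>i\<in>\<alpha>. gen (E i)) = KP.sk 1"
    using KP.em_rel[OF R_rel(1)] s by (simp add: KP.em_simps)
  then show "(\<Sum>i\<in>\<alpha>. Ke i) = KP.sk 1" by (subst (asm) KP.em_sum) auto
  show "Ke i * Ke j = (if i = j then Ke i else 0)" if "i \<in> \<alpha>" "j \<in> \<alpha>" for i j
    using KP.em_rel[OF R_rel(2)[OF that]] that by (auto simp: KP.em_simps split: if_splits)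
  show "Ky k * Ky l = Ky l * Ky k" if "k \<in> {1..n}" "l \<in> {1..n}" for k l
    using KP.em_rel[OF R_rel(3)[OF that]] that by (simp add: KP.em_simps)
  show "Ky k * Ke i = Ke i * Ky k" if "k \<in> {1..n}" "i \<in> \<alpha>" for k i
    using KP.em_rel[OF R_rel(4)[OF that]] that by (simp add: KP.em_simps)
  show "Kp a * Ke i = Ke (swp a i) * Kp a" if "a \<in> {1..<n}" "i \<in> \<alpha>" for a i
    using KP.em_rel[OF R_rel(5)[OF that]] that alpha_swp[OF that] by (simp add: KP.em_simps)
  show "(Kp b * Ky j - Ky (sb b j) * Kp b) * Ke i
      = (if j = b \<and> ix i b = ix i (b+1) then - Ke i else if j = b + 1 \<and> ix i b = ix i (b+1) then Ke i else 0)"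
    if "b \<in> {1..<n}" "j \<in> {1..n}" "i \<in> \<alpha>" for b j i
    using KP.em_rel[OF R_rel(6)[OF that]] that sb_range[OF that(1,2)] by (simp add: KP.em_simps split: if_splits)
  show "Kp a * Kp c = Kp c * Kp a" if "a \<in> {1..<n}" "c \<in> {1..<n}" "a + 1 < c \<or> c + 1 < a" for a c
    using KP.em_rel[OF R_rel(7)[OF that]] that by (simp add: KP.em_simps)
  show "Kp b * Kp b * Ke i = klr_sq q Ky Ke i b" if "b \<in> {1..<n}" "i \<in> \<alpha>" for b i
  proof -
    have r: "b \<in> {1..n}" "b + 1 \<in> {1..n}" using that by auto
    have "psisq q i b \<in> fac (rgens n \<alpha>) \<and> KP.em (psisq q i b) = klr_sq q Ky Ke i b"
      unfolding psisq_def klr_sq_def Let_def using r that by (simp add: KP.em_simps)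
    then show ?thesis using KP.em_rel[OF R_rel(8)[OF that]] that by (simp add: KP.em_simps)
  qed
  show "(Kp b * Kp (b+1) * Kp b - Kp (b+1) * Kp b * Kp (b+1)) * Ke i = klr_braid q Ky Ke i b"
    if b: "b \<in> {1..<n}" "b + 1 \<in> {1..<n}" and i: "i \<in> \<alpha>" for b i
  proof -
    have b2: "1 \<le> b" "b + 2 \<le> n" using b by auto
    have r: "b \<in> {1..n}" "b + 1 \<in> {1..n}" "b + 2 \<in> {1..n}" using b by auto
    have g: "gen (Y k) \<in> fac (rgens n \<alpha>)" if "k \<in> {1..n}" for k using that by simp
    have e: "gen (E i) \<in> fac (rgens n \<alpha>)" using i by simp
    note d1 = fac_minus[OF g[OF r(3)] g[OF r(2)]]
    note d2 = fac_minus[OF d1 g[OF r(2)]]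
    note d3 = fac_add[OF d2 g[OF r(1)]]
    have "KP.em ((gen (Y (b+2)) - gen (Y (b+1)) - gen (Y (b+1)) + gen (Y b)) \<star> gen (E i))
      = (Ky (b+2) - Ky (b+1) - Ky (b+1) + Ky b) * Ke i"
      unfolding KP.em_mult[OF d3 e] KP.em_add[OF d2 g[OF r(1)]] KP.em_minus[OF d1 g[OF r(2)]]
        KP.em_minus[OF g[OF r(3)] g[OF r(2)]] ..
    then have "braidrhs q i b \<in> fac (rgens n \<alpha>) \<and> KP.em (braidrhs q i b) = klr_braid q Ky Ke i b"
      unfolding braidrhs_def klr_braid_def Let_def
      using fac_mult[OF d3 e] e fac_uminus[OF e] KP.em_uminus[OF e]
      by (auto simp only: if_True if_False fac_0 KP.em_0 split: if_split)
    then show ?thesis using KP.em_rel[OF R_rel(9)[OF b2 i]] b i by (simp add: KP.em_simps)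
  qed
  show "((*) (Ky 1) ^^ m (ix i 1)) (Ke i) = 0" if "i \<in> \<alpha>" for i
    using KP.em_rel[OF R_rel(10)[OF that]] that n1 lpow_mult_right[of "m (ix i 1)" "Ky 1" "KP.sk 1" "Ke i"]
    by (simp add: KP.em_simps KP.u_em)
qed

sublocale KK: klr KP.sk q n \<alpha> Ke Ky Kp m by (rule klr_K)

text \<open>Checked on each \<open>e i\<close>: the factor of the polynomial at the label i_1 alone
  already kills \<open>e i\<close>.\<close>

lemma K_cyclotomic: "KP.pev (cyc_poly S m) (KK.XX 1) = 0"
proof -
  have u: "KP.sk 1 * KP.pev (cyc_poly S m) (KK.XX 1) = KP.pev (cyc_poly S m) (KK.XX 1)"
    unfolding KP.pev_def sum_distrib_left by (simp add: mult.assoc[symmetric])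
  show ?thesis
  proof (rule KK.eq_on_e[OF u])
    fix i assume i: "i \<in> \<alpha>"
    let ?s = "ix i 1"
    have "?s \<in> S" using alpha_ix[OF i, of 1] n1 by simp
    from cyc_poly_factors[OF mfin this] obtain zs
      where zs: "cyc_poly S m = (\<Prod>t\<leftarrow>zs @ replicate (m ?s) ?s. [:- t, 1:])" by blast
    have "KP.pev (cyc_poly S m) (KK.XX 1) * Ke i = KP.pr zs (KK.XX 1) (((*) (KK.XX 1 - KP.sk ?s) ^^ m ?s) (KP.sk 1 * Ke i))"
      unfolding zs KP.pev_prod KP.pr_mult_right[symmetric] KP.pr_append KP.pr_replicate lpow_mult_right ..
    then show "KP.pev (cyc_poly S m) (KK.XX 1) * Ke i = 0 * Ke i"
      using KK.XX_cyclotomic_at[OF n1 i] KK.u_e[OF i] by simp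
  qed simp
qed

text \<open>The set S may be infinite, so idempotents are formed only for tuples over a finite part
  \<open>T\<close>. It contains the roots found for every X k, so these idempotents sum to the unit,
  and all entries of \<open>\<alpha>\<close>, so every tuple of \<open>\<alpha>\<close> has an
  idempotent, possibly 0.\<close>

lemma spectral_H:
  obtains T eH where "finite T" "T \<subseteq> S" "(\<Union>i\<in>\<alpha>. set i) \<subseteq> T"
    "spectral HP.sk q n {i. set i \<subseteq> T \<and> length i = n} eH HX"
proof -
  interpret H: hecke HP.sk q n HX HG by (rule hecke_H)
  obtain zs where zs: "set zs \<subseteq> {i\<in>S. m i \<noteq> 0}" "cyc_poly S m = (\<Prod>s\<leftarrow>zs. [:- s, 1:])"
    using linear_factors[OF mfin, of m] unfolding cyc_poly_def by blast
  have 1: "HP.pr zs (HX 1) (HP.sk 1) = 0"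
    using H_cyclotomic unfolding zs(2) HP.pev_prod .
  have zsS: "set zs \<subseteq> S" using zs(1) by auto
  have "\<forall>k\<in>{1..n}. \<exists>xs. set xs \<subseteq> S \<and> HP.pr xs (HX k) (HP.sk 1) = 0"
    using H.roots_exist[OF S_div zsS 1] by blast
  then obtain xs where xs: "\<And>k. k \<in> {1..n} \<Longrightarrow> set (xs k) \<subseteq> S \<and> HP.pr (xs k) (HX k) (HP.sk 1) = 0" by metis
  define T where "T = (\<Union>k\<in>{1..n}. set (xs k)) \<union> (\<Union>i\<in>\<alpha>. set i)"
  have T: "finite T" "T \<subseteq> S" using xs alpha_fin alpha_sub unfolding T_def by fastforce+
  have T0: "0 \<notin> T" using T(2) S_nz by blast
  have "\<exists>xs. set xs \<subseteq> T \<and> HP.pr xs (HX k) (HP.sk 1) = 0" if "k \<in> {1..n}" for k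
    using xs[OF that] that unfolding T_def by (intro exI[of _ "xs k"]) auto
  from HP.spectral_exists[where X = HX and n = n and T = T, OF q0 q2 H.u_X' H.X_X' T(1) T0 this]
  obtain e where "spectral HP.sk q n {i. set i \<subseteq> T \<and> length i = n} e HX" by auto
  then show thesis using that[OF T] unfolding T_def by blast
qed

end

section \<open>The block idempotent and the two homomorphisms\<close>

locale cyclotomic_spectral = cyclotomic q lam m n \<alpha>
  for q :: "'k::field" and lam m n \<alpha> +
  fixes T :: "'k set" and eH :: "'k list \<Rightarrow> (hgen, 'k) fa set big"
  assumes T_S: "T \<subseteq> S" and alpha_T: "(\<Union>i\<in>\<alpha>. set i) \<subseteq> T"
    and spectral_eH: "spectral HP.sk q n {i. set i \<subseteq> T \<and> length i = n} eH HX"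
begin

abbreviation B :: "'k list set" where "B \<equiv> {i. set i \<subseteq> T \<and> length i = n}"

interpretation HS: hecke_spectral HP.sk q n B eH HX HG
  by (intro hecke_spectral.intro hecke_H spectral_eH)

lemma alpha_B: "\<alpha> \<subseteq> B"
  using alpha_T alpha_len by auto

text \<open>This is e_alpha, as \<open>is_e_alpha_iff\<close> confirms.\<close>

definition c :: "(hgen, 'k) fa set big" where "c = (\<Sum>i\<in>\<alpha>. eH i)"

abbreviation hk :: "'k \<Rightarrow> (hgen, 'k) fa set big" where "hk a \<equiv> HP.sk a * c"

lemma u_c: "HP.sk 1 * c = c"
  unfolding c_def sum_distrib_left using HS.u_e alpha_B by (intro sum.cong) auto

lemma c_e: "i \<in> B \<Longrightarrow> c * eH i = (if i \<in> \<alpha> then eH i else 0)"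
  unfolding c_def by (rule HS.sum_e_mult[OF alpha_B])

lemma c_c: "c * c = c"
proof -
  have "c * c = (\<Sum>i\<in>\<alpha>. c * eH i)" by (simp add: c_def sum_distrib_left)
  also have "\<dots> = c" unfolding c_def[of] using c_e alpha_B by (intro sum.cong) (auto simp: c_def)
  finally show ?thesis .
qed

text \<open>For the generators g a and X k this is \<open>sum_e_central\<close>; commutation with X
  k passes to its inverse.\<close>

lemma c_central: "x * c = c * x"
proof (rule HP.central[OF u_c])
  fix x assume x: "x \<in> hgens n"
  have X_c: "HX k * c = c * HX k" if "k \<in> {1..n}" for k
    using HS.sum_e_central(2)[OF alpha_B alpha_swp that] by (simp add: c_def)
  show "HP.em (gen x) * c = c * HP.em (gen x)"
  proof (cases x)
    case (G a) then show ?thesis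
      using HS.sum_e_central(1)[OF alpha_B alpha_swp, of a] x by (simp add: c_def)
  next
    case (X k) then show ?thesis using X_c[of k] x by simp
  next
    case (Xi k)
    then have k: "k \<in> {1..n}" using x by simp
    have "HP.sk 1 * HXi k = HXi k" using k by (intro HP.u_em) auto
    from HP.inverse_commute[OF HXi[OF k] this u_c X_c[OF k]] show ?thesis using Xi by simp
  qed
qed

lemma c_mult: "x * c * (y * c) = x * y * c"
proof -
  have "x * c * (y * c) = x * (c * (y * c))" by (rule mult.assoc)
  also have "c * (y * c) = y * c" by (simp only: c_central[of y] mult.assoc[symmetric] c_c)
  finally show ?thesis by (simp only: mult.assoc)
qed

interpretation HA: hecke_spectral hk q n \<alpha> eH "\<lambda>k. HX k * c" "\<lambda>a. HG a * c"
  by (rule HS.restrict[OF alpha_B alpha_swp c_central c_def])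

text \<open>The whole cyclotomic polynomial kills \<open>eH i\<close>, and its factors at roots
  other than i_1 are injective on this eigenspace, so the power of X 1 - i_1 does so alone.\<close>

lemma H_cyclotomic_at: "i \<in> \<alpha> \<Longrightarrow> ((*) (HX 1 * c - hk (ix i 1)) ^^ m (ix i 1)) (eH i) = 0"
proof -
  assume i: "i \<in> \<alpha>"
  let ?s = "ix i 1"
  let ?x = "HX 1 - HP.sk ?s"
  let ?v = "((*) ?x ^^ m ?s) (eH i)"
  have iB: "i \<in> B" using i alpha_B by auto
  have k: "1 \<in> {1..n}" using n1 by simp
  obtain zs where zs: "set zs \<subseteq> {j\<in>S. m j \<noteq> 0} - {?s}" "cyc_poly S m = (\<Prod>t\<leftarrow>zs @ replicate (m ?s) ?s. [:- t, 1:])"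
    using cyc_poly_factors[OF mfin alpha_ix[OF i k]] by blast
  have "HP.pr zs (HX 1) (((*) ?x ^^ m ?s) (HP.sk 1 * eH i)) = HP.pev (cyc_poly S m) (HX 1) * eH i"
    unfolding zs HP.pev_prod HP.pr_mult_right[symmetric] HP.pr_append HP.pr_replicate lpow_mult_right ..
  then have 1: "HP.pr zs (HX 1) ?v = 0" using H_cyclotomic HS.u_e[OF iB] by simp
  have "nil ?x (((*) ?x ^^ N) (eH i))" for N
    by (induction N) (simp_all add: nil_step_iff HS.nil_X[OF iB k])
  moreover have "HP.sk 1 * ((*) ?x ^^ N) (eH i) = ((*) ?x ^^ N) (eH i)" for N
    by (induction N) (simp_all add: HS.u_e[OF iB] HP.u_mult_left)
  ultimately have "?v = 0" using HP.pr_cancel[OF 1] zs(1) by blast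
  then show ?thesis
    using lpow_mult_central[OF c_central, of "eH i" "m ?s" ?x] c_e[OF iB] i by (simp add: left_diff_distrib)
qed

interpretation HK: hecke_klr hk q n \<alpha> eH "\<lambda>k. HX k * c" "\<lambda>a. HG a * c" HA.psi
  by (rule HA.hecke_klr)

interpretation HC: klr hk q n \<alpha> eH HK.yy HA.psi m
  by (rule HK.klr[OF HA.hecke_axioms H_cyclotomic_at n1])

interpretation KH: hecke KP.sk q n KK.XX KK.gg
  by (rule KK.hecke)

text \<open>The two homomorphisms are only determined on the direct factors HP.P and KP.P, whose unit
  elements are the images of 1 under the scalar embeddings.\<close>

lemma mutually_inverse:
  "\<exists>Th Ps. ring_map Th \<and> ring_map Ps \<and> (\<forall>a. Th (HP.sk a) = KP.sk a) \<and> Th c = KP.sk 1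
    \<and> (\<forall>f\<in>fac (hgens n). Ps (Th (HP.em f)) = HP.em f * c)
    \<and> (\<forall>f\<in>fac (rgens n \<alpha>). Th (Ps (KP.em f)) = KP.em f)"
proof -
  \<comment> \<open>These will be the images of the inverse generators of the Hecke algebra.\<close>
  obtain Y where "\<forall>k\<in>{1..n}. KP.sk 1 * Y k = Y k \<and> KK.XX k * Y k = KP.sk 1 \<and> Y k * KK.XX k = KP.sk 1"
    "\<forall>k\<in>{1..n}. \<forall>l\<in>{1..n}. KK.XX k * Y l = Y l * KK.XX k \<and> Y k * Y l = Y l * Y k"
    using KK.inverse_family by blast
  then have Y: "\<And>k. k \<in> {1..n} \<Longrightarrow> KP.sk 1 * Y k = Y k"
    "\<And>k. k \<in> {1..n} \<Longrightarrow> KK.XX k * Y k = KP.sk 1" "\<And>k. k \<in> {1..n} \<Longrightarrow> Y k * KK.XX k = KP.sk 1"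
    "\<And>k l. k \<in> {1..n} \<Longrightarrow> l \<in> {1..n} \<Longrightarrow> KK.XX k * Y l = Y l * KK.XX k"
    "\<And>k l. k \<in> {1..n} \<Longrightarrow> l \<in> {1..n} \<Longrightarrow> Y k * Y l = Y l * Y k"
    by blast+
  obtain Th where Th: "\<And>x y. Th (x + y) = Th x + Th y" "\<And>x y. Th (x * y) = Th x * Th y"
    "\<And>f. f \<in> fac (hgens n) \<Longrightarrow> Th (HP.em f) = KP.ev (KH.hasg Y) f"
    by (rule HP.universal[OF KP.scalars_sk, where a = "KH.hasg Y"])
      (use KH.u_hasg[OF Y] KH.ev_relations[OF Y n1 K_cyclotomic] in auto)
  obtain Ps where Ps: "\<And>x y. Ps (x + y) = Ps x + Ps y" "\<And>x y. Ps (x * y) = Ps x * Ps y"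
    "\<And>f. f \<in> fac (rgens n \<alpha>) \<Longrightarrow> Ps (KP.em f) = HA.ev HC.asg f"
    by (rule KP.universal[OF HA.scalars_axioms, where a = HC.asg])
      (use HC.u_asg HC.ev_relations[OF n1] in auto)
  interpret Th: ring_map Th by unfold_locales (fact Th)+
  interpret Ps: ring_map Ps by unfold_locales (fact Ps)+
  have Th_sk: "Th (HP.sk a) = KP.sk a" for a
    using Th(3)[of "sc a"] by (simp add: KP.ev_sc HP.sk_def)
  have Th_gen: "Th (HP.em (gen x)) = KH.hasg Y x" if "x \<in> hgens n" for x
    using Th(3)[of "gen x"] that KP.ev_gen[OF KH.u_hasg[OF Y] that] by simp
  have Th_X: "Th (HX k) = KK.XX k" if "k \<in> {1..n}" for k using Th_gen[of "X k"] that by simp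
  have Th_G: "Th (HG a) = KK.gg a" if "a \<in> {1..<n}" for a using Th_gen[of "G a"] that by simp
  have Th_Xi: "Th (HXi k) = Y k" if "k \<in> {1..n}" for k using Th_gen[of "Xi k"] that by simp
  have Ps_sk: "Ps (KP.sk a) = hk a" for a
    using Ps(3)[of "sc a"] by (simp add: HA.ev_sc KP.sk_def)
  have Ps_gen: "Ps (KP.em (gen x)) = HC.asg x" if "x \<in> rgens n \<alpha>" for x
    using Ps(3)[of "gen x"] that HA.ev_gen[OF HC.u_asg that] by simp
  have Ps_e: "Ps (Ke i) = eH i" if "i \<in> \<alpha>" for i using Ps_gen[of "E i"] that by simp
  have Ps_y: "Ps (Ky k) = HK.yy k" if "k \<in> {1..n}" for k using Ps_gen[of "rgen.Y k"] that by simp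
  have Ps_p: "Ps (Kp a) = HA.psi a" if "a \<in> {1..<n}" for a using Ps_gen[of "Psi a"] that by simp

  have Th_v: "KP.sk 1 * Th (eH i) = Th (eH i)" "\<And>k. k \<in> {1..n} \<Longrightarrow> nil (KK.XX k - KP.sk (ix i k)) (Th (eH i))"
    if i: "i \<in> B" for i
  proof -
    show "KP.sk 1 * Th (eH i) = Th (eH i)"
      using arg_cong[OF HS.u_e[OF i], of Th] by (simp add: Th(2) Th_sk)
    show "nil (KK.XX k - KP.sk (ix i k)) (Th (eH i))" if k: "k \<in> {1..n}" for k
      using Th.h_nil[OF HS.nil_X[OF i k]] by (simp add: Th.h_diff Th_X[OF k] Th_sk)
  qed
  \<comment> \<open>The images of the idempotents are not prescribed but determined by the spectrum:
    \<open>Th (eH j)\<close> lies in the eigenspace of j, so \<open>Ke i\<close> singles out j = i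
    in the image of the unit.\<close>
  have Th_e: "Th (eH i) = Ke i" if i: "i \<in> \<alpha>" for i
  proof -
    have iB: "i \<in> B" using i alpha_B by auto
    have 0: "Ke i * Th (eH j) = (if j = i then Th (eH i) else 0)" if j: "j \<in> B" for j
    proof (cases "j = i")
      case True
      then show ?thesis using KK.in_eigenspace(1)[OF i Th_v(1)[OF iB] Th_v(2)[OF iB]] by simp
    next
      case False
      have "Ke i * Th (eH j) = 0"
        by (rule KK.other_eigenspace[OF _ Th_v[OF j] i]) (use j False in auto)
      then show ?thesis using False by simp
    qed
    have "Ke i = Ke i * Th (\<Sum>j\<in>B. eH j)" using HS.sum_e Th_sk KK.e_u[OF i] by simp
    also have "\<dots> = (\<Sum>j\<in>B. if j = i then Th (eH i) else 0)"
      unfolding Th.h_sum sum_distrib_left by (intro sum.cong refl 0)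
    also have "\<dots> = Th (eH i)" using iB HS.fin_B by simp
    finally show ?thesis by simp
  qed
  have Th_c: "Th c = KP.sk 1"
    unfolding c_def Th.h_sum KK.sum_e[symmetric] using Th_e by (intro sum.cong) auto
  have Th_hk: "Th (hk a) = KP.sk a" for a by (simp add: Th(2) Th_sk Th_c)
  have Th_Xc: "Th (HX k * c) = KK.XX k" if "k \<in> {1..n}" for k
    using KP.u_right[OF KK.u_XX[OF that]] by (simp add: Th(2) Th_c Th_X[OF that])
  have Th_Gc: "Th (HG a * c) = KK.gg a" if "a \<in> {1..<n}" for a
    using KP.u_right[OF KH.u_g'[OF that]] by (simp add: Th(2) Th_c Th_G[OF that])
  have Th_yy: "Th (HK.yy k) = Ky k" if k: "k \<in> {1..n}" for k
  proof -
    have "Th (HK.yy k) = KK.yy k"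
      unfolding HK.yy_def KK.yy_def Th.h_sum
    proof (rule sum.cong[OF refl])
      fix i assume "i \<in> \<alpha>"
      then show "Th (eH i - hk (inverse (ix i k)) * (HX k * c * eH i))
          = Ke i - KP.sk (inverse (ix i k)) * (KK.XX k * Ke i)"
        by (simp only: Th.h_diff Th(2)[of "hk (inverse (ix i k))"] Th(2)[of "HX k * c"] Th_hk Th_Xc[OF k] Th_e)
    qed
    then show ?thesis using KK.yy_XX[OF k] by simp
  qed
  have Ps_X: "Ps (KK.XX k) = HX k * c" if k: "k \<in> {1..n}" for k
  proof -
    have "Ps (KK.XX k) = (\<Sum>i\<in>\<alpha>. HX k * c * eH i)"
      unfolding KK.XX_def Ps.h_sum
    proof (rule sum.cong[OF refl])
      fix i assume i: "i \<in> \<alpha>"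
      show "Ps (KP.sk (ix i k) * (Ke i - Ky k * Ke i)) = HX k * c * eH i"
        unfolding HK.X_yy[OF i k] by (simp only: Ps(2) Ps.h_diff Ps_sk Ps_e[OF i] Ps_y[OF k])
    qed
    then show ?thesis using HK.sum_X_e[OF k] by simp
  qed
  have Ps_G: "Ps (KK.gg a) = HG a * c" if a: "a \<in> {1..<n}" for a
    by (rule Ps.link_transfer(1)[OF KK.hecke_klr_axioms HK.hecke_klr_axioms Ps_sk Ps_e Ps_X a Ps_p[OF a]])
  \<comment> \<open>Uniqueness of inverses in the block reduces this to the image of
    \<open>KK.XX k\<close>.\<close>
  have Ps_Xi: "Ps (Y k) = HXi k * c" if k: "k \<in> {1..n}" for k
  proof -
    have u1: "HP.sk 1 * HXi k = HXi k" using k by (intro HP.u_em) auto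
    have "Ps (Y k) = Ps (Y k * KP.sk 1)" using KP.u_right[OF Y(1)[OF k]] by simp
    also have "\<dots> = Ps (Y k) * (HX k * HXi k * c)" by (simp add: Ps(2) Ps_sk HXi[OF k])
    also have "\<dots> = Ps (Y k) * (HX k * c * (HXi k * c))" by (simp only: c_mult)
    also have "\<dots> = Ps (Y k * KK.XX k) * (HXi k * c)" by (simp only: Ps(2) Ps_X[OF k] mult.assoc)
    also have "\<dots> = HXi k * c" unfolding Y(3)[OF k] Ps_sk u_c
      by (simp only: c_central[of "HXi k"] mult.assoc[symmetric] c_c)
    finally show ?thesis .
  qed
  \<comment> \<open>On the whole Hecke algebra the composite is multiplication by c rather than the
    identity, since Th kills the complementary block.\<close>
  have PT: "Ps (Th (HP.em f)) = HP.em f * c" if "f \<in> fac (hgens n)" for f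
  proof (rule HP.hom_unique[where h = "\<lambda>x. Ps (Th x)" and h' = "\<lambda>x. x * c", OF _ _ _ _ _ _ that])
    fix x assume x: "x \<in> hgens n"
    show "Ps (Th (HP.em (gen x))) = HP.em (gen x) * c"
    proof (cases x)
      case (G a) then show ?thesis using x Th_G Ps_G by simp
    next
      case (X k) then show ?thesis using x Th_X Ps_X by simp
    next
      case (Xi k) then show ?thesis using x Th_Xi Ps_Xi by simp
    qed
  qed (simp_all add: Th(1,2) Ps(1,2) Th_sk Ps_sk distrib_right c_mult)
  have TP: "Th (Ps (KP.em f)) = KP.em f" if "f \<in> fac (rgens n \<alpha>)" for f
  proof (rule KP.hom_unique[where h = "\<lambda>x. Th (Ps x)" and h' = "\<lambda>x. x", OF _ _ _ _ _ _ that])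
    fix x assume x: "x \<in> rgens n \<alpha>"
    show "Th (Ps (KP.em (gen x))) = KP.em (gen x)"
    proof (cases x)
      case (Psi a)
      then have a: "a \<in> {1..<n}" using x by simp
      have "Th (HA.psi a) = Kp a"
        by (rule Th.link_transfer(2)[OF HK.hecke_klr_axioms KK.hecke_klr_axioms Th_hk Th_e Th_Xc a Th_Gc[OF a]])
      then show ?thesis using Psi Ps_p[OF a] by simp
    next
      case (Y k) then show ?thesis using x Ps_y Th_yy by simp
    next
      case (E i) then show ?thesis using x Ps_e Th_e by simp
    qed
  qed (simp_all add: Th(1,2) Ps(1,2) Th_sk Th_c Ps_sk KP.k_u)
  show ?thesis using Th.ring_map_axioms Ps.ring_map_axioms Th_sk Th_c PT TP by blast
qed

lemma em_eq_0_iff: "f \<in> fac (hgens n) \<Longrightarrow> HP.em f = 0 \<longleftrightarrow> HP.pc f = \<zero>\<^bsub>HP.P\<^esub>"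
  using HP.em_inj[of f 0] by (auto simp: HP.pc_0[symmetric]) (auto simp: HP.em_def emb_zero[OF HP.ring_P] HP.pc_0)

lemma em_eq_iff: "f \<in> fac (hgens n) \<Longrightarrow> g \<in> fac (hgens n) \<Longrightarrow> HP.em f = HP.em g \<longleftrightarrow> HP.pc f = HP.pc g"
  using HP.em_inj[of f g] by (auto simp: HP.em_def)

lemma Mspace_iff:
  assumes f: "f \<in> fac (hgens n)"
  shows "HP.pc f \<in> Mspace q lam m n i \<longleftrightarrow> (\<forall>k\<in>{1..n}. nil (HX k - HP.sk (ix i k)) (HP.em f))"
proof -
  have "HP.pc (fpow (gen (X k) - sc (ix i k)) N) \<otimes>\<^bsub>HP.P\<^esub> HP.pc f = \<zero>\<^bsub>HP.P\<^esub>
      \<longleftrightarrow> ((*) (HX k - HP.sk (ix i k)) ^^ N) (HP.em f) = 0" if "k \<in> {1..n}" for k N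
  proof -
    have d: "gen (X k) - sc (ix i k) \<in> fac (hgens n)" using that by auto
    then have g: "fpow (gen (X k) - sc (ix i k)) N \<in> fac (hgens n)" by auto
    have "HP.em (fpow (gen (X k) - sc (ix i k)) N \<star> f) = ((*) (HX k - HP.sk (ix i k)) ^^ N) (HP.sk 1) * HP.em f"
      using that f d g by (simp add: HP.em_simps)
    also have "\<dots> = ((*) (HX k - HP.sk (ix i k)) ^^ N) (HP.em f)"
      using HP.u_em[OF f] by (simp add: lpow_mult_right[symmetric])
    finally show ?thesis using em_eq_0_iff[of "fpow (gen (X k) - sc (ix i k)) N \<star> f"] f g
      by (simp add: HP.pc_mult)
  qed
  then show ?thesis
    unfolding Mspace_def Hcls_def Hcyc_def nil_def using HP.pc_carrier[OF f] by auto
qed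

text \<open>From right to left the tuple runs through all of S^n; if it is not in
  \<open>\<alpha>\<close>, \<open>other_eigenspace\<close> shows that each \<open>eH j\<close> with
  j in \<open>\<alpha>\<close> kills M_i, also for tuples outside \<open>B\<close>. From left to
  right it is enough to test on the \<open>eH i\<close> with i in \<open>B\<close>, as they sum to
  the unit.\<close>

lemma is_e_alpha_iff:
  assumes f: "f \<in> fac (hgens n)"
  shows "is_e_alpha q lam m n \<alpha> (HP.pc f) \<longleftrightarrow> HP.em f = c"
proof
  assume *: "HP.em f = c"
  have "HP.em f * HP.em g = (if i \<in> \<alpha> then HP.em g else 0)"
    if i: "length i = n" "set i \<subseteq> S" and g: "g \<in> fac (hgens n)" "HP.pc g \<in> Mspace q lam m n i" for i g
  proof -
    note v = HP.u_em[OF g(1)] g(2)[unfolded Mspace_iff[OF g(1)], rule_format]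
    show ?thesis
    proof (cases "i \<in> \<alpha>")
      case True
      then have iB: "i \<in> B" using alpha_B by auto
      have e: "eH i * HP.em g = HP.em g" by (rule HS.in_eigenspace(1)[OF iB v])
      then have "c * HP.em g = c * eH i * HP.em g" by (simp add: mult.assoc)
      then show ?thesis using * c_e[OF iB] True e by simp
    next
      case False
      have "eH j * HP.em g = 0" if "j \<in> \<alpha>" for j
        by (rule HS.other_eigenspace[OF i(1) v]) (use that False alpha_B in auto)
      then show ?thesis using * False by (simp add: c_def sum_distrib_right)
    qed
  qed
  then have "HP.pc f \<otimes>\<^bsub>HP.P\<^esub> x = (if i \<in> \<alpha> then x else \<zero>\<^bsub>HP.P\<^esub>)"
    if i: "length i = n" "set i \<subseteq> S" and x: "x \<in> Mspace q lam m n i" for i x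
  proof -
    have "x \<in> carrier HP.P" using x by (simp add: Mspace_def Hcyc_def)
    then obtain g where g: "g \<in> fac (hgens n)" "x = HP.pc g" using HP.carrier_P by blast
    have "HP.em (f \<star> g) = HP.em (if i \<in> \<alpha> then g else 0)"
      using * \<open>\<And>i g. length i = n \<Longrightarrow> set i \<subseteq> S \<Longrightarrow> g \<in> fac (hgens n) \<Longrightarrow> HP.pc g \<in> Mspace q lam m n i \<Longrightarrow> HP.em f * HP.em g = (if i \<in> \<alpha> then HP.em g else 0)\<close>[OF i g(1)] x g f
      by (simp add: HP.em_mult)
    then have "HP.pc (f \<star> g) = HP.pc (if i \<in> \<alpha> then g else 0)"
      using f g by (subst (asm) em_eq_iff) auto
    then show ?thesis using f g by (simp add: HP.pc_mult HP.pc_0 split: if_splits)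
  qed
  then show "is_e_alpha q lam m n \<alpha> (HP.pc f)"
    unfolding is_e_alpha_def Hcyc_def using HP.pc_carrier[OF f] by simp
next
  assume *: "is_e_alpha q lam m n \<alpha> (HP.pc f)"
  show "HP.em f = c"
  proof (rule HS.eq_on_e[OF HP.u_em[OF f] u_c])
    fix i assume i: "i \<in> B"
    obtain g where g: "g \<in> fac (hgens n)" "eH i = HP.em g"
      using HP.big_em[of "eH i"] HS.u_e[OF i] by metis
    have "HP.pc g \<in> Mspace q lam m n i"
      unfolding Mspace_iff[OF g(1)] g(2)[symmetric] using HS.nil_X[OF i] by blast
    then have "HP.pc f \<otimes>\<^bsub>HP.P\<^esub> HP.pc g = (if i \<in> \<alpha> then HP.pc g else \<zero>\<^bsub>HP.P\<^esub>)"
      using * i T_S unfolding is_e_alpha_def Hcyc_def by blast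
    then have "HP.pc (f \<star> g) = HP.pc (if i \<in> \<alpha> then g else 0)"
      using f g by (simp add: HP.pc_mult HP.pc_0)
    then have "HP.em (f \<star> g) = HP.em (if i \<in> \<alpha> then g else 0)" by (simp add: HP.em_def)
    then show "HP.em f * eH i = c * eH i"
      using c_e[OF i] g f by (simp add: HP.em_mult split: if_splits)
  qed
qed

lemma e_alpha_exists: "\<exists>e. is_e_alpha q lam m n \<alpha> e"
proof -
  obtain f where "f \<in> fac (hgens n)" "HP.sk 1 * c = HP.em f" by (rule HP.big_em)
  then show ?thesis using is_e_alpha_iff[of f] u_c by auto
qed

text \<open>The isomorphism is Th read on carriers: embed, apply Th, project to the KLR factor. On
  the corner, multiplication by c is the identity, so Ps is a left inverse; for surjectivity the
  image under Ps is represented in the Hecke algebra and multiplied by e.\<close>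

lemma iso:
  assumes e: "is_e_alpha q lam m n \<alpha> e"
  shows "\<exists>\<phi>. alg_iso (corner (Hcyc q lam m n) e) (Hsc q lam m n) (KLR q m n \<alpha>) (Rsc q m n \<alpha>) \<phi>"
proof -
  have "e \<in> carrier HP.P" using e by (simp add: is_e_alpha_def Hcyc_def)
  then obtain f0 where f0: "f0 \<in> fac (hgens n)" "e = HP.pc f0" using HP.carrier_P by blast
  have em_f0: "HP.em f0 = c" using e is_e_alpha_iff[OF f0(1)] f0(2) by simp
  obtain Th Ps where maps: "ring_map Th" "ring_map Ps" and "\<forall>a. Th (HP.sk a) = KP.sk a" and Th_c: "Th c = KP.sk 1"
    and "\<forall>f\<in>fac (hgens n). Ps (Th (HP.em f)) = HP.em f * c"
    and "\<forall>f\<in>fac (rgens n \<alpha>). Th (Ps (KP.em f)) = KP.em f"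
    using mutually_inverse by (elim exE conjE) (rule that)
  then have Th_sk: "\<And>a. Th (HP.sk a) = KP.sk a"
    and PT: "\<And>f. f \<in> fac (hgens n) \<Longrightarrow> Ps (Th (HP.em f)) = HP.em f * c"
    and TP: "\<And>f. f \<in> fac (rgens n \<alpha>) \<Longrightarrow> Th (Ps (KP.em f)) = KP.em f"
    by blast+
  interpret Th: ring_map Th by (rule maps)
  interpret Ps: ring_map Ps by (rule maps)
  interpret HR: Ring.ring HP.P by (rule HP.ring_P)
  define \<phi> where "\<phi> x = Rep_big (Th (emb HP.P x)) KP.P" for x
  have \<phi>_carrier: "\<phi> x \<in> carrier KP.P" for x
    unfolding \<phi>_def by (rule Rep_big_carrier[OF KP.ring_P])
  \<comment> \<open>The projection loses nothing, because the images under Th of elements of the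
    Hecke factor lie in the KLR factor.\<close>
  have emb_\<phi>: "emb KP.P (\<phi> (HP.pc f)) = Th (HP.em f)" if f: "f \<in> fac (hgens n)" for f
  proof -
    obtain g where g: "g \<in> fac (rgens n \<alpha>)" "KP.sk 1 * Th (HP.em f) = KP.em g"
      "Rep_big (Th (HP.em f)) KP.P = KP.pc g" by (rule KP.big_em)
    have "KP.sk 1 * Th (HP.em f) = Th (HP.em f)"
      using arg_cong[OF HP.u_em[OF f], of Th] by (simp add: Th.h_mult Th_sk)
    then show ?thesis using g by (simp add: \<phi>_def HP.em_def KP.em_def)
  qed
  have \<phi>_mult: "\<phi> (x \<otimes>\<^bsub>HP.P\<^esub> y) = \<phi> x \<otimes>\<^bsub>KP.P\<^esub> \<phi> y" if "x \<in> carrier HP.P" "y \<in> carrier HP.P" for x y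
    unfolding \<phi>_def using that by (simp add: emb_mult[OF HP.ring_P] Th.h_mult Rep_big_simps[OF KP.ring_P])
  have \<phi>_add: "\<phi> (x \<oplus>\<^bsub>HP.P\<^esub> y) = \<phi> x \<oplus>\<^bsub>KP.P\<^esub> \<phi> y" if "x \<in> carrier HP.P" "y \<in> carrier HP.P" for x y
    unfolding \<phi>_def using that by (simp add: emb_add[OF HP.ring_P] Th.h_add Rep_big_simps[OF KP.ring_P])
  have \<phi>_sc: "\<phi> (HP.pc (sc a)) = KP.pc (sc a)" for a
  proof -
    have "KP.pc (sc a) \<in> carrier KP.P" by (rule KP.pc_carrier) simp
    then show ?thesis using Th_sk[of a]
      by (simp add: \<phi>_def HP.sk_def HP.em_def KP.sk_def KP.em_def Rep_emb[OF _ KP.ring_P])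
  qed
  have \<phi>_e: "\<phi> e = \<one>\<^bsub>KP.P\<^esub>"
  proof -
    have "\<phi> e = \<phi> (HP.pc (sc 1))"
      using em_f0 Th_c Th_sk[of 1] by (simp add: \<phi>_def f0(2) HP.em_def HP.sk_def)
    then show ?thesis by (simp add: \<phi>_sc KP.pc_one[symmetric] fa_one_sc)
  qed
  let ?C = "{e \<otimes>\<^bsub>HP.P\<^esub> x | x. x \<in> carrier HP.P}"
  have e_in: "e \<in> carrier HP.P" by fact
  have C: "?C \<subseteq> carrier HP.P" using e_in by auto
  have Cf: "\<exists>f\<in>fac (hgens n). x = HP.pc f \<and> HP.em f * c = HP.em f" if x: "x \<in> ?C" for x
  proof -
    obtain y where y: "y \<in> carrier HP.P" "x = e \<otimes>\<^bsub>HP.P\<^esub> y" using x by blast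
    then obtain g where g: "g \<in> fac (hgens n)" "y = HP.pc g" using HP.carrier_P by blast
    have "HP.em (f0 \<star> g) * c = HP.em (f0 \<star> g)"
      unfolding HP.em_mult[OF f0(1) g(1)] em_f0 by (simp only: mult.assoc c_central[of "HP.em g"]) (simp only: mult.assoc[symmetric] c_c)
    then show ?thesis using g y f0 by (intro bexI[of _ "f0 \<star> g"]) (auto simp: HP.pc_mult)
  qed
  have inj: "inj_on \<phi> ?C"
  proof (rule inj_onI)
    fix x y assume x: "x \<in> ?C" and y: "y \<in> ?C" and eq: "\<phi> x = \<phi> y"
    obtain f where f: "f \<in> fac (hgens n)" "x = HP.pc f" "HP.em f * c = HP.em f" using Cf[OF x] by blast
    obtain g where g: "g \<in> fac (hgens n)" "y = HP.pc g" "HP.em g * c = HP.em g" using Cf[OF y] by blast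
    have "Th (HP.em f) = Th (HP.em g)"
      using eq unfolding f(2) g(2) emb_\<phi>[OF f(1), symmetric] emb_\<phi>[OF g(1), symmetric] by (rule arg_cong)
    from arg_cong[OF this, of Ps] have "HP.em f = HP.em g" unfolding PT[OF f(1)] PT[OF g(1)] f(3) g(3) .
    then show "x = y" unfolding f(2) g(2) em_eq_iff[OF f(1) g(1)] .
  qed
  have surj: "z \<in> \<phi> ` ?C" if z: "z \<in> carrier KP.P" for z
  proof -
    obtain g where g: "g \<in> fac (rgens n \<alpha>)" "z = KP.pc g" using KP.carrier_P[OF z] by blast
    obtain f where f: "f \<in> fac (hgens n)" "HP.sk 1 * Ps (KP.em g) = HP.em f" by (rule HP.big_em)
    have "Th (HP.em (f0 \<star> f)) = Th c * Th (HP.sk 1 * Ps (KP.em g))"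
      by (simp only: HP.em_mult[OF f0(1) f(1)] em_f0 Th.h_mult f(2)[symmetric])
    also have "\<dots> = KP.em g"
      by (simp only: Th_c Th.h_mult Th_sk TP[OF g(1)] KP.u_em[OF g(1)])
    finally have "emb KP.P (\<phi> (HP.pc (f0 \<star> f))) = emb KP.P z"
      using emb_\<phi>[of "f0 \<star> f"] f0 f g by (simp add: KP.em_def)
    then have "\<phi> (HP.pc (f0 \<star> f)) = z" by (rule emb_inj[OF KP.ring_P \<phi>_carrier z])
    moreover have "HP.pc (f0 \<star> f) \<in> ?C" using f0 f HP.pc_mult HP.pc_carrier by blast
    ultimately show ?thesis by blast
  qed
  have "\<phi> \<in> ring_iso (corner HP.P e) KP.P"
  proof -
    have "\<phi> \<in> ring_hom (corner HP.P e) KP.P"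
      unfolding corner_def
      by (rule ring_hom_memI) (use C \<phi>_carrier \<phi>_mult \<phi>_add \<phi>_e in \<open>auto simp: subset_iff\<close>)
    moreover have "bij_betw \<phi> ?C (carrier KP.P)"
      unfolding bij_betw_def using inj surj \<phi>_carrier by blast
    ultimately show ?thesis by (simp add: ring_iso_def corner_def)
  qed
  moreover have "\<phi> (HP.pc (sc a) \<otimes>\<^bsub>HP.P\<^esub> x) = KP.pc (sc a) \<otimes>\<^bsub>KP.P\<^esub> \<phi> x" if "x \<in> ?C" for a x
    using \<phi>_mult[of "HP.pc (sc a)" x] that C HP.pc_carrier[of "sc a"] \<phi>_sc by auto
  ultimately have "alg_iso (corner HP.P e) (Hsc q lam m n) KP.P (Rsc q m n \<alpha>) \<phi>"
    unfolding alg_iso_def Hsc_def Rsc_def Hcls_def Hcyc_def KLR_def by (auto simp: corner_def)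
  then show ?thesis unfolding Hcyc_def KLR_def by blast
qed

end

theorem mainTheorem6:
  fixes q :: "'k::field" and lam :: "'k list" and m :: "'k \<Rightarrow> nat" and n :: nat
    and \<alpha> :: "'k list set"
  assumes char: "(2::'k) \<noteq> 0"
    and q0: "q \<noteq> 0" and q2: "q^2 \<noteq> 1"
    and lam0: "\<forall>a\<in>set lam. a \<noteq> 0"
    and disj: "\<forall>a<length lam. \<forall>b<length lam. a \<noteq> b \<longrightarrow> Ilam q (lam ! a) \<inter> Ilam q (lam ! b) = {}"
    and mfin: "finite {i \<in> Sset q lam. m i \<noteq> 0}"
    and n1: "n \<ge> 1"
    and alpha_sub: "\<alpha> \<subseteq> {i. length i = n \<and> set i \<subseteq> Sset q lam}"
    and alpha_fin: "finite \<alpha>"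
    and alpha_orb: "\<forall>i\<in>\<alpha>. \<forall>j. mset j = mset i \<longrightarrow> j \<in> \<alpha>"
  shows "(\<exists>e. is_e_alpha q lam m n \<alpha> e) \<and>
    (\<forall>e. is_e_alpha q lam m n \<alpha> e \<longrightarrow>
       (\<exists>\<phi>. alg_iso (corner (Hcyc q lam m n) e) (Hsc q lam m n)
                     (KLR q m n \<alpha>) (Rsc q m n \<alpha>) \<phi>))"
proof -
  interpret cyclotomic q lam m n \<alpha> by unfold_locales fact+
  obtain T eH where "finite T" and T: "T \<subseteq> S" "(\<Union>i\<in>\<alpha>. set i) \<subseteq> T"
    "spectral HP.sk q n {i. set i \<subseteq> T \<and> length i = n} eH HX" by (rule spectral_H)
  interpret cyclotomic_spectral q lam m n \<alpha> T eH
    by (intro cyclotomic_spectral.intro cyclotomic_spectral_axioms.intro cyclotomic_axioms T)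
  show ?thesis using e_alpha_exists iso by blast
qed

end
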